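(* Let $d\ge1$, let $p>1$ with $p-1\notin 2\mathbb{N}$, and let $s_c:=\frac d2-\frac2{p-1}$. Consider (with either choice of sign) the nonlinear Schrödinger equation $$i\partial_tu-\Delta u=\pm|u|^{p-1}u,\qquad u(0)=u_0.$$ There is an initial datum $u_0\in C_c^\infty(\mathbb{R}^d)$ of arbitrarily small norm (that is, for every $\varepsilon>0$ and $\sigma\ge0$ one can choose it with $\|u_0\|_{H^\sigma(\mathbb{R}^d)}<\varepsilon$) such that for every $T>0$ and every $s\geq\max\{s_c,p+\frac52\}$ there is no corresponding solution $u\in C([0,T];H^s(\mathbb{R}^d))$.
   Context: Here $\mathbb{N}=\{1,2,3,\dots\}$ and $u$ is complex-valued. A solution in $C([0,T];H^s(\mathbb{R}^d))$ is a function in this class with $u(0)=u_0$ satisfying the equation in the sense of distributions on $(0,T)\times\mathbb{R}^d$ (equivalently Duhamel's formula); for the stated range of $s$ the nonlinearity is a well-defined space-time distribution. *)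

theory Defs
  imports "HOL-Analysis.Analysis"
begin

subsection \<open>Smooth functions, test functions and Schwartz functions\<close>

definition directional_deriv ::
    "'a::euclidean_space \<Rightarrow> ('a \<Rightarrow> complex) \<Rightarrow> 'a \<Rightarrow> complex" where
  "directional_deriv v f = (\<lambda>x. frechet_derivative f (at x) v)"

text \<open>All iterated directional derivatives exist and are again Frechet differentiable everywhere,
  that is, \<open>f\<close> is of class \<open>C\<^sup>\<infinity>\<close>.\<close>

definition smooth_fun :: "('a::euclidean_space \<Rightarrow> complex) \<Rightarrow> bool" where
  "smooth_fun f \<longleftrightarrow> (\<forall>vs x. fold directional_deriv vs f differentiable (at x))"

definition test_function_on :: "'a::euclidean_space set \<Rightarrow> ('a \<Rightarrow> complex) \<Rightarrow> bool" where
  "test_function_on \<Omega> f \<longleftrightarrow>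
     smooth_fun f \<and> compact (closure {x. f x \<noteq> 0}) \<and> closure {x. f x \<noteq> 0} \<subseteq> \<Omega>"

definition schwartz_fun :: "('a::euclidean_space \<Rightarrow> complex) \<Rightarrow> bool" where
  "schwartz_fun f \<longleftrightarrow> smooth_fun f \<and>
     (\<forall>vs (k::nat). bounded (range (\<lambda>x. (1 + norm x) ^ k *\<^sub>R fold directional_deriv vs f x)))"

subsection \<open>Fourier transform and Sobolev spaces\<close>

definition fourier_integral :: "('a::euclidean_space \<Rightarrow> complex) \<Rightarrow> 'a \<Rightarrow> complex" where
  "fourier_integral f \<xi> =
     complex_of_real ((2 * pi) powr (- real DIM('a) / 2)) *
     (LINT x|lborel. cis (- (x \<bullet> \<xi>)) * f x)"

definition square_integrable :: "('a::euclidean_space \<Rightarrow> complex) \<Rightarrow> bool" where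
  "square_integrable f \<longleftrightarrow>
     f \<in> borel_measurable lborel \<and> integrable lborel (\<lambda>x. (norm (f x))\<^sup>2)"

text \<open>\<open>g\<close> represents the Fourier transform of \<open>f \<in> L\<^sup>2\<close> as a tempered distribution.
  By Plancherel such a \<open>g\<close> exists for every \<open>f \<in> L\<^sup>2\<close>, and it is unique almost everywhere.\<close>

definition is_fourier_transform ::
    "('a::euclidean_space \<Rightarrow> complex) \<Rightarrow> ('a \<Rightarrow> complex) \<Rightarrow> bool" where
  "is_fourier_transform f g \<longleftrightarrow> square_integrable f \<and> square_integrable g \<and>
     (\<forall>\<phi>. schwartz_fun \<phi> \<longrightarrow>
        (LINT \<xi>|lborel. g \<xi> * \<phi> \<xi>) = (LINT x|lborel. f x * fourier_integral \<phi> x))"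

definition fourier_transform :: "('a::euclidean_space \<Rightarrow> complex) \<Rightarrow> 'a \<Rightarrow> complex" where
  "fourier_transform f = (SOME g. is_fourier_transform f g)"

text \<open>\<open>H\<^sup>s\<close> for exponents \<open>s \<ge> 0\<close>, where it is a subspace of \<open>L\<^sup>2\<close>. Its elements are represented
  by functions rather than by classes modulo almost everywhere equality; membership and norm
  depend on the class only.\<close>

definition sobolev_space :: "real \<Rightarrow> ('a::euclidean_space \<Rightarrow> complex) set" where
  "sobolev_space s = {f. \<exists>g. is_fourier_transform f g \<and>
     integrable lborel (\<lambda>\<xi>. (1 + (norm \<xi>)\<^sup>2) powr s * (norm (g \<xi>))\<^sup>2)}"

definition sobolev_norm :: "real \<Rightarrow> ('a::euclidean_space \<Rightarrow> complex) \<Rightarrow> real" where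
  "sobolev_norm s f =
     sqrt (LINT \<xi>|lborel. (1 + (norm \<xi>)\<^sup>2) powr s * (norm (fourier_transform f \<xi>))\<^sup>2)"

text \<open>The class \<open>C([0,T]; H\<^sup>s)\<close>.\<close>

definition continuous_into_sobolev ::
    "real \<Rightarrow> real \<Rightarrow> (real \<Rightarrow> 'a::euclidean_space \<Rightarrow> complex) \<Rightarrow> bool" where
  "continuous_into_sobolev T s u \<longleftrightarrow>
     (\<forall>t\<in>{0..T}. u t \<in> sobolev_space s \<and>
        ((\<lambda>r. sobolev_norm s (\<lambda>x. u r x - u t x)) \<longlongrightarrow> 0) (at t within {0..T}))"

subsection \<open>The nonlinear Schroedinger equation\<close>

definition time_deriv ::
    "(real \<times> 'a::euclidean_space \<Rightarrow> complex) \<Rightarrow> real \<times> 'a \<Rightarrow> complex" where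
  "time_deriv \<phi> = directional_deriv (1, 0) \<phi>"

definition space_laplacian ::
    "(real \<times> 'a::euclidean_space \<Rightarrow> complex) \<Rightarrow> real \<times> 'a \<Rightarrow> complex" where
  "space_laplacian \<phi> =
     (\<lambda>z. \<Sum>b\<in>Basis. directional_deriv (0, b) (directional_deriv (0, b) \<phi>) z)"

definition nls_nonlinearity :: "real \<Rightarrow> complex \<Rightarrow> complex" where
  "nls_nonlinearity p z = complex_of_real (norm z powr (p - 1)) * z"

text \<open>The equation \<open>\<i> \<partial>\<^sub>t u - \<Delta> u = \<kappa> |u|\<^bsup>p-1\<^esup> u\<close> in the sense of distributions on
  \<open>(0,T) \<times> \<real>\<^sup>d\<close>, with all derivatives moved to the test function; the pairing is bilinear. The
  space-time integrals are iterated with time outermost, so that they do not depend on the choice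
  of a representative of each \<open>u t\<close> and no joint measurability is needed.\<close>

definition nls_distributional ::
    "real \<Rightarrow> real \<Rightarrow> real \<Rightarrow> (real \<Rightarrow> 'a::euclidean_space \<Rightarrow> complex) \<Rightarrow> bool" where
  "nls_distributional p \<kappa> T u \<longleftrightarrow>
     (\<forall>\<phi>. test_function_on ({0<..<T} \<times> (UNIV :: 'a set)) \<phi> \<longrightarrow>
        (LINT t:{0<..<T}|lborel. LINT x|lborel.
           u t x * (- \<i> * time_deriv \<phi> (t, x) - space_laplacian \<phi> (t, x)))
      = (LINT t:{0<..<T}|lborel. LINT x|lborel.
           complex_of_real \<kappa> * nls_nonlinearity p (u t x) * \<phi> (t, x)))"

definition nls_solution ::
    "real \<Rightarrow> real \<Rightarrow> real \<Rightarrow> real \<Rightarrow> ('a::euclidean_space \<Rightarrow> complex) \<Rightarrow>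
     (real \<Rightarrow> 'a \<Rightarrow> complex) \<Rightarrow> bool" where
  "nls_solution p \<kappa> s T u\<^sub>0 u \<longleftrightarrow>
     continuous_into_sobolev T s u \<and>
     (AE x in lborel. u 0 x = u\<^sub>0 x) \<and>
     nls_distributional p \<kappa> T u"

definition critical_exponent :: "nat \<Rightarrow> real \<Rightarrow> real" where
  "critical_exponent d p = real d / 2 - 2 / (p - 1)"

end

theory Submission
  imports Defs "HOL-Probability.Characteristic_Functions" "HOL-Probability.Sinc_Integral"
begin

text \<open>Take \<open>u\<^sub>0 = c x\<^sub>1\<close> near the origin. Then \<open>|u\<^sub>0|\<^bsup>p-1\<^esup>u\<^sub>0 = c\<^bsup>p\<^esup>|x\<^sub>1|\<^bsup>p-1\<^esup>x\<^sub>1\<close> is not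
  smooth across \<open>x\<^sub>1 = 0\<close>, because \<open>p\<close> is not an odd integer, and the equation does not
  tolerate a nonlinearity this rough.

  Test the equation against \<open>\<theta>(t/r\<^sup>2) \<psi>\<^sub>r(x)\<close>, where \<open>\<psi>\<^sub>r(x) = \<omega>\<^bsup>(m)\<^esup>(x\<^sub>1/r) \<eta>(x')\<close> oscillates at
  scale \<open>r\<close> in the direction \<open>x\<^sub>1\<close> only. The vanishing moments give
  \<open>\<parallel>\<psi>\<^sub>r\<parallel>\<^bsub>H\<^bsup>-\<sigma>\<^esup>\<^esub> = O(r\<^bsup>\<sigma>+1/2\<^esup>)\<close>, so for \<open>s \<ge> p + 5/2\<close> and \<open>u\<close> continuous into \<open>H\<^bsup>s\<^esup>\<close> both linear
  terms are \<open>o(r\<^bsup>p+1\<^esup>)\<close> on the time scale \<open>r\<^sup>2\<close>, whereas the nonlinearity of \<open>u\<^sub>0\<close>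
  contributes exactly a multiple of \<open>r\<^bsup>p+1\<^esup>\<close>. On this time scale \<open>u\<close> moves by only \<open>O(r\<^sup>2)\<close> in
  \<open>L\<^bsup>max(p,2)\<^esup>\<close>, which is negligible against \<open>|u\<^sub>0| \<approx> r\<close>: the nonlinearity cannot be
  balanced. The condition \<open>s \<ge> s\<^sub>c\<close> enters through Sobolev embeddings in the last bound.\<close>

subsection \<open>Smooth functions and test functions\<close>

text \<open>The threshold p + 5/2 is where both linear terms meet the nonlinear size r^(p+1)
  exactly. The packet has H^(-s) size r^(s+1/2). The Laplacian costs two orders and the time
  derivative a factor r^(-2), so both leave r^(s-3/2), which is r^(p+1) at s = p + 5/2. Power
  counting alone gives no gain at this endpoint: the little-o comes from pairing only with u(t) -
  u(0), which is small in H^s for short times. The pairings with u(0) itself drop out exactly: in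
  the time-derivative term because the derivative of the window integrates to zero, in the Laplacian
  term because x_1 is harmonic. This is why the datum is linear on the support of the packets. In
  high dimension H^s need not embed into bounded functions. The displacement u(t) - u(0) is
  therefore measured in L^P with P = max(p, 2) and compared with |u(0)| by splitting its values at a
  threshold between r^2 and r. Everything happens near the origin and at small times, so a single
  datum excludes all T and s.\<close>

fun csmooth :: "nat \<Rightarrow> ('a::euclidean_space \<Rightarrow> complex) \<Rightarrow> bool" where
  "csmooth 0 f \<longleftrightarrow> (\<forall>x. f differentiable (at x))"
| "csmooth (Suc k) f \<longleftrightarrow> (\<forall>x. f differentiable (at x)) \<and> (\<forall>v. csmooth k (directional_deriv v f))"

lemma csmooth_differentiable: "csmooth k f \<Longrightarrow> f differentiable (at x)"
  by (cases k) auto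

text \<open>The counter in \<open>csmooth\<close> lets the product and chain rules be proved by
  induction on the order with the functions generalized, which is awkward for lists of directions.
  \<open>csmooth k\<close> asks the derivatives of orders 0 to k to be differentiable, so it amounts
  to k + 1 derivatives; hence \<open>length vs \<le> k\<close> on the right.\<close>

lemma csmooth_iff:
  "csmooth k f \<longleftrightarrow> (\<forall>vs x. length vs \<le> k \<longrightarrow> fold directional_deriv vs f differentiable (at x))"
proof (induction k arbitrary: f)
  case 0
  then show ?case by simp
next
  case (Suc k)
  show ?case
  proof
    assume R: "csmooth (Suc k) f"
    show "\<forall>vs x. length vs \<le> Suc k \<longrightarrow> fold directional_deriv vs f differentiable (at x)"
    proof (intro allI impI)
      fix vs :: "'a list" and x
      assume "length vs \<le> Suc k"
      then show "fold directional_deriv vs f differentiable (at x)"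
        using R Suc.IH by (cases vs) auto
    qed
  next
    assume R: "\<forall>vs x. length vs \<le> Suc k \<longrightarrow> fold directional_deriv vs f differentiable (at x)"
    have "f differentiable (at x)" for x using R[rule_format, of "[]" x] by simp
    moreover have "csmooth k (directional_deriv v f)" for v
      unfolding Suc.IH using R[rule_format, of "v # _"] by simp
    ultimately show "csmooth (Suc k) f" by simp
  qed
qed

lemma smooth_fun_iff: "smooth_fun f \<longleftrightarrow> (\<forall>k. csmooth k f)"
  unfolding smooth_fun_def csmooth_iff by auto

lemma smooth_fun_differentiable: "smooth_fun f \<Longrightarrow> f differentiable (at x)"
  unfolding smooth_fun_iff by (metis csmooth_differentiable)

lemma smooth_fun_has_derivative:
  "smooth_fun f \<Longrightarrow> (f has_derivative (\<lambda>v. directional_deriv v f x)) (at x)"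
  using smooth_fun_differentiable[of f x]
  by (simp add: directional_deriv_def frechet_derivative_works)

lemma smooth_fun_dd: "smooth_fun f \<Longrightarrow> smooth_fun (directional_deriv v f)"
  unfolding smooth_fun_iff by (metis csmooth.simps(2))

lemma smooth_funI:
  assumes "\<And>x. f differentiable (at x)" "\<And>v. smooth_fun (directional_deriv v f)"
  shows "smooth_fun f"
  unfolding smooth_fun_iff
proof
  fix k show "csmooth k f" using assms unfolding smooth_fun_iff by (cases k) auto
qed

text \<open>Coinduction for smoothness: a family of differentiable functions that reproduces itself
  under differentiation needs no control of individual derivatives. It is applied to constants,
  conjugates, the flat functions \<open>exp_flat\<close>, multiples of
  \<open>cis (x \<bullet> \<xi>)\<close> and transforms of test functions.\<close>

lemma smooth_fun_invariant:
  assumes "P f" and "\<And>f x. P f \<Longrightarrow> f differentiable (at x)"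
    and "\<And>f v. P f \<Longrightarrow> P (directional_deriv v f)"
  shows "smooth_fun f"
  unfolding smooth_fun_iff
proof
  fix k show "csmooth k f" using assms(1)
    by (induction k arbitrary: f) (auto simp: assms(2,3))
qed

lemma directional_deriv_eq:
  "(f has_derivative f') (at x) \<Longrightarrow> directional_deriv v f x = f' v"
  unfolding directional_deriv_def using frechet_derivative_at by metis

lemma directional_derivI:
  "(\<And>x. (f has_derivative f' x) (at x)) \<Longrightarrow> directional_deriv v f = (\<lambda>x. f' x v)"
  using directional_deriv_eq by (metis (no_types, lifting) ext)

lemma has_derivative_dd:
  "f differentiable (at x) \<Longrightarrow> (f has_derivative (\<lambda>v. directional_deriv v f x)) (at x)"
  by (simp add: directional_deriv_def frechet_derivative_works)

lemma smooth_fun_continuous_on: "smooth_fun f \<Longrightarrow> continuous_on S f"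
  by (meson continuous_at_imp_continuous_on differentiable_imp_continuous_within smooth_fun_differentiable)

lemma smooth_fun_measurable: "smooth_fun f \<Longrightarrow> f \<in> borel_measurable borel"
  by (rule borel_measurable_continuous_onI) (rule smooth_fun_continuous_on)

lemma directional_deriv_add:
  assumes "f differentiable (at x)" "g differentiable (at x)"
  shows "directional_deriv v (\<lambda>x. f x + g x) x = directional_deriv v f x + directional_deriv v g x"
  by (rule directional_deriv_eq) (intro has_derivative_add has_derivative_dd assms)

lemma directional_deriv_mult:
  assumes "f differentiable (at x)" "g differentiable (at x)"
  shows "directional_deriv v (\<lambda>x. f x * g x) x = f x * directional_deriv v g x + directional_deriv v f x * g x"
  by (rule directional_deriv_eq) (intro has_derivative_mult has_derivative_dd assms)

lemma csmooth_mono: "csmooth (Suc k) f \<Longrightarrow> csmooth k f"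
  unfolding csmooth_iff by auto

lemma csmooth_add: "csmooth k f \<Longrightarrow> csmooth k g \<Longrightarrow> csmooth k (\<lambda>x. f x + g x)"
proof (induction k arbitrary: f g)
  case (Suc k)
  then have "directional_deriv v (\<lambda>x. f x + g x) = (\<lambda>x. directional_deriv v f x + directional_deriv v g x)" for v
    by (intro ext directional_deriv_add) auto
  with Suc show ?case by auto
qed auto

lemma csmooth_mult: "csmooth k f \<Longrightarrow> csmooth k g \<Longrightarrow> csmooth k (\<lambda>x. f x * g x)"
proof (induction k arbitrary: f g)
  case (Suc k)
  then have "directional_deriv v (\<lambda>x. f x * g x) = (\<lambda>x. f x * directional_deriv v g x + directional_deriv v f x * g x)" for v
    by (intro ext directional_deriv_mult) auto
  moreover have "csmooth k f" "csmooth k g" using Suc.prems csmooth_mono by auto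
  ultimately show ?case using Suc by (auto intro!: csmooth_add)
qed auto

lemma directional_deriv_const [simp]: "directional_deriv v (\<lambda>x. c) = (\<lambda>x. 0)"
  by (rule directional_derivI) (rule has_derivative_const)

lemma smooth_fun_const [simp, intro]: "smooth_fun (\<lambda>x. c)"
  by (rule smooth_fun_invariant[where P="\<lambda>f. \<exists>c. f = (\<lambda>x. c)"]) auto

lemma smooth_fun_add [intro]: "smooth_fun f \<Longrightarrow> smooth_fun g \<Longrightarrow> smooth_fun (\<lambda>x. f x + g x)"
  unfolding smooth_fun_iff by (auto intro: csmooth_add)

lemma smooth_fun_mult [intro]: "smooth_fun f \<Longrightarrow> smooth_fun g \<Longrightarrow> smooth_fun (\<lambda>x. f x * g x)"
  unfolding smooth_fun_iff by (auto intro: csmooth_mult)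

lemma smooth_fun_uminus [intro]: "smooth_fun f \<Longrightarrow> smooth_fun (\<lambda>x. - f x)"
  using smooth_fun_mult[of "\<lambda>x. -1" f] by simp

lemma smooth_fun_diff [intro]: "smooth_fun f \<Longrightarrow> smooth_fun g \<Longrightarrow> smooth_fun (\<lambda>x. f x - g x)"
  using smooth_fun_add[of f "\<lambda>x. - g x"] by auto

lemma smooth_fun_prod [intro]: "(\<And>i. i \<in> I \<Longrightarrow> smooth_fun (f i)) \<Longrightarrow> smooth_fun (\<lambda>x. \<Prod>i\<in>I. f i x)"
  by (induction I rule: infinite_finite_induct) auto

lemma smooth_fun_bounded_linear:
  assumes "bounded_linear f" shows "smooth_fun f"
proof (rule smooth_funI)
  show "f differentiable (at x)" for x
    using assms bounded_linear_imp_differentiable by blast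
  have "directional_deriv v f = (\<lambda>x. f v)" for v
    by (rule directional_derivI) (simp add: assms bounded_linear_imp_has_derivative)
  then show "smooth_fun (directional_deriv v f)" for v by simp
qed

lemma smooth_fun_inner [intro]: "smooth_fun (\<lambda>x. complex_of_real (x \<bullet> b))"
  by (rule smooth_fun_bounded_linear)
     (intro bounded_linear_compose[OF bounded_linear_of_real] bounded_linear_inner_left)

lemma smooth_fun_real_polynomial:
  "real_polynomial_function f \<Longrightarrow> smooth_fun (\<lambda>x. complex_of_real (f x))"
proof (induction rule: real_polynomial_function.induct)
  case (linear f)
  then show ?case
    by (intro smooth_fun_bounded_linear bounded_linear_compose[OF bounded_linear_of_real])
qed auto

text \<open>Differentiating along v produces the derivative of \<open>g\<close>, which is smooth,
  times h' composed with \<open>g\<close>. The order of \<open>h\<close> drops by one,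
  \<open>g\<close> stays the same, and the product rule closes the induction. The outer derivative
  is always \<open>directional_deriv 1 h\<close>, because on the line the other directions are
  multiples of 1.\<close>

lemma csmooth_compose:
  fixes h :: "real \<Rightarrow> complex" and g :: "'a::euclidean_space \<Rightarrow> real"
  assumes g: "smooth_fun (\<lambda>x. complex_of_real (g x))"
    and "csmooth k h"
  shows "csmooth k (\<lambda>x. h (g x))"
proof -
  have gd: "(g has_derivative (\<lambda>v. Re (directional_deriv v (\<lambda>x. complex_of_real (g x)) x))) (at x)" for x
    using bounded_linear.has_derivative[OF bounded_linear_Re smooth_fun_has_derivative[OF g, of x]] by simp
  have gd': "Re (directional_deriv v (\<lambda>x. complex_of_real (g x)) x) *\<^sub>R c
      = directional_deriv v (\<lambda>x. complex_of_real (g x)) x * c" for v x c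
  proof -
    have "((\<lambda>x. complex_of_real (g x)) has_derivative (\<lambda>v. complex_of_real (Re (directional_deriv v (\<lambda>x. complex_of_real (g x)) x)))) (at x)"
      by (rule bounded_linear.has_derivative[OF bounded_linear_of_real gd])
    from directional_deriv_eq[OF this, of v] show ?thesis by (simp add: scaleR_conv_of_real)
  qed
  have D: "((\<lambda>x. h (g x)) has_derivative (\<lambda>v. directional_deriv v (\<lambda>x. complex_of_real (g x)) x * directional_deriv 1 h (g x))) (at x)"
    if "h differentiable (at (g x))" for h :: "real \<Rightarrow> complex" and x
  proof -
    have hd: "(h has_derivative (\<lambda>v. directional_deriv v h (g x))) (at (g x))"
      using that by (rule has_derivative_dd)
    have lin: "directional_deriv v h (g x) = v *\<^sub>R directional_deriv 1 h (g x)" for v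
      using linear_scale[OF has_derivative_linear[OF hd], of v 1] by simp
    show ?thesis
      by (rule has_derivative_eq_rhs[OF has_derivative_compose[OF gd hd]]) (simp only: lin[symmetric] gd'[symmetric])
  qed
  show ?thesis using assms(2)
  proof (induction k arbitrary: h)
    case 0
    then show ?case using D unfolding csmooth.simps differentiable_def by blast
  next
    case (Suc k)
    then have hd: "h differentiable (at y)" for y by auto
    have "directional_deriv v (\<lambda>x. h (g x)) = (\<lambda>x. directional_deriv v (\<lambda>x. complex_of_real (g x)) x * directional_deriv 1 h (g x))" for v
      by (rule directional_derivI) (rule D[OF hd])
    moreover have "csmooth k (\<lambda>x. directional_deriv v (\<lambda>x. complex_of_real (g x)) x * directional_deriv 1 h (g x))" for v
      using smooth_fun_dd[OF g] Suc by (intro csmooth_mult) (auto simp: smooth_fun_iff)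
    ultimately show ?case using D[OF hd] unfolding csmooth.simps differentiable_def by auto
  qed
qed

lemma smooth_fun_compose:
  fixes h :: "real \<Rightarrow> complex"
  assumes "smooth_fun h" "smooth_fun (\<lambda>x. complex_of_real (g x))"
  shows "smooth_fun (\<lambda>x. h (g x))"
  using assms csmooth_compose unfolding smooth_fun_iff by blast

lemma directional_deriv_compose_linear:
  assumes "bounded_linear L" "f differentiable (at (L x + c))"
  shows "directional_deriv v (\<lambda>x. f (L x + c)) x = directional_deriv (L v) f (L x + c)"
proof (rule directional_deriv_eq)
  have "((\<lambda>x. L x + c) has_derivative L) (at x)"
    by (auto intro!: derivative_eq_intros bounded_linear_imp_has_derivative assms)
  from has_derivative_compose[OF this has_derivative_dd[OF assms(2)]]
  show "((\<lambda>x. f (L x + c)) has_derivative (\<lambda>v. directional_deriv (L v) f (L x + c))) (at x)" .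
qed

lemma csmooth_compose_linear:
  assumes L: "bounded_linear L" and "csmooth k f" shows "csmooth k (\<lambda>x. f (L x + c))"
  using assms(2)
proof (induction k arbitrary: f)
  have d: "(\<lambda>x. f (L x + c)) differentiable (at x)" if "\<And>y. f differentiable (at y)" for f :: "'b \<Rightarrow> complex" and x
  proof -
    have "((\<lambda>x. L x + c) has_derivative L) (at x)"
      by (auto intro!: derivative_eq_intros bounded_linear_imp_has_derivative L)
    from has_derivative_compose[OF this has_derivative_dd[OF that]] show ?thesis
      unfolding differentiable_def by blast
  qed
  { case 0 then show ?case using d by simp
  next
    case (Suc k)
    then have "directional_deriv v (\<lambda>x. f (L x + c)) = (\<lambda>x. directional_deriv (L v) f (L x + c))" for v
      by (intro ext directional_deriv_compose_linear L) auto
    with Suc d show ?case by auto }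
qed

lemma smooth_fun_compose_linear:
  "bounded_linear L \<Longrightarrow> smooth_fun f \<Longrightarrow> smooth_fun (\<lambda>x. f (L x + c))"
  unfolding smooth_fun_iff by (blast intro: csmooth_compose_linear)

lemma smooth_fun_linear_arg: "bounded_linear L \<Longrightarrow> smooth_fun f \<Longrightarrow> smooth_fun (\<lambda>x. f (L x))"
  using smooth_fun_compose_linear[where c=0] by simp

lemma smooth_fun_cnj: assumes "smooth_fun f" shows "smooth_fun (\<lambda>x. cnj (f x))"
proof (rule smooth_fun_invariant[where P="\<lambda>g. \<exists>f. smooth_fun f \<and> g = (\<lambda>x. cnj (f x))"])
  show "\<exists>fa. smooth_fun fa \<and> (\<lambda>x. cnj (f x)) = (\<lambda>x. cnj (fa x))" using assms by auto
next
  fix g :: "'a \<Rightarrow> complex" and x v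
  assume "\<exists>f. smooth_fun f \<and> g = (\<lambda>x. cnj (f x))"
  then obtain f where f: "smooth_fun f" "g = (\<lambda>x. cnj (f x))" by auto
  have d: "(g has_derivative (\<lambda>v. cnj (directional_deriv v f x))) (at x)" for x
    unfolding f(2) by (rule bounded_linear.has_derivative[OF bounded_linear_cnj smooth_fun_has_derivative[OF f(1)]])
  then show "g differentiable (at x)" unfolding differentiable_def by blast
  show "\<exists>f. smooth_fun f \<and> directional_deriv v g = (\<lambda>x. cnj (f x))"
    using smooth_fun_dd[OF f(1)] directional_derivI[OF d] by blast
qed

text \<open>On the line the derivative along \<open>v\<close> is the scalar \<open>v\<close> times
  \<open>f'\<close>, so smoothness passes from a derivative to its primitive.\<close>

lemma smooth_fun_real_iff:
  fixes f :: "real \<Rightarrow> complex"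
  assumes "\<And>x. (f has_vector_derivative f' x) (at x)" "smooth_fun f'"
  shows "smooth_fun f"
proof (rule smooth_funI)
  show "f differentiable (at x)" for x
    using assms(1)[of x] unfolding has_vector_derivative_def differentiable_def by blast
  have "directional_deriv v f = (\<lambda>x. v *\<^sub>R f' x)" for v
    by (rule directional_derivI[where f'="\<lambda>x v. v *\<^sub>R f' x"]) (rule assms(1)[unfolded has_vector_derivative_def])
  then show "smooth_fun (directional_deriv v f)" for v
    using smooth_fun_mult[OF smooth_fun_const assms(2), of "of_real v"] by (simp add: scaleR_conv_of_real)
qed

lemma directional_deriv_real:
  fixes f :: "real \<Rightarrow> complex"
  assumes "\<And>x. (f has_vector_derivative f' x) (at x)"
  shows "directional_deriv 1 f = f'"
proof -
  have "directional_deriv 1 f = (\<lambda>x. 1 *\<^sub>R f' x)"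
    using directional_derivI[where f=f and f'="\<lambda>x v. v *\<^sub>R f' x" and v=1, OF assms[unfolded has_vector_derivative_def]] .
  then show ?thesis by simp
qed

section \<open>Test functions and integration by parts\<close>

abbreviation test_fun :: "('a::euclidean_space \<Rightarrow> complex) \<Rightarrow> bool" where
  "test_fun \<equiv> test_function_on UNIV"

lemma test_funI:
  assumes "smooth_fun f" "\<And>x. R < norm x \<Longrightarrow> f x = 0"
  shows "test_fun f"
proof -
  have "{x. f x \<noteq> 0} \<subseteq> cball 0 R" using assms(2) by (force simp: not_less[symmetric])
  then have "bounded {x. f x \<noteq> 0}" using bounded_cball bounded_subset by blast
  then show ?thesis using assms(1) unfolding test_function_on_def by (auto simp: compact_closure)
qed

lemma test_fun_smooth: "test_function_on U f \<Longrightarrow> smooth_fun f"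
  unfolding test_function_on_def by auto

lemma test_fun_support:
  assumes "test_fun f" obtains R where "R > 0" "\<And>x. R < norm x \<Longrightarrow> f x = 0"
proof -
  have "bounded {x. f x \<noteq> 0}" using assms unfolding test_function_on_def by (simp add: compact_closure)
  then obtain R where "R > 0" "\<forall>x\<in>{x. f x \<noteq> 0}. norm x \<le> R" by (auto simp: bounded_pos)
  then show thesis using that by (metis (mono_tags, lifting) linorder_not_less mem_Collect_eq)
qed

lemma directional_deriv_local_cong:
  assumes "open U" "x \<in> U" "\<And>y. y \<in> U \<Longrightarrow> f y = g y" "f differentiable (at x)"
  shows "directional_deriv v f x = directional_deriv v g x"
  using directional_deriv_eq[OF has_derivative_transform_within_open[OF has_derivative_dd[OF assms(4)] assms(1-3)]]
  by simp

lemma directional_deriv_zero_outside: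
  assumes "smooth_fun f" "closed S" "\<And>x. x \<notin> S \<Longrightarrow> f x = 0" "x \<notin> S"
  shows "directional_deriv v f x = 0"
proof -
  have "directional_deriv v f x = directional_deriv v (\<lambda>x. 0) x"
    by (rule directional_deriv_local_cong[where U="- S"]) (use assms in \<open>auto intro: smooth_fun_differentiable\<close>)
  then show ?thesis by simp
qed

lemma test_fun_dd:
  assumes "test_fun f" shows "test_fun (directional_deriv v f)"
proof -
  obtain R where R: "\<And>x. R < norm x \<Longrightarrow> f x = 0" using test_fun_support[OF assms] by blast
  show ?thesis
  proof (rule test_funI[where R=R])
    show "smooth_fun (directional_deriv v f)" using assms by (intro smooth_fun_dd test_fun_smooth)
    show "directional_deriv v f x = 0" if "R < norm x" for x
      by (rule directional_deriv_zero_outside[where S="cball 0 R"])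
        (use R that assms in \<open>auto intro: test_fun_smooth\<close>)
  qed
qed

lemma test_fun_fold: "test_fun f \<Longrightarrow> test_fun (fold directional_deriv vs f)"
  by (induction vs arbitrary: f) (auto simp: test_fun_dd)

lemma test_fun_mult_right: assumes "test_fun f" "smooth_fun g" shows "test_fun (\<lambda>x. f x * g x)"
proof -
  obtain R where R: "\<And>x. R < norm x \<Longrightarrow> f x = 0" using test_fun_support[OF assms(1)] by blast
  then show ?thesis using assms by (intro test_funI[where R=R]) (auto intro: test_fun_smooth)
qed

lemma test_fun_mult_left: assumes "test_fun f" "smooth_fun g" shows "test_fun (\<lambda>x. g x * f x)"
  using test_fun_mult_right[OF assms] by (simp add: mult.commute)

lemma test_fun_cmult: "test_fun f \<Longrightarrow> test_fun (\<lambda>x. c * f x)"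
  by (rule test_fun_mult_left) auto

lemma test_fun_add: assumes "test_fun f" "test_fun g" shows "test_fun (\<lambda>x. f x + g x)"
proof -
  obtain R where R: "\<And>x. R < norm x \<Longrightarrow> f x = 0" using test_fun_support[OF assms(1)] by blast
  obtain R' where R': "\<And>x. R' < norm x \<Longrightarrow> g x = 0" using test_fun_support[OF assms(2)] by blast
  show ?thesis using assms R R' by (intro test_funI[where R="max R R'"]) (auto intro: test_fun_smooth)
qed

lemma test_fun_diff: "test_fun f \<Longrightarrow> test_fun g \<Longrightarrow> test_fun (\<lambda>x. f x - g x)"
  using test_fun_add[of f "\<lambda>x. -1 * g x"] test_fun_cmult[of g "-1"] by simp

lemma test_fun_zero: "test_fun (\<lambda>x. 0)"
  by (rule test_funI[where R=0]) auto

lemma test_fun_sum: "(\<And>i. i \<in> I \<Longrightarrow> test_fun (f i)) \<Longrightarrow> test_fun (\<lambda>x. \<Sum>i\<in>I. f i x)"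
  by (induction I rule: infinite_finite_induct) (auto simp: test_fun_zero intro: test_fun_add)

lemma test_fun_cnj: assumes "test_fun f" shows "test_fun (\<lambda>x. cnj (f x))"
proof -
  obtain R where R: "\<And>x. R < norm x \<Longrightarrow> f x = 0" using test_fun_support[OF assms] by blast
  then show ?thesis using assms by (intro test_funI[where R=R]) (auto intro: smooth_fun_cnj test_fun_smooth)
qed

lemma test_fun_affine:
  fixes f :: "'a::euclidean_space \<Rightarrow> complex"
  assumes "test_fun f" "c \<noteq> 0" shows "test_fun (\<lambda>x. f (c *\<^sub>R x + t))"
proof -
  obtain R where R: "\<And>x. R < norm x \<Longrightarrow> f x = 0" using test_fun_support[OF assms(1)] by blast
  show ?thesis
  proof (rule test_funI[where R="(R + norm t) / \<bar>c\<bar>"])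
    show "smooth_fun (\<lambda>x. f (c *\<^sub>R x + t))"
      by (rule smooth_fun_compose_linear) (auto intro: assms test_fun_smooth bounded_linear_scaleR_right)
    fix x :: 'a assume "(R + norm t) / \<bar>c\<bar> < norm x"
    then have "R + norm t < norm (c *\<^sub>R x)" using assms(2) by (simp add: field_simps)
    also have "\<dots> \<le> norm (c *\<^sub>R x + t) + norm t"
      by (metis add_diff_cancel_right' norm_triangle_ineq4)
    finally show "f (c *\<^sub>R x + t) = 0" by (intro R) simp
  qed
qed

lemma continuous_compact_support_integrable:
  fixes f :: "'a::euclidean_space \<Rightarrow> 'b::{banach, second_countable_topology}"
  assumes "continuous_on UNIV f" "\<And>x. R < norm x \<Longrightarrow> f x = 0"
  shows "integrable lborel f"
proof -
  have "integrable lborel (\<lambda>x. indicator (cball 0 R) x *\<^sub>R f x)"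
    by (rule borel_integrable_compact) (auto intro: continuous_on_subset[OF assms(1)])
  also have "(\<lambda>x. indicator (cball 0 R) x *\<^sub>R f x) = f"
    using assms(2) by (force simp: indicator_def not_le)
  finally show ?thesis .
qed

lemma test_fun_integrable: assumes "test_fun f" shows "integrable lborel f"
proof -
  obtain R where R: "\<And>x. R < norm x \<Longrightarrow> f x = 0" using test_fun_support[OF assms] by blast
  show ?thesis
    by (rule continuous_compact_support_integrable[OF smooth_fun_continuous_on R])
       (use assms in \<open>auto intro: test_fun_smooth\<close>)
qed

lemma test_fun_bounded: assumes "test_fun f" obtains M where "M > 0" "\<And>x. norm (f x) \<le> M"
proof -
  obtain R where R: "R > 0" "\<And>x. R < norm x \<Longrightarrow> f x = 0" using test_fun_support[OF assms] by blast
  have "bounded (f ` cball 0 R)"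
    by (intro compact_imp_bounded compact_continuous_image smooth_fun_continuous_on test_fun_smooth[OF assms] compact_cball)
  then obtain M where M: "M > 0" "\<And>x. norm x \<le> R \<Longrightarrow> norm (f x) \<le> M"
    by (auto simp: bounded_pos)
  show thesis
  proof (rule that[OF M(1)])
    show "norm (f x) \<le> M" for x using M R by (cases "norm x \<le> R") auto
  qed
qed

lemma test_fun_measurable: "test_fun f \<Longrightarrow> f \<in> borel_measurable borel"
  by (intro smooth_fun_measurable test_fun_smooth)

lemma integral_lborel_translation:
  fixes f :: "'a::euclidean_space \<Rightarrow> 'b::{banach, second_countable_topology}"
  assumes "f \<in> borel_measurable borel"
  shows "(LINT x|lborel. f (x + t)) = (LINT x|lborel. f x)"
proof -
  have "(LINT x|lborel. f x) = (LINT x|distr lborel borel ((+) t). f x)" by (simp add: lborel_distr_plus)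
  also have "\<dots> = (LINT x|lborel. f (t + x))" by (rule integral_distr) (use assms in auto)
  finally show ?thesis by (simp add: add.commute)
qed

lemma smooth_fun_vector_derivative_line:
  assumes "smooth_fun f"
  shows "((\<lambda>t. f (x + t *\<^sub>R v)) has_vector_derivative directional_deriv v f (x + t *\<^sub>R v)) (at t)"
proof -
  have 1: "((\<lambda>t. x + t *\<^sub>R v) has_derivative (\<lambda>t. t *\<^sub>R v)) (at t)"
    by (auto intro!: derivative_eq_intros)
  note d = smooth_fun_has_derivative[OF assms, of "x + t *\<^sub>R v"]
  have "(\<lambda>s. directional_deriv (s *\<^sub>R v) f (x + t *\<^sub>R v)) = (\<lambda>s. s *\<^sub>R directional_deriv v f (x + t *\<^sub>R v))"
    using linear_scale[OF has_derivative_linear[OF d]] by auto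
  with has_derivative_compose[OF 1 d] show ?thesis unfolding has_vector_derivative_def by simp
qed

text \<open>Difference quotients have integral zero by translation invariance of Lebesgue measure,
  and they converge to the derivative under a common integrable bound. No coordinates are involved,
  so \<open>v\<close> may be any direction.\<close>

lemma integral_directional_deriv:
  assumes "test_fun f" shows "(LINT x|lborel. directional_deriv v f x) = 0"
proof -
  let ?D = "directional_deriv v f"
  obtain R where R: "R > 0" "\<And>x. R < norm x \<Longrightarrow> f x = 0" using test_fun_support[OF assms] by blast
  obtain M where M: "M > 0" "\<And>x. norm (?D x) \<le> M" using test_fun_bounded[OF test_fun_dd[OF assms]] by blast
  note [measurable] = test_fun_measurable[OF assms] test_fun_measurable[OF test_fun_dd[OF assms]]
  define q where "q n x = (f (x + inverse (real (Suc n)) *\<^sub>R v) - f x) /\<^sub>R inverse (real (Suc n))" for n x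
  have int: "integrable lborel (\<lambda>x. f (x + t))" for t
    using test_fun_integrable[OF test_fun_affine[OF assms, of 1 t]] by simp
  have "(\<lambda>n. LINT x|lborel. q n x) \<longlonglongrightarrow> (LINT x|lborel. ?D x)"
  proof (rule integral_dominated_convergence[where w="\<lambda>x. indicator (cball 0 (R + norm v)) x * M"])
    show "?D \<in> borel_measurable lborel" "\<And>n. q n \<in> borel_measurable lborel" unfolding q_def by measurable
    show "integrable lborel (\<lambda>x. indicator (cball 0 (R + norm v)) x * M)"
      by (intro integrable_mult_left integrable_real_indicator)
         (use emeasure_bounded_finite[OF bounded_cball] in \<open>auto simp: infinity_ennreal_def\<close>)
    show "AE x in lborel. (\<lambda>n. q n x) \<longlonglongrightarrow> ?D x"
    proof (rule AE_I2)
      fix x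
      have "((\<lambda>t. f (x + t *\<^sub>R v)) has_vector_derivative ?D (x + 0 *\<^sub>R v)) (at 0)"
        by (intro smooth_fun_vector_derivative_line test_fun_smooth[OF assms])
      then have "((\<lambda>h. norm (f (x + h *\<^sub>R v) - f x - h *\<^sub>R ?D x) / \<bar>h\<bar>) \<longlongrightarrow> 0) (at 0)"
        by (simp add: has_vector_derivative_def has_derivative_at)
      moreover have "\<forall>\<^sub>F h in at 0. norm (f (x + h *\<^sub>R v) - f x - h *\<^sub>R ?D x) / \<bar>h\<bar>
          = norm ((f (x + h *\<^sub>R v) - f x) /\<^sub>R h - ?D x)"
      proof (rule eventually_at_topological[THEN iffD2], intro exI[of _ UNIV] conjI ballI impI)
        fix h :: real assume "h \<noteq> 0"
        then have "(f (x + h *\<^sub>R v) - f x) /\<^sub>R h - ?D x = (f (x + h *\<^sub>R v) - f x - h *\<^sub>R ?D x) /\<^sub>R h"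
          by (simp add: scaleR_diff_right)
        then show "norm (f (x + h *\<^sub>R v) - f x - h *\<^sub>R ?D x) / \<bar>h\<bar>
          = norm ((f (x + h *\<^sub>R v) - f x) /\<^sub>R h - ?D x)"
          by (simp add: divide_inverse mult.commute)
      qed auto
      ultimately have "((\<lambda>h. norm ((f (x + h *\<^sub>R v) - f x) /\<^sub>R h - ?D x)) \<longlongrightarrow> 0) (at 0)"
        by (rule Lim_transform_eventually)
      then have "((\<lambda>h. (f (x + h *\<^sub>R v) - f x) /\<^sub>R h) \<longlongrightarrow> ?D x) (at 0)"
        by (simp add: Lim_null[of _ "?D x"] tendsto_norm_zero_iff)
      moreover have "filterlim (\<lambda>n. inverse (real (Suc n))) (at 0) sequentially"
        by (intro filterlim_atI LIMSEQ_inverse_real_of_nat) auto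
      ultimately show "(\<lambda>n. q n x) \<longlonglongrightarrow> ?D x" unfolding q_def
        by (rule filterlim_compose)
    qed
    \<comment> \<open>The steps \<open>inverse (real (Suc n))\<close> are at most 1, so a quotient
      can be nonzero only within distance \<open>norm v\<close> of the ball carrying
      \<open>f\<close>; there the mean value inequality along the line bounds it by
      \<open>M\<close>.\<close>
    show "AE x in lborel. norm (q n x) \<le> indicator (cball 0 (R + norm v)) x * M" for n
    proof (rule AE_I2)
      fix x
      define e where "e = inverse (real (Suc n))"
      have h: "0 < e" "e \<le> 1" by (auto simp: e_def field_simps)
      have qe: "q n x = (f (x + e *\<^sub>R v) - f x) /\<^sub>R e" by (simp only: q_def e_def)
      have "norm (f (x + e *\<^sub>R v) - f (x + 0 *\<^sub>R v)) \<le> M * norm (e - 0)"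
      proof (rule differentiable_bound[where S=UNIV])
        show "((\<lambda>t. f (x + t *\<^sub>R v)) has_derivative (\<lambda>s. s *\<^sub>R ?D (x + t *\<^sub>R v))) (at t within UNIV)" for t
          using smooth_fun_vector_derivative_line[OF test_fun_smooth[OF assms], of x v t]
          by (simp add: has_vector_derivative_def)
        show "onorm (\<lambda>s. s *\<^sub>R ?D (x + t *\<^sub>R v)) \<le> M" for t
          by (rule onorm_le) (use mult_left_mono[OF M(2) abs_ge_zero] in \<open>simp add: mult.commute\<close>)
      qed auto
      then have 1: "norm (q n x) \<le> M" using h by (simp add: qe inverse_eq_divide pos_divide_le_eq mult.commute)
      show "norm (q n x) \<le> indicator (cball 0 (R + norm v)) x * M"
      proof (cases "norm x \<le> R + norm v")
        case True then show ?thesis using 1 by simp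
      next
        case False
        have "norm (e *\<^sub>R v) \<le> norm v" using h by (simp add: mult_left_le_one_le)
        moreover have "norm x \<le> norm (x + e *\<^sub>R v) + norm (e *\<^sub>R v)"
          by (metis add_diff_cancel_right' norm_triangle_ineq4)
        ultimately have "R < norm (x + e *\<^sub>R v)" "R < norm x" using False norm_ge_zero[of v] by linarith+
        then show ?thesis using R M(1) by (simp add: qe indicator_def)
      qed
    qed
  qed
  moreover have "(LINT x|lborel. q n x) = 0" for n
    unfolding q_def using int[of 0] by (simp add: int integral_lborel_translation)
  ultimately show ?thesis by (simp add: LIMSEQ_const_iff)
qed

lemma integration_by_parts_test:
  assumes "test_fun f" "smooth_fun g"
  shows "(LINT x|lborel. g x * directional_deriv v f x) = - (LINT x|lborel. directional_deriv v g x * f x)"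
proof -
  have eq: "directional_deriv v (\<lambda>x. g x * f x) = (\<lambda>x. g x * directional_deriv v f x + directional_deriv v g x * f x)"
    by (intro ext directional_deriv_mult smooth_fun_differentiable assms(2) test_fun_smooth[OF assms(1)])
  have "(LINT x|lborel. g x * directional_deriv v f x) + (LINT x|lborel. directional_deriv v g x * f x)
     = (LINT x|lborel. directional_deriv v (\<lambda>x. g x * f x) x)"
    unfolding eq
    by (intro Bochner_Integration.integral_add[symmetric] test_fun_integrable test_fun_mult_left test_fun_dd assms smooth_fun_dd)
  also have "\<dots> = 0" by (intro integral_directional_deriv test_fun_mult_left assms)
  finally show ?thesis by (simp add: eq_neg_iff_add_eq_0)
qed

subsection \<open>Bump and cutoff functions\<close>

text \<open>The functions P(1/x) exp(-1/x), continued by zero to x \<le> 0, are closed under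
  differentiation: in y = 1/x the derivative replaces P by y^2 (P - P'). The polynomial parameter is
  carried along for this reason; the classical flat function is \<open>exp_flat 1\<close>.\<close>

definition exp_flat :: "real poly \<Rightarrow> real \<Rightarrow> real" where
  "exp_flat P x = (if x > 0 then poly P (1 / x) * exp (- 1 / x) else 0)"

lemma tendsto_poly_exp_0: "((\<lambda>y. poly P y * exp (- y)) \<longlongrightarrow> (0::real)) at_top"
proof -
  have "((\<lambda>y. \<Sum>i\<le>degree P. coeff P i * (y ^ i / exp y)) \<longlongrightarrow> (\<Sum>i\<le>degree P. coeff P i * 0)) at_top"
    by (intro tendsto_sum tendsto_mult_left tendsto_power_div_exp_0)
  then show ?thesis
    by (simp add: poly_altdef exp_minus sum_distrib_right sum_distrib_left divide_inverse mult.assoc)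
qed

lemma exp_flat_deriv:
  "(exp_flat P has_real_derivative exp_flat (monom 1 2 * (P - pderiv P)) x) (at x)"
proof -
  consider "x > 0" | "x < 0" | "x = 0" by linarith
  then show ?thesis
  proof cases
    case 1
    have "((\<lambda>x. poly P (1 / x) * exp (- 1 / x)) has_real_derivative
      exp_flat (monom 1 2 * (P - pderiv P)) x) (at x)"
      using 1 by (auto intro!: derivative_eq_intros DERIV_chain2[OF poly_DERIV]
        simp: exp_flat_def poly_monom field_simps power2_eq_square)
    then show ?thesis
      by (rule has_field_derivative_transform_within_open[where S="{0<..}"])
         (use 1 in \<open>auto simp: exp_flat_def\<close>)
  next
    case 2
    have "((\<lambda>x. 0) has_real_derivative exp_flat (monom 1 2 * (P - pderiv P)) x) (at x)"
      using 2 by (simp add: exp_flat_def)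
    then show ?thesis
      by (rule has_field_derivative_transform_within_open[where S="{..<0}"])
         (use 2 in \<open>auto simp: exp_flat_def\<close>)
  next
    case 3
    \<comment> \<open>The right difference quotient at 0 is again of flat form, with P multiplied by
      its variable (\<open>pCons 0 P\<close>), and exponential decay in 1/x beats any
      polynomial.\<close>
    have "((\<lambda>y. exp_flat P y / y) \<longlongrightarrow> 0) (at_right 0)"
    proof -
      have "((\<lambda>y. poly (pCons 0 P) (inverse y) * exp (- inverse y)) \<longlongrightarrow> 0) (at_right (0::real))"
        by (rule filterlim_compose[OF tendsto_poly_exp_0 filterlim_inverse_at_top_right])
      moreover have "\<forall>\<^sub>F y in at_right (0::real). poly (pCons 0 P) (inverse y) * exp (- inverse y) = exp_flat P y / y"
        by (rule eventually_at_rightI[where b=1]) (auto simp: exp_flat_def field_simps)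
      ultimately show ?thesis by (rule Lim_transform_eventually)
    qed
    moreover have "((\<lambda>y. exp_flat P y / y) \<longlongrightarrow> 0) (at_left 0)"
    proof -
      have "\<forall>\<^sub>F y in at_left (0::real). 0 = exp_flat P y / y"
        by (rule eventually_at_leftI[where a="-1"]) (auto simp: exp_flat_def)
      then show ?thesis by (rule Lim_transform_eventually[OF tendsto_const])
    qed
    ultimately have "((\<lambda>y. exp_flat P y / y) \<longlongrightarrow> 0) (at 0)"
      by (simp add: filterlim_split_at)
    then show ?thesis using 3 by (simp add: has_field_derivative_iff exp_flat_def)
  qed
qed

lemma smooth_fun_exp_flat: "smooth_fun (\<lambda>x. complex_of_real (exp_flat P x))"
proof (rule smooth_fun_invariant[where P="\<lambda>f. \<exists>c P. f = (\<lambda>x. complex_of_real (c * exp_flat P x))"])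
  show "\<exists>c Pa. (\<lambda>x. complex_of_real (exp_flat P x)) = (\<lambda>x. complex_of_real (c * exp_flat Pa x))"
    by (rule exI[where x=1]) auto
next
  fix f :: "real \<Rightarrow> complex" and x v
  assume "\<exists>c P. f = (\<lambda>x. complex_of_real (c * exp_flat P x))"
  then obtain c P where f: "f = (\<lambda>x. complex_of_real (c * exp_flat P x))" by auto
  let ?Q = "monom 1 2 * (P - pderiv P)"
  have d: "(f has_derivative (\<lambda>v. complex_of_real (c * v * exp_flat ?Q x))) (at x)" for x
  proof -
    have "(exp_flat P has_derivative (\<lambda>v. v * exp_flat ?Q x)) (at x)"
      by (rule has_derivative_eq_rhs[OF exp_flat_deriv[of P x, unfolded has_field_derivative_def]]) (simp add: fun_eq_iff)
    from bounded_linear.has_derivative[OF bounded_linear_of_real has_derivative_mult_right[OF this, of c]]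
    show ?thesis unfolding f by (simp add: mult.assoc)
  qed
  show "f differentiable (at x)" using d unfolding differentiable_def by blast
  show "\<exists>c P. directional_deriv v f = (\<lambda>x. complex_of_real (c * exp_flat P x))"
    using directional_derivI[OF d, of v] by blast
qed

lemma smooth_antiderivative:
  fixes f :: "real \<Rightarrow> complex"
  assumes "smooth_fun f"
  obtains F where "smooth_fun F" "\<And>x. (F has_vector_derivative f x) (at x)"
proof -
  have "\<exists>F. \<forall>x::real. -\<infinity> < ereal x \<longrightarrow> ereal x < \<infinity> \<longrightarrow> (F has_vector_derivative f x) (at x)"
    by (rule einterval_antiderivative)
       (use smooth_fun_continuous_on[OF assms, of UNIV] in \<open>auto simp: continuous_on_eq_continuous_at\<close>)
  then obtain F where F: "\<And>x. (F has_vector_derivative f x) (at x)" by auto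
  then show thesis using that smooth_fun_real_iff[OF F assms] by blast
qed

lemma bump_exists:
  obtains g :: "real \<Rightarrow> real" where "smooth_fun (\<lambda>x. complex_of_real (g x))"
    "\<And>x. 0 \<le> g x" "\<And>x. 0 < x \<Longrightarrow> x < 1 \<Longrightarrow> 0 < g x" "\<And>x. x \<notin> {0<..<1} \<Longrightarrow> g x = 0"
proof -
  let ?e = "exp_flat 1"
  have 1: "smooth_fun (\<lambda>x. complex_of_real (?e x))" by (rule smooth_fun_exp_flat)
  have "smooth_fun (\<lambda>x. complex_of_real (?e x) * complex_of_real (?e (-1 *\<^sub>R x + 1)))"
    by (intro smooth_fun_mult 1 smooth_fun_compose_linear[where f="\<lambda>x. complex_of_real (?e x)"] bounded_linear_scaleR_right)
  then show thesis
    by (intro that[of "\<lambda>x. ?e x * ?e (1 - x)"]) (auto simp: exp_flat_def)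
qed

text \<open>\<open>H\<close> is the primitive of a bump on (0, 1) divided by its total increase, so
  the density \<open>h\<close> has integral one. The pair supplies the spatial cutoffs, the time
  windows and the transversal profile of the packets.\<close>

lemma smooth_step_exists:
  obtains H h :: "real \<Rightarrow> real" where
    "smooth_fun (\<lambda>x. complex_of_real (H x))" "smooth_fun (\<lambda>x. complex_of_real (h x))"
    "\<And>x. (H has_real_derivative h x) (at x)" "\<And>x. 0 \<le> h x" "\<And>x. x \<notin> {0<..<1} \<Longrightarrow> h x = 0"
    "\<And>x. x \<le> 0 \<Longrightarrow> H x = 0" "\<And>x. 1 \<le> x \<Longrightarrow> H x = 1" "\<And>x. 0 \<le> H x" "\<And>x. H x \<le> 1"
proof -
  obtain g :: "real \<Rightarrow> real" where g: "smooth_fun (\<lambda>x. complex_of_real (g x))"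
    "\<And>x. 0 \<le> g x" "\<And>x. 0 < x \<Longrightarrow> x < 1 \<Longrightarrow> 0 < g x" "\<And>x. x \<notin> {0<..<1} \<Longrightarrow> g x = 0"
    using bump_exists by metis
  obtain G where G: "\<And>x. (G has_vector_derivative complex_of_real (g x)) (at x)"
    using smooth_antiderivative[OF g(1)] by metis
  define F where "F x = Re (G x)" for x
  have F: "(F has_real_derivative g x) (at x)" for x
    using bounded_linear.has_vector_derivative[OF bounded_linear_Re G[of x]]
    by (simp add: F_def[abs_def] has_real_derivative_iff_has_vector_derivative)
  have mono: "F x \<le> F y" if "x \<le> y" for x y
    by (rule DERIV_nonneg_imp_nondecreasing[OF that]) (use F g(2) in blast)
  have cont: "continuous_on S F" for S
    by (rule DERIV_continuous_on) (use F has_field_derivative_at_within in blast)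
  have "F 0 < F 1"
    by (rule DERIV_pos_imp_increasing_open) (use F g(3) cont in auto)
  define c where "c = F 1 - F 0"
  have c: "c > 0" using \<open>F 0 < F 1\<close> by (simp add: c_def)
  define H where "H x = (F x - F 0) / c" for x
  define h where "h x = g x / c" for x
  have Hh: "(H has_real_derivative h x) (at x)" for x
    unfolding H_def h_def using c by (auto intro!: derivative_eq_intros F)
  have sh: "smooth_fun (\<lambda>x. complex_of_real (h x))"
    using smooth_fun_mult[OF smooth_fun_const g(1), of "complex_of_real (1/c)"] by (simp add: h_def)
  have sH: "smooth_fun (\<lambda>x. complex_of_real (H x))"
  proof (rule smooth_fun_real_iff[OF _ sh])
    show "((\<lambda>x. complex_of_real (H x)) has_vector_derivative complex_of_real (h x)) (at x)" for x
      using bounded_linear.has_vector_derivative[OF bounded_linear_of_real Hh[of x, unfolded has_real_derivative_iff_has_vector_derivative]] by simp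
  qed
  have F0: "(F has_real_derivative 0) (at x)" if "x \<notin> {0<..<1}" for x
    using F[of x] g(4)[OF that] by simp
  have low: "F x = F 0" if "x \<le> 0" for x
  proof (cases "x = 0")
    case False
    show ?thesis
      by (rule DERIV_isconst_end[where f=F, symmetric]) (use that False F0 cont in auto)
  qed simp
  have high: "F x = F 1" if "1 \<le> x" for x
  proof (cases "x = 1")
    case False
    show ?thesis
      by (rule DERIV_isconst_end[where f=F]) (use that False F0 cont in auto)
  qed simp
  have H0: "H x \<ge> 0" for x
    using mono[of 0 x] low[of x] c by (cases "x \<ge> 0") (auto simp: H_def)
  have "F x \<le> F 1" for x using mono[of x 1] high[of x] by (cases "x \<le> 1") auto
  then have H1: "H x \<le> 1" for x using c by (simp add: H_def c_def divide_le_eq_1)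
  have HL: "H x = 0" if "x \<le> 0" for x using low[OF that] by (simp add: H_def)
  have HR: "H x = 1" if "1 \<le> x" for x using high[OF that] c by (simp add: H_def c_def)
  have h0: "0 \<le> h x" for x using g(2)[of x] c by (simp add: h_def)
  have hz: "h x = 0" if "x \<notin> {0<..<1}" for x using g(4)[OF that] by (simp add: h_def)
  show thesis by (rule that[OF sH sh Hh h0 hz HL HR H0 H1])
qed

text \<open>The primitive that vanishes at -R is zero to the left of the support and equals the
  total integral to the right of it. A vanishing mean is thus the only obstruction to a primitive
  with compact support.\<close>

lemma test_antiderivative:
  fixes f :: "real \<Rightarrow> complex"
  assumes "test_fun f" "(LINT x|lborel. f x) = 0"
  obtains F where "test_fun F" "directional_deriv 1 F = f"
proof -
  obtain G where G: "smooth_fun G" "\<And>x. (G has_vector_derivative f x) (at x)"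
    using smooth_antiderivative[OF test_fun_smooth[OF assms(1)]] by metis
  obtain R where R: "R > 0" "\<And>x. R < norm x \<Longrightarrow> f x = 0" using test_fun_support[OF assms(1)] by blast
  have ftc: "(LINT x|lborel. indicator {a..b} x *\<^sub>R f x) = G b - G a" if "a \<le> b" for a b
    by (rule integral_FTC_atLeastAtMost) (use that G smooth_fun_continuous_on[OF test_fun_smooth[OF assms(1)]] in
      \<open>auto intro: has_vector_derivative_at_within\<close>)
  define F where "F x = G x - G (- R)" for x
  have Fd: "(F has_vector_derivative f x) (at x)" for x
    unfolding F_def using has_vector_derivative_diff[OF G(2) has_vector_derivative_const] by simp
  have F0: "F x = 0" if "R < norm x" for x
  proof (cases "x < 0")
    case True
    then have "x \<le> - R" using that by auto
    then have "G (- R) - G x = (LINT y|lborel. indicator {x..- R} y *\<^sub>R f y)" using ftc by simp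
    also have "\<dots> = (LINT y::real|lborel. 0)"
    proof (rule integral_cong_AE)
      show "AE y in lborel. indicator {x..- R} y *\<^sub>R f y = 0"
        using AE_lborel_singleton[of "- R"] by eventually_elim (use R in \<open>auto simp: indicator_def\<close>)
    qed (use test_fun_measurable[OF assms(1)] in auto)
    finally show ?thesis by (simp add: F_def)
  next
    case False
    then have "R < x" using that by auto
    then have "G x - G (- R) = (LINT y|lborel. indicator {- R..x} y *\<^sub>R f y)" using ftc R by simp
    also have "\<dots> = (LINT y|lborel. f y)"
      by (rule Bochner_Integration.integral_cong) (use R \<open>R < x\<close> in \<open>auto simp: indicator_def\<close>)
    finally show ?thesis using assms(2) by (simp add: F_def)
  qed
  have "smooth_fun F" by (rule smooth_fun_real_iff[OF Fd test_fun_smooth[OF assms(1)]])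
  with F0 have "test_fun F" by (intro test_funI[where R=R])
  then show thesis using that directional_deriv_real[OF Fd] by blast
qed

text \<open>A tensor product of one-dimensional plateaus is 1 on a coordinate box. Boxes rather than
  balls are the natural shape here because the packets are tensor products as well.\<close>

lemma cutoff_exists:
  fixes R :: real
  assumes "R > 0"
  obtains \<Theta> :: "'a::euclidean_space \<Rightarrow> real" where
    "test_fun (\<lambda>x. complex_of_real (\<Theta> x))" "\<And>x. (\<forall>b\<in>Basis. \<bar>x \<bullet> b\<bar> \<le> R) \<Longrightarrow> \<Theta> x = 1"
    "\<And>x. 0 \<le> \<Theta> x" "\<And>x. \<Theta> x \<le> 1"
proof -
  obtain H h :: "real \<Rightarrow> real" where H: "smooth_fun (\<lambda>x. complex_of_real (H x))"
    "\<And>x. x \<le> 0 \<Longrightarrow> H x = 0" "\<And>x. 1 \<le> x \<Longrightarrow> H x = 1" "\<And>x. 0 \<le> H x" "\<And>x. H x \<le> 1"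
    using smooth_step_exists by metis
  \<comment> \<open>A rising step times a falling one: \<open>k\<close> is 1 on [-R, R] and 0
    outside [-(R+1), R+1].\<close>
  define k where "k y = H (y + (R + 1)) * H (-1 *\<^sub>R y + (R + 1))" for y
  have "smooth_fun (\<lambda>x. complex_of_real (k x))"
    unfolding k_def of_real_mult
    by (intro smooth_fun_mult smooth_fun_compose_linear[OF _ H(1)] bounded_linear_ident bounded_linear_scaleR_right)
  then have sm: "smooth_fun (\<lambda>x. complex_of_real (\<Prod>b\<in>Basis. k (x \<bullet> b)))"
    unfolding of_real_prod by (intro smooth_fun_prod smooth_fun_compose[where h="\<lambda>y. complex_of_real (k y)" and g="\<lambda>x. x \<bullet> b" for b] smooth_fun_inner)
  have k0: "k y = 0" if "R + 1 < \<bar>y\<bar>" for y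
    using that H(2)[of "y + (R + 1)"] H(2)[of "R + 1 - y"] by (cases "y \<ge> 0") (auto simp: k_def)
  have k01: "0 \<le> k y" "k y \<le> 1" for y using H by (auto simp: k_def intro!: mult_le_one)
  show thesis
  proof (rule that[of "\<lambda>x. \<Prod>b\<in>Basis. k (x \<bullet> b)"])
    show "test_fun (\<lambda>x::'a. complex_of_real (\<Prod>b\<in>Basis. k (x \<bullet> b)))"
    proof (rule test_funI[OF sm, where R="DIM('a) * (R + 1)"])
      fix x :: 'a assume x: "DIM('a) * (R + 1) < norm x"
      have "\<exists>b\<in>Basis. R + 1 < \<bar>x \<bullet> b\<bar>"
      proof (rule ccontr)
        assume "\<not> ?thesis"
        then have "(\<Sum>b\<in>Basis. \<bar>x \<bullet> b\<bar>) \<le> (\<Sum>b\<in>(Basis::'a set). R + 1)"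
          by (intro sum_mono) (auto simp: not_less)
        then show False using norm_le_l1[of x] x by simp
      qed
      then obtain b where "b \<in> Basis" "k (x \<bullet> b) = 0" using k0 by blast
      then show "complex_of_real (\<Prod>b\<in>Basis. k (x \<bullet> b)) = 0" by auto
    qed
    show "(\<Prod>b\<in>Basis. k (x \<bullet> b)) = 1" if "\<forall>b\<in>Basis. \<bar>x \<bullet> b\<bar> \<le> R" for x :: 'a
      using that by (intro prod.neutral) (auto simp: k_def abs_le_iff H)
  qed (auto intro!: prod_nonneg prod_le_1 k01)
qed

subsection \<open>Fourier inversion and Plancherel\<close>

text \<open>\<open>lborel\<close> is the image of the product of one-dimensional Lebesgue measures
  under the coordinate expansion, so tensor products integrate factor by factor. This yields the
  Gaussian integrals, an integrable majorant for decaying functions, and later the exact moment of a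
  packet.\<close>

lemma lborel_product_integral:
  fixes f :: "'a::euclidean_space \<Rightarrow> real \<Rightarrow> 'b::{real_normed_field,banach,second_countable_topology}"
  assumes f: "\<And>b. b \<in> Basis \<Longrightarrow> integrable lborel (f b)"
  shows "integrable lborel (\<lambda>x::'a. \<Prod>b\<in>Basis. f b (x \<bullet> b))"
    and "(LINT x|lborel. (\<Prod>b\<in>Basis. f b ((x::'a) \<bullet> b))) = (\<Prod>b\<in>Basis. (LINT y|lborel. f b y))"
proof -
  interpret product_sigma_finite "\<lambda>_::'a. lborel :: real measure" ..
  have [measurable]: "f b \<in> borel_measurable borel" if "b \<in> Basis" for b using f[OF that] by auto
  have eq: "(\<Prod>b\<in>Basis. f b ((\<Sum>c\<in>Basis. x c *\<^sub>R c) \<bullet> b)) = (\<Prod>b\<in>Basis. f b (x b))" for x :: "'a \<Rightarrow> real"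
    by (rule prod.cong) (simp_all add: inner_sum_left_Basis)
  have T: "(\<lambda>x. \<Sum>c\<in>Basis. x c *\<^sub>R c) \<in> (\<Pi>\<^sub>M b\<in>Basis. lborel) \<rightarrow>\<^sub>M (borel :: 'a measure)" by measurable
  show "integrable lborel (\<lambda>x::'a. \<Prod>b\<in>Basis. f b (x \<bullet> b))"
    unfolding lborel_eq[where 'a='a]
    by (subst integrable_distr_eq[OF T])
       (auto simp: eq intro!: product_integrable_prod f)
  show "(LINT x|lborel. (\<Prod>b\<in>Basis. f b ((x::'a) \<bullet> b))) = (\<Prod>b\<in>Basis. (LINT y|lborel. f b y))"
    unfolding lborel_eq[where 'a='a]
    by (subst integral_distr[OF T]) (auto simp: eq intro!: product_integral_prod f)
qed

text \<open>The product form makes the Fourier transform a product of one-dimensional characteristic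
  functions of the normal distribution; the radial form is recovered in
  \<open>gauss_eq\<close>.\<close>

definition gauss :: "'a::euclidean_space \<Rightarrow> real" where
  "gauss x = (\<Prod>b\<in>Basis. std_normal_density (x \<bullet> b))"

lemma norm_squared_Basis: "(norm (x::'a::euclidean_space))\<^sup>2 = (\<Sum>b\<in>Basis. (x \<bullet> b)\<^sup>2)"
  by (subst power2_norm_eq_inner, subst euclidean_inner) (simp add: power2_eq_square)

lemma gauss_nonneg [simp]: "0 \<le> gauss x"
  unfolding gauss_def by (intro prod_nonneg) (auto simp: normal_density_nonneg)

lemma gauss_eq: "gauss (x::'a::euclidean_space) = (2 * pi) powr (- real DIM('a) / 2) * exp (- (norm x)\<^sup>2 / 2)"
proof -
  have "gauss x = (\<Prod>b\<in>(Basis::'a set). 1 / sqrt (2 * pi)) * exp (\<Sum>b\<in>Basis. - (x \<bullet> b)\<^sup>2 / 2)"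
    unfolding gauss_def std_normal_density_def prod.distrib exp_sum[OF finite_Basis] by simp
  also have "(\<Sum>b\<in>Basis. - (x \<bullet> b)\<^sup>2 / 2) = - (norm x)\<^sup>2 / 2"
    by (simp add: norm_squared_Basis sum_divide_distrib sum_negf)
  also have "(\<Prod>b\<in>(Basis::'a set). 1 / sqrt (2 * pi)) = (2 * pi) powr (- real DIM('a) / 2)"
  proof -
    have "1 / sqrt (2 * pi) = (2 * pi) powr (- (1 / 2))"
      unfolding powr_minus_divide by (subst powr_half_sqrt) simp_all
    then have "(\<Prod>b\<in>(Basis::'a set). 1 / sqrt (2 * pi)) = ((2 * pi) powr (- (1 / 2))) ^ DIM('a)"
      by (simp only: prod_constant)
    then show ?thesis by (simp add: powr_power)
  qed
  finally show ?thesis .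
qed

lemma gauss_measurable [measurable]: "gauss \<in> borel_measurable borel"
  unfolding gauss_def[abs_def] by measurable

lemma gauss_integrable: "integrable lborel (gauss :: 'a::euclidean_space \<Rightarrow> real)"
  unfolding gauss_def[abs_def] by (rule lborel_product_integral) simp

lemma std_normal_fourier:
  "(LINT y|lborel. complex_of_real (std_normal_density y) * cis (t * y)) = complex_of_real (exp (- t\<^sup>2 / 2))"
proof -
  have "(LINT y|lborel. complex_of_real (std_normal_density y) * cis (t * y)) = (LINT y|lborel. std_normal_density y *\<^sub>R iexp (t * y))"
    by (simp add: cis_conv_exp scaleR_conv_of_real mult.assoc)
  also have "\<dots> = char std_normal_distribution t"
    unfolding char_def by (subst integral_density) (auto simp: normal_density_nonneg)
  finally show ?thesis by (simp add: char_std_normal_distribution)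
qed

lemma integrable_cis_mult:
  fixes f :: "'a::euclidean_space \<Rightarrow> complex"
  assumes "integrable lborel f" "g \<in> borel_measurable borel"
  shows "integrable lborel (\<lambda>x. cis (g x) * f x)"
proof (rule Bochner_Integration.integrable_bound[OF assms(1)])
  have [measurable]: "f \<in> borel_measurable borel" using assms(1) by auto
  note assms(2)[measurable]
  show "(\<lambda>x. cis (g x) * f x) \<in> borel_measurable lborel" unfolding cis_conv_exp by measurable
qed (simp add: norm_mult)

lemma integrable_mult_cis:
  fixes f :: "'a::euclidean_space \<Rightarrow> complex"
  assumes "integrable lborel f" "g \<in> borel_measurable borel"
  shows "integrable lborel (\<lambda>x. f x * cis (g x))"
  using integrable_cis_mult[OF assms] by (simp add: mult.commute)

lemma cis_sum: "finite A \<Longrightarrow> cis (\<Sum>b\<in>A. f b) = (\<Prod>b\<in>A. cis (f b))"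
  by (induction rule: finite_induct) (auto simp: cis_mult[symmetric])

lemma gauss_fourier:
  fixes \<xi> :: "'a::euclidean_space"
  shows "(LINT x|lborel. complex_of_real (gauss x) * cis (\<xi> \<bullet> x)) = complex_of_real (exp (- (norm \<xi>)\<^sup>2 / 2))"
proof -
  let ?f = "\<lambda>b y. complex_of_real (std_normal_density y) * cis ((\<xi> \<bullet> b) * y)"
  have "complex_of_real (gauss x) * cis (\<xi> \<bullet> x) = (\<Prod>b\<in>Basis. ?f b (x \<bullet> b))" for x :: 'a
    by (simp add: gauss_def euclidean_inner[of \<xi> x] cis_sum prod.distrib)
  then have "(LINT x|lborel. complex_of_real (gauss x) * cis (\<xi> \<bullet> x)) = (LINT x::'a|lborel. (\<Prod>b\<in>Basis. ?f b (x \<bullet> b)))"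
    by simp
  also have "\<dots> = (\<Prod>b\<in>Basis. (LINT y|lborel. ?f b y))"
  proof (rule lborel_product_integral)
    have "integrable lborel (\<lambda>y. cis ((\<xi> \<bullet> b) * y) * complex_of_real (std_normal_density y))" for b
      by (rule integrable_cis_mult) auto
    then show "integrable lborel (?f b)" for b by (simp add: mult.commute)
  qed
  also have "\<dots> = complex_of_real (exp (\<Sum>b\<in>Basis. - (\<xi> \<bullet> b)\<^sup>2 / 2))"
    by (simp add: std_normal_fourier exp_sum exp_of_real[symmetric])
  also have "(\<Sum>b\<in>Basis. - (\<xi> \<bullet> b)\<^sup>2 / 2) = - (norm \<xi>)\<^sup>2 / 2"
    by (simp add: norm_squared_Basis sum_divide_distrib sum_negf)
  finally show ?thesis .
qed

lemma gauss_integral: "(LINT x|lborel. gauss (x::'a::euclidean_space)) = 1"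
proof -
  have "complex_of_real (LINT x|lborel. gauss (x::'a)) = (LINT x|lborel. complex_of_real (gauss (x::'a)) * cis ((0::'a) \<bullet> x))"
    by simp
  also have "\<dots> = 1" by (subst gauss_fourier) simp
  finally show ?thesis by (simp only: of_real_eq_1_iff)
qed

lemma integral_lborel_affine:
  fixes f :: "'a::euclidean_space \<Rightarrow> 'b::{banach, second_countable_topology}"
  assumes [measurable]: "f \<in> borel_measurable borel" and c: "c \<noteq> 0"
  shows "(LINT x|lborel. f x) = \<bar>c\<bar> ^ DIM('a) *\<^sub>R (LINT x|lborel. f (t + c *\<^sub>R x))"
  by (subst lborel_affine[OF c, of t]) (simp add: integral_density integral_distr)

lemma nn_integral_lborel_affine:
  fixes f :: "'a::euclidean_space \<Rightarrow> ennreal"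
  assumes [measurable]: "f \<in> borel_measurable borel" and c: "c \<noteq> 0"
  shows "(\<integral>\<^sup>+x. f x \<partial>lborel) = ennreal (\<bar>c\<bar> ^ DIM('a)) * (\<integral>\<^sup>+x. f (t + c *\<^sub>R x) \<partial>lborel)"
  by (subst lborel_affine[OF c, of t]) (simp add: nn_integral_density nn_integral_distr nn_integral_cmult)

lemma lborel_pair_integrable_bound:
  fixes k :: "'a::euclidean_space \<Rightarrow> 'b::euclidean_space \<Rightarrow> complex"
  assumes F: "integrable lborel F" and G: "integrable lborel G"
    and k: "case_prod k \<in> borel_measurable (borel \<Otimes>\<^sub>M borel)" "\<And>x y. norm (k x y) \<le> M"
  shows "integrable (lborel \<Otimes>\<^sub>M lborel) (\<lambda>(x, y). F x * k x y * G y :: complex)"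
proof -
  have [measurable]: "F \<in> borel_measurable borel" "G \<in> borel_measurable borel"
    "case_prod k \<in> borel_measurable (borel \<Otimes>\<^sub>M borel)" using F G k by auto
  have M: "0 \<le> M" using order_trans[OF norm_ge_zero k(2)] .
  have "integrable (lborel \<Otimes>\<^sub>M lborel) (\<lambda>p. M * (norm (F (fst p)) * norm (G (snd p))))"
  proof (rule lborel_pair.Fubini_integrable)
    show "integrable lborel (\<lambda>x. LINT y|lborel. norm (M * (norm (F (fst (x, y))) * norm (G (snd (x, y))))))"
      using F by (simp add: abs_mult)
    show "AE x in lborel. integrable lborel (\<lambda>y. M * (norm (F (fst (x, y))) * norm (G (snd (x, y)))))"
      using G by simp
  qed measurable
  then show ?thesis
  proof (rule Bochner_Integration.integrable_bound)
    show "(\<lambda>(x, y). F x * k x y * G y) \<in> borel_measurable (lborel \<Otimes>\<^sub>M lborel)" by measurable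
    show "AE p in lborel \<Otimes>\<^sub>M lborel. norm (case p of (x, y) \<Rightarrow> F x * k x y * G y) \<le> norm (M * (norm (F (fst p)) * norm (G (snd p))))"
    proof (rule AE_I2, clarify)
      fix x y
      have "norm (F x) * norm (G y) * norm (k x y) \<le> norm (F x) * norm (G y) * M"
        by (intro mult_left_mono k) auto
      then show "norm (F x * k x y * G y) \<le> norm (M * (norm (F (fst (x, y))) * norm (G (snd (x, y)))))"
        using M by (simp add: norm_mult abs_mult mult_ac)
    qed
  qed
qed

text \<open>A bounded kernel between two integrable functions is jointly integrable. With a kernel
  of modulus one this justifies the exchanges of integrals against an exponential below.\<close>

lemma lborel_Fubini_kernel:
  fixes k :: "'a::euclidean_space \<Rightarrow> 'b::euclidean_space \<Rightarrow> complex"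
  assumes F: "integrable lborel F" and G: "integrable lborel G"
    and k: "case_prod k \<in> borel_measurable (borel \<Otimes>\<^sub>M borel)" "\<And>x y. norm (k x y) \<le> M"
  shows "(LINT x|lborel. F x * (LINT y|lborel. k x y * G y)) = (LINT y|lborel. (LINT x|lborel. F x * k x y) * G y)"
proof -
  have "(LINT y|lborel. (LINT x|lborel. F x * k x y * G y)) = (LINT x|lborel. (LINT y|lborel. F x * k x y * G y))"
    by (rule lborel_pair.Fubini_integral) (rule lborel_pair_integrable_bound[OF assms])
  moreover have "(LINT x|lborel. F x * k x y * G y) = (LINT x|lborel. F x * k x y) * G y" for y
    by (rule integral_mult_left_zero)
  moreover have "(LINT y|lborel. F x * k x y * G y) = F x * (LINT y|lborel. k x y * G y)" for x
    by (simp only: mult.assoc integral_mult_right_zero)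
  ultimately show ?thesis by simp
qed

lemma cis_inner_measurable [measurable]: "(\<lambda>(x::'a::euclidean_space, y). cis (x \<bullet> y)) \<in> borel_measurable (borel \<Otimes>\<^sub>M borel)"
  "(\<lambda>(x::'a::euclidean_space, y). cis (- (x \<bullet> y))) \<in> borel_measurable (borel \<Otimes>\<^sub>M borel)"
  unfolding cis_conv_exp by measurable

lemma cis_inner_borel [measurable]: "(\<lambda>x::'a::euclidean_space. cis (a \<bullet> x)) \<in> borel_measurable borel"
  "(\<lambda>x::'a::euclidean_space. cis (x \<bullet> a)) \<in> borel_measurable borel"
  "(\<lambda>x::'a::euclidean_space. cis (- (a \<bullet> x))) \<in> borel_measurable borel"
  "(\<lambda>x::'a::euclidean_space. cis (- (x \<bullet> a))) \<in> borel_measurable borel"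
  unfolding cis_conv_exp by measurable

section \<open>The unitary Fourier integral and its Gaussian regularization\<close>

definition fconst :: "'a::euclidean_space itself \<Rightarrow> real" where
  "fconst _ = (2 * pi) powr (- real DIM('a) / 2)"

lemma fconst_pos: "0 < fconst TYPE('a::euclidean_space)"
  by (simp add: fconst_def)

lemma fconst_square: "(fconst TYPE('a::euclidean_space))\<^sup>2 * (2 * pi) ^ DIM('a) = 1"
proof -
  have "(fconst TYPE('a))\<^sup>2 = (2 * pi) powr (- real DIM('a))"
    by (simp add: fconst_def power2_eq_square powr_add[symmetric])
  moreover have "(2 * pi) ^ DIM('a) = (2 * pi) powr real DIM('a)"
    by (rule powr_realpow[symmetric]) simp
  ultimately show ?thesis by (simp only: powr_add[symmetric]) simp
qed

text \<open>The Fourier integral with the opposite sign. It is the basic transform here because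
  \<open>is_fourier_transform\<close> pairs \<open>f\<close> with
  \<open>fourier_integral \<phi>\<close>: the choice \<open>\<phi> = inv_fourier \<psi>\<close>
  turns that side into the pairing of \<open>f\<close> with \<open>\<psi>\<close> itself.\<close>

definition inv_fourier :: "('a::euclidean_space \<Rightarrow> complex) \<Rightarrow> 'a \<Rightarrow> complex" where
  "inv_fourier f \<xi> = complex_of_real (fconst TYPE('a)) * (LINT x|lborel. cis (x \<bullet> \<xi>) * f x)"

lemma fourier_integral_eq:
  "fourier_integral f (\<xi>::'a::euclidean_space) = complex_of_real (fconst TYPE('a)) * (LINT x|lborel. cis (- (x \<bullet> \<xi>)) * f x)"
  by (simp add: fourier_integral_def fconst_def)

lemma cnj_inv_fourier: "cnj (inv_fourier f \<xi>) = fourier_integral (\<lambda>x. cnj (f x)) \<xi>"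
proof -
  have "cnj (LINT x|lborel. cis (x \<bullet> \<xi>) * f x) = (LINT x|lborel. cnj (cis (x \<bullet> \<xi>) * f x))"
    by (rule Bochner_Integration.integral_cnj[symmetric])
  then show ?thesis by (simp add: inv_fourier_def fourier_integral_eq cis_cnj)
qed

lemma fourier_integral_measurable:
  assumes [measurable]: "f \<in> borel_measurable borel"
  shows "fourier_integral f \<in> borel_measurable borel" "inv_fourier f \<in> borel_measurable borel"
  unfolding fourier_integral_eq[abs_def] inv_fourier_def[abs_def] by measurable

lemma norm_fourier_integral_le:
  "norm (fourier_integral f (\<xi>::'a::euclidean_space)) \<le> fconst TYPE('a) * (LINT x|lborel. norm (f x))"
  using integral_norm_bound[of lborel "\<lambda>x. cis (- (x \<bullet> \<xi>)) * f x"] fconst_pos[where 'a='a]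
  by (simp add: fourier_integral_eq norm_mult)

lemma norm_inv_fourier_le:
  "norm (inv_fourier f (\<xi>::'a::euclidean_space)) \<le> fconst TYPE('a) * (LINT x|lborel. norm (f x))"
  using norm_fourier_integral_le[of "\<lambda>x. cnj (f x)" \<xi>] by (simp add: cnj_inv_fourier[symmetric])

text \<open>A convergence factor for Fourier integrals; its Fourier transform is an approximate identity.\<close>

definition gauss_reg :: "real \<Rightarrow> 'a::euclidean_space \<Rightarrow> real" where
  "gauss_reg \<epsilon> \<xi> = exp (- (\<epsilon> * norm \<xi>)\<^sup>2 / 2)"

lemma gauss_reg_eq: "gauss_reg \<epsilon> (\<xi>::'a::euclidean_space) = gauss (\<epsilon> *\<^sub>R \<xi>) / fconst TYPE('a)"
  by (simp add: gauss_reg_def gauss_eq fconst_def power_mult_distrib)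

lemma gauss_reg_measurable [measurable]: "gauss_reg \<epsilon> \<in> borel_measurable borel"
  unfolding gauss_reg_def[abs_def] by measurable

lemma gauss_reg_bounds: "0 < gauss_reg \<epsilon> \<xi>" "gauss_reg \<epsilon> \<xi> \<le> 1"
  by (auto simp: gauss_reg_def)

lemma gauss_affine_integral:
  fixes y :: "'a::euclidean_space"
  assumes "\<epsilon> > 0"
  shows "(\<integral>\<^sup>+x. ennreal (gauss ((x - y) /\<^sub>R \<epsilon>) / \<epsilon> ^ DIM('a)) \<partial>lborel) = 1"
proof -
  have "(\<integral>\<^sup>+x. ennreal (gauss ((x - y) /\<^sub>R \<epsilon>) / \<epsilon> ^ DIM('a)) \<partial>lborel)
    = ennreal (\<bar>\<epsilon>\<bar> ^ DIM('a)) * (\<integral>\<^sup>+x. ennreal (gauss ((y + \<epsilon> *\<^sub>R x - y) /\<^sub>R \<epsilon>) / \<epsilon> ^ DIM('a)) \<partial>lborel)"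
    by (rule nn_integral_lborel_affine) (use assms in auto)
  also have "\<dots> = ennreal (\<epsilon> ^ DIM('a)) * (\<integral>\<^sup>+x. ennreal (1 / \<epsilon> ^ DIM('a)) * ennreal (gauss (x::'a)) \<partial>lborel)"
    using assms by (subst ennreal_mult[symmetric]) auto
  also have "\<dots> = ennreal (\<epsilon> ^ DIM('a)) * (ennreal (1 / \<epsilon> ^ DIM('a)) * (\<integral>\<^sup>+x. ennreal (gauss (x::'a)) \<partial>lborel))"
    by (subst nn_integral_cmult) auto
  also have "(\<integral>\<^sup>+x. ennreal (gauss (x::'a)) \<partial>lborel) = 1"
    by (subst nn_integral_eq_integral) (auto simp: gauss_integrable gauss_nonneg gauss_integral)
  also have "ennreal (\<epsilon> ^ DIM('a)) * (ennreal (1 / \<epsilon> ^ DIM('a)) * 1) = 1"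
    using assms by (simp add: ennreal_mult[symmetric])
  finally show ?thesis .
qed

lemma gauss_reg_integrable: assumes "\<epsilon> > 0" shows "integrable lborel (gauss_reg \<epsilon> :: 'a::euclidean_space \<Rightarrow> real)"
proof -
  have "(\<integral>\<^sup>+x. ennreal (norm (gauss ((x::'a) /\<^sub>R (1/\<epsilon>)) / (1/\<epsilon>) ^ DIM('a))) \<partial>lborel) = 1"
    using gauss_affine_integral[of "1/\<epsilon>" "0::'a"] assms gauss_nonneg by simp
  then have "integrable lborel (\<lambda>x::'a. gauss (x /\<^sub>R (1/\<epsilon>)) / (1/\<epsilon>) ^ DIM('a))"
    by (intro integrableI_bounded) auto
  then have "integrable lborel (\<lambda>x::'a. ((1/\<epsilon>) ^ DIM('a) / fconst TYPE('a)) * (gauss (x /\<^sub>R (1/\<epsilon>)) / (1/\<epsilon>) ^ DIM('a)))"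
    by (rule integrable_mult_right)
  also have "(\<lambda>x::'a. ((1/\<epsilon>) ^ DIM('a) / fconst TYPE('a)) * (gauss (x /\<^sub>R (1/\<epsilon>)) / (1/\<epsilon>) ^ DIM('a))) = gauss_reg \<epsilon>"
    using assms by (auto simp: gauss_reg_eq)
  finally show ?thesis .
qed

lemma gauss_reg_fourier:
  fixes z :: "'a::euclidean_space"
  assumes "\<epsilon> > 0"
  shows "(LINT \<xi>|lborel. complex_of_real (gauss_reg \<epsilon> \<xi>) * cis (z \<bullet> \<xi>))
    = complex_of_real ((2 * pi) ^ DIM('a) * (gauss (z /\<^sub>R \<epsilon>) / \<epsilon> ^ DIM('a)))"
proof -
  let ?c = "fconst TYPE('a)"
  have c: "?c > 0" by (rule fconst_pos)
  have "(LINT \<xi>|lborel. complex_of_real (gauss_reg \<epsilon> \<xi>) * cis (z \<bullet> \<xi>))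
    = \<bar>1/\<epsilon>\<bar> ^ DIM('a) *\<^sub>R (LINT \<xi>|lborel. complex_of_real (gauss_reg \<epsilon> (0 + (1/\<epsilon>) *\<^sub>R \<xi>)) * cis (z \<bullet> (0 + (1/\<epsilon>) *\<^sub>R \<xi>)))"
    by (rule integral_lborel_affine) (use assms in auto)
  also have "\<dots> = (1/\<epsilon>) ^ DIM('a) *\<^sub>R (LINT \<xi>|lborel. complex_of_real (1 / ?c) * (complex_of_real (gauss \<xi>) * cis ((z /\<^sub>R \<epsilon>) \<bullet> \<xi>)))"
    using assms by (simp add: gauss_reg_eq divide_inverse mult_ac)
  also have "\<dots> = complex_of_real ((1/\<epsilon>) ^ DIM('a) / ?c * exp (- (norm (z /\<^sub>R \<epsilon>))\<^sup>2 / 2))"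
    unfolding integral_mult_right_zero gauss_fourier by (simp add: scaleR_conv_of_real)
  also have "exp (- (norm (z /\<^sub>R \<epsilon>))\<^sup>2 / 2) = gauss (z /\<^sub>R \<epsilon>) / ?c"
    using c by (simp add: gauss_eq fconst_def)
  also have "(1/\<epsilon>) ^ DIM('a) / ?c * (gauss (z /\<^sub>R \<epsilon>) / ?c) = (2 * pi) ^ DIM('a) * (gauss (z /\<^sub>R \<epsilon>) / \<epsilon> ^ DIM('a))"
  proof -
    have "1 / ?c / ?c = (2 * pi) ^ DIM('a)"
      using fconst_square[where 'a='a] c by (simp add: field_simps power2_eq_square)
    moreover have "(1/\<epsilon>) ^ DIM('a) / ?c * (gauss (z /\<^sub>R \<epsilon>) / ?c) = 1 / ?c / ?c * (gauss (z /\<^sub>R \<epsilon>) / \<epsilon> ^ DIM('a))"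
      by (simp add: power_one_over)
    ultimately show ?thesis by simp
  qed
  finally show ?thesis .
qed

lemma gauss_reg_tendsto: "(\<lambda>n. gauss_reg (inverse (real (Suc n))) \<xi>) \<longlonglongrightarrow> 1"
proof -
  have "(\<lambda>n. exp (- (inverse (real (Suc n)) * norm \<xi>)\<^sup>2 / 2)) \<longlonglongrightarrow> exp (- (0 * norm \<xi>)\<^sup>2 / 2)"
    by (intro tendsto_intros LIMSEQ_inverse_real_of_nat) auto
  then show ?thesis by (simp add: gauss_reg_def)
qed

text \<open>The Gaussian factor makes the double integral absolutely convergent, so the order may be
  exchanged, and the inner frequency integral is an explicit Gaussian of width \<epsilon>.
  Regularized inversion is therefore an average of \<open>f\<close> around \<open>x\<close>. The
  constants reduce to 1 only after a second factor \<open>fconst\<close> joins, by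
  \<open>fconst_square\<close>.\<close>

lemma fourier_reg_inner:
  fixes f :: "'a::euclidean_space \<Rightarrow> complex"
  assumes f: "integrable lborel f" and \<epsilon>: "\<epsilon> > 0"
  defines "c \<equiv> complex_of_real (fconst TYPE('a))"
  shows "(LINT \<xi>|lborel. complex_of_real (gauss_reg \<epsilon> \<xi>) * cis (- (x \<bullet> \<xi>)) * inv_fourier f \<xi>)
    = c * (LINT y|lborel. complex_of_real ((2 * pi) ^ DIM('a) * (gauss ((y - x) /\<^sub>R \<epsilon>) / \<epsilon> ^ DIM('a))) * f y)"
proof -
  have G: "integrable lborel (\<lambda>\<xi>. complex_of_real (gauss_reg \<epsilon> \<xi>) * cis (- (x \<bullet> \<xi>)))"
    by (rule integrable_mult_cis) (use gauss_reg_integrable[OF \<epsilon>] in auto)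
  have "(LINT \<xi>|lborel. complex_of_real (gauss_reg \<epsilon> \<xi>) * cis (- (x \<bullet> \<xi>)) * inv_fourier f \<xi>)
    = c * (LINT \<xi>|lborel. (complex_of_real (gauss_reg \<epsilon> \<xi>) * cis (- (x \<bullet> \<xi>))) * (LINT y|lborel. cis (\<xi> \<bullet> y) * f y))"
    by (simp add: inv_fourier_def c_def mult_ac inner_commute integral_mult_right_zero[symmetric])
  also have "\<dots> = c * (LINT y|lborel. (LINT \<xi>|lborel. (complex_of_real (gauss_reg \<epsilon> \<xi>) * cis (- (x \<bullet> \<xi>))) * cis (\<xi> \<bullet> y)) * f y)"
    by (subst lborel_Fubini_kernel[OF G f, where M=1]) auto
  also have "(\<lambda>y. (LINT \<xi>|lborel. (complex_of_real (gauss_reg \<epsilon> \<xi>) * cis (- (x \<bullet> \<xi>))) * cis (\<xi> \<bullet> y)))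
      = (\<lambda>y. LINT \<xi>|lborel. complex_of_real (gauss_reg \<epsilon> \<xi>) * cis ((y - x) \<bullet> \<xi>))"
    by (simp add: mult.assoc cis_mult inner_diff_left inner_diff_right inner_commute)
  finally show ?thesis by (simp only: gauss_reg_fourier[OF \<epsilon>])
qed

lemma abs_gauss_reg: "\<bar>gauss_reg \<epsilon> \<xi>\<bar> = gauss_reg \<epsilon> \<xi>"
  by (simp add: gauss_reg_def)

lemma ennreal_norm_integral_le:
  fixes f :: "'a \<Rightarrow> 'b::{banach, second_countable_topology}"
  shows "ennreal (norm (integral\<^sup>L M f)) \<le> (\<integral>\<^sup>+x. ennreal (norm (f x)) \<partial>M)"
  by (cases "integrable M f") (auto simp: integral_norm_bound_ennreal not_integrable_integral_eq)

text \<open>The weighted energy equals a quadratic form in \<open>f\<close> with kernel G(y - x),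
  where \<open>G\<close> is a Gaussian of mass one in either variable. The inequality |f(y) f(x)|
  \<le> (|f(y)|^2 + |f(x)|^2)/2 then bounds the form by the integral of |f|^2, as in Schur's test,
  with constant exactly 1.\<close>

lemma plancherel_regularized:
  fixes f :: "'a::euclidean_space \<Rightarrow> complex"
  assumes f: "integrable lborel f" and f2: "integrable lborel (\<lambda>x. (norm (f x))\<^sup>2)" and e: "\<epsilon> > 0"
  shows "(\<integral>\<^sup>+\<xi>. ennreal (gauss_reg \<epsilon> \<xi> * (norm (inv_fourier f \<xi>))\<^sup>2) \<partial>lborel) \<le> ennreal (LINT x|lborel. (norm (f x))\<^sup>2)"
proof -
  have [measurable]: "f \<in> borel_measurable borel" using f by auto
  note [measurable] = fourier_integral_measurable
  let ?\<phi> = "inv_fourier f" and ?c = "complex_of_real (fconst TYPE('a))"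
  define G where "G z = gauss (z /\<^sub>R \<epsilon>) / \<epsilon> ^ DIM('a)" for z :: 'a
  have G0: "0 \<le> G z" for z using e by (simp add: G_def)
  have [measurable]: "G \<in> borel_measurable borel" unfolding G_def[abs_def] by measurable
  have Gsym: "G (x - y) = G (y - x)" for x y
    by (simp add: G_def gauss_eq norm_minus_commute)
  have G1: "(\<integral>\<^sup>+x. ennreal (G (x - y)) \<partial>lborel) = 1" for y
    using gauss_affine_integral[OF e, of y] by (simp add: G_def)
  have G2: "(\<integral>\<^sup>+x. ennreal (G (y - x)) \<partial>lborel) = 1" for y
  proof -
    have "(\<lambda>x. ennreal (G (y - x))) = (\<lambda>x. ennreal (G (x - y)))"
      by (intro ext arg_cong[where f=ennreal] Gsym)
    then show ?thesis by (simp only: G1)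
  qed
  have bnd: "norm (?\<phi> \<xi>) \<le> fconst TYPE('a) * (LINT x|lborel. norm (f x))" for \<xi>
    by (rule norm_inv_fourier_le)
  let ?B = "fconst TYPE('a) * (LINT x|lborel. norm (f x))"
  have gint: "integrable lborel (\<lambda>\<xi>::'a. complex_of_real (gauss_reg \<epsilon> \<xi>))"
    using gauss_reg_integrable[OF e, where 'a='a] by simp
  have B0: "0 \<le> ?B" using order_trans[OF norm_ge_zero bnd] .
  have gphi: "integrable lborel (\<lambda>\<xi>. complex_of_real (gauss_reg \<epsilon> \<xi>) * ?\<phi> \<xi>)"
  proof (rule Bochner_Integration.integrable_bound[OF integrable_mult_right[OF gint, of "complex_of_real ?B"]])
    show "AE \<xi> in lborel. norm (complex_of_real (gauss_reg \<epsilon> \<xi>) * ?\<phi> \<xi>) \<le> norm (complex_of_real ?B * complex_of_real (gauss_reg \<epsilon> \<xi>))"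
    proof (rule AE_I2)
      fix \<xi> :: 'a
      have "norm (complex_of_real ?B * complex_of_real (gauss_reg \<epsilon> \<xi>)) = ?B * gauss_reg \<epsilon> \<xi>"
        unfolding norm_mult norm_of_real abs_gauss_reg using B0 by (simp only: abs_of_nonneg)
      then show "norm (complex_of_real (gauss_reg \<epsilon> \<xi>) * ?\<phi> \<xi>) \<le> norm (complex_of_real ?B * complex_of_real (gauss_reg \<epsilon> \<xi>))"
        using mult_right_mono[OF bnd less_imp_le[OF gauss_reg_bounds(1)]]
        by (simp only: norm_mult norm_of_real abs_gauss_reg mult.commute)
    qed
  qed measurable
  have cf: "integrable lborel (\<lambda>x. cnj (f x))" using f by simp
  have "(LINT \<xi>|lborel. complex_of_real (gauss_reg \<epsilon> \<xi>) * ?\<phi> \<xi> * cnj (?\<phi> \<xi>))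
    = ?c * (LINT \<xi>|lborel. complex_of_real (gauss_reg \<epsilon> \<xi>) * ?\<phi> \<xi> * (LINT x|lborel. cis (- (x \<bullet> \<xi>)) * cnj (f x)))"
    unfolding cnj_inv_fourier fourier_integral_eq
    by (subst integral_mult_right_zero[symmetric]) (simp add: mult_ac)
  also have "(LINT \<xi>|lborel. complex_of_real (gauss_reg \<epsilon> \<xi>) * ?\<phi> \<xi> * (LINT x|lborel. cis (- (x \<bullet> \<xi>)) * cnj (f x)))
    = (LINT x|lborel. (LINT \<xi>|lborel. complex_of_real (gauss_reg \<epsilon> \<xi>) * ?\<phi> \<xi> * cis (- (x \<bullet> \<xi>))) * cnj (f x))"
    by (rule lborel_Fubini_kernel[OF gphi cf, where M=1]) (auto simp: inner_commute)
  also have "(\<lambda>x. LINT \<xi>|lborel. complex_of_real (gauss_reg \<epsilon> \<xi>) * ?\<phi> \<xi> * cis (- (x \<bullet> \<xi>)))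
    = (\<lambda>x. ?c * (LINT y|lborel. complex_of_real ((2 * pi) ^ DIM('a) * G (y - x)) * f y))"
    using fourier_reg_inner[OF f e] by (simp add: mult_ac G_def)
  also have "?c * (LINT x|lborel. ?c * (LINT y|lborel. complex_of_real ((2 * pi) ^ DIM('a) * G (y - x)) * f y) * cnj (f x))
     = (?c\<^sup>2 * complex_of_real ((2 * pi) ^ DIM('a))) * (LINT x|lborel. (LINT y|lborel. complex_of_real (G (y - x)) * f y) * cnj (f x))"
    by (simp add: mult.assoc power2_eq_square)
  also have "?c\<^sup>2 * complex_of_real ((2 * pi) ^ DIM('a)) = 1"
    using fconst_square[where 'a='a] by (simp only: of_real_power[symmetric] of_real_mult[symmetric] of_real_1)
  finally have eq: "(LINT \<xi>|lborel. complex_of_real (gauss_reg \<epsilon> \<xi>) * ?\<phi> \<xi> * cnj (?\<phi> \<xi>))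
    = (LINT x|lborel. (LINT y|lborel. complex_of_real (G (y - x)) * f y) * cnj (f x))" by simp
  have gphi2: "integrable lborel (\<lambda>\<xi>. gauss_reg \<epsilon> \<xi> * (norm (?\<phi> \<xi>))\<^sup>2)"
  proof (rule Bochner_Integration.integrable_bound[OF integrable_mult_right[OF gauss_reg_integrable[OF e], of "?B\<^sup>2"]])
    show "AE \<xi> in lborel. norm (gauss_reg \<epsilon> \<xi> * (norm (?\<phi> \<xi>))\<^sup>2) \<le> norm (?B\<^sup>2 * gauss_reg \<epsilon> \<xi>)"
      using gauss_reg_bounds(1)[of \<epsilon>] power_mono[OF bnd, of _ 2]
      by (intro AE_I2) (simp add: abs_mult mult.commute abs_of_nonneg less_imp_le mult_left_mono del: power_mult_distrib)
  qed measurable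
  have "(\<integral>\<^sup>+\<xi>. ennreal (gauss_reg \<epsilon> \<xi> * (norm (?\<phi> \<xi>))\<^sup>2) \<partial>lborel) = ennreal (LINT \<xi>|lborel. gauss_reg \<epsilon> \<xi> * (norm (?\<phi> \<xi>))\<^sup>2)"
    by (rule nn_integral_eq_integral[OF gphi2]) (simp add: less_imp_le[OF gauss_reg_bounds(1)])
  also have "(LINT \<xi>|lborel. gauss_reg \<epsilon> \<xi> * (norm (?\<phi> \<xi>))\<^sup>2) = norm (LINT \<xi>|lborel. complex_of_real (gauss_reg \<epsilon> \<xi>) * ?\<phi> \<xi> * cnj (?\<phi> \<xi>))"
  proof -
    have "(LINT \<xi>|lborel. complex_of_real (gauss_reg \<epsilon> \<xi>) * ?\<phi> \<xi> * cnj (?\<phi> \<xi>)) = complex_of_real (LINT \<xi>|lborel. gauss_reg \<epsilon> \<xi> * (norm (?\<phi> \<xi>))\<^sup>2)"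
    proof -
      have "complex_of_real (gauss_reg \<epsilon> \<xi>) * ?\<phi> \<xi> * cnj (?\<phi> \<xi>) = complex_of_real (gauss_reg \<epsilon> \<xi> * (norm (?\<phi> \<xi>))\<^sup>2)" for \<xi>
        by (simp add: mult.assoc complex_norm_square[symmetric])
      then have "(LINT \<xi>|lborel. complex_of_real (gauss_reg \<epsilon> \<xi>) * ?\<phi> \<xi> * cnj (?\<phi> \<xi>))
        = (LINT \<xi>|lborel. complex_of_real (gauss_reg \<epsilon> \<xi> * (norm (?\<phi> \<xi>))\<^sup>2))" by (simp only:)
      also have "\<dots> = complex_of_real (LINT \<xi>|lborel. gauss_reg \<epsilon> \<xi> * (norm (?\<phi> \<xi>))\<^sup>2)"
        by (rule Bochner_Integration.integral_complex_of_real)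
      finally show ?thesis .
    qed
    then show ?thesis
      by (simp add: abs_of_nonneg less_imp_le[OF gauss_reg_bounds(1)])
  qed
  also have "ennreal \<dots> \<le> (\<integral>\<^sup>+x. ennreal (norm ((LINT y|lborel. complex_of_real (G (y - x)) * f y) * cnj (f x))) \<partial>lborel)"
    unfolding eq by (rule ennreal_norm_integral_le)
  also have "\<dots> \<le> (\<integral>\<^sup>+x. (\<integral>\<^sup>+y. ennreal (G (y - x)) * ennreal ((norm (f y))\<^sup>2 / 2) + ennreal (G (y - x)) * ennreal ((norm (f x))\<^sup>2 / 2) \<partial>lborel) \<partial>lborel)"
  proof (rule nn_integral_mono)
    fix x
    have "ennreal (norm ((LINT y|lborel. complex_of_real (G (y - x)) * f y) * cnj (f x)))
      \<le> (\<integral>\<^sup>+y. ennreal (norm (complex_of_real (G (y - x)) * f y * cnj (f x))) \<partial>lborel)"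
      by (subst integral_mult_left_zero[symmetric]) (rule ennreal_norm_integral_le)
    also have "\<dots> \<le> (\<integral>\<^sup>+y. ennreal (G (y - x)) * ennreal ((norm (f y))\<^sup>2 / 2) + ennreal (G (y - x)) * ennreal ((norm (f x))\<^sup>2 / 2) \<partial>lborel)"
    proof (rule nn_integral_mono)
      fix y
      have "norm (f y) * norm (f x) \<le> (norm (f y))\<^sup>2 / 2 + (norm (f x))\<^sup>2 / 2"
        using sum_squares_bound[of "norm (f y)" "norm (f x)"] by (simp add: add_divide_distrib[symmetric])
      from mult_left_mono[OF this G0[of "y - x"]]
      show "ennreal (norm (complex_of_real (G (y - x)) * f y * cnj (f x)))
        \<le> ennreal (G (y - x)) * ennreal ((norm (f y))\<^sup>2 / 2) + ennreal (G (y - x)) * ennreal ((norm (f x))\<^sup>2 / 2)"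
        using G0[of "y - x"]
        by (simp add: norm_mult ennreal_mult[symmetric] ennreal_plus[symmetric] distrib_left mult.assoc ennreal_leI del: ennreal_plus)
    qed
    finally show "ennreal (norm ((LINT y|lborel. complex_of_real (G (y - x)) * f y) * cnj (f x)))
      \<le> (\<integral>\<^sup>+y. ennreal (G (y - x)) * ennreal ((norm (f y))\<^sup>2 / 2) + ennreal (G (y - x)) * ennreal ((norm (f x))\<^sup>2 / 2) \<partial>lborel)" .
  qed
  also have "\<dots> = (\<integral>\<^sup>+x. (\<integral>\<^sup>+y. ennreal (G (y - x)) * ennreal ((norm (f y))\<^sup>2 / 2) \<partial>lborel) \<partial>lborel)
     + (\<integral>\<^sup>+x. (\<integral>\<^sup>+y. ennreal (G (y - x)) * ennreal ((norm (f x))\<^sup>2 / 2) \<partial>lborel) \<partial>lborel)"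
    by (simp add: nn_integral_add)
  also have "(\<integral>\<^sup>+x. (\<integral>\<^sup>+y. ennreal (G (y - x)) * ennreal ((norm (f x))\<^sup>2 / 2) \<partial>lborel) \<partial>lborel) = (\<integral>\<^sup>+x. ennreal ((norm (f x))\<^sup>2 / 2) \<partial>lborel)"
    by (simp add: nn_integral_multc G1)
  also have "(\<integral>\<^sup>+x. (\<integral>\<^sup>+y. ennreal (G (y - x)) * ennreal ((norm (f y))\<^sup>2 / 2) \<partial>lborel) \<partial>lborel)
     = (\<integral>\<^sup>+y. (\<integral>\<^sup>+x. ennreal (G (y - x)) * ennreal ((norm (f y))\<^sup>2 / 2) \<partial>lborel) \<partial>lborel)"
    by (rule lborel_pair.Fubini') measurable
  also have "\<dots> = (\<integral>\<^sup>+y. ennreal ((norm (f y))\<^sup>2 / 2) \<partial>lborel)"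
    by (simp add: nn_integral_multc G2)
  also have "\<dots> + (\<integral>\<^sup>+x. ennreal ((norm (f x))\<^sup>2 / 2) \<partial>lborel) = (\<integral>\<^sup>+x. ennreal ((norm (f x))\<^sup>2) \<partial>lborel)"
    by (subst nn_integral_add[symmetric]) (auto simp: ennreal_plus[symmetric] simp del: ennreal_plus)
  also have "\<dots> = ennreal (LINT x|lborel. (norm (f x))\<^sup>2)"
    by (rule nn_integral_eq_integral[OF f2]) auto
  finally show ?thesis .
qed

text \<open>Fatou's lemma along \<epsilon> = 1/(n + 1) removes the Gaussian weight.\<close>

lemma plancherel_le:
  fixes f :: "'a::euclidean_space \<Rightarrow> complex"
  assumes f: "integrable lborel f" and f2: "integrable lborel (\<lambda>x. (norm (f x))\<^sup>2)"
  shows "(\<integral>\<^sup>+\<xi>. ennreal ((norm (inv_fourier f \<xi>))\<^sup>2) \<partial>lborel) \<le> ennreal (LINT x|lborel. (norm (f x))\<^sup>2)"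
proof -
  have [measurable]: "f \<in> borel_measurable borel" using f by auto
  note [measurable] = fourier_integral_measurable
  let ?g = "\<lambda>n \<xi>. ennreal (gauss_reg (inverse (real (Suc n))) \<xi> * (norm (inv_fourier f \<xi>))\<^sup>2)"
  have "liminf (\<lambda>n. ?g n \<xi>) = ennreal ((norm (inv_fourier f \<xi>))\<^sup>2)" for \<xi>
  proof (rule lim_imp_Liminf)
    have "(\<lambda>n. gauss_reg (inverse (real (Suc n))) \<xi> * (norm (inv_fourier f \<xi>))\<^sup>2) \<longlonglongrightarrow> 1 * (norm (inv_fourier f \<xi>))\<^sup>2"
      by (intro tendsto_mult_right gauss_reg_tendsto)
    then show "(\<lambda>n. ?g n \<xi>) \<longlonglongrightarrow> ennreal ((norm (inv_fourier f \<xi>))\<^sup>2)" by (simp add: tendsto_ennrealI)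
  qed auto
  then have "(\<integral>\<^sup>+\<xi>. ennreal ((norm (inv_fourier f \<xi>))\<^sup>2) \<partial>lborel) = (\<integral>\<^sup>+\<xi>. liminf (\<lambda>n. ?g n \<xi>) \<partial>lborel)" by simp
  also have "\<dots> \<le> liminf (\<lambda>n. \<integral>\<^sup>+\<xi>. ?g n \<xi> \<partial>lborel)"
    by (rule nn_integral_liminf) measurable
  also have "\<dots> \<le> limsup (\<lambda>n. \<integral>\<^sup>+\<xi>. ?g n \<xi> \<partial>lborel)" by (rule Liminf_le_Limsup) simp
  also have "\<dots> \<le> ennreal (LINT x|lborel. (norm (f x))\<^sup>2)"
    by (rule Limsup_bounded) (intro always_eventually allI plancherel_regularized f f2, simp)
  finally show ?thesis .
qed

text \<open>The regularized inversion integral is followed to its limit twice: on the frequency side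
  by domination with the integrable transform, on the space side as an average of \<open>f\<close>
  over Gaussians shrinking to \<open>x\<close>. The second limit is where continuity and boundedness
  of \<open>f\<close> enter.\<close>

lemma fourier_inversion:
  fixes f :: "'a::euclidean_space \<Rightarrow> complex"
  assumes f: "integrable lborel f" "continuous_on UNIV f" "\<And>x. norm (f x) \<le> M"
    and F: "integrable lborel (inv_fourier f)"
  shows "fourier_integral (inv_fourier f) x = f x"
proof -
  let ?c = "fconst TYPE('a)"
  have [measurable]: "f \<in> borel_measurable borel" using f by auto
  note [measurable] = fourier_integral_measurable
  define e where "e n = inverse (real (Suc n))" for n
  have e: "e n > 0" for n by (simp add: e_def)
  have elim: "e \<longlonglongrightarrow> 0" unfolding e_def[abs_def] by (rule LIMSEQ_inverse_real_of_nat)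
  let ?I = "\<lambda>n. LINT \<xi>|lborel. complex_of_real (gauss_reg (e n) \<xi>) * cis (- (x \<bullet> \<xi>)) * inv_fourier f \<xi>"
  have lim1: "?I \<longlonglongrightarrow> (LINT \<xi>|lborel. cis (- (\<xi> \<bullet> x)) * inv_fourier f \<xi>)"
  proof (rule integral_dominated_convergence[where w="\<lambda>\<xi>. norm (inv_fourier f \<xi>)"])
    show "AE \<xi> in lborel. (\<lambda>n. complex_of_real (gauss_reg (e n) \<xi>) * cis (- (x \<bullet> \<xi>)) * inv_fourier f \<xi>) \<longlonglongrightarrow> cis (- (\<xi> \<bullet> x)) * inv_fourier f \<xi>"
    proof (rule AE_I2)
      fix \<xi> :: 'a
      have "(\<lambda>n. complex_of_real (gauss_reg (e n) \<xi>) * (cis (- (x \<bullet> \<xi>)) * inv_fourier f \<xi>)) \<longlonglongrightarrow> complex_of_real 1 * (cis (- (x \<bullet> \<xi>)) * inv_fourier f \<xi>)"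
        unfolding e_def by (intro tendsto_mult_right tendsto_of_real gauss_reg_tendsto)
      then show "(\<lambda>n. complex_of_real (gauss_reg (e n) \<xi>) * cis (- (x \<bullet> \<xi>)) * inv_fourier f \<xi>) \<longlonglongrightarrow> cis (- (\<xi> \<bullet> x)) * inv_fourier f \<xi>"
        by (simp add: inner_commute mult.assoc)
    qed
    show "AE \<xi> in lborel. norm (complex_of_real (gauss_reg (e n) \<xi>) * cis (- (x \<bullet> \<xi>)) * inv_fourier f \<xi>) \<le> norm (inv_fourier f \<xi>)" for n
      by (intro AE_I2) (simp add: norm_mult mult_left_le_one_le abs_gauss_reg gauss_reg_bounds less_imp_le[OF gauss_reg_bounds(1)])
    show "integrable lborel (\<lambda>\<xi>. norm (inv_fourier f \<xi>))" using F by simp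
  qed measurable
  let ?J = "\<lambda>n. LINT z|lborel. complex_of_real (gauss z) * f (x + e n *\<^sub>R z)"
  have J: "?I n = complex_of_real (?c * (2 * pi) ^ DIM('a)) * ?J n" for n
  proof -
    have "(LINT y|lborel. complex_of_real ((2 * pi) ^ DIM('a) * (gauss ((y - x) /\<^sub>R e n) / e n ^ DIM('a))) * f y)
      = \<bar>e n\<bar> ^ DIM('a) *\<^sub>R (LINT z|lborel. complex_of_real ((2 * pi) ^ DIM('a) * (gauss ((x + e n *\<^sub>R z - x) /\<^sub>R e n) / e n ^ DIM('a))) * f (x + e n *\<^sub>R z))"
      by (rule integral_lborel_affine) (use e[of n] in auto)
    also have "\<dots> = e n ^ DIM('a) *\<^sub>R (LINT z|lborel. complex_of_real ((2 * pi) ^ DIM('a) / e n ^ DIM('a)) * (complex_of_real (gauss z) * f (x + e n *\<^sub>R z)))"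
      using e[of n] by (simp add: mult.assoc)
    also have "\<dots> = complex_of_real ((2 * pi) ^ DIM('a)) * ?J n"
      unfolding integral_mult_right_zero using e[of n] by (simp add: scaleR_conv_of_real)
    finally show ?thesis using fourier_reg_inner[OF f(1) e, of n x] by (simp add: mult.assoc)
  qed
  have "?J \<longlonglongrightarrow> (LINT z|lborel. complex_of_real (gauss (z::'a)) * f x)"
  proof (rule integral_dominated_convergence[where w="\<lambda>z::'a. gauss z * M"])
    show "AE z in lborel. (\<lambda>n. complex_of_real (gauss z) * f (x + e n *\<^sub>R z)) \<longlonglongrightarrow> complex_of_real (gauss z) * f x"
    proof (rule AE_I2)
      fix z :: 'a
      have "(\<lambda>n. x + e n *\<^sub>R z) \<longlonglongrightarrow> x + 0 *\<^sub>R z" by (intro tendsto_intros elim)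
      then have "(\<lambda>n. f (x + e n *\<^sub>R z)) \<longlonglongrightarrow> f x"
        using continuous_on_tendsto_compose[OF f(2), of "\<lambda>n. x + e n *\<^sub>R z" x] by simp
      then show "(\<lambda>n. complex_of_real (gauss z) * f (x + e n *\<^sub>R z)) \<longlonglongrightarrow> complex_of_real (gauss z) * f x"
        by (rule tendsto_mult_left)
    qed
    show "AE z in lborel. norm (complex_of_real (gauss z) * f (x + e n *\<^sub>R z)) \<le> gauss z * M" for n
      using f(3) by (intro AE_I2) (simp add: norm_mult mult_left_mono)
    show "integrable lborel (\<lambda>z::'a. gauss z * M)" using gauss_integrable[where 'a='a] by simp
  qed measurable
  also have "(LINT z|lborel. complex_of_real (gauss (z::'a)) * f x) = f x"
    using gauss_integral[where 'a='a] by simp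
  finally have "?I \<longlonglongrightarrow> complex_of_real (?c * (2 * pi) ^ DIM('a)) * f x"
    unfolding J by (intro tendsto_mult_left)
  from LIMSEQ_unique[OF lim1 this]
  have "fourier_integral (inv_fourier f) x = complex_of_real (?c\<^sup>2 * (2 * pi) ^ DIM('a)) * f x"
    by (simp add: fourier_integral_eq power2_eq_square)
  then show ?thesis by (simp only: fconst_square of_real_1 mult_1)
qed

section \<open>Smoothness and decay of transforms of test functions\<close>

lemma cis_quadratic_remainder: "norm (cis (s + t) - cis s - \<i> * of_real t * cis s) \<le> t\<^sup>2"
proof -
  have "cis (s + t) - cis s - \<i> * of_real t * cis s = cis s * (iexp t - (\<Sum>k\<le>1. (\<i> * complex_of_real t) ^ k / fact k))"
    unfolding cis_mult[symmetric] cis_conv_exp[of t] by (simp add: algebra_simps)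
  also have "norm \<dots> = norm (iexp t - (\<Sum>k\<le>1. (\<i> * complex_of_real t) ^ k / fact k))"
    by (simp add: norm_mult)
  also have "\<dots> \<le> \<bar>t\<bar> ^ (Suc 1) / fact (Suc 1)" by (rule iexp_approx1)
  also have "\<dots> \<le> t\<^sup>2" by (simp add: power2_eq_square)
  finally show ?thesis .
qed

text \<open>Differentiation under the integral with an explicit error: for |x| \<le> R the
  exponential differs from its linearization in \<open>h\<close> by at most (R |h|)^2, so the
  remainder is quadratic in \<open>h\<close>.\<close>

lemma inv_fourier_has_derivative:
  fixes f :: "'a::euclidean_space \<Rightarrow> complex"
  assumes "test_fun f"
  shows "(inv_fourier f has_derivative (\<lambda>v. inv_fourier (\<lambda>x. \<i> * of_real (x \<bullet> v) * f x) \<xi>)) (at \<xi>)"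
proof -
  let ?L = "\<lambda>v. inv_fourier (\<lambda>x. \<i> * of_real (x \<bullet> v) * f x) \<xi>"
  obtain R where R: "R > 0" "\<And>x. R < norm x \<Longrightarrow> f x = 0" using test_fun_support[OF assms] by blast
  have [measurable]: "f \<in> borel_measurable borel" by (rule test_fun_measurable[OF assms])
  have int: "integrable lborel (\<lambda>x. \<i> * of_real (x \<bullet> v) * f x)" for v
    by (intro test_fun_integrable test_fun_mult_left assms smooth_fun_mult smooth_fun_const smooth_fun_inner)
  have fint: "integrable lborel f" by (rule test_fun_integrable[OF assms])
  let ?K = "LINT x|lborel. norm (f x)"
  have lin: "bounded_linear ?L"
  proof (rule bounded_linear_intro[where K="fconst TYPE('a) * (R * ?K)"])
    fix v w :: 'a and c :: real
    have "integrable lborel (\<lambda>x. cis (x \<bullet> \<xi>) * (\<i> * of_real (x \<bullet> v) * f x))" for v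
      by (rule integrable_cis_mult[OF int]) measurable
    then show "?L (v + w) = ?L v + ?L w"
      by (simp add: inv_fourier_def inner_add_right distrib_left distrib_right)
    have "?L (c *\<^sub>R v) = complex_of_real (fconst TYPE('a)) * (LINT x|lborel. of_real c * (cis (x \<bullet> \<xi>) * (\<i> * of_real (x \<bullet> v) * f x)))"
      by (simp add: inv_fourier_def mult_ac)
    then show "?L (c *\<^sub>R v) = c *\<^sub>R ?L v"
      by (simp add: inv_fourier_def scaleR_conv_of_real)
    have "norm (?L v) \<le> fconst TYPE('a) * (LINT x|lborel. norm (\<i> * of_real (x \<bullet> v) * f x))"
      by (rule norm_inv_fourier_le)
    also have "(LINT x|lborel. norm (\<i> * of_real (x \<bullet> v) * f x)) \<le> (LINT x|lborel. (R * norm v) * norm (f x))"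
    proof (rule integral_mono)
      show "norm (\<i> * of_real (x \<bullet> v) * f x) \<le> R * norm v * norm (f x)" for x
      proof (cases "norm x \<le> R")
        case True
        then have "\<bar>x \<bullet> v\<bar> \<le> R * norm v"
          using Cauchy_Schwarz_ineq2[of x v] mult_right_mono[OF True norm_ge_zero[of v]] by linarith
        then show ?thesis by (simp add: norm_mult mult_right_mono)
      qed (use R in auto)
    qed (use int fint in auto)
    finally show "norm (?L v) \<le> norm v * (fconst TYPE('a) * (R * ?K))"
      using fconst_pos[where 'a='a] by (simp add: mult_ac)
  qed
  have rem: "norm (inv_fourier f (\<xi> + h) - inv_fourier f \<xi> - ?L h) \<le> (fconst TYPE('a) * (R\<^sup>2 * ?K)) * (norm h)\<^sup>2" for h
  proof -
    have i1: "integrable lborel (\<lambda>x. cis (x \<bullet> \<zeta>) * f x)" for \<zeta> by (rule integrable_cis_mult[OF fint]) measurable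
    have i2: "integrable lborel (\<lambda>x. cis (x \<bullet> \<xi>) * (\<i> * of_real (x \<bullet> h) * f x))" by (rule integrable_cis_mult[OF int]) measurable
    have "inv_fourier f (\<xi> + h) - inv_fourier f \<xi> - ?L h
      = complex_of_real (fconst TYPE('a)) * (LINT x|lborel. cis (x \<bullet> (\<xi> + h)) * f x - cis (x \<bullet> \<xi>) * f x - cis (x \<bullet> \<xi>) * (\<i> * of_real (x \<bullet> h) * f x))"
      using i1 i2 by (simp add: inv_fourier_def right_diff_distrib)
    also have "norm \<dots> \<le> fconst TYPE('a) * (LINT x|lborel. (R\<^sup>2 * (norm h)\<^sup>2) * norm (f x))"
      unfolding norm_mult norm_of_real using fconst_pos[where 'a='a]
    proof (intro mult_mono order_trans[OF integral_norm_bound] integral_mono)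
      show "norm (cis (x \<bullet> (\<xi> + h)) * f x - cis (x \<bullet> \<xi>) * f x - cis (x \<bullet> \<xi>) * (\<i> * of_real (x \<bullet> h) * f x)) \<le> R\<^sup>2 * (norm h)\<^sup>2 * norm (f x)" for x
      proof (cases "norm x \<le> R")
        case True
        have "cis (x \<bullet> (\<xi> + h)) * f x - cis (x \<bullet> \<xi>) * f x - cis (x \<bullet> \<xi>) * (\<i> * of_real (x \<bullet> h) * f x)
          = (cis (x \<bullet> \<xi> + x \<bullet> h) - cis (x \<bullet> \<xi>) - \<i> * of_real (x \<bullet> h) * cis (x \<bullet> \<xi>)) * f x"
          by (simp add: inner_add_right algebra_simps)
        also have "norm \<dots> \<le> (x \<bullet> h)\<^sup>2 * norm (f x)"
          unfolding norm_mult by (intro mult_right_mono cis_quadratic_remainder) simp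
        also have "(x \<bullet> h)\<^sup>2 \<le> (R * norm h)\<^sup>2"
        proof -
          have "\<bar>x \<bullet> h\<bar> \<le> R * norm h"
            using Cauchy_Schwarz_ineq2[of x h] mult_right_mono[OF True, of "norm h"] by simp
          then show ?thesis by (metis abs_ge_zero power2_abs power_mono)
        qed
        finally show ?thesis by (simp add: power_mult_distrib mult_right_mono)
      qed (use R in auto)
    qed (use i1 i2 fint in auto)
    finally show ?thesis by (simp add: mult_ac)
  qed
  let ?C = "fconst TYPE('a) * (R\<^sup>2 * ?K)"
  have "((\<lambda>h. norm (inv_fourier f (\<xi> + h) - inv_fourier f \<xi> - ?L h) / norm h) \<longlongrightarrow> 0) (at 0)"
  proof (rule Lim_null_comparison)
    show "\<forall>\<^sub>F h in at 0. norm (norm (inv_fourier f (\<xi> + h) - inv_fourier f \<xi> - ?L h) / norm h) \<le> ?C * norm h"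
    proof (rule eventually_at_topological[THEN iffD2], intro exI[of _ UNIV] conjI ballI impI)
      fix h :: 'a assume "h \<noteq> 0"
      then show "norm (norm (inv_fourier f (\<xi> + h) - inv_fourier f \<xi> - ?L h) / norm h) \<le> ?C * norm h"
        using rem[of h] by (simp add: divide_le_eq power2_eq_square mult.assoc)
    qed auto
    have "((\<lambda>h::'a. ?C * norm h) \<longlongrightarrow> ?C * norm (0::'a)) (at 0)"
      by (rule tendsto_mult_left[OF tendsto_norm[OF tendsto_ident_at]])
    then show "((\<lambda>h::'a. ?C * norm h) \<longlongrightarrow> 0) (at 0)" by simp
  qed
  then show ?thesis using lin by (simp add: has_derivative_at)
qed

lemma directional_deriv_inv_fourier:
  assumes "test_fun f"
  shows "directional_deriv v (inv_fourier f) = inv_fourier (\<lambda>x. \<i> * of_real (x \<bullet> v) * f x)"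
  using directional_derivI[OF inv_fourier_has_derivative[OF assms]] by (simp add: eta_contract_eq)

lemma test_fun_inner_mult: "test_fun f \<Longrightarrow> test_fun (\<lambda>x. \<i> * of_real (x \<bullet> v) * f x)"
  by (intro test_fun_mult_left smooth_fun_mult smooth_fun_const smooth_fun_inner)

lemma fold_inv_fourier:
  "test_fun f \<Longrightarrow> \<exists>h. test_fun h \<and> fold directional_deriv vs (inv_fourier f) = inv_fourier h"
  by (induction vs arbitrary: f) (auto simp: directional_deriv_inv_fourier test_fun_inner_mult)

lemma smooth_fun_inv_fourier: assumes "test_fun f" shows "smooth_fun (inv_fourier f)"
proof (rule smooth_fun_invariant[where P="\<lambda>g. \<exists>f. test_fun f \<and> g = inv_fourier f"])
  show "\<exists>fa. test_fun fa \<and> inv_fourier f = inv_fourier fa" using assms by auto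
  show "g differentiable (at x)" if "\<exists>f. test_fun f \<and> g = inv_fourier f" for g :: "'a \<Rightarrow> complex" and x
    using that inv_fourier_has_derivative unfolding differentiable_def by blast
  show "\<exists>f. test_fun f \<and> directional_deriv v g = inv_fourier f" if "\<exists>f. test_fun f \<and> g = inv_fourier f" for g :: "'a \<Rightarrow> complex" and v
    using that directional_deriv_inv_fourier test_fun_inner_mult by metis
qed

lemma has_derivative_cis_inner:
  "((\<lambda>x. cis (x \<bullet> \<xi>)) has_derivative (\<lambda>v. \<i> * of_real (v \<bullet> \<xi>) * cis (x \<bullet> \<xi>))) (at x)"
proof -
  have 1: "((\<lambda>x. complex_of_real (x \<bullet> \<xi>)) has_derivative (\<lambda>v. complex_of_real (v \<bullet> \<xi>))) (at x)"
    by (intro bounded_linear_imp_has_derivative bounded_linear_compose[OF bounded_linear_of_real] bounded_linear_inner_left)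
  have 2: "((\<lambda>z. exp (\<i> * z)) has_field_derivative (\<i> * exp (\<i> * z))) (at z)" for z
    by (auto intro!: derivative_eq_intros)
  show ?thesis
    using has_derivative_compose[OF 1 2[unfolded has_field_derivative_def]]
    by (simp add: cis_conv_exp mult_ac)
qed

lemma smooth_fun_cis: "smooth_fun (\<lambda>x. cis (x \<bullet> \<xi>))"
proof (rule smooth_fun_invariant[where P="\<lambda>g. \<exists>c. g = (\<lambda>x. c * cis (x \<bullet> \<xi>))"])
  show "\<exists>c. (\<lambda>x. cis (x \<bullet> \<xi>)) = (\<lambda>x. c * cis (x \<bullet> \<xi>))" by (rule exI[where x=1]) simp
next
  fix g :: "'a \<Rightarrow> complex" and x v
  assume "\<exists>c. g = (\<lambda>x. c * cis (x \<bullet> \<xi>))"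
  then obtain c where g: "g = (\<lambda>x. c * cis (x \<bullet> \<xi>))" by auto
  have d: "(g has_derivative (\<lambda>v. (c * \<i> * of_real (v \<bullet> \<xi>)) * cis (x \<bullet> \<xi>))) (at x)" for x
    unfolding g using has_derivative_mult_right[OF has_derivative_cis_inner, of c] by (simp add: mult_ac)
  show "g differentiable (at x)" using d unfolding differentiable_def by blast
  show "\<exists>c. directional_deriv v g = (\<lambda>x. c * cis (x \<bullet> \<xi>))" using directional_derivI[OF d] by blast
qed

lemma directional_deriv_cis: "directional_deriv v (\<lambda>x. cis (x \<bullet> \<xi>)) = (\<lambda>x. \<i> * of_real (v \<bullet> \<xi>) * cis (x \<bullet> \<xi>))"
  by (rule directional_derivI[OF has_derivative_cis_inner])

lemma inv_fourier_directional_deriv: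
  assumes "test_fun f"
  shows "inv_fourier (directional_deriv v f) \<xi> = - \<i> * of_real (v \<bullet> \<xi>) * inv_fourier f \<xi>"
proof -
  have "(LINT x|lborel. cis (x \<bullet> \<xi>) * directional_deriv v f x) = - (LINT x|lborel. \<i> * of_real (v \<bullet> \<xi>) * cis (x \<bullet> \<xi>) * f x)"
    using integration_by_parts_test[OF assms smooth_fun_cis, of \<xi> v] by (simp only: directional_deriv_cis)
  also have "\<dots> = - \<i> * of_real (v \<bullet> \<xi>) * (LINT x|lborel. cis (x \<bullet> \<xi>) * f x)"
    by (simp add: mult.assoc)
  finally show ?thesis by (simp add: inv_fourier_def)
qed

text \<open>One factor 1 + |\<xi>| is at most 1 plus the sum of the |\<xi> \<bullet> b|, and each
  |\<xi> \<bullet> b| is absorbed by differentiating the test function. The induction therefore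
  generalizes over \<open>f\<close>.\<close>

lemma inv_fourier_decay:
  fixes f :: "'a::euclidean_space \<Rightarrow> complex"
  shows "test_fun f \<Longrightarrow> \<exists>C. \<forall>\<xi>. (1 + norm \<xi>) ^ k * norm (inv_fourier f \<xi>) \<le> C"
proof (induction k arbitrary: f)
  case 0
  then show ?case using norm_inv_fourier_le[of f] by auto
next
  case (Suc k)
  obtain C0 where C0: "\<And>\<xi>. (1 + norm \<xi>) ^ k * norm (inv_fourier f \<xi>) \<le> C0" using Suc by blast
  have "\<forall>b. \<exists>C. \<forall>\<xi>. (1 + norm \<xi>) ^ k * norm (inv_fourier (directional_deriv b f) \<xi>) \<le> C"
    using Suc test_fun_dd by blast
  then obtain C where C: "\<And>b \<xi>. (1 + norm \<xi>) ^ k * norm (inv_fourier (directional_deriv b f) \<xi>) \<le> C b" by metis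
  have "(1 + norm \<xi>) ^ Suc k * norm (inv_fourier f \<xi>) \<le> C0 + (\<Sum>b\<in>Basis. C b)" for \<xi>
  proof -
    have "(1 + norm \<xi>) ^ Suc k * norm (inv_fourier f \<xi>) = (1 + norm \<xi>) * ((1 + norm \<xi>) ^ k * norm (inv_fourier f \<xi>))"
      by simp
    also have "\<dots> \<le> (1 + (\<Sum>b\<in>Basis. \<bar>\<xi> \<bullet> b\<bar>)) * ((1 + norm \<xi>) ^ k * norm (inv_fourier f \<xi>))"
      using norm_le_l1[of \<xi>] by (intro mult_right_mono) auto
    also have "\<dots> = (1 + norm \<xi>) ^ k * norm (inv_fourier f \<xi>)
        + (\<Sum>b\<in>Basis. (1 + norm \<xi>) ^ k * norm (inv_fourier (directional_deriv b f) \<xi>))"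
      by (simp add: inv_fourier_directional_deriv[OF Suc.prems] norm_mult distrib_left distrib_right sum_distrib_left sum_distrib_right mult_ac inner_commute)
    also have "\<dots> \<le> C0 + (\<Sum>b\<in>Basis. C b)" by (intro add_mono sum_mono C0 C)
    finally show ?thesis .
  qed
  then show ?case by blast
qed

lemma schwartz_inv_fourier: assumes "test_fun f" shows "schwartz_fun (inv_fourier f)"
  unfolding schwartz_fun_def
proof (intro conjI allI)
  show "smooth_fun (inv_fourier f)" by (rule smooth_fun_inv_fourier[OF assms])
  fix vs :: "'a list" and k :: nat
  obtain h where h: "test_fun h" "fold directional_deriv vs (inv_fourier f) = inv_fourier h"
    using fold_inv_fourier[OF assms] by blast
  obtain C where "\<And>\<xi>. (1 + norm \<xi>) ^ k * norm (inv_fourier h \<xi>) \<le> C"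
    using inv_fourier_decay[OF h(1)] by blast
  then show "bounded (range (\<lambda>x. (1 + norm x) ^ k *\<^sub>R fold directional_deriv vs (inv_fourier f) x))"
    unfolding h(2) by (intro boundedI[where B=C]) auto
qed

text \<open>Each 1 + (x \<bullet> b)^2 is at most (1 + |x|)^2, so decay of order 2d is dominated by
  a product of d one-dimensional functions 1/(1 + y^2).\<close>

lemma decay_integrable:
  fixes f :: "'a::euclidean_space \<Rightarrow> 'b::{banach, second_countable_topology}"
  assumes "f \<in> borel_measurable borel"
    and C: "\<And>x. (1 + norm x) ^ (2 * DIM('a)) * norm (f x) \<le> C"
  shows "integrable lborel f"
proof -
  have "set_integrable lborel (einterval (-\<infinity>) \<infinity>) (\<lambda>x. inverse (1 + x\<^sup>2))"
    by (rule integrable_inverse_1_plus_square)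
  then have "integrable lborel (\<lambda>y::real. inverse (1 + y\<^sup>2))"
    by (simp add: set_integrable_def einterval_def)
  then have "integrable lborel (\<lambda>x::'a. \<Prod>b\<in>Basis. inverse (1 + (x \<bullet> b)\<^sup>2))"
    by (intro lborel_product_integral(1))
  then have "integrable lborel (\<lambda>x::'a. C * (\<Prod>b\<in>Basis. inverse (1 + (x \<bullet> b)\<^sup>2)))" by simp
  then show ?thesis
  proof (rule Bochner_Integration.integrable_bound)
    show "f \<in> borel_measurable lborel" using assms(1) by simp
    show "AE x in lborel. norm (f x) \<le> norm (C * (\<Prod>b\<in>Basis. inverse (1 + (x \<bullet> b)\<^sup>2)))"
    proof (rule AE_I2)
      fix x :: 'a
      have "(\<Prod>b\<in>(Basis::'a set). 1 + (x \<bullet> b)\<^sup>2) \<le> (\<Prod>b\<in>(Basis::'a set). (1 + norm x)\<^sup>2)"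
      proof (rule prod_mono, safe)
        fix b :: 'a assume "b \<in> Basis"
        then have "(x \<bullet> b)\<^sup>2 \<le> (norm x)\<^sup>2" using Basis_le_norm[of b x] by (metis abs_ge_zero power2_abs power_mono)
        then show "1 + (x \<bullet> b)\<^sup>2 \<le> (1 + norm x)\<^sup>2"
          using norm_ge_zero[of x] unfolding power2_sum by (simp only: power_one mult_1_right)
      qed (simp add: add_nonneg_nonneg)
      also have "\<dots> = (1 + norm x) ^ (2 * DIM('a))" by (simp add: power_mult)
      finally have "(\<Prod>b\<in>(Basis::'a set). 1 + (x \<bullet> b)\<^sup>2) * norm (f x) \<le> C"
        by (rule order_trans[OF mult_right_mono C]) simp
      moreover have "0 < (\<Prod>b\<in>(Basis::'a set). 1 + (x \<bullet> b)\<^sup>2)" by (intro prod_pos) (simp add: add_pos_nonneg)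
      ultimately have "norm (f x) \<le> C * (\<Prod>b\<in>Basis. inverse (1 + (x \<bullet> b)\<^sup>2))"
        using prod_inversef[of "\<lambda>b. 1 + (x \<bullet> b)\<^sup>2" Basis]
        by (simp add: o_def divide_inverse[symmetric] pos_le_divide_eq mult.commute)
      then show "norm (f x) \<le> norm (C * (\<Prod>b\<in>Basis. inverse (1 + (x \<bullet> b)\<^sup>2)))" by simp
    qed
  qed
qed

lemma schwartz_integrable:
  fixes f :: "'a::euclidean_space \<Rightarrow> complex"
  assumes "schwartz_fun f" shows "integrable lborel f"
proof -
  have "bounded (range (\<lambda>x. (1 + norm x) ^ (2 * DIM('a)) *\<^sub>R fold directional_deriv [] f x))"
    using assms unfolding schwartz_fun_def by blast
  then obtain C where "\<And>x. (1 + norm x) ^ (2 * DIM('a)) * norm (f x) \<le> C"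
    by (auto simp: bounded_iff)
  then show ?thesis
    using assms by (intro decay_integrable smooth_fun_measurable) (auto simp: schwartz_fun_def)
qed

lemma fourier_inversion_test: assumes "test_fun f" shows "fourier_integral (inv_fourier f) = f"
proof
  obtain M where "\<And>x. norm (f x) \<le> M" using test_fun_bounded[OF assms] by blast
  then show "fourier_integral (inv_fourier f) x = f x" for x
    by (intro fourier_inversion test_fun_integrable smooth_fun_continuous_on test_fun_smooth[OF assms] assms
        schwartz_integrable schwartz_inv_fourier)
qed

lemma smooth_fun_polynomial_function:
  fixes g :: "'a::euclidean_space \<Rightarrow> complex"
  assumes "polynomial_function g" shows "smooth_fun g"
proof -
  have "real_polynomial_function (Re \<circ> g)" "real_polynomial_function (Im \<circ> g)"
    using assms bounded_linear_Re bounded_linear_Im unfolding polynomial_function_def by blast+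
  then have "smooth_fun (\<lambda>x. complex_of_real ((Re \<circ> g) x))" "smooth_fun (\<lambda>x. complex_of_real ((Im \<circ> g) x))"
    using smooth_fun_real_polynomial by blast+
  then have "smooth_fun (\<lambda>x. complex_of_real ((Re \<circ> g) x) + \<i> * complex_of_real ((Im \<circ> g) x))"
    by (intro smooth_fun_add smooth_fun_mult smooth_fun_const)
  also have "(\<lambda>x. complex_of_real ((Re \<circ> g) x) + \<i> * complex_of_real ((Im \<circ> g) x)) = g"
    by (simp add: complex_eq[symmetric])
  finally show ?thesis .
qed

text \<open>A measurable function is an almost everywhere limit of continuous ones. These are
  clipped to the ball of radius \<open>M\<close> by the metric projection, approximated by
  polynomials up to 1/(n + 1) on a compact ball, and multiplied by a cutoff. The uniform bound and
  the common support are recorded because the limits taken later rest on dominated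
  convergence.\<close>

lemma test_fun_approximation:
  fixes h :: "'a::euclidean_space \<Rightarrow> complex"
  assumes h: "h \<in> borel_measurable borel" "\<And>x. norm (h x) \<le> M" "\<And>x. R < norm x \<Longrightarrow> h x = 0"
    and "R > 0" "M \<ge> 0"
  obtains \<psi> R' where "\<And>n. test_fun (\<psi> n)" "\<And>n x. norm (\<psi> n x :: complex) \<le> M + 1"
    "\<And>n x. R' < norm x \<Longrightarrow> \<psi> n x = 0" "AE x in lborel. (\<lambda>n. \<psi> n x) \<longlonglongrightarrow> h x"
proof -
  have "h \<in> borel_measurable lebesgue" using h(1) by (intro measurable_completion) simp
  then have "h measurable_on UNIV" by (rule lebesgue_measurable_imp_measurable_on) simp
  then obtain N g where N: "negligible N" and g: "\<And>n. continuous_on UNIV (g n)"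
    "\<And>x. x \<notin> N \<Longrightarrow> (\<lambda>n. g n x) \<longlonglongrightarrow> h x"
    unfolding measurable_on_def by auto
  let ?cp = "closest_point (cball (0::complex) M)"
  have cpc: "continuous_on UNIV ?cp"
    by (rule continuous_on_closest_point) (use \<open>M \<ge> 0\<close> in auto)
  define c where "c n x = ?cp (g n x)" for n x
  have cc: "continuous_on UNIV (c n)" for n
    unfolding c_def by (rule continuous_on_compose2[OF cpc g(1)]) auto
  have cM: "norm (c n x) \<le> M" for n x
    using closest_point_in_set[of "cball (0::complex) M" "g n x"] \<open>M \<ge> 0\<close> by (auto simp: c_def)
  have clim: "(\<lambda>n. c n x) \<longlonglongrightarrow> h x" if "x \<notin> N" for x
  proof -
    have "(\<lambda>n. c n x) \<longlonglongrightarrow> ?cp (h x)"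
      unfolding c_def by (rule continuous_on_tendsto_compose[OF cpc g(2)[OF that]]) auto
    moreover have "?cp (h x) = h x" by (rule closest_point_self) (use h(2)[of x] in auto)
    ultimately show ?thesis by simp
  qed
  obtain \<Theta> :: "'a \<Rightarrow> real" where \<Theta>: "test_fun (\<lambda>x. complex_of_real (\<Theta> x))"
    "\<And>x. (\<forall>b\<in>Basis. \<bar>x \<bullet> b\<bar> \<le> R) \<Longrightarrow> \<Theta> x = 1" "\<And>x. 0 \<le> \<Theta> x" "\<And>x. \<Theta> x \<le> 1"
    using cutoff_exists[OF \<open>R > 0\<close>] by metis
  obtain R' where R': "\<And>x. R' < norm x \<Longrightarrow> complex_of_real (\<Theta> x) = 0" using test_fun_support[OF \<Theta>(1)] by blast
  have "\<exists>P. polynomial_function P \<and> (\<forall>x\<in>cball 0 R'. norm (c n x - P x) < inverse (real (Suc n)))" for n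
    by (rule Stone_Weierstrass_polynomial_function) (auto intro: continuous_on_subset[OF cc])
  then obtain P where P: "\<And>n. polynomial_function (P n)"
    "\<And>n x. norm x \<le> R' \<Longrightarrow> norm (c n x - P n x) < inverse (real (Suc n))" by (metis mem_cball_0)
  have Pb: "norm (c n x - P n x) \<le> 1" if "norm x \<le> R'" for n x
  proof -
    have "inverse (real (Suc n)) \<le> 1" by (simp add: field_simps)
    with P(2)[OF that, of n] show ?thesis by linarith
  qed
  define \<psi> where "\<psi> n x = complex_of_real (\<Theta> x) * P n x" for n x
  show thesis
  proof (rule that[of \<psi> R'])
    show "test_fun (\<psi> n)" for n
      unfolding \<psi>_def by (intro test_fun_mult_right \<Theta>(1) smooth_fun_polynomial_function P)
    show "\<psi> n x = 0" if "R' < norm x" for n x using R'[OF that] by (simp add: \<psi>_def)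
    show "norm (\<psi> n x) \<le> M + 1" for n x
    proof (cases "norm x \<le> R'")
      case True
      have "norm (P n x) \<le> M + 1"
        using norm_triangle_sub[of "P n x" "c n x"] Pb[OF True, of n] cM[of n x]
        unfolding norm_minus_commute[of "P n x"] by linarith
      moreover have "norm (\<psi> n x) \<le> 1 * norm (P n x)"
        unfolding \<psi>_def norm_mult by (intro mult_right_mono) (use \<Theta>(3,4)[of x] in auto)
      ultimately show ?thesis by simp
    next
      case False
      then show ?thesis using R'[of x] \<open>M \<ge> 0\<close> by (simp add: \<psi>_def)
    qed
    have "(\<lambda>n. \<psi> n x) \<longlonglongrightarrow> h x" if "x \<notin> N" for x
    proof (cases "norm x \<le> R'")
      case True
      have "(\<lambda>n. c n x - P n x) \<longlonglongrightarrow> 0"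
        by (rule Lim_null_comparison[OF _ LIMSEQ_inverse_real_of_nat])
           (use P(2)[OF True] in \<open>auto intro!: always_eventually less_imp_le\<close>)
      from tendsto_diff[OF clim[OF that] this] have "(\<lambda>n. P n x) \<longlonglongrightarrow> h x" by simp
      then have "(\<lambda>n. \<psi> n x) \<longlonglongrightarrow> complex_of_real (\<Theta> x) * h x" unfolding \<psi>_def by (rule tendsto_mult_left)
      also have "complex_of_real (\<Theta> x) * h x = h x"
      proof (cases "norm x \<le> R")
        case True
        then have "\<Theta> x = 1" by (intro \<Theta>(2)) (meson Basis_le_norm order_trans)
        then show ?thesis by simp
      qed (use h(3) in auto)
      finally show ?thesis .
    next
      case False
      have "h x = 0"
      proof (cases "norm x \<le> R")
        case True
        then have "\<Theta> x = 1" by (intro \<Theta>(2)) (meson Basis_le_norm order_trans)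
        then show ?thesis using R'[of x] False by simp
      qed (use h(3) in auto)
      then show ?thesis using R'[of x] False by (simp add: \<psi>_def)
    qed
    moreover have "AE x in lborel. x \<notin> N"
    proof -
      have "AE x in lebesgue. x \<notin> N" using N AE_not_in by (simp add: negligible_iff_null_sets)
      then show ?thesis by (simp add: AE_completion_iff)
    qed
    ultimately show "AE x in lborel. (\<lambda>n. \<psi> n x) \<longlonglongrightarrow> h x" by (auto elim: eventually_mono)
  qed
qed

subsection \<open>Duality and Sobolev embedding\<close>

lemma indicator_bounded_integrable:
  assumes "A \<in> sets borel" "bounded A"
  shows "integrable lborel (indicator A :: 'a::euclidean_space \<Rightarrow> real)"
  using emeasure_bounded_finite[OF assms(2)] assms(1) by (intro integrable_real_indicator) auto

lemma cball_const_integrable: "integrable lborel (\<lambda>x::'a::euclidean_space. indicator (cball 0 R) x * (c::real))"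
  by (intro integrable_mult_left indicator_bounded_integrable) auto

text \<open>Testing with the Hoelder extremizer conj(sgn f) |f|^(q-1), restricted to a set
  \<open>S\<close>, gives E, the integral of |f|^q over \<open>S\<close>, on one side and A E^(1 -
  1/q) on the other. The truncation makes E finite before anything is known about \<open>f\<close>,
  so that E^(1 - 1/q) can be divided out. The extremizer is not a test function and is reached
  through \<open>test_fun_approximation\<close>.\<close>

lemma converse_holder_truncated:
  fixes f :: "'a::euclidean_space \<Rightarrow> complex"
  assumes f [measurable]: "f \<in> borel_measurable borel"
    and loc: "\<And>R. integrable lborel (\<lambda>x. indicator (cball 0 R) x *\<^sub>R f x)"
    and q: "q > 1" and A: "A \<ge> 0" and M: "M > 0"
    and H: "\<And>\<psi>. test_fun \<psi> \<Longrightarrow> (LINT x|lborel. norm (\<psi> x) powr (q / (q - 1))) \<le> 1 \<Longrightarrow>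
      norm (LINT x|lborel. f x * \<psi> x) \<le> A"
  shows "integrable lborel (\<lambda>x. indicator {x. norm x \<le> M \<and> norm (f x) \<le> M} x * norm (f x) powr q)"
    and "(LINT x|lborel. indicator {x. norm x \<le> M \<and> norm (f x) \<le> M} x * norm (f x) powr q) \<le> A powr q"
proof -
  define S where "S = {x. norm x \<le> M \<and> norm (f x) \<le> M}"
  have S [measurable]: "S \<in> sets borel" unfolding S_def by measurable
  define p where "p = q / (q - 1)"
  have p: "p > 1" "(q - 1) * p = q" "1 / p = 1 - 1 / q" using q by (auto simp: p_def field_simps)
  define K where "K = M powr (q - 1)"
  have K: "K \<ge> 0" by (simp add: K_def)
  define h where "h x = indicator S x *\<^sub>R (cnj (sgn (f x)) * complex_of_real (norm (f x) powr (q - 1)))" for x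
  have [measurable]: "cnj \<in> borel_measurable borel" "complex_of_real \<in> borel_measurable borel"
    by (intro borel_measurable_continuous_onI linear_continuous_on bounded_linear_cnj bounded_linear_of_real)+
  have hm [measurable]: "h \<in> borel_measurable borel" unfolding h_def[abs_def] sgn_div_norm by measurable
  have nh: "norm (h x) = indicator S x * norm (f x) powr (q - 1)" for x
    by (cases "f x = 0") (auto simp: h_def norm_mult norm_sgn indicator_def)
  have hK: "norm (h x) \<le> K" for x
    using q by (auto simp: nh K_def S_def indicator_def intro!: powr_mono2)
  have h0: "h x = 0" if "M < norm x" for x using that by (simp add: h_def S_def)
  have nhp: "norm (h x) powr p = indicator S x * norm (f x) powr q" for x
    by (simp add: nh powr_powr p indicator_def)
  have fh: "f x * h x = complex_of_real (indicator S x * norm (f x) powr q)" for x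
  proof (cases "f x = 0 \<or> x \<notin> S")
    case False
    have "f x * cnj (sgn (f x)) = complex_of_real (norm (f x))"
    proof -
      have "f x * cnj (sgn (f x)) = complex_of_real (inverse (norm (f x))) * (f x * cnj (f x))"
        by (simp add: sgn_div_norm scaleR_conv_of_real mult_ac)
      also have "f x * cnj (f x) = complex_of_real (norm (f x)) * complex_of_real (norm (f x))"
        by (simp add: complex_norm_square[symmetric] power2_eq_square)
      also have "complex_of_real (inverse (norm (f x))) * \<dots> = complex_of_real (norm (f x))"
        using False by simp
      finally show ?thesis .
    qed
    moreover have "norm (f x) * norm (f x) powr (q - 1) = norm (f x) powr q"
      using False by (simp add: powr_mult_base)
    ultimately show ?thesis using False unfolding h_def
      by (simp add: mult.assoc[symmetric] of_real_mult[symmetric] del: of_real_mult)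
  qed (auto simp: h_def)
  define E where "E = (LINT x|lborel. indicator S x * norm (f x) powr q)"
  have Sint: "integrable lborel (\<lambda>x. indicator S x * norm (f x) powr q)"
  proof (rule Bochner_Integration.integrable_bound[OF cball_const_integrable[of M "M powr q"]])
    show "AE x in lborel. norm (indicator S x * norm (f x) powr q) \<le> norm (indicator (cball 0 M) x * M powr q)"
      using q by (intro AE_I2) (auto simp: S_def indicator_def intro!: powr_mono2)
  qed measurable
  then show "integrable lborel (\<lambda>x. indicator {x. norm x \<le> M \<and> norm (f x) \<le> M} x * norm (f x) powr q)"
    by (simp add: S_def)
  obtain \<psi> R' where \<psi>: "\<And>n. test_fun (\<psi> n)" "\<And>n x. norm (\<psi> n x :: complex) \<le> K + 1"
    "\<And>n x. R' < norm x \<Longrightarrow> \<psi> n x = 0" "AE x in lborel. (\<lambda>n. \<psi> n x) \<longlonglongrightarrow> h x"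
    by (rule test_fun_approximation[OF hm hK h0 M K]) (assumption, rule that)
  have [measurable]: "\<psi> n \<in> borel_measurable borel" for n by (rule test_fun_measurable[OF \<psi>(1)])
  define a where "a n = (LINT x|lborel. norm (\<psi> n x) powr p)" for n
  define b where "b n = (LINT x|lborel. f x * \<psi> n x)" for n
  have "a \<longlonglongrightarrow> (LINT x|lborel. norm (h x) powr p)"
    unfolding a_def
  proof (rule integral_dominated_convergence[where w="\<lambda>x. indicator (cball 0 R') x * (K + 1) powr p"])
    show "AE x in lborel. (\<lambda>n. norm (\<psi> n x) powr p) \<longlonglongrightarrow> norm (h x) powr p"
      using \<psi>(4)
    proof eventually_elim
      case (elim x)
      show ?case by (rule tendsto_powr'[OF tendsto_norm[OF elim] tendsto_const]) (use p in auto)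
    qed
    show "AE x in lborel. norm (norm (\<psi> n x) powr p) \<le> indicator (cball 0 R') x * (K + 1) powr p" for n
      using \<psi>(2,3) p by (intro AE_I2) (auto simp: indicator_def not_le intro!: powr_mono2)
  qed (use cball_const_integrable in measurable)
  then have alim: "a \<longlonglongrightarrow> E" by (simp add: nhp E_def)
  have "b \<longlonglongrightarrow> (LINT x|lborel. f x * h x)"
    unfolding b_def
  proof (rule integral_dominated_convergence[where w="\<lambda>x. norm (indicator (cball 0 R') x *\<^sub>R f x) * (K + 1)"])
    show "AE x in lborel. (\<lambda>n. f x * \<psi> n x) \<longlonglongrightarrow> f x * h x"
      using \<psi>(4) by eventually_elim (rule tendsto_mult_left)
    show "AE x in lborel. norm (f x * \<psi> n x) \<le> norm (indicator (cball 0 R') x *\<^sub>R f x) * (K + 1)" for n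
      using \<psi>(2,3) by (intro AE_I2) (auto simp: indicator_def not_le norm_mult intro!: mult_left_mono)
    show "integrable lborel (\<lambda>x. norm (indicator (cball 0 R') x *\<^sub>R f x) * (K + 1))"
      by (intro integrable_mult_left integrable_norm loc)
  qed measurable
  then have blim: "b \<longlonglongrightarrow> complex_of_real E" by (simp add: fh E_def del: of_real_mult)
  have E0: "0 \<le> E" unfolding E_def by (intro integral_nonneg_AE AE_I2) simp
  have "E \<le> A powr q"
  proof (cases "E = 0")
    case False
    then have Epos: "E > 0" using E0 by simp
    have "\<forall>\<^sub>F n in sequentially. a n > 0" using alim Epos by (rule order_tendstoD)
    then have "\<forall>\<^sub>F n in sequentially. norm (b n) \<le> A * a n powr (1 / p)"
    proof eventually_elim
      case (elim n)
      \<comment> \<open>Rescales \<open>\<psi> n\<close> so that the normalization in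
        \<open>H\<close> holds with equality. This is possible once \<open>a n > 0\<close>, which
        holds eventually since \<open>a n\<close> tends to E > 0.\<close>
      define c where "c = a n powr (- (1 / p))"
      have c: "c > 0" "c powr p = 1 / a n" "1 / c = a n powr (1 / p)"
      proof -
        show "c > 0" using elim by (simp add: c_def)
        have "c powr p = a n powr (- 1)" using p(1) by (simp add: c_def powr_powr)
        then show "c powr p = 1 / a n" using elim by (simp add: powr_minus_divide)
        show "1 / c = a n powr (1 / p)" by (simp add: c_def powr_minus_divide)
      qed
      have t: "test_fun (\<lambda>x. complex_of_real c * \<psi> n x)" by (intro test_fun_cmult \<psi>(1))
      have "(LINT x|lborel. norm (complex_of_real c * \<psi> n x) powr p) = c powr p * a n"
        using c(1) by (simp add: norm_mult powr_mult a_def)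
      then have "norm (LINT x|lborel. f x * (complex_of_real c * \<psi> n x)) \<le> A"
        using H[OF t] c elim by (simp add: p_def)
      also have "(LINT x|lborel. f x * (complex_of_real c * \<psi> n x)) = complex_of_real c * b n"
        by (simp add: b_def mult.left_commute)
      finally have "norm (b n) \<le> A / c" using c by (simp add: norm_mult pos_le_divide_eq mult.commute)
      then show ?case using c(3) by (simp add: divide_inverse)
    qed
    moreover have "(\<lambda>n. norm (b n)) \<longlonglongrightarrow> norm (complex_of_real E)" by (intro tendsto_norm blim)
    moreover have "(\<lambda>n. A * a n powr (1 / p)) \<longlonglongrightarrow> A * E powr (1 / p)"
      by (intro tendsto_mult_left tendsto_powr alim tendsto_const) (use Epos in auto)
    ultimately have "norm (complex_of_real E) \<le> A * E powr (1 / p)"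
      by (intro tendsto_le[OF sequentially_bot]) auto
    then have "E powr (1 / q) * E powr (1 - 1 / q) \<le> A * E powr (1 - 1 / q)"
      using Epos by (simp add: p powr_add[symmetric])
    then have "E powr (1 / q) \<le> A" using Epos by simp
    then have "(E powr (1 / q)) powr q \<le> A powr q" using q by (intro powr_mono2) auto
    then show ?thesis using q Epos by (simp add: powr_powr)
  qed simp
  then show "(LINT x|lborel. indicator {x. norm x \<le> M \<and> norm (f x) \<le> M} x * norm (f x) powr q) \<le> A powr q"
    by (simp add: E_def S_def)
qed

text \<open>The truncations exhaust the space and Fatou's lemma lifts the bound, so finiteness of
  the L^q norm is a result and not an assumption. The L^q bounds for Sobolev functions and for the
  displacement of the solution are obtained in this way from pairings with test functions.\<close>

lemma converse_holder:
  fixes f :: "'a::euclidean_space \<Rightarrow> complex"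
  assumes f [measurable]: "f \<in> borel_measurable borel"
    and loc: "\<And>R. integrable lborel (\<lambda>x. indicator (cball 0 R) x *\<^sub>R f x)"
    and q: "q > 1" and A: "A \<ge> 0"
    and H: "\<And>\<psi>. test_fun \<psi> \<Longrightarrow> (LINT x|lborel. norm (\<psi> x) powr (q / (q - 1))) \<le> 1 \<Longrightarrow>
      norm (LINT x|lborel. f x * \<psi> x) \<le> A"
  shows "(\<integral>\<^sup>+x. ennreal (norm (f x) powr q) \<partial>lborel) \<le> ennreal (A powr q)"
proof -
  define S where "S n = {x. norm x \<le> real (Suc n) \<and> norm (f x) \<le> real (Suc n)}" for n
  have [measurable]: "S n \<in> sets borel" for n unfolding S_def by measurable
  let ?g = "\<lambda>n x. ennreal (indicator (S n) x * norm (f x) powr q)"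
  have "liminf (\<lambda>n. ?g n x) = ennreal (norm (f x) powr q)" for x
  proof (rule lim_imp_Liminf)
    obtain N :: nat where N: "norm x \<le> real N" "norm (f x) \<le> real N"
      by (metis max.bounded_iff real_arch_simple)
    have "\<forall>\<^sub>F n in sequentially. ?g n x = ennreal (norm (f x) powr q)"
      using eventually_ge_at_top[of N] by eventually_elim (use N in \<open>auto simp: S_def indicator_def\<close>)
    then show "(\<lambda>n. ?g n x) \<longlonglongrightarrow> ennreal (norm (f x) powr q)" by (rule tendsto_eventually)
  qed auto
  then have "(\<integral>\<^sup>+x. ennreal (norm (f x) powr q) \<partial>lborel) = (\<integral>\<^sup>+x. liminf (\<lambda>n. ?g n x) \<partial>lborel)" by simp
  also have "\<dots> \<le> liminf (\<lambda>n. \<integral>\<^sup>+x. ?g n x \<partial>lborel)" by (rule nn_integral_liminf) measurable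
  also have "\<dots> \<le> limsup (\<lambda>n. \<integral>\<^sup>+x. ?g n x \<partial>lborel)" by (rule Liminf_le_Limsup) simp
  also have "\<dots> \<le> ennreal (A powr q)"
  proof (rule Limsup_bounded, intro always_eventually allI)
    fix n
    have "(\<integral>\<^sup>+x. ?g n x \<partial>lborel) = ennreal (LINT x|lborel. indicator (S n) x * norm (f x) powr q)"
      unfolding S_def
      by (rule nn_integral_eq_integral[OF converse_holder_truncated(1)[OF f loc q A _ H]]) auto
    also have "\<dots> \<le> ennreal (A powr q)"
      unfolding S_def by (rule ennreal_leI[OF converse_holder_truncated(2)[OF f loc q A _ H]]) auto
    finally show "(\<integral>\<^sup>+x. ?g n x \<partial>lborel) \<le> ennreal (A powr q)" .
  qed
  finally show ?thesis .
qed

lemma test_fun_powr_integrable: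
  assumes "test_fun \<psi>" "p \<ge> 1" shows "integrable lborel (\<lambda>x. norm (\<psi> x) powr p)"
proof -
  obtain M where M: "M > 0" "\<And>x. norm (\<psi> x) \<le> M" using test_fun_bounded[OF assms(1)] by blast
  have [measurable]: "\<psi> \<in> borel_measurable borel" by (rule test_fun_measurable[OF assms(1)])
  have "integrable lborel (\<lambda>x. norm (\<psi> x) * M powr (p - 1))"
    using test_fun_integrable[OF assms(1)] by simp
  then show ?thesis
  proof (rule Bochner_Integration.integrable_bound)
    show "AE x in lborel. norm (norm (\<psi> x) powr p) \<le> norm (norm (\<psi> x) * M powr (p - 1))"
    proof (rule AE_I2)
      fix x
      have "norm (\<psi> x) powr p = norm (\<psi> x) * norm (\<psi> x) powr (p - 1)"
        by (cases "\<psi> x = 0") (auto simp: powr_mult_base)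
      also have "\<dots> \<le> norm (\<psi> x) * M powr (p - 1)"
        using assms(2) M(2) by (intro mult_left_mono powr_mono2) auto
      finally show "norm (norm (\<psi> x) powr p) \<le> norm (norm (\<psi> x) * M powr (p - 1))" by simp
    qed
  qed measurable
qed

lemma emeasure_cball_le:
  assumes "R \<ge> 0" shows "emeasure lborel (cball (0::'a::euclidean_space) R) \<le> ennreal ((2 * R) ^ DIM('a))"
proof -
  have "cball (0::'a) R \<subseteq> cbox (- R *\<^sub>R One) (R *\<^sub>R One)"
  proof
    fix x :: 'a assume "x \<in> cball 0 R"
    then have "\<bar>x \<bullet> b\<bar> \<le> R" if "b \<in> Basis" for b
      using Basis_le_norm[OF that, of x] by simp
    then show "x \<in> cbox (- R *\<^sub>R One) (R *\<^sub>R One)"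
      by (auto simp: cbox_def abs_le_iff minus_le_iff)
  qed
  then have "emeasure lborel (cball (0::'a) R) \<le> emeasure lborel (cbox (- R *\<^sub>R One) (R *\<^sub>R One :: 'a))"
    by (intro emeasure_mono) auto
  also have "\<dots> = ennreal ((2 * R) ^ DIM('a))"
  proof -
    have "(\<Prod>b\<in>(Basis::'a set). (R *\<^sub>R One - (- R *\<^sub>R One)) \<bullet> b) = (\<Prod>b\<in>(Basis::'a set). 2 * R)"
      by (rule prod.cong) (auto simp: inner_add_left)
    then show ?thesis using assms by (subst emeasure_lborel_cbox) auto
  qed
  finally show ?thesis .
qed

text \<open>Split \<open>\<psi>\<close> at the height \<open>R\<^bsup>d/p\<^esup>\<close>: the tall part is estimated in \<open>L\<^sup>1\<close>,
  the low part in \<open>L\<^sup>2\<close>.\<close>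

lemma fourier_ball_estimate:
  fixes \<psi> :: "'a::euclidean_space \<Rightarrow> complex"
  assumes \<psi>: "test_fun \<psi>" and p: "1 < p" "p \<le> 2" and R: "R \<ge> 1"
    and I: "(LINT x|lborel. norm (\<psi> x) powr p) \<le> 1"
  shows "(\<integral>\<^sup>+\<xi>. indicator (cball 0 R) \<xi> * ennreal ((norm (inv_fourier \<psi> \<xi>))\<^sup>2) \<partial>lborel)
    \<le> ennreal ((2 * (fconst TYPE('a))\<^sup>2 * 2 ^ DIM('a) + 2) * R powr (real DIM('a) * (2 / p - 1)))"
proof -
  have [measurable]: "\<psi> \<in> borel_measurable borel" by (rule test_fun_measurable[OF \<psi>])
  let ?d = "real DIM('a)" and ?c = "fconst TYPE('a)"
  define l where "l = R powr (?d / p)"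
  have l: "l > 0" using R by (simp add: l_def)
  define f where "f x = (if norm (\<psi> x) > l then \<psi> x else 0)" for x
  define g where "g x = (if norm (\<psi> x) > l then 0 else \<psi> x)" for x
  have [measurable]: "f \<in> borel_measurable borel" "g \<in> borel_measurable borel"
    unfolding f_def[abs_def] g_def[abs_def] by measurable
  note pint = test_fun_powr_integrable[OF \<psi> less_imp_le[OF p(1)]]
  have \<psi>int: "integrable lborel \<psi>" by (rule test_fun_integrable[OF \<psi>])
  have fint: "integrable lborel f"
    by (rule Bochner_Integration.integrable_bound[OF \<psi>int]) (auto simp: f_def)
  have gint: "integrable lborel g"
    by (rule Bochner_Integration.integrable_bound[OF \<psi>int]) (auto simp: g_def)
  \<comment> \<open>Chebyshev-type bounds: above the height the negative power |\<psi>|^(1-p) is at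
    most l^(1-p), and below it |\<psi>|^(2-p) is at most l^(2-p), which uses p \<le> 2.\<close>
  have fb: "norm (f x) \<le> l powr (1 - p) * norm (\<psi> x) powr p" for x
  proof (cases "norm (\<psi> x) > l")
    case True
    have "norm (f x) = norm (\<psi> x) powr (1 - p) * norm (\<psi> x) powr p"
      using True l by (simp add: f_def powr_add[symmetric])
    also have "\<dots> \<le> l powr (1 - p) * norm (\<psi> x) powr p"
      using True l p by (intro mult_right_mono powr_mono2') auto
    finally show ?thesis .
  qed (simp add: f_def)
  have gb: "(norm (g x))\<^sup>2 \<le> l powr (2 - p) * norm (\<psi> x) powr p" for x
  proof (cases "norm (\<psi> x) > l \<or> \<psi> x = 0")
    case False
    then have "(norm (g x))\<^sup>2 = norm (\<psi> x) powr (2 - p) * norm (\<psi> x) powr p"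
      by (simp add: g_def powr_add[symmetric])
    also have "\<dots> \<le> l powr (2 - p) * norm (\<psi> x) powr p"
      using False l p by (intro mult_right_mono powr_mono2) auto
    finally show ?thesis .
  qed (auto simp: g_def)
  have g2int: "integrable lborel (\<lambda>x. (norm (g x))\<^sup>2)"
    by (rule Bochner_Integration.integrable_bound[OF integrable_mult_right[OF pint, of "l powr (2 - p)"]])
       (use gb in \<open>auto simp: abs_mult\<close>)
  have F1: "(LINT x|lborel. norm (f x)) \<le> l powr (1 - p)"
  proof -
    have "(LINT x|lborel. norm (f x)) \<le> (LINT x|lborel. l powr (1 - p) * norm (\<psi> x) powr p)"
      by (rule integral_mono) (use fb fint pint in auto)
    also have "\<dots> \<le> l powr (1 - p) * 1" using mult_left_mono[OF I, of "l powr (1 - p)"] by simp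
    finally show ?thesis by simp
  qed
  have G1: "(LINT x|lborel. (norm (g x))\<^sup>2) \<le> l powr (2 - p)"
  proof -
    have "(LINT x|lborel. (norm (g x))\<^sup>2) \<le> (LINT x|lborel. l powr (2 - p) * norm (\<psi> x) powr p)"
      by (rule integral_mono) (use gb g2int pint in auto)
    also have "\<dots> \<le> l powr (2 - p) * 1" using mult_left_mono[OF I, of "l powr (2 - p)"] by simp
    finally show ?thesis by simp
  qed
  have split: "inv_fourier \<psi> \<xi> = inv_fourier f \<xi> + inv_fourier g \<xi>" for \<xi>
  proof -
    have "integrable lborel (\<lambda>x. cis (x \<bullet> \<xi>) * f x)" "integrable lborel (\<lambda>x. cis (x \<bullet> \<xi>) * g x)"
      by (intro integrable_cis_mult fint gint; measurable)+
    moreover have "cis (x \<bullet> \<xi>) * \<psi> x = cis (x \<bullet> \<xi>) * f x + cis (x \<bullet> \<xi>) * g x" for x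
      by (simp add: f_def g_def)
    ultimately show ?thesis by (simp add: inv_fourier_def distrib_left)
  qed
  note [measurable] = fourier_integral_measurable
  have sq: "(norm (inv_fourier \<psi> \<xi>))\<^sup>2 \<le> 2 * (?c * l powr (1 - p))\<^sup>2 + 2 * (norm (inv_fourier g \<xi>))\<^sup>2" for \<xi>
  proof -
    have "norm (inv_fourier f \<xi>) \<le> ?c * l powr (1 - p)"
      using norm_inv_fourier_le[of f \<xi>] mult_left_mono[OF F1 less_imp_le[OF fconst_pos[where 'a='a]]] by linarith
    then have "norm (inv_fourier \<psi> \<xi>) \<le> ?c * l powr (1 - p) + norm (inv_fourier g \<xi>)"
      using norm_triangle_ineq[of "inv_fourier f \<xi>" "inv_fourier g \<xi>"] unfolding split by linarith
    then have "(norm (inv_fourier \<psi> \<xi>))\<^sup>2 \<le> (?c * l powr (1 - p) + norm (inv_fourier g \<xi>))\<^sup>2" by (rule power_mono) simp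
    also have "\<dots> \<le> 2 * (?c * l powr (1 - p))\<^sup>2 + 2 * (norm (inv_fourier g \<xi>))\<^sup>2"
      using sum_squares_bound[of "?c * l powr (1 - p)" "norm (inv_fourier g \<xi>)"] by (simp add: power2_sum)
    finally show ?thesis .
  qed
  \<comment> \<open>At this height the two parts grow alike: the tall part contributes the square of
    l^(1-p) times the volume R^d, the low part l^(2-p), and both equal R^(d (2/p - 1)).\<close>
  have e1: "l powr (2 - p) = R powr (?d * (2 / p - 1))"
    using p by (simp add: l_def powr_powr field_simps)
  have e2: "(l powr (1 - p))\<^sup>2 * R ^ DIM('a) = R powr (?d * (2 / p - 1))"
  proof -
    have "(l powr (1 - p))\<^sup>2 * R ^ DIM('a) = R powr (?d / p * (1 - p) + ?d / p * (1 - p) + ?d)"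
    proof -
      have "(l powr (1 - p))\<^sup>2 = R powr (?d / p * (1 - p)) * R powr (?d / p * (1 - p))"
        by (simp add: l_def powr_powr power2_eq_square)
      moreover have "R ^ DIM('a) = R powr ?d" using R by (simp add: powr_realpow)
      ultimately show ?thesis by (simp only: powr_add)
    qed
    also have "?d / p * (1 - p) + ?d / p * (1 - p) + ?d = ?d * (2 / p - 1)"
      using p by (simp add: field_simps)
    finally show ?thesis .
  qed
  define a where "a = 2 * (?c * l powr (1 - p))\<^sup>2"
  have a0: "a \<ge> 0" by (simp add: a_def)
  have "(\<integral>\<^sup>+\<xi>. indicator (cball 0 R) \<xi> * ennreal ((norm (inv_fourier \<psi> \<xi>))\<^sup>2) \<partial>lborel)
    \<le> (\<integral>\<^sup>+\<xi>. ennreal (a) * indicator (cball 0 R) \<xi> + ennreal 2 * ennreal ((norm (inv_fourier g \<xi>))\<^sup>2) \<partial>lborel)"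
  proof (rule nn_integral_mono)
    fix \<xi> :: 'a
    show "indicator (cball 0 R) \<xi> * ennreal ((norm (inv_fourier \<psi> \<xi>))\<^sup>2)
      \<le> ennreal (a) * indicator (cball 0 R) \<xi> + ennreal 2 * ennreal ((norm (inv_fourier g \<xi>))\<^sup>2)"
      using ennreal_leI[OF sq[of \<xi>]]
      using a0
      by (cases "\<xi> \<in> cball 0 R") (simp_all add: ennreal_plus ennreal_mult a_def[symmetric] del: mem_cball_0)
  qed
  also have "\<dots> = ennreal (a) * emeasure lborel (cball (0::'a) R)
      + ennreal 2 * (\<integral>\<^sup>+\<xi>. ennreal ((norm (inv_fourier g \<xi>))\<^sup>2) \<partial>lborel)"
    proof -
    have [measurable]: "inv_fourier g \<in> borel_measurable borel" by (rule fourier_integral_measurable) measurable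
    have m2: "(\<lambda>\<xi>. ennreal ((norm (inv_fourier g \<xi>))\<^sup>2)) \<in> borel_measurable lborel" by measurable
    have m1: "(\<lambda>\<xi>::'a. ennreal a * indicator (cball 0 R) \<xi>) \<in> borel_measurable lborel"
      by (intro borel_measurable_times_ennreal borel_measurable_const) (simp add: borel_measurable_indicator)
    have "(\<integral>\<^sup>+\<xi>. ennreal a * indicator (cball 0 R) (\<xi>::'a) \<partial>lborel) = ennreal a * emeasure lborel (cball (0::'a) R)"
      by (rule nn_integral_cmult_indicator) simp
    moreover have "(\<integral>\<^sup>+\<xi>. ennreal 2 * ennreal ((norm (inv_fourier g \<xi>))\<^sup>2) \<partial>lborel)
      = ennreal 2 * (\<integral>\<^sup>+\<xi>. ennreal ((norm (inv_fourier g \<xi>))\<^sup>2) \<partial>lborel)"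
      by (rule nn_integral_cmult[OF m2])
    ultimately show ?thesis
      using nn_integral_add[OF m1 borel_measurable_times_ennreal[OF borel_measurable_const m2], of "ennreal 2"] by simp
  qed
  also have "\<dots> \<le> ennreal (a) * ennreal ((2 * R) ^ DIM('a)) + ennreal 2 * ennreal (l powr (2 - p))"
    using R by (intro add_mono mult_left_mono emeasure_cball_le order_trans[OF plancherel_le[OF gint g2int] ennreal_leI[OF G1]]) auto
  also have "\<dots> = ennreal (a * (2 * R) ^ DIM('a) + 2 * l powr (2 - p))"
    using R a0 by (simp add: ennreal_plus ennreal_mult)
  also have "a * (2 * R) ^ DIM('a) + 2 * l powr (2 - p)
     = 2 * ?c\<^sup>2 * 2 ^ DIM('a) * ((l powr (1 - p))\<^sup>2 * R ^ DIM('a)) + 2 * l powr (2 - p)"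
    by (simp add: a_def power_mult_distrib mult_ac)
  also have "\<dots> = (2 * ?c\<^sup>2 * 2 ^ DIM('a) + 2) * R powr (?d * (2 / p - 1))"
    unfolding e2 e1 by (simp add: distrib_right)
  finally show ?thesis .
qed

text \<open>For the least k with |\<xi>| \<le> 2^k the k-th term alone dominates the weight. The
  factor 4^\<sigma> pays for passing from the lower bound 2^(k-1) to 2^k. Balls replace shells
  because the Fourier estimate available is one on balls.\<close>

lemma weight_dyadic_bound:
  fixes \<xi> :: "'a::euclidean_space"
  assumes "\<sigma> \<ge> 0"
  shows "ennreal ((1 + (norm \<xi>)\<^sup>2) powr (- \<sigma>))
    \<le> (\<Sum>k. ennreal (4 powr \<sigma> * 2 powr (- 2 * \<sigma> * real k)) * indicator (cball 0 (2 ^ k)) \<xi>)"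
proof -
  have ex: "\<exists>k. norm \<xi> \<le> 2 ^ k" using real_arch_pow[of 2 "norm \<xi>"] by (auto intro: less_imp_le)
  define k where "k = (LEAST k. norm \<xi> \<le> 2 ^ k)"
  have k: "norm \<xi> \<le> 2 ^ k" unfolding k_def by (rule LeastI_ex[OF ex])
  have "(1 + (norm \<xi>)\<^sup>2) powr (- \<sigma>) \<le> 4 powr \<sigma> * 2 powr (- 2 * \<sigma> * real k)"
  proof (cases k)
    case 0
    have "(1 + (norm \<xi>)\<^sup>2) powr (- \<sigma>) \<le> 1 powr (- \<sigma>)" using assms by (intro powr_mono2') auto
    also have "\<dots> \<le> 4 powr \<sigma>" using assms by (simp add: ge_one_powr_ge_zero)
    finally show ?thesis using 0 by simp
  next
    case (Suc j)
    then have "\<not> norm \<xi> \<le> 2 ^ j" using not_less_Least[of j "\<lambda>k. norm \<xi> \<le> 2 ^ k"] by (simp add: k_def)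
    then have "(2 ^ j)\<^sup>2 \<le> (norm \<xi>)\<^sup>2" by (intro power_mono) auto
    then have "((2 ^ j)\<^sup>2 :: real) \<le> 1 + (norm \<xi>)\<^sup>2" by (rule order_trans) simp
    then have "(1 + (norm \<xi>)\<^sup>2) powr (- \<sigma>) \<le> ((2 ^ j)\<^sup>2) powr (- \<sigma>)" using assms by (intro powr_mono2') auto
    also have "((2 ^ j)\<^sup>2) powr (- \<sigma>) = 2 powr (- 2 * \<sigma> * real j)"
    proof -
      have "((2::real) ^ j)\<^sup>2 = 2 powr (2 * real j)"
        by (simp add: powr_realpow[symmetric] power2_eq_square powr_add[symmetric])
      then show ?thesis by (simp add: powr_powr mult_ac)
    qed
    also have "\<dots> = 4 powr \<sigma> * 2 powr (- 2 * \<sigma> * real k)"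
    proof -
      have "(4::real) powr \<sigma> = 2 powr (2 * \<sigma>)" using powr_powr[of "2::real" 2 \<sigma>] by simp
      then show ?thesis using Suc by (simp add: powr_add[symmetric] algebra_simps)
    qed
    finally show ?thesis .
  qed
  then have "ennreal ((1 + (norm \<xi>)\<^sup>2) powr (- \<sigma>)) \<le> (\<Sum>k\<in>{k}. ennreal (4 powr \<sigma> * 2 powr (- 2 * \<sigma> * real k)) * indicator (cball 0 (2 ^ k)) \<xi>)"
    using k by (simp add: ennreal_leI)
  also have "\<dots> \<le> (\<Sum>k. ennreal (4 powr \<sigma> * 2 powr (- 2 * \<sigma> * real k)) * indicator (cball 0 (2 ^ k)) \<xi>)"
    by (rule sum_le_suminf) auto
  finally show ?thesis .
qed

text \<open>This is the embedding of L^(q/(q-1)) into H^(-\<sigma>). The balls of radius 2^k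
  contribute a geometric series of ratio 2^(d (1 - 2/q) - 2 \<sigma>), and the strict inequality for
  \<sigma> says precisely that this ratio is below 1.\<close>

lemma dual_sobolev:
  assumes q: "q \<ge> 2" and \<sigma>: "\<sigma> > real DIM('a) * (1 / 2 - 1 / q)"
  obtains C where "C \<ge> 0"
    "\<And>\<psi> :: 'a::euclidean_space \<Rightarrow> complex. test_fun \<psi> \<Longrightarrow> (LINT x|lborel. norm (\<psi> x) powr (q / (q - 1))) \<le> 1 \<Longrightarrow>
      (\<integral>\<^sup>+\<xi>. ennreal ((1 + (norm \<xi>)\<^sup>2) powr (- \<sigma>) * (norm (inv_fourier \<psi> \<xi>))\<^sup>2) \<partial>lborel) \<le> ennreal C"
proof -
  let ?d = "real DIM('a)"
  define p where "p = q / (q - 1)"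
  have p: "1 < p" "p \<le> 2" "2 / p - 1 = 1 - 2 / q" using q by (auto simp: p_def field_simps)
  define C0 where "C0 = 2 * (fconst TYPE('a))\<^sup>2 * 2 ^ DIM('a) + 2"
  have C0: "C0 \<ge> 0" by (simp add: C0_def)
  define \<rho> where "\<rho> = 2 powr (?d * (1 - 2 / q) - 2 * \<sigma>)"
  have "?d * (1 - 2 / q) - 2 * \<sigma> < 0" using \<sigma> by (simp add: algebra_simps)
  then have \<rho>: "0 < \<rho>" "\<rho> < 1" by (auto simp: \<rho>_def powr_less_one)
  have "0 \<le> ?d * (1 / 2 - 1 / q)" using q by (intro mult_nonneg_nonneg) (auto simp: field_simps)
  then have \<sigma>0: "\<sigma> \<ge> 0" using \<sigma> by simp
  show thesis
  proof (rule that[of "4 powr \<sigma> * C0 / (1 - \<rho>)"])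
    show "0 \<le> 4 powr \<sigma> * C0 / (1 - \<rho>)" using C0 \<rho> by simp
    fix \<psi> :: "'a \<Rightarrow> complex"
    assume \<psi>: "test_fun \<psi>" and I: "(LINT x|lborel. norm (\<psi> x) powr (q / (q - 1))) \<le> 1"
    have [measurable]: "\<psi> \<in> borel_measurable borel" by (rule test_fun_measurable[OF \<psi>])
    have [measurable]: "inv_fourier \<psi> \<in> borel_measurable borel" by (rule fourier_integral_measurable) measurable
    let ?c = "\<lambda>k. 4 powr \<sigma> * 2 powr (- 2 * \<sigma> * real k)"
    let ?P = "\<lambda>\<xi>. ennreal ((norm (inv_fourier \<psi> \<xi>))\<^sup>2)"
    have ball: "(\<lambda>\<xi>::'a. indicator (cball 0 (2 ^ k)) \<xi> :: ennreal) \<in> borel_measurable borel" for k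
      by (simp add: borel_measurable_indicator)
    have P: "?P \<in> borel_measurable lborel" by measurable
    have m: "(\<lambda>\<xi>. indicator (cball 0 (2 ^ k)) \<xi> * ?P \<xi>) \<in> borel_measurable lborel" for k
      using ball[of k] P by (intro borel_measurable_times_ennreal) simp_all
    have "(\<integral>\<^sup>+\<xi>. ennreal ((1 + (norm \<xi>)\<^sup>2) powr (- \<sigma>) * (norm (inv_fourier \<psi> \<xi>))\<^sup>2) \<partial>lborel)
      \<le> (\<integral>\<^sup>+\<xi>. (\<Sum>k. ennreal (?c k) * (indicator (cball 0 (2 ^ k)) \<xi> * ?P \<xi>)) \<partial>lborel)"
    proof (rule nn_integral_mono)
      fix \<xi> :: 'a
      have "ennreal ((1 + (norm \<xi>)\<^sup>2) powr (- \<sigma>) * (norm (inv_fourier \<psi> \<xi>))\<^sup>2)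
        \<le> (\<Sum>k. ennreal (?c k) * indicator (cball 0 (2 ^ k)) \<xi>) * ?P \<xi>"
        unfolding ennreal_mult[OF powr_ge_zero zero_le_power2]
        by (intro mult_right_mono weight_dyadic_bound \<sigma>0) simp
      also have "\<dots> = (\<Sum>k. ennreal (?c k) * (indicator (cball 0 (2 ^ k)) \<xi> * ?P \<xi>))"
        by (subst ennreal_suminf_multc[symmetric]) (simp add: mult.assoc)
      finally show "ennreal ((1 + (norm \<xi>)\<^sup>2) powr (- \<sigma>) * (norm (inv_fourier \<psi> \<xi>))\<^sup>2)
        \<le> (\<Sum>k. ennreal (?c k) * (indicator (cball 0 (2 ^ k)) \<xi> * ?P \<xi>))" .
    qed
    also have "\<dots> = (\<Sum>k. \<integral>\<^sup>+\<xi>. ennreal (?c k) * (indicator (cball 0 (2 ^ k)) \<xi> * ?P \<xi>) \<partial>lborel)"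
      by (intro nn_integral_suminf borel_measurable_times_ennreal[OF borel_measurable_const m])
    also have "\<dots> = (\<Sum>k. ennreal (?c k) * (\<integral>\<^sup>+\<xi>. indicator (cball 0 (2 ^ k)) \<xi> * ?P \<xi> \<partial>lborel))"
      by (simp only: nn_integral_cmult[OF m])
    also have "\<dots> \<le> (\<Sum>k. ennreal (4 powr \<sigma> * C0 * \<rho> ^ k))"
    proof (rule suminf_le)
      fix k
      have "ennreal (?c k) * (\<integral>\<^sup>+\<xi>. indicator (cball 0 (2 ^ k)) \<xi> * ?P \<xi> \<partial>lborel)
        \<le> ennreal (?c k) * ennreal (C0 * (2 ^ k) powr (?d * (2 / p - 1)))"
        unfolding C0_def
        by (intro mult_left_mono fourier_ball_estimate \<psi> p) (use I in \<open>auto simp: p_def\<close>)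
      also have "\<dots> = ennreal (?c k * (C0 * (2 ^ k) powr (?d * (2 / p - 1))))"
        using C0 by (simp add: ennreal_mult)
      also have "?c k * (C0 * (2 ^ k) powr (?d * (2 / p - 1))) = 4 powr \<sigma> * C0 * \<rho> ^ k"
      proof -
        have "(2 ^ k) powr (?d * (2 / p - 1)) = 2 powr (real k * (?d * (1 - 2 / q)))"
          by (simp add: powr_realpow[symmetric] powr_powr p)
        moreover have "\<rho> ^ k = 2 powr (real k * (?d * (1 - 2 / q) - 2 * \<sigma>))"
          using \<rho> by (simp add: powr_realpow[symmetric] \<rho>_def powr_powr mult.commute)
        moreover have "2 powr (- 2 * \<sigma> * real k) * 2 powr (real k * (?d * (1 - 2 / q))) = 2 powr (real k * (?d * (1 - 2 / q) - 2 * \<sigma>))"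
          unfolding powr_add[symmetric] by (rule arg_cong[where f="\<lambda>x. 2 powr x"]) (simp add: algebra_simps)
        ultimately show ?thesis by (metis mult.assoc mult.commute)
      qed
      finally show "ennreal (?c k) * (\<integral>\<^sup>+\<xi>. indicator (cball 0 (2 ^ k)) \<xi> * ?P \<xi> \<partial>lborel) \<le> ennreal (4 powr \<sigma> * C0 * \<rho> ^ k)" .
    qed auto
    also have "\<dots> = ennreal (4 powr \<sigma> * C0 * (1 / (1 - \<rho>)))"
      using \<rho> C0 by (intro suminf_ennreal_eq sums_mult geometric_sums) auto
    finally show "(\<integral>\<^sup>+\<xi>. ennreal ((1 + (norm \<xi>)\<^sup>2) powr (- \<sigma>) * (norm (inv_fourier \<psi> \<xi>))\<^sup>2) \<partial>lborel)
      \<le> ennreal (4 powr \<sigma> * C0 / (1 - \<rho>))" by simp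
  qed
qed

section \<open>The distributional Fourier transform and Sobolev duality\<close>

lemma cball_borel [measurable]: "cball (a::'a::euclidean_space) r \<in> sets borel"
  by simp

lemma square_integrable_local:
  fixes f :: "'a::euclidean_space \<Rightarrow> complex"
  assumes "square_integrable f"
  shows "integrable lborel (\<lambda>x. indicator (cball 0 R) x *\<^sub>R f x)"
proof -
  have [measurable]: "f \<in> borel_measurable borel" and f2: "integrable lborel (\<lambda>x. (norm (f x))\<^sup>2)"
    using assms by (auto simp: square_integrable_def)
  have "integrable lborel (\<lambda>x::'a. indicator (cball 0 R) x * (1::real) + (norm (f x))\<^sup>2)"
    by (intro Bochner_Integration.integrable_add f2 cball_const_integrable)
  then show ?thesis
  proof (rule Bochner_Integration.integrable_bound)
    show "AE x in lborel. norm (indicator (cball 0 R) x *\<^sub>R f x) \<le> norm (indicator (cball 0 R) x * 1 + (norm (f x))\<^sup>2)"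
    proof (rule AE_I2)
      fix x
      have "norm (f x) \<le> 1 + (norm (f x))\<^sup>2"
        using sum_squares_bound[of 1 "norm (f x)"] norm_ge_zero[of "f x"] by (simp del: norm_ge_zero)
      then show "norm (indicator (cball 0 R) x *\<^sub>R f x) \<le> norm (indicator (cball 0 R) x * 1 + (norm (f x))\<^sup>2)"
        by (auto simp: indicator_def)
    qed
  qed measurable
qed

lemma test_fun_schwartz: assumes "test_fun \<psi>" shows "schwartz_fun \<psi>"
  unfolding schwartz_fun_def
proof (intro conjI allI)
  show "smooth_fun \<psi>" by (rule test_fun_smooth[OF assms])
  fix vs :: "'a list" and k :: nat
  let ?h = "fold directional_deriv vs \<psi>"
  have h: "test_fun ?h" by (rule test_fun_fold[OF assms])
  obtain R where R: "R > 0" "\<And>x. R < norm x \<Longrightarrow> ?h x = 0" using test_fun_support[OF h] by blast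
  obtain M where M: "M > 0" "\<And>x. norm (?h x) \<le> M" using test_fun_bounded[OF h] by blast
  have "norm ((1 + norm x) ^ k *\<^sub>R ?h x) \<le> (1 + R) ^ k * M" for x
  proof (cases "norm x \<le> R")
    case True
    then have "(1 + norm x) ^ k * norm (?h x) \<le> (1 + R) ^ k * M"
      using M R by (intro mult_mono power_mono) auto
    then show ?thesis by simp
  qed (use R M in auto)
  then show "bounded (range (\<lambda>x. (1 + norm x) ^ k *\<^sub>R ?h x))" by (auto intro!: boundedI)
qed

lemma is_fourier_transform_test:
  assumes "is_fourier_transform f g" "test_fun \<psi>"
  shows "(LINT x|lborel. f x * \<psi> x) = (LINT \<xi>|lborel. g \<xi> * inv_fourier \<psi> \<xi>)"
  using assms schwartz_inv_fourier[OF assms(2)] fourier_inversion_test[OF assms(2)]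
  unfolding is_fourier_transform_def by metis

lemma square_integrable_mult_test:
  assumes "square_integrable f" "test_fun \<psi>"
  shows "integrable lborel (\<lambda>x. f x * \<psi> x)"
proof -
  obtain R where R: "R > 0" "\<And>x. R < norm x \<Longrightarrow> \<psi> x = 0" using test_fun_support[OF assms(2)] by blast
  obtain M where M: "M > 0" "\<And>x. norm (\<psi> x) \<le> M" using test_fun_bounded[OF assms(2)] by blast
  have [measurable]: "f \<in> borel_measurable borel" "\<psi> \<in> borel_measurable borel"
    using assms by (auto simp: square_integrable_def intro: test_fun_measurable)
  have "integrable lborel (\<lambda>x. (indicator (cball 0 R) x *\<^sub>R f x) * complex_of_real M)"
    by (intro integrable_mult_left square_integrable_local assms)
  then show ?thesis
  proof (rule Bochner_Integration.integrable_bound)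
    show "AE x in lborel. norm (f x * \<psi> x) \<le> norm ((indicator (cball 0 R) x *\<^sub>R f x) * complex_of_real M)"
      using R M by (intro AE_I2) (auto simp: indicator_def norm_mult not_le intro!: mult_left_mono)
  qed measurable
qed

lemma mult_le_sum_squares: "0 \<le> a \<Longrightarrow> 0 \<le> b \<Longrightarrow> a * b \<le> a\<^sup>2 + (b::real)\<^sup>2"
  using sum_squares_bound[of a b] mult_nonneg_nonneg[of a b] by linarith

lemma ennreal_weight_square:
  assumes "0 \<le> x" shows "(ennreal (a powr (r / 2) * x))\<^sup>2 = ennreal (a powr r * x\<^sup>2)"
proof -
  have "(a powr (r / 2))\<^sup>2 = a powr r" by (simp add: power2_eq_square powr_add[symmetric])
  then show ?thesis using assms by (simp add: ennreal_power power_mult_distrib)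
qed

lemma norm_diff_squared_le: "(norm (a - b :: 'a::real_normed_vector))\<^sup>2 \<le> 2 * (norm a)\<^sup>2 + 2 * (norm b)\<^sup>2"
proof -
  have "(norm (a - b))\<^sup>2 \<le> (norm a + norm b)\<^sup>2" by (intro power_mono norm_triangle_ineq4) simp
  then show ?thesis using sum_squares_bound[of "norm a" "norm b"] by (simp add: power2_sum)
qed

lemma square_integrable_diff:
  assumes "square_integrable f" "square_integrable g"
  shows "square_integrable (\<lambda>x. f x - g x)"
proof -
  have [measurable]: "f \<in> borel_measurable lborel" "g \<in> borel_measurable lborel"
    using assms by (auto simp: square_integrable_def)
  have "integrable lborel (\<lambda>x. 2 * (norm (f x))\<^sup>2 + 2 * (norm (g x))\<^sup>2)"
    using assms by (auto simp: square_integrable_def)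
  then have "integrable lborel (\<lambda>x. (norm (f x - g x))\<^sup>2)"
  proof (rule Bochner_Integration.integrable_bound)
    show "AE x in lborel. norm ((norm (f x - g x))\<^sup>2) \<le> norm (2 * (norm (f x))\<^sup>2 + 2 * (norm (g x))\<^sup>2)"
      by (intro AE_I2) (use norm_diff_squared_le in simp)
  qed measurable
  then show ?thesis by (simp add: square_integrable_def)
qed

text \<open>\<open>converse_holder\<close> with q = 2 and A = 0: the two candidates have the same
  pairings with test functions, so their difference has L^2 norm zero.\<close>

lemma is_fourier_transform_unique:
  assumes "is_fourier_transform f g" "is_fourier_transform f h"
  shows "AE \<xi> in lborel. g \<xi> = h \<xi>"
proof -
  have sq: "square_integrable g" "square_integrable h" using assms by (auto simp: is_fourier_transform_def)
  have d: "square_integrable (\<lambda>\<xi>. g \<xi> - h \<xi>)" by (rule square_integrable_diff[OF sq])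
  then have [measurable]: "(\<lambda>\<xi>. g \<xi> - h \<xi>) \<in> borel_measurable borel" by (simp add: square_integrable_def)
  have "(\<integral>\<^sup>+\<xi>. ennreal (norm (g \<xi> - h \<xi>) powr 2) \<partial>lborel) \<le> ennreal (0 powr 2)"
  proof (rule converse_holder)
    fix \<psi> :: "'a \<Rightarrow> complex" assume \<psi>: "test_fun \<psi>"
    have "(LINT \<xi>|lborel. g \<xi> * \<psi> \<xi>) = (LINT \<xi>|lborel. h \<xi> * \<psi> \<xi>)"
      using assms test_fun_schwartz[OF \<psi>] unfolding is_fourier_transform_def by metis
    then have "(LINT \<xi>|lborel. (g \<xi> - h \<xi>) * \<psi> \<xi>) = 0"
      using square_integrable_mult_test[OF sq(1) \<psi>] square_integrable_mult_test[OF sq(2) \<psi>]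
      by (simp add: left_diff_distrib)
    then show "norm (LINT \<xi>|lborel. (g \<xi> - h \<xi>) * \<psi> \<xi>) \<le> 0" by simp
  qed (use square_integrable_local[OF d] in auto)
  then have "(\<integral>\<^sup>+\<xi>. ennreal (norm (g \<xi> - h \<xi>) powr 2) \<partial>lborel) = 0" by simp
  then have "AE \<xi> in lborel. ennreal (norm (g \<xi> - h \<xi>) powr 2) = 0"
    by (subst (asm) nn_integral_0_iff_AE) auto
  then show ?thesis by eventually_elim simp
qed

text \<open>\<open>fourier_transform\<close> is obtained by choice, so it may differ from the
  witness of membership in \<open>sobolev_space\<close>; almost everywhere uniqueness carries the
  weighted integrability over.\<close>

lemma sobolev_fourier_transform:
  assumes "f \<in> sobolev_space s"
  shows "is_fourier_transform f (fourier_transform f)"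
    and "integrable lborel (\<lambda>\<xi>. (1 + (norm \<xi>)\<^sup>2) powr s * (norm (fourier_transform f \<xi>))\<^sup>2)"
proof -
  obtain g where g: "is_fourier_transform f g" "integrable lborel (\<lambda>\<xi>. (1 + (norm \<xi>)\<^sup>2) powr s * (norm (g \<xi>))\<^sup>2)"
    using assms by (auto simp: sobolev_space_def)
  show F: "is_fourier_transform f (fourier_transform f)"
    unfolding fourier_transform_def by (rule someI[where P="is_fourier_transform f", OF g(1)])
  have [measurable]: "g \<in> borel_measurable lborel" "fourier_transform f \<in> borel_measurable lborel"
    using F g by (auto simp: is_fourier_transform_def square_integrable_def)
  show "integrable lborel (\<lambda>\<xi>. (1 + (norm \<xi>)\<^sup>2) powr s * (norm (fourier_transform f \<xi>))\<^sup>2)"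
    using g(2)
  proof (rule integrable_cong_AE_imp)
    show "AE \<xi> in lborel. (1 + (norm \<xi>)\<^sup>2) powr s * (norm (g \<xi>))\<^sup>2 = (1 + (norm \<xi>)\<^sup>2) powr s * (norm (fourier_transform f \<xi>))\<^sup>2"
      using is_fourier_transform_unique[OF g(1) F] by eventually_elim simp
  qed measurable
qed

lemma sobolev_norm_eq:
  assumes "is_fourier_transform f g"
  shows "sobolev_norm s f = sqrt (LINT \<xi>|lborel. (1 + (norm \<xi>)\<^sup>2) powr s * (norm (g \<xi>))\<^sup>2)"
proof -
  have F: "is_fourier_transform f (fourier_transform f)"
    unfolding fourier_transform_def by (rule someI[where P="is_fourier_transform f", OF assms])
  have [measurable]: "g \<in> borel_measurable lborel" "fourier_transform f \<in> borel_measurable lborel"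
    using F assms by (auto simp: is_fourier_transform_def square_integrable_def)
  show ?thesis unfolding sobolev_norm_def
  proof (rule arg_cong[where f=sqrt], rule integral_cong_AE)
    show "AE \<xi> in lborel. (1 + (norm \<xi>)\<^sup>2) powr s * (norm (fourier_transform f \<xi>))\<^sup>2 = (1 + (norm \<xi>)\<^sup>2) powr s * (norm (g \<xi>))\<^sup>2"
      using is_fourier_transform_unique[OF assms F] by eventually_elim simp
  qed measurable
qed

lemma sobolev_norm_nonneg: "0 \<le> sobolev_norm s f"
  unfolding sobolev_norm_def by (intro real_sqrt_ge_zero integral_nonneg_AE AE_I2) simp

lemma sobolev_space_square_integrable: "f \<in> sobolev_space s \<Longrightarrow> square_integrable f"
  by (auto simp: sobolev_space_def is_fourier_transform_def)

lemma schwartz_bounded: assumes "schwartz_fun \<phi>" obtains M where "\<And>x. norm (\<phi> x) \<le> M"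
proof -
  have "bounded (range (\<lambda>x. (1 + norm x) ^ 0 *\<^sub>R fold directional_deriv [] \<phi> x))"
    using assms unfolding schwartz_fun_def by blast
  then show thesis using that by (auto simp: bounded_iff)
qed

lemma square_integrable_mult_schwartz:
  assumes "square_integrable g" "schwartz_fun \<phi>"
  shows "integrable lborel (\<lambda>x. g x * \<phi> x)"
proof -
  have sm: "smooth_fun \<phi>" using assms(2) by (simp add: schwartz_fun_def)
  obtain M where M: "\<And>x. norm (\<phi> x) \<le> M" using schwartz_bounded[OF assms(2)] by blast
  have [measurable]: "g \<in> borel_measurable borel" "\<phi> \<in> borel_measurable borel"
    using assms smooth_fun_measurable[OF sm] by (auto simp: square_integrable_def)
  have "integrable lborel (\<lambda>x. (norm (g x))\<^sup>2 + norm (\<phi> x) * M)"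
    using assms schwartz_integrable[OF assms(2)] by (auto simp: square_integrable_def)
  then show ?thesis
  proof (rule Bochner_Integration.integrable_bound)
    show "AE x in lborel. norm (g x * \<phi> x) \<le> norm ((norm (g x))\<^sup>2 + norm (\<phi> x) * M)"
    proof (rule AE_I2)
      fix x
      have "norm (g x) * norm (\<phi> x) \<le> (norm (g x))\<^sup>2 + (norm (\<phi> x))\<^sup>2"
        by (intro mult_le_sum_squares) auto
      also have "(norm (\<phi> x))\<^sup>2 \<le> norm (\<phi> x) * M"
        unfolding power2_eq_square by (intro mult_left_mono M) simp
      finally show "norm (g x * \<phi> x) \<le> norm ((norm (g x))\<^sup>2 + norm (\<phi> x) * M)" by (simp add: norm_mult)
    qed
  qed measurable
qed

text \<open>Subtracting the pairings on the space side requires f times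
  \<open>fourier_integral \<phi>\<close> to be integrable for square integrable f, since a Bochner
  integral that does not exist is 0 by convention. The Plancherel bound, applied to the conjugate of
  \<phi>, provides this.\<close>

lemma is_fourier_transform_diff:
  assumes "is_fourier_transform f g" "is_fourier_transform f' g'"
  shows "is_fourier_transform (\<lambda>x. f x - f' x) (\<lambda>x. g x - g' x)"
  unfolding is_fourier_transform_def
proof (intro conjI allI impI)
  have sq: "square_integrable f" "square_integrable f'" "square_integrable g" "square_integrable g'"
    using assms by (auto simp: is_fourier_transform_def)
  then show "square_integrable (\<lambda>x. f x - f' x)" "square_integrable (\<lambda>x. g x - g' x)" by (auto intro: square_integrable_diff)
  fix \<phi> :: "'a \<Rightarrow> complex" assume \<phi>: "schwartz_fun \<phi>"
  have "(LINT \<xi>|lborel. g \<xi> * \<phi> \<xi>) = (LINT x|lborel. f x * fourier_integral \<phi> x)"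
    "(LINT \<xi>|lborel. g' \<xi> * \<phi> \<xi>) = (LINT x|lborel. f' x * fourier_integral \<phi> x)"
    using assms \<phi> unfolding is_fourier_transform_def by blast+
  moreover have "integrable lborel (\<lambda>x. f x * fourier_integral \<phi> x)" if "square_integrable f" for f
  proof -
    obtain M where M: "\<And>x. norm (\<phi> x) \<le> M" using schwartz_bounded[OF \<phi>] by blast
    have sm: "smooth_fun \<phi>" using \<phi> by (simp add: schwartz_fun_def)
    have i1: "integrable lborel (\<lambda>x. cnj (\<phi> x))" using schwartz_integrable[OF \<phi>] by simp
    have [measurable]: "\<phi> \<in> borel_measurable borel" by (rule smooth_fun_measurable[OF sm])
    have [measurable]: "(\<lambda>x. cnj (\<phi> x)) \<in> borel_measurable borel"
      using borel_measurable_integrable[OF i1] by simp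
    have i2: "integrable lborel (\<lambda>x. (norm (cnj (\<phi> x)))\<^sup>2)"
    proof (rule Bochner_Integration.integrable_bound[OF integrable_mult_right[OF integrable_norm[OF schwartz_integrable[OF \<phi>]], of M]])
      show "AE x in lborel. norm ((norm (cnj (\<phi> x)))\<^sup>2) \<le> norm (M * norm (\<phi> x))"
        using M order_trans[OF norm_ge_zero M] by (intro AE_I2) (simp add: power2_eq_square mult_right_mono)
    qed measurable
    have eq: "norm (fourier_integral \<phi> \<xi>) = norm (inv_fourier (\<lambda>x. cnj (\<phi> x)) \<xi>)" for \<xi>
      using arg_cong[OF cnj_inv_fourier[of "\<lambda>x. cnj (\<phi> x)" \<xi>], of norm] by simp
    have [measurable]: "fourier_integral \<phi> \<in> borel_measurable borel" "f \<in> borel_measurable borel"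
      using that by (auto intro: fourier_integral_measurable simp: square_integrable_def)
    have "(\<integral>\<^sup>+\<xi>. ennreal (norm ((norm (fourier_integral \<phi> \<xi>))\<^sup>2)) \<partial>lborel) < \<infinity>"
      using plancherel_le[OF i1 i2] by (simp add: eq le_less_trans)
    then have "integrable lborel (\<lambda>\<xi>. (norm (fourier_integral \<phi> \<xi>))\<^sup>2)"
      by (intro integrableI_bounded) auto
    moreover have "integrable lborel (\<lambda>\<xi>. (norm (f \<xi>))\<^sup>2)" using that by (simp add: square_integrable_def)
    ultimately have "integrable lborel (\<lambda>\<xi>. (norm (f \<xi>))\<^sup>2 + (norm (fourier_integral \<phi> \<xi>))\<^sup>2)" by simp
    then show ?thesis
    proof (rule Bochner_Integration.integrable_bound)
      show "AE x in lborel. norm (f x * fourier_integral \<phi> x) \<le> norm ((norm (f x))\<^sup>2 + (norm (fourier_integral \<phi> x))\<^sup>2)"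
      proof (rule AE_I2)
        fix x
        show "norm (f x * fourier_integral \<phi> x) \<le> norm ((norm (f x))\<^sup>2 + (norm (fourier_integral \<phi> x))\<^sup>2)"
          using mult_le_sum_squares[of "norm (f x)" "norm (fourier_integral \<phi> x)"] by (simp add: norm_mult)
      qed
    qed measurable
  qed
  ultimately show "(LINT \<xi>|lborel. (g \<xi> - g' \<xi>) * \<phi> \<xi>) = (LINT x|lborel. (f x - f' x) * fourier_integral \<phi> x)"
    using sq square_integrable_mult_schwartz[OF sq(3) \<phi>] square_integrable_mult_schwartz[OF sq(4) \<phi>]
    by (simp add: left_diff_distrib)
qed

lemma sobolev_space_diff:
  assumes "f \<in> sobolev_space s" "g \<in> sobolev_space s"
  shows "(\<lambda>x. f x - g x) \<in> sobolev_space s"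
proof -
  note F = sobolev_fourier_transform[OF assms(1)] and G = sobolev_fourier_transform[OF assms(2)]
  let ?w = "\<lambda>\<xi>::'a. (1 + (norm \<xi>)\<^sup>2) powr s" and ?d = "\<lambda>\<xi>. fourier_transform f \<xi> - fourier_transform g \<xi>"
  have FT: "is_fourier_transform (\<lambda>x. f x - g x) ?d" by (rule is_fourier_transform_diff[OF F(1) G(1)])
  have [measurable]: "fourier_transform f \<in> borel_measurable lborel" "fourier_transform g \<in> borel_measurable lborel"
    using F G by (auto simp: is_fourier_transform_def square_integrable_def)
  have "integrable lborel (\<lambda>\<xi>. 2 * (?w \<xi> * (norm (fourier_transform f \<xi>))\<^sup>2) + 2 * (?w \<xi> * (norm (fourier_transform g \<xi>))\<^sup>2))"
    using F(2) G(2) by auto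
  then have "integrable lborel (\<lambda>\<xi>. ?w \<xi> * (norm (?d \<xi>))\<^sup>2)"
  proof (rule Bochner_Integration.integrable_bound)
    show "AE \<xi> in lborel. norm (?w \<xi> * (norm (?d \<xi>))\<^sup>2) \<le> norm (2 * (?w \<xi> * (norm (fourier_transform f \<xi>))\<^sup>2) + 2 * (?w \<xi> * (norm (fourier_transform g \<xi>))\<^sup>2))"
    proof (rule AE_I2)
      fix \<xi> :: 'a
      have "?w \<xi> * (norm (?d \<xi>))\<^sup>2 \<le> ?w \<xi> * (2 * (norm (fourier_transform f \<xi>))\<^sup>2 + 2 * (norm (fourier_transform g \<xi>))\<^sup>2)"
        by (intro mult_left_mono norm_diff_squared_le) auto
      then show "norm (?w \<xi> * (norm (?d \<xi>))\<^sup>2) \<le> norm (2 * (?w \<xi> * (norm (fourier_transform f \<xi>))\<^sup>2) + 2 * (?w \<xi> * (norm (fourier_transform g \<xi>))\<^sup>2))"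
        by (simp add: distrib_left abs_mult mult.left_commute)
    qed
  qed measurable
  with FT show ?thesis unfolding sobolev_space_def by blast
qed

text \<open>The duality of H^s and H^(-s): Cauchy-Schwarz on the Fourier side with the weight (1 +
  |\<xi>|^2)^(s/2) and its inverse distributed over the factors. The negative norm enters as a bound
  \<open>b\<close> on a nonnegative integral, so the dyadic and packet estimates can be plugged in
  directly.\<close>

lemma sobolev_pairing:
  assumes f: "f \<in> sobolev_space s" and \<psi>: "test_fun \<psi>"
    and b: "(\<integral>\<^sup>+\<xi>. ennreal ((1 + (norm \<xi>)\<^sup>2) powr (- s) * (norm (inv_fourier \<psi> \<xi>))\<^sup>2) \<partial>lborel) \<le> ennreal b" "0 \<le> b"
  shows "norm (LINT x|lborel. f x * \<psi> x) \<le> sobolev_norm s f * sqrt b"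
proof -
  let ?g = "fourier_transform f" and ?\<phi> = "inv_fourier \<psi>" and ?w = "\<lambda>r \<xi>::'a. (1 + (norm \<xi>)\<^sup>2) powr r"
  note F = sobolev_fourier_transform[OF f]
  have [measurable]: "?g \<in> borel_measurable lborel" "\<psi> \<in> borel_measurable borel"
    using F test_fun_measurable[OF \<psi>] by (auto simp: is_fourier_transform_def square_integrable_def)
  have [measurable]: "?\<phi> \<in> borel_measurable borel" by (rule fourier_integral_measurable) measurable
  let ?X = "norm (LINT x|lborel. f x * \<psi> x)"
  have w: "?w (s/2) \<xi> * ?w (- (s/2)) \<xi> = 1" for \<xi> :: 'a
    by (simp add: powr_add[symmetric] add_nonneg_eq_0_iff)
  have "ennreal ?X \<le> (\<integral>\<^sup>+\<xi>. ennreal (norm (?g \<xi> * ?\<phi> \<xi>)) \<partial>lborel)"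
    unfolding is_fourier_transform_test[OF F(1) \<psi>] by (rule ennreal_norm_integral_le)
  also have "\<dots> = (\<integral>\<^sup>+\<xi>. ennreal (?w (s/2) \<xi> * norm (?g \<xi>)) * ennreal (?w (- (s/2)) \<xi> * norm (?\<phi> \<xi>)) \<partial>lborel)"
  proof (rule nn_integral_cong)
    fix \<xi> :: 'a
    have "(?w (s/2) \<xi> * norm (?g \<xi>)) * (?w (- (s/2)) \<xi> * norm (?\<phi> \<xi>)) = (?w (s/2) \<xi> * ?w (- (s/2)) \<xi>) * (norm (?g \<xi>) * norm (?\<phi> \<xi>))"
      by (simp only: mult_ac)
    then show "ennreal (norm (?g \<xi> * ?\<phi> \<xi>)) = ennreal (?w (s/2) \<xi> * norm (?g \<xi>)) * ennreal (?w (- (s/2)) \<xi> * norm (?\<phi> \<xi>))"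
      by (simp add: w norm_mult ennreal_mult[symmetric])
  qed
  finally have "(ennreal ?X)\<^sup>2 \<le> (\<integral>\<^sup>+\<xi>. ennreal (?w (s/2) \<xi> * norm (?g \<xi>)) * ennreal (?w (- (s/2)) \<xi> * norm (?\<phi> \<xi>)) \<partial>lborel)\<^sup>2"
    by (rule power_mono) simp
  also have "\<dots> \<le> (\<integral>\<^sup>+\<xi>. (ennreal (?w (s/2) \<xi> * norm (?g \<xi>)))\<^sup>2 \<partial>lborel) * (\<integral>\<^sup>+\<xi>. (ennreal (?w (- (s/2)) \<xi> * norm (?\<phi> \<xi>)))\<^sup>2 \<partial>lborel)"
    by (rule Cauchy_Schwarz_nn_integral) measurable
  also have "(\<integral>\<^sup>+\<xi>. (ennreal (?w (s/2) \<xi> * norm (?g \<xi>)))\<^sup>2 \<partial>lborel) = (\<integral>\<^sup>+\<xi>. ennreal (?w s \<xi> * (norm (?g \<xi>))\<^sup>2) \<partial>lborel)"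
    by (rule nn_integral_cong) (simp only: ennreal_weight_square[OF norm_ge_zero])
  also have "\<dots> = ennreal (LINT \<xi>|lborel. ?w s \<xi> * (norm (?g \<xi>))\<^sup>2)"
    by (rule nn_integral_eq_integral[OF F(2)]) auto
  also have "(LINT \<xi>|lborel. ?w s \<xi> * (norm (?g \<xi>))\<^sup>2) = (sobolev_norm s f)\<^sup>2"
    unfolding sobolev_norm_def by (rule real_sqrt_pow2[symmetric]) (intro integral_nonneg_AE AE_I2, simp)
  also have "(\<integral>\<^sup>+\<xi>. (ennreal (?w (- (s/2)) \<xi> * norm (?\<phi> \<xi>)))\<^sup>2 \<partial>lborel) = (\<integral>\<^sup>+\<xi>. ennreal (?w (- s) \<xi> * (norm (?\<phi> \<xi>))\<^sup>2) \<partial>lborel)"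
    by (rule nn_integral_cong) (simp only: ennreal_weight_square[OF norm_ge_zero] minus_divide_left)
  also have "ennreal ((sobolev_norm s f)\<^sup>2) * \<dots> \<le> ennreal ((sobolev_norm s f)\<^sup>2) * ennreal b"
    by (rule mult_left_mono[OF b(1)]) simp
  finally have "ennreal (?X\<^sup>2) \<le> ennreal ((sobolev_norm s f)\<^sup>2 * b)"
    using b(2) by (simp add: ennreal_power ennreal_mult)
  then have "?X\<^sup>2 \<le> (sobolev_norm s f * sqrt b)\<^sup>2"
    using b(2) by (simp add: power_mult_distrib)
  then show ?thesis
    by (rule power2_le_imp_le) (intro mult_nonneg_nonneg sobolev_norm_nonneg real_sqrt_ge_zero b(2))
qed

text \<open>Dual to \<open>dual_sobolev\<close>: test functions normalized in L^(q/(q-1)) have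
  bounded H^(-s) norm, their pairings with \<open>f\<close> are controlled by
  \<open>sobolev_pairing\<close>, and \<open>converse_holder\<close> recovers the L^q norm.\<close>

lemma sobolev_embedding:
  assumes q: "q \<ge> 2" and s: "s > real DIM('a) * (1 / 2 - 1 / q)"
  obtains C where "C \<ge> 0"
    "\<And>f :: 'a::euclidean_space \<Rightarrow> complex. f \<in> sobolev_space s \<Longrightarrow>
      (\<integral>\<^sup>+x. ennreal (norm (f x) powr q) \<partial>lborel) \<le> ennreal ((C * sobolev_norm s f) powr q)"
proof -
  obtain C where C: "C \<ge> 0" "\<And>\<psi> :: 'a \<Rightarrow> complex. test_fun \<psi> \<Longrightarrow> (LINT x|lborel. norm (\<psi> x) powr (q / (q - 1))) \<le> 1 \<Longrightarrow>
      (\<integral>\<^sup>+\<xi>. ennreal ((1 + (norm \<xi>)\<^sup>2) powr (- s) * (norm (inv_fourier \<psi> \<xi>))\<^sup>2) \<partial>lborel) \<le> ennreal C"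
    using dual_sobolev[OF q s] by blast
  show thesis
  proof (rule that[of "sqrt C"])
    fix f :: "'a \<Rightarrow> complex" assume f: "f \<in> sobolev_space s"
    have sq: "square_integrable f" by (rule sobolev_space_square_integrable[OF f])
    show "(\<integral>\<^sup>+x. ennreal (norm (f x) powr q) \<partial>lborel) \<le> ennreal ((sqrt C * sobolev_norm s f) powr q)"
    proof (rule converse_holder)
      show "f \<in> borel_measurable borel" using sq by (simp add: square_integrable_def)
      show "integrable lborel (\<lambda>x. indicator (cball 0 R) x *\<^sub>R f x)" for R
        by (rule square_integrable_local[OF sq])
      show "norm (LINT x|lborel. f x * \<psi> x) \<le> sqrt C * sobolev_norm s f"
        if "test_fun \<psi>" "(LINT x|lborel. norm (\<psi> x) powr (q / (q - 1))) \<le> 1" for \<psi>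
        using sobolev_pairing[OF f that(1) C(2)[OF that] C(1)] by (simp add: mult.commute)
    qed (use q C sobolev_norm_nonneg[of s f] in auto)
  qed (use C in simp)
qed

section \<open>Test functions as elements of Sobolev spaces\<close>

lemma weight_bound_nat:
  fixes \<xi> :: "'a::real_normed_vector"
  assumes "s \<le> 2 * real N"
  shows "(1 + (norm \<xi>)\<^sup>2) powr s \<le> (1 + norm \<xi>) ^ (4 * N)"
proof -
  have "(1 + (norm \<xi>)\<^sup>2) powr s \<le> (1 + (norm \<xi>)\<^sup>2) powr (2 * real N)"
    using assms by (intro powr_mono) auto
  also have "\<dots> = (1 + (norm \<xi>)\<^sup>2) ^ (2 * N)"
    by (subst powr_realpow[symmetric]) (auto intro: add_pos_nonneg)
  also have "\<dots> \<le> ((1 + norm \<xi>)\<^sup>2) ^ (2 * N)"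
    by (intro power_mono) (auto simp: power2_sum)
  finally show ?thesis by (simp add: power_mult[symmetric])
qed

text \<open>The pairing identity is the multiplication formula, that is, Fubini for the exponential
  kernel; the weighted integrability is rapid decay. The conjugate of \<open>f\<close> appears
  because the decay was proved for \<open>inv_fourier\<close>.\<close>

lemma test_fun_is_fourier_transform:
  fixes f :: "'a::euclidean_space \<Rightarrow> complex"
  assumes "test_fun f"
  shows "is_fourier_transform f (fourier_integral f)"
    and "integrable lborel (\<lambda>\<xi>. (1 + (norm \<xi>)\<^sup>2) powr s * (norm (fourier_integral f \<xi>))\<^sup>2)"
proof -
  have [measurable]: "f \<in> borel_measurable borel" by (rule test_fun_measurable[OF assms])
  have [measurable]: "fourier_integral f \<in> borel_measurable borel" by (rule fourier_integral_measurable) measurable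
  have eq: "norm (fourier_integral f \<xi>) = norm (inv_fourier (\<lambda>x. cnj (f x)) \<xi>)" for \<xi>
    using arg_cong[OF cnj_inv_fourier[of "\<lambda>x. cnj (f x)" \<xi>], of norm] by simp
  have W: "integrable lborel (\<lambda>\<xi>. (1 + (norm \<xi>)\<^sup>2) powr s * (norm (fourier_integral f \<xi>))\<^sup>2)" for s
  proof -
    obtain N :: nat where N: "s \<le> real N" using real_arch_simple by blast
    then have N2: "s \<le> 2 * real N" by simp
    obtain C where C: "\<And>\<xi>. (1 + norm \<xi>) ^ (DIM('a) + 2 * N) * norm (inv_fourier (\<lambda>x. cnj (f x)) \<xi>) \<le> C"
      using inv_fourier_decay[OF test_fun_cnj[OF assms]] by blast
    show ?thesis
    proof (rule decay_integrable)
      fix \<xi> :: 'a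
      have "(1 + norm \<xi>) ^ (2 * DIM('a)) * norm ((1 + (norm \<xi>)\<^sup>2) powr s * (norm (fourier_integral f \<xi>))\<^sup>2)
        \<le> (1 + norm \<xi>) ^ (2 * DIM('a)) * ((1 + norm \<xi>) ^ (4 * N) * (norm (fourier_integral f \<xi>))\<^sup>2)"
        using weight_bound_nat[OF N2, of \<xi>] by (intro mult_left_mono) (auto simp: abs_mult intro!: mult_right_mono)
      also have "\<dots> = ((1 + norm \<xi>) ^ (DIM('a) + 2 * N) * norm (fourier_integral f \<xi>))\<^sup>2"
        by (simp add: power_mult_distrib power_mult[symmetric] power_add[symmetric] algebra_simps)
      also have "\<dots> \<le> C\<^sup>2" unfolding eq by (intro power_mono C) auto
      finally show "(1 + norm \<xi>) ^ (2 * DIM('a)) * norm ((1 + (norm \<xi>)\<^sup>2) powr s * (norm (fourier_integral f \<xi>))\<^sup>2) \<le> C\<^sup>2" .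
    qed measurable
  qed
  show "integrable lborel (\<lambda>\<xi>. (1 + (norm \<xi>)\<^sup>2) powr s * (norm (fourier_integral f \<xi>))\<^sup>2)" by (rule W)
  show "is_fourier_transform f (fourier_integral f)"
    unfolding is_fourier_transform_def
  proof (intro conjI allI impI)
    have "integrable lborel (\<lambda>x. norm (f x) powr 2)" by (rule test_fun_powr_integrable[OF assms]) simp
    moreover have "norm (f x) powr 2 = (norm (f x))\<^sup>2" for x
      by (cases "f x = 0") auto
    ultimately show "square_integrable f" by (simp add: square_integrable_def)
    have "integrable lborel (\<lambda>\<xi>::'a. (1 + (norm \<xi>)\<^sup>2) powr 0 * (norm (fourier_integral f \<xi>))\<^sup>2)" by (rule W)
    \<comment> \<open>\<open>x powr 0\<close> is 1 only for nonzero x, so the base has to be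
      excluded from being 0 before the weight of order zero disappears.\<close>
    moreover have "1 + (norm \<xi>)\<^sup>2 \<noteq> 0" for \<xi> :: 'a
      by (metis add_nonneg_eq_0_iff zero_le_one zero_le_power2 zero_neq_one)
    ultimately show "square_integrable (fourier_integral f)" by (simp add: square_integrable_def)
    fix \<phi> :: "'a \<Rightarrow> complex" assume \<phi>: "schwartz_fun \<phi>"
    have "(LINT \<xi>|lborel. \<phi> \<xi> * (LINT x|lborel. cis (- (\<xi> \<bullet> x)) * f x)) = (LINT x|lborel. (LINT \<xi>|lborel. \<phi> \<xi> * cis (- (\<xi> \<bullet> x))) * f x)"
      by (rule lborel_Fubini_kernel[OF schwartz_integrable[OF \<phi>] test_fun_integrable[OF assms], where M=1]) auto
    moreover have "fourier_integral f \<xi> * \<phi> \<xi> = complex_of_real (fconst TYPE('a)) * (\<phi> \<xi> * (LINT x|lborel. cis (- (\<xi> \<bullet> x)) * f x))" for \<xi>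
      by (simp add: fourier_integral_eq inner_commute)
    moreover have "f x * fourier_integral \<phi> x = complex_of_real (fconst TYPE('a)) * ((LINT \<xi>|lborel. \<phi> \<xi> * cis (- (\<xi> \<bullet> x))) * f x)" for x
      by (simp add: fourier_integral_eq mult_ac)
    ultimately show "(LINT \<xi>|lborel. fourier_integral f \<xi> * \<phi> \<xi>) = (LINT x|lborel. f x * fourier_integral \<phi> x)"
      by (simp only: integral_mult_right_zero)
  qed
qed

lemma test_fun_sobolev: "test_fun f \<Longrightarrow> f \<in> sobolev_space s"
  using test_fun_is_fourier_transform unfolding sobolev_space_def by blast

lemma sobolev_norm_cmult_test:
  assumes "test_fun f" shows "sobolev_norm s (\<lambda>x. of_real c * f x) = \<bar>c\<bar> * sobolev_norm s f"
proof -
  have eq: "fourier_integral (\<lambda>x. of_real c * f x) \<xi> = of_real c * fourier_integral f \<xi>" for \<xi>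
    unfolding fourier_integral_def by (simp add: mult.left_commute)
  show ?thesis
    unfolding sobolev_norm_eq[OF test_fun_is_fourier_transform(1)[OF assms]]
      sobolev_norm_eq[OF test_fun_is_fourier_transform(1)[OF test_fun_cmult[OF assms]]]
    by (simp add: eq norm_mult power_mult_distrib mult.left_commute real_sqrt_mult)
qed

subsection \<open>Negative Sobolev norms of wave packets\<close>

definition lap :: "('a::euclidean_space \<Rightarrow> complex) \<Rightarrow> 'a \<Rightarrow> complex" where
  "lap f = (\<lambda>x. \<Sum>b\<in>Basis. directional_deriv b (directional_deriv b f) x)"

lemma test_fun_lap: "test_fun f \<Longrightarrow> test_fun (lap f)"
  unfolding lap_def by (intro test_fun_sum test_fun_dd)

lemma inv_fourier_sum:
  assumes "\<And>i. i \<in> I \<Longrightarrow> integrable lborel (f i)"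
  shows "inv_fourier (\<lambda>x. \<Sum>i\<in>I. f i x) \<xi> = (\<Sum>i\<in>I. inv_fourier (f i) \<xi>)"
proof -
  have "integrable lborel (\<lambda>x. cis (x \<bullet> \<xi>) * f i x)" if "i \<in> I" for i
    by (rule integrable_cis_mult[OF assms[OF that]]) measurable
  then show ?thesis by (simp add: inv_fourier_def sum_distrib_left)
qed

lemma inv_fourier_lap:
  assumes "test_fun f"
  shows "inv_fourier (lap f) \<xi> = - of_real ((norm \<xi>)\<^sup>2) * inv_fourier f \<xi>"
proof -
  have "inv_fourier (lap f) \<xi> = (\<Sum>b\<in>Basis. inv_fourier (directional_deriv b (directional_deriv b f)) \<xi>)"
    unfolding lap_def by (intro inv_fourier_sum test_fun_integrable test_fun_dd assms)
  also have "\<dots> = (\<Sum>b\<in>Basis. - of_real ((\<xi> \<bullet> b)\<^sup>2) * inv_fourier f \<xi>)"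
    by (simp add: inv_fourier_directional_deriv test_fun_dd assms inner_commute power2_eq_square mult_ac)
  also have "\<dots> = - of_real ((norm \<xi>)\<^sup>2) * inv_fourier f \<xi>"
    by (simp add: norm_squared_Basis sum_distrib_right sum_negf)
  finally show ?thesis .
qed

text \<open>The Laplacian multiplies the transform by |\<xi>|^2 up to sign, and |\<xi>|^4 \<le> (1 +
  |\<xi>|^2)^2: two derivatives cost two Sobolev orders. Passing from \<open>s\<close> to a smaller
  \<open>s'\<close> is built in so that the packets can be estimated at order p + 5/2 whatever the
  regularity \<open>s\<close> of the solution.\<close>

lemma lap_weight_le:
  fixes \<psi> :: "'a::euclidean_space \<Rightarrow> complex"
  assumes "test_fun \<psi>" "s' \<le> s"
  shows "(\<integral>\<^sup>+\<xi>. ennreal ((1 + (norm \<xi>)\<^sup>2) powr (- s) * (norm (inv_fourier (lap \<psi>) \<xi>))\<^sup>2) \<partial>lborel)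
    \<le> (\<integral>\<^sup>+\<xi>. ennreal ((1 + (norm \<xi>)\<^sup>2) powr (- (s' - 2)) * (norm (inv_fourier \<psi> \<xi>))\<^sup>2) \<partial>lborel)"
proof (rule nn_integral_mono, rule ennreal_leI)
  fix \<xi> :: 'a
  let ?w = "1 + (norm \<xi>)\<^sup>2"
  have w: "1 \<le> ?w" "0 < ?w" by (auto intro: add_pos_nonneg)
  have "?w powr (- s) * ((norm \<xi>)\<^sup>2)\<^sup>2 \<le> ?w powr (- s') * ?w\<^sup>2"
    using w assms(2) by (intro mult_mono powr_mono power_mono) auto
  also have "\<dots> = ?w powr (- (s' - 2))"
    using w by (simp add: powr_add[symmetric] powr_realpow[symmetric, of _ 2] del: powr_numeral powr_realpow)
  finally have *: "?w powr (- s) * ((norm \<xi>)\<^sup>2)\<^sup>2 * (norm (inv_fourier \<psi> \<xi>))\<^sup>2 \<le> ?w powr (- (s' - 2)) * (norm (inv_fourier \<psi> \<xi>))\<^sup>2"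
    by (rule mult_right_mono) simp
  then show "?w powr (- s) * (norm (inv_fourier (lap \<psi>) \<xi>))\<^sup>2 \<le> ?w powr (- (s' - 2)) * (norm (inv_fourier \<psi> \<xi>))\<^sup>2"
  proof -
    have "norm (inv_fourier (lap \<psi>) \<xi>) = (norm \<xi>)\<^sup>2 * norm (inv_fourier \<psi> \<xi>)"
      unfolding inv_fourier_lap[OF assms(1)] norm_mult norm_minus_cancel norm_of_real by simp
    then show ?thesis using * by (simp only: power_mult_distrib mult.assoc)
  qed
qed

lemma weight_mono:
  fixes \<psi> :: "'a::euclidean_space \<Rightarrow> complex"
  assumes "s' \<le> s"
  shows "(\<integral>\<^sup>+\<xi>. ennreal ((1 + (norm \<xi>)\<^sup>2) powr (- s) * (norm (\<psi> \<xi>))\<^sup>2) \<partial>lborel)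
    \<le> (\<integral>\<^sup>+\<xi>. ennreal ((1 + (norm \<xi>)\<^sup>2) powr (- s') * (norm (\<psi> \<xi>))\<^sup>2) \<partial>lborel)"
  using assms by (intro nn_integral_mono ennreal_leI mult_right_mono powr_mono) auto

lemma test_fun_square_integrable:
  assumes "test_fun f" shows "integrable lborel (\<lambda>x. (norm (f x))\<^sup>2)"
  using test_fun_is_fourier_transform(1)[OF assms] by (simp add: is_fourier_transform_def square_integrable_def)

lemma test_fun_weight_finite:
  fixes \<psi> :: "'a::euclidean_space \<Rightarrow> complex"
  assumes "test_fun \<psi>" "s \<ge> 0"
  shows "(\<integral>\<^sup>+\<xi>. ennreal ((1 + (norm \<xi>)\<^sup>2) powr (- s) * (norm (inv_fourier \<psi> \<xi>))\<^sup>2) \<partial>lborel)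
    \<le> ennreal (LINT x|lborel. (norm (\<psi> x))\<^sup>2)"
proof -
  have "(\<integral>\<^sup>+\<xi>. ennreal ((1 + (norm \<xi>)\<^sup>2) powr (- s) * (norm (inv_fourier \<psi> \<xi>))\<^sup>2) \<partial>lborel)
    \<le> (\<integral>\<^sup>+\<xi>. ennreal ((norm (inv_fourier \<psi> \<xi>))\<^sup>2) \<partial>lborel)"
  proof (intro nn_integral_mono ennreal_leI)
    fix \<xi> :: 'a
    have "(1 + (norm \<xi>)\<^sup>2) powr (- s) \<le> 1 powr (- s)" using assms by (intro powr_mono2') auto
    then show "(1 + (norm \<xi>)\<^sup>2) powr (- s) * (norm (inv_fourier \<psi> \<xi>))\<^sup>2 \<le> (norm (inv_fourier \<psi> \<xi>))\<^sup>2"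
      by (simp add: mult_left_le_one_le)
  qed
  also have "\<dots> \<le> ennreal (LINT x|lborel. (norm (\<psi> x))\<^sup>2)"
    by (intro plancherel_le test_fun_integrable test_fun_square_integrable assms)
  finally show ?thesis .
qed

lemma test_fun_funpow: "test_fun f \<Longrightarrow> test_fun ((directional_deriv b ^^ m) f)"
  by (induction m) (auto intro: test_fun_dd)

lemma inv_fourier_funpow:
  assumes "test_fun f"
  shows "inv_fourier ((directional_deriv b ^^ m) f) \<xi> = (- \<i> * of_real (b \<bullet> \<xi>)) ^ m * inv_fourier f \<xi>"
  by (induction m) (auto simp: inv_fourier_directional_deriv test_fun_funpow assms mult_ac)

text \<open>The point is that \<open>\<sigma>\<close> need not be an integer: on the side \<open>r|\<xi> \<bullet> b| \<ge> 1\<close> use \<open>\<psi>\<close>, on the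
  other side \<open>X\<close>.\<close>

lemma packet_negative_sobolev:
  fixes X :: "'a::euclidean_space \<Rightarrow> complex"
  assumes X: "test_fun X" and b: "b \<in> Basis" and r: "r > 0" and \<sigma>: "0 \<le> \<sigma>" "\<sigma> \<le> real m"
    and \<psi>: "\<psi> = (\<lambda>x. of_real (r ^ m) * (directional_deriv b ^^ m) X x)"
  shows "(\<integral>\<^sup>+\<xi>. ennreal ((1 + (norm \<xi>)\<^sup>2) powr (- \<sigma>) * (norm (inv_fourier \<psi> \<xi>))\<^sup>2) \<partial>lborel)
    \<le> ennreal (r powr (2 * \<sigma>) * ((LINT x|lborel. (norm (X x))\<^sup>2) + (LINT x|lborel. (norm (\<psi> x))\<^sup>2)))"
proof -
  have \<psi>t: "test_fun \<psi>" unfolding \<psi> by (intro test_fun_cmult test_fun_funpow X)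
  have [measurable]: "X \<in> borel_measurable borel" "\<psi> \<in> borel_measurable borel"
    by (intro test_fun_measurable X \<psi>t)+
  have [measurable]: "inv_fourier X \<in> borel_measurable borel" "inv_fourier \<psi> \<in> borel_measurable borel"
    by (rule fourier_integral_measurable; measurable)+
  have F: "norm (inv_fourier \<psi> \<xi>) = (r * \<bar>\<xi> \<bullet> b\<bar>) ^ m * norm (inv_fourier X \<xi>)" for \<xi>
  proof -
    have "inv_fourier \<psi> \<xi> = of_real (r ^ m) * inv_fourier ((directional_deriv b ^^ m) X) \<xi>"
    proof -
      have "(LINT x|lborel. cis (x \<bullet> \<xi>) * (of_real (r ^ m) * (directional_deriv b ^^ m) X x))
        = (LINT x|lborel. of_real (r ^ m) * (cis (x \<bullet> \<xi>) * (directional_deriv b ^^ m) X x))"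
        by (simp only: mult.left_commute)
      also have "\<dots> = of_real (r ^ m) * (LINT x|lborel. cis (x \<bullet> \<xi>) * (directional_deriv b ^^ m) X x)"
        by (rule integral_mult_right_zero)
      finally show ?thesis unfolding \<psi> inv_fourier_def by simp
    qed
    then show ?thesis using r
      by (simp add: inv_fourier_funpow[OF X] norm_mult norm_power power_mult_distrib inner_commute)
  qed
  have P: "(1 + (norm \<xi>)\<^sup>2) powr (- \<sigma>) * (norm (inv_fourier \<psi> \<xi>))\<^sup>2
    \<le> r powr (2 * \<sigma>) * ((norm (inv_fourier X \<xi>))\<^sup>2 + (norm (inv_fourier \<psi> \<xi>))\<^sup>2)" for \<xi> :: 'a
  proof -
    define a where "a = r * \<bar>\<xi> \<bullet> b\<bar>"
    have a0: "a \<ge> 0" using r by (simp add: a_def)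
    \<comment> \<open>In the variable a = r |\<xi> \<bullet> b| the claim becomes one-dimensional;
      for a > 0 the weight enters only through |\<xi>| \<ge> a/r.\<close>
    have le: "(1 + (norm \<xi>)\<^sup>2) powr (- \<sigma>) * (a ^ m)\<^sup>2 \<le> r powr (2 * \<sigma>) * (1 + (a ^ m)\<^sup>2)"
    proof (cases "a = 0")
      case True
      show ?thesis
      proof (cases "m = 0")
        case True
        then have "\<sigma> = 0" using \<sigma> by simp
        moreover have "1 + (norm \<xi>)\<^sup>2 > 0" by (intro add_pos_nonneg) auto
        ultimately show ?thesis using True r by simp
      next
        case False
        then show ?thesis using \<open>a = 0\<close> by (simp add: zero_power)
      qed
    next
      case False
      then have a: "a > 0" using a0 by simp
      have "(a / r)\<^sup>2 \<le> (norm \<xi>)\<^sup>2"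
        using Basis_le_norm[OF b, of \<xi>] r by (intro power_mono) (auto simp: a_def)
      then have "(a / r)\<^sup>2 \<le> 1 + (norm \<xi>)\<^sup>2" by simp
      then have "(1 + (norm \<xi>)\<^sup>2) powr (- \<sigma>) \<le> ((a / r)\<^sup>2) powr (- \<sigma>)"
        using a r \<sigma> by (intro powr_mono2') auto
      also have "((a / r)\<^sup>2) powr (- \<sigma>) = r powr (2 * \<sigma>) * a powr (- 2 * \<sigma>)"
      proof -
        have "((a / r)\<^sup>2) powr (- \<sigma>) = ((a / r) powr 2) powr (- \<sigma>)"
          using a r by simp
        also have "\<dots> = (a / r) powr (- 2 * \<sigma>)" by (simp add: powr_powr)
        also have "\<dots> = r powr (2 * \<sigma>) * a powr (- 2 * \<sigma>)"
        proof -
          have "(a / r) powr (- 2 * \<sigma>) = a powr (- 2 * \<sigma>) / r powr (- 2 * \<sigma>)"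
            by (rule powr_divide)
          moreover have "r powr (- 2 * \<sigma>) = 1 / r powr (2 * \<sigma>)"
            using powr_minus_divide[of r "2 * \<sigma>"] by simp
          ultimately show ?thesis by (simp add: mult.commute)
        qed
        finally show ?thesis .
      qed
      finally have "(1 + (norm \<xi>)\<^sup>2) powr (- \<sigma>) * (a ^ m)\<^sup>2 \<le> (r powr (2 * \<sigma>) * a powr (- 2 * \<sigma>)) * (a ^ m)\<^sup>2"
        by (rule mult_right_mono) simp
      also have "\<dots> = r powr (2 * \<sigma>) * a powr (2 * real m - 2 * \<sigma>)"
      proof -
        have "(a ^ m)\<^sup>2 = a powr (2 * real m)"
          using a by (simp add: powr_realpow[symmetric] power2_eq_square powr_add[symmetric])
        then show ?thesis by (simp add: powr_add[symmetric] powr_diff powr_minus mult.assoc divide_inverse)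
      qed
      also have "\<dots> \<le> r powr (2 * \<sigma>) * (1 + (a ^ m)\<^sup>2)"
      proof (rule mult_left_mono)
        \<comment> \<open>For a \<le> 1 the exponent has to be nonnegative, which is \<sigma> \<le>
          m; for a > 1 it must not exceed 2m, which is \<sigma> \<ge> 0. The summands 1 and a^(2m)
          become the contributions of \<open>X\<close> and \<open>\<psi>\<close>.\<close>
        show "a powr (2 * real m - 2 * \<sigma>) \<le> 1 + (a ^ m)\<^sup>2"
        proof (cases "a \<le> 1")
          case True
          then have "a powr (2 * real m - 2 * \<sigma>) \<le> 1" using a \<sigma> by (intro powr_le1) auto
          then show ?thesis by (rule order_trans) simp
        next
          case False
          then have "a powr (2 * real m - 2 * \<sigma>) \<le> a powr (2 * real m)" using \<sigma> by (intro powr_mono) auto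
          also have "\<dots> = (a ^ m)\<^sup>2"
            using a by (simp add: powr_realpow[symmetric] power2_eq_square powr_add[symmetric])
          finally show ?thesis by simp
        qed
      qed simp
      finally show ?thesis .
    qed
    have "(1 + (norm \<xi>)\<^sup>2) powr (- \<sigma>) * (norm (inv_fourier \<psi> \<xi>))\<^sup>2
      = ((1 + (norm \<xi>)\<^sup>2) powr (- \<sigma>) * (a ^ m)\<^sup>2) * (norm (inv_fourier X \<xi>))\<^sup>2"
      unfolding F a_def by (simp add: power_mult_distrib mult.assoc)
    also have "\<dots> \<le> (r powr (2 * \<sigma>) * (1 + (a ^ m)\<^sup>2)) * (norm (inv_fourier X \<xi>))\<^sup>2"
      by (rule mult_right_mono[OF le]) simp
    also have "\<dots> = r powr (2 * \<sigma>) * ((norm (inv_fourier X \<xi>))\<^sup>2 + (norm (inv_fourier \<psi> \<xi>))\<^sup>2)"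
      unfolding F a_def[symmetric] by (simp add: power_mult_distrib algebra_simps)
    finally show ?thesis .
  qed
  have m1: "(\<lambda>\<xi>. ennreal ((norm (inv_fourier X \<xi>))\<^sup>2)) \<in> borel_measurable lborel"
    and m2: "(\<lambda>\<xi>. ennreal ((norm (inv_fourier \<psi> \<xi>))\<^sup>2)) \<in> borel_measurable lborel" by measurable
  have "(\<integral>\<^sup>+\<xi>. ennreal ((1 + (norm \<xi>)\<^sup>2) powr (- \<sigma>) * (norm (inv_fourier \<psi> \<xi>))\<^sup>2) \<partial>lborel)
    \<le> (\<integral>\<^sup>+\<xi>. ennreal (r powr (2 * \<sigma>)) * (ennreal ((norm (inv_fourier X \<xi>))\<^sup>2) + ennreal ((norm (inv_fourier \<psi> \<xi>))\<^sup>2)) \<partial>lborel)"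
  proof (rule nn_integral_mono)
    fix \<xi> :: 'a
    show "ennreal ((1 + (norm \<xi>)\<^sup>2) powr (- \<sigma>) * (norm (inv_fourier \<psi> \<xi>))\<^sup>2)
      \<le> ennreal (r powr (2 * \<sigma>)) * (ennreal ((norm (inv_fourier X \<xi>))\<^sup>2) + ennreal ((norm (inv_fourier \<psi> \<xi>))\<^sup>2))"
      using ennreal_leI[OF P[of \<xi>]]
      by (simp add: ennreal_plus[symmetric] ennreal_mult[symmetric] del: ennreal_plus)
  qed
  also have "\<dots> = ennreal (r powr (2 * \<sigma>)) * ((\<integral>\<^sup>+\<xi>. ennreal ((norm (inv_fourier X \<xi>))\<^sup>2) \<partial>lborel) + (\<integral>\<^sup>+\<xi>. ennreal ((norm (inv_fourier \<psi> \<xi>))\<^sup>2) \<partial>lborel))"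
    using m1 m2 by (simp add: nn_integral_cmult nn_integral_add)
  also have "\<dots> \<le> ennreal (r powr (2 * \<sigma>)) * (ennreal (LINT x|lborel. (norm (X x))\<^sup>2) + ennreal (LINT x|lborel. (norm (\<psi> x))\<^sup>2))"
    by (intro mult_left_mono add_mono plancherel_le test_fun_integrable test_fun_square_integrable X \<psi>t) auto
  also have "\<dots> = ennreal (r powr (2 * \<sigma>) * ((LINT x|lborel. (norm (X x))\<^sup>2) + (LINT x|lborel. (norm (\<psi> x))\<^sup>2)))"
    by (simp add: ennreal_plus[symmetric] ennreal_mult[symmetric] integral_nonneg_AE del: ennreal_plus)
  finally show ?thesis .
qed

subsection \<open>The equation tested against tensor products\<close>

text \<open>These are the embedding conditions that place the Laplacian of u, then u, and then |u|^p
  in L^P: H^(s-2) and H^s into L^P, and H^s into L^(pP). For p \<le> 2 the first has right side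
  zero, and the second always follows from the first. In the remaining cases the dimension decides:
  if d (p - 1) exceeds 2 p^2 (or 4 p when p \<le> 2) the critical exponent suffices, otherwise p +
  5/2 does.\<close>

lemma exponent_conditions:
  fixes p s :: real
  assumes p: "p > 1" and d: "d \<ge> 1"
    and s: "s \<ge> critical_exponent d p" "s \<ge> p + 5 / 2"
  defines "P \<equiv> max p 2"
  shows "s - 2 > real d * (1 / 2 - 1 / P)" and "s > real d * (1 / 2 - 1 / P)" and "s > real d * (1 / 2 - 1 / (p * P))"
proof -
  let ?D = "real d"
  have D: "?D \<ge> 1" using d by simp
  have s1: "s \<ge> ?D / 2 - 2 / (p - 1)" using s(1) by (simp add: critical_exponent_def)
  show A: "s - 2 > ?D * (1 / 2 - 1 / P)"
  proof (cases "p \<le> 2")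
    case True
    then show ?thesis using s(2) p by (simp add: P_def)
  next
    case False
    then have P: "P = p" by (simp add: P_def)
    show ?thesis
    proof (cases "?D * (p - 1) > 2 * p\<^sup>2")
      case True
      then have "?D > 2 * p\<^sup>2 / (p - 1)" using p by (simp add: pos_divide_less_eq)
      then have "?D / p > 2 * p / (p - 1)"
        using p by (simp add: field_simps power2_eq_square)
      moreover have "2 * p / (p - 1) = 2 + 2 / (p - 1)" using p by (simp add: field_simps)
      ultimately show ?thesis using s1 P by (simp add: right_diff_distrib)
    next
      case F: False
      have "?D * (p - 2) * (p - 1) \<le> (2 * p\<^sup>2) * (p - 2)"
        using F \<open>\<not> p \<le> 2\<close> mult_right_mono[of "?D * (p - 1)" "2 * p\<^sup>2" "p - 2"] by (simp add: mult_ac)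
      also have "\<dots> < (p + 1 / 2) * (2 * p * (p - 1))"
        using p by (simp add: algebra_simps power2_eq_square)
      finally have "(?D * (p - 2) / (2 * p)) < p + 1 / 2"
        using p by (simp add: pos_divide_less_eq mult.assoc[symmetric])
      moreover have "?D * (1 / 2 - 1 / p) = ?D * (p - 2) / (2 * p)" using p by (simp add: field_simps)
      ultimately show ?thesis using s(2) P by simp
    qed
  qed
  then show "s > ?D * (1 / 2 - 1 / P)" by simp
  show "s > ?D * (1 / 2 - 1 / (p * P))"
  proof (cases "p \<le> 2")
    case True
    then have P: "P = 2" by (simp add: P_def)
    show ?thesis
    proof (cases "?D * (p - 1) > 4 * p")
      case True
      then have "?D / (2 * p) > 2 / (p - 1)" using p by (simp add: field_simps)
      then show ?thesis using s1 P by (simp add: right_diff_distrib mult.commute)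
    next
      case False
      then have "?D * (p - 1) / (2 * p) \<le> 2" using p by (simp add: pos_divide_le_eq)
      moreover have "?D * (1 / 2 - 1 / (p * 2)) = ?D * (p - 1) / (2 * p)" using p by (simp add: field_simps)
      ultimately show ?thesis using s(2) P p by simp
    qed
  next
    case False
    then have P: "P = p" by (simp add: P_def)
    show ?thesis
    proof (cases "?D * (p - 1) > 2 * p\<^sup>2")
      case True
      then have "?D / p\<^sup>2 > 2 / (p - 1)" using p by (simp add: field_simps)
      then show ?thesis using s1 P by (simp add: right_diff_distrib power2_eq_square)
    next
      case F: False
      have pp: "p\<^sup>2 - 2 > 0" using False mult_strict_mono[of 2 p 2 p] by (simp add: power2_eq_square)
      have "?D * (p\<^sup>2 - 2) * (p - 1) \<le> (2 * p\<^sup>2) * (p\<^sup>2 - 2)"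
        using F pp mult_right_mono[of "?D * (p - 1)" "2 * p\<^sup>2" "p\<^sup>2 - 2"] by (simp add: mult_ac)
      also have "\<dots> \<le> (2 * p\<^sup>2) * ((p + 1) * (p - 1))"
        using p by (intro mult_left_mono) (auto simp: algebra_simps power2_eq_square)
      finally have "?D * (p\<^sup>2 - 2) * (p - 1) \<le> (2 * p\<^sup>2 * (p + 1)) * (p - 1)" by (simp add: mult_ac)
      then have "?D * (p\<^sup>2 - 2) \<le> 2 * p\<^sup>2 * (p + 1)" using p by simp
      then have "?D * (p\<^sup>2 - 2) / (2 * p\<^sup>2) \<le> p + 1" using p by (simp add: pos_divide_le_eq mult.commute)
      moreover have "?D * (1 / 2 - 1 / (p * p)) = ?D * (p\<^sup>2 - 2) / (2 * p\<^sup>2)" using p by (simp add: field_simps power2_eq_square)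
      ultimately show ?thesis using s(2) P by simp
    qed
  qed
qed

section \<open>Pointwise bounds for the power nonlinearity\<close>

definition nl_const :: "real \<Rightarrow> real" where
  "nl_const p = 3 powr p + 2 powr p + (3 / 2) powr (p - 1) * (1 + 2 * (p - 1))"

lemma nls_nonlinearity_norm: "norm (nls_nonlinearity p z) = norm z powr p" if "p > 1"
  by (cases "z = 0") (auto simp: nls_nonlinearity_def norm_mult powr_mult_base mult.commute)

text \<open>If |v| \<le> 2|w|, both values are of size |w|^p, which accounts for 3^p + 2^p.
  Otherwise the moduli of v and v + w stay in [c/2, 3c/2] with c = |v|, away from the origin, and
  the mean value theorem for t^(p-1) applies even if p < 2, when this power is not Lipschitz at 0.
  The last summand of \<open>nl_const\<close> belongs to this case.\<close>

lemma nls_nonlinearity_diff: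
  assumes p: "p > 1"
  shows "norm (nls_nonlinearity p (v + w) - nls_nonlinearity p v)
    \<le> nl_const p * (norm v powr (p - 1) * norm w + norm w powr p)"
proof (cases "norm v \<le> 2 * norm w")
  case True
  have "norm (nls_nonlinearity p (v + w) - nls_nonlinearity p v) \<le> norm (v + w) powr p + norm v powr p"
    using norm_triangle_ineq4[of "nls_nonlinearity p (v + w)" "nls_nonlinearity p v"] nls_nonlinearity_norm[OF p] by simp
  also have "norm (v + w) powr p \<le> (3 * norm w) powr p"
    using True norm_triangle_ineq[of v w] p by (intro powr_mono2) auto
  also have "norm v powr p \<le> (2 * norm w) powr p" using True p by (intro powr_mono2) auto
  also have "(3 * norm w) powr p + (2 * norm w) powr p = (3 powr p + 2 powr p) * norm w powr p"
    by (simp add: powr_mult distrib_right)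
  also have "\<dots> \<le> nl_const p * (norm v powr (p - 1) * norm w + norm w powr p)"
    using p by (intro mult_mono) (auto simp: nl_const_def)
  finally show ?thesis by simp
next
  case False
  define a where "a = norm (v + w)"
  define c where "c = norm v"
  have c: "c > 0" "norm w < c / 2" using False norm_ge_zero[of w] by (auto simp: c_def simp del: norm_ge_zero)
  have ac: "\<bar>a - c\<bar> \<le> norm w" unfolding a_def c_def
    using norm_triangle_ineq3[of "v + w" v] by simp
  have a: "c / 2 \<le> a" "a \<le> 3 / 2 * c" using ac c by (auto simp: abs_le_iff)
  have mvt: "\<bar>a powr (p - 1) - c powr (p - 1)\<bar> \<le> ((p - 1) * ((3 / 2 * c) powr (p - 1) * (2 / c))) * \<bar>a - c\<bar>"
  proof -
    have "norm (a powr (p - 1) - c powr (p - 1)) \<le> ((p - 1) * ((3 / 2 * c) powr (p - 1) * (2 / c))) * norm (a - c)"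
    proof (rule field_differentiable_bound[where S="{c / 2..3 / 2 * c}" and f'="\<lambda>t. (p - 1) * t powr (p - 1 - 1)"])
      fix t assume t: "t \<in> {c / 2..3 / 2 * c}"
      then have t0: "t > 0" using c by auto
      show "((\<lambda>t. t powr (p - 1)) has_field_derivative (p - 1) * t powr (p - 1 - 1)) (at t within {c / 2..3 / 2 * c})"
        using t0 by (intro has_field_derivative_at_within[OF has_real_derivative_powr])
      have "t powr (p - 1 - 1) = t powr (p - 1) * (1 / t)" using powr_diff[of t "p - 1" 1] t0 by simp
      also have "\<dots> \<le> (3 / 2 * c) powr (p - 1) * (2 / c)"
        using t t0 c p by (intro mult_mono powr_mono2) (auto simp: field_simps)
      finally have "(p - 1) * t powr (p - 1 - 1) \<le> (p - 1) * ((3 / 2 * c) powr (p - 1) * (2 / c))"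
        using p by (intro mult_left_mono) auto
      moreover have "0 \<le> (p - 1) * t powr (p - 1 - 1)" using p by simp
      ultimately show "norm ((p - 1) * t powr (p - 1 - 1)) \<le> (p - 1) * ((3 / 2 * c) powr (p - 1) * (2 / c))"
        by (simp only: real_norm_def abs_of_nonneg)
    qed (use a c in auto)
    then show ?thesis by simp
  qed
  have "nls_nonlinearity p (v + w) - nls_nonlinearity p v
    = complex_of_real (a powr (p - 1)) * w + complex_of_real (a powr (p - 1) - c powr (p - 1)) * v"
    by (simp add: nls_nonlinearity_def a_def c_def algebra_simps)
  then have "norm (nls_nonlinearity p (v + w) - nls_nonlinearity p v)
    \<le> a powr (p - 1) * norm w + \<bar>a powr (p - 1) - c powr (p - 1)\<bar> * c"
    using norm_triangle_ineq[of "complex_of_real (a powr (p - 1)) * w" "complex_of_real (a powr (p - 1) - c powr (p - 1)) * v"]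
    unfolding norm_mult norm_of_real c_def by simp
  also have "\<dots> \<le> (3 / 2 * c) powr (p - 1) * norm w + (((p - 1) * ((3 / 2 * c) powr (p - 1) * (2 / c))) * norm w) * c"
    using a c p by (intro add_mono mult_right_mono powr_mono2 order_trans[OF mvt] mult_left_mono ac) auto
  also have "(((p - 1) * ((3 / 2 * c) powr (p - 1) * (2 / c))) * norm w) * c = (3 / 2 * c) powr (p - 1) * (2 * (p - 1)) * norm w" using c by simp
  also have "(3 / 2 * c) powr (p - 1) * norm w + (3 / 2 * c) powr (p - 1) * (2 * (p - 1)) * norm w
    = ((3 / 2) powr (p - 1) * (1 + 2 * (p - 1))) * (c powr (p - 1) * norm w)"
  proof -
    have "(3 / 2 * c) powr (p - 1) = (3 / 2) powr (p - 1) * c powr (p - 1)" by (rule powr_mult)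
    then show ?thesis by (simp add: algebra_simps)
  qed
  also have "\<dots> \<le> nl_const p * (norm v powr (p - 1) * norm w + norm w powr p)"
    using p by (intro mult_mono) (auto simp: nl_const_def c_def)
  finally show ?thesis by (simp add: mult_right_mono)
qed

text \<open>The weak form of i a' - b = \<kappa> n on (0, T). Pairing the equation with one spatial
  test function leaves this scalar statement, where \<open>a\<close> and \<open>b\<close> come from
  the solution paired with the test function and with its Laplacian, and \<open>n\<close> from the
  nonlinearity. The interval [l, h] makes the compact support inside (0, T) explicit.\<close>

definition weak_ode :: "real \<Rightarrow> real \<Rightarrow> (real \<Rightarrow> complex) \<Rightarrow> (real \<Rightarrow> complex) \<Rightarrow> (real \<Rightarrow> complex) \<Rightarrow> bool" where
  "weak_ode \<kappa> T a b n \<longleftrightarrow> (\<forall>\<theta> l h. test_fun \<theta> \<longrightarrow> 0 < l \<longrightarrow> h < T \<longrightarrow> (\<forall>t. t \<notin> {l..h} \<longrightarrow> \<theta> t = 0) \<longrightarrow>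
     (LINT t|lborel. - \<i> * directional_deriv 1 \<theta> t * a t - \<theta> t * b t) = (LINT t|lborel. of_real \<kappa> * (\<theta> t * n t)))"

lemma directional_deriv_diff:
  assumes "f differentiable (at x)" "g differentiable (at x)"
  shows "directional_deriv v (\<lambda>x. f x - g x) x = directional_deriv v f x - directional_deriv v g x"
  by (rule directional_deriv_eq) (intro has_derivative_diff has_derivative_dd assms)

lemma directional_deriv_zero_direction: "f differentiable (at x) \<Longrightarrow> directional_deriv 0 f x = 0"
  using linear_0[OF has_derivative_linear[OF has_derivative_dd]] .

lemma directional_deriv_tensor:
  fixes \<theta> :: "real \<Rightarrow> complex" and \<psi> :: "'a::euclidean_space \<Rightarrow> complex"
  assumes "smooth_fun \<theta>" "smooth_fun \<psi>"
  shows "directional_deriv (1, 0) (\<lambda>z. \<theta> (fst z) * \<psi> (snd z)) = (\<lambda>z. directional_deriv 1 \<theta> (fst z) * \<psi> (snd z))"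
    and "directional_deriv (0, b) (\<lambda>z. \<theta> (fst z) * \<psi> (snd z)) = (\<lambda>z. \<theta> (fst z) * directional_deriv b \<psi> (snd z))"
proof -
  have d1: "directional_deriv v (\<lambda>z. \<theta> (fst z)) z = directional_deriv (fst v) \<theta> (fst z)" for v z :: "real \<times> 'a"
    using directional_deriv_compose_linear[OF bounded_linear_fst, where c=0 and f=\<theta> and v=v and x=z] smooth_fun_differentiable[OF assms(1)] by simp
  have d2: "directional_deriv v (\<lambda>z. \<psi> (snd z)) z = directional_deriv (snd v) \<psi> (snd z)" for v z :: "real \<times> 'a"
    using directional_deriv_compose_linear[OF bounded_linear_snd, where c=0 and f=\<psi> and v=v and x=z] smooth_fun_differentiable[OF assms(2)] by simp
  have D: "(\<lambda>z::real \<times> 'a. \<theta> (fst z)) differentiable (at z)" "(\<lambda>z::real \<times> 'a. \<psi> (snd z)) differentiable (at z)" for z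
    by (rule smooth_fun_differentiable[OF smooth_fun_linear_arg[OF bounded_linear_fst assms(1)]]
        smooth_fun_differentiable[OF smooth_fun_linear_arg[OF bounded_linear_snd assms(2)]])+
  show "directional_deriv (1, 0) (\<lambda>z. \<theta> (fst z) * \<psi> (snd z)) = (\<lambda>z. directional_deriv 1 \<theta> (fst z) * \<psi> (snd z))"
    by (rule ext) (simp add: directional_deriv_mult[OF D] d1 d2 directional_deriv_zero_direction smooth_fun_differentiable assms)
  show "directional_deriv (0, b) (\<lambda>z. \<theta> (fst z) * \<psi> (snd z)) = (\<lambda>z. \<theta> (fst z) * directional_deriv b \<psi> (snd z))"
    by (rule ext) (simp add: directional_deriv_mult[OF D] d1 d2 directional_deriv_zero_direction smooth_fun_differentiable assms)
qed

lemma test_function_tensor: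
  fixes \<theta> :: "real \<Rightarrow> complex" and \<psi> :: "'a::euclidean_space \<Rightarrow> complex"
  assumes \<theta>: "test_fun \<theta>" and supp: "0 < l" "h < T" "\<And>t. t \<notin> {l..h} \<Longrightarrow> \<theta> t = 0" and \<psi>: "test_fun \<psi>"
  shows "test_function_on ({0<..<T} \<times> UNIV) (\<lambda>z. \<theta> (fst z) * \<psi> (snd z))"
proof -
  obtain R1 where R1: "\<And>x. R1 < norm x \<Longrightarrow> \<theta> x = 0" using test_fun_support[OF \<theta>] by blast
  obtain R2 where R2: "\<And>x. R2 < norm x \<Longrightarrow> \<psi> x = 0" using test_fun_support[OF \<psi>] by blast
  have "test_fun (\<lambda>z::real \<times> 'a. \<theta> (fst z) * \<psi> (snd z))"
  proof (rule test_funI[where R="\<bar>R1\<bar> + \<bar>R2\<bar>"])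
    show "smooth_fun (\<lambda>z::real \<times> 'a. \<theta> (fst z) * \<psi> (snd z))"
      by (rule smooth_fun_mult[OF smooth_fun_linear_arg[OF bounded_linear_fst test_fun_smooth[OF \<theta>]]
            smooth_fun_linear_arg[OF bounded_linear_snd test_fun_smooth[OF \<psi>]]])
    fix z :: "real \<times> 'a" assume "\<bar>R1\<bar> + \<bar>R2\<bar> < norm z"
    moreover have "norm z \<le> norm (fst z) + norm (snd z)" using norm_Pair_le[of "fst z" "snd z"] by simp
    ultimately have "R1 < norm (fst z) \<or> R2 < norm (snd z)" by linarith
    then show "\<theta> (fst z) * \<psi> (snd z) = 0" using R1 R2 by auto
  qed
  moreover have "closure {z::real \<times> 'a. \<theta> (fst z) * \<psi> (snd z) \<noteq> 0} \<subseteq> {l..h} \<times> UNIV"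
    by (rule closure_minimal) (use supp(3) in \<open>force\<close>, intro closed_Times closed_atLeastAtMost closed_UNIV)
  moreover have "{l..h} \<times> (UNIV :: 'a set) \<subseteq> {0<..<T} \<times> UNIV" using supp by auto
  ultimately show ?thesis unfolding test_function_on_def by blast
qed

text \<open>Products \<theta>(t) \<psi>(x) are the test functions used against the equation
  throughout. Square integrability of each u(t) permits splitting the linear space integral into its
  two pairings; in the nonlinear one only scalars are pulled out.\<close>

lemma nls_weak_ode:
  fixes u :: "real \<Rightarrow> 'a::euclidean_space \<Rightarrow> complex"
  assumes eq: "nls_distributional p \<kappa> T u" and sq: "\<And>t. t \<in> {0..T} \<Longrightarrow> square_integrable (u t)" and \<psi>: "test_fun \<psi>"
  shows "weak_ode \<kappa> T (\<lambda>t. LINT x|lborel. u t x * \<psi> x) (\<lambda>t. LINT x|lborel. u t x * lap \<psi> x)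
    (\<lambda>t. LINT x|lborel. nls_nonlinearity p (u t x) * \<psi> x)"
  unfolding weak_ode_def
proof (intro allI impI)
  fix \<theta> :: "real \<Rightarrow> complex" and l h
  assume \<theta>: "test_fun \<theta>" and lh: "0 < l" "h < T" and supp: "\<forall>t. t \<notin> {l..h} \<longrightarrow> \<theta> t = 0"
  let ?a = "\<lambda>t. LINT x|lborel. u t x * \<psi> x" and ?b = "\<lambda>t. LINT x|lborel. u t x * lap \<psi> x"
    and ?n = "\<lambda>t. LINT x|lborel. nls_nonlinearity p (u t x) * \<psi> x"
  let ?\<phi> = "\<lambda>z. \<theta> (fst z) * \<psi> (snd z)"
  have s\<theta>: "smooth_fun \<theta>" and s\<psi>: "smooth_fun \<psi>" using \<theta> \<psi> by (auto intro: test_fun_smooth)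
  have td: "time_deriv ?\<phi> (t, x) = directional_deriv 1 \<theta> t * \<psi> x" for t x
    unfolding time_deriv_def directional_deriv_tensor[OF s\<theta> s\<psi>] by simp
  have sl: "space_laplacian ?\<phi> (t, x) = \<theta> t * lap \<psi> x" for t x
    unfolding space_laplacian_def directional_deriv_tensor(2)[OF s\<theta> s\<psi>]
      directional_deriv_tensor(2)[OF s\<theta> smooth_fun_dd[OF s\<psi>]] lap_def by (simp add: sum_distrib_left)
  have d0: "directional_deriv 1 \<theta> t = 0" if "t \<notin> {l..h}" for t
    by (rule directional_deriv_zero_outside[where S="{l..h}"]) (use s\<theta> supp that in auto)
  have L: "indicator {0<..<T} t *\<^sub>R (LINT x|lborel. u t x * (- \<i> * time_deriv ?\<phi> (t, x) - space_laplacian ?\<phi> (t, x)))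
    = - \<i> * directional_deriv 1 \<theta> t * ?a t - \<theta> t * ?b t" for t
  proof (cases "t \<in> {l..h}")
    case True
    then have t: "t \<in> {0<..<T}" "t \<in> {0..T}" using lh by auto
    have i: "integrable lborel (\<lambda>x. u t x * \<psi> x)" "integrable lborel (\<lambda>x. u t x * lap \<psi> x)"
      by (intro square_integrable_mult_test sq t \<psi> test_fun_lap)+
    have "(LINT x|lborel. u t x * (- \<i> * time_deriv ?\<phi> (t, x) - space_laplacian ?\<phi> (t, x)))
      = (LINT x|lborel. (- \<i> * directional_deriv 1 \<theta> t) * (u t x * \<psi> x) - \<theta> t * (u t x * lap \<psi> x))"
      by (simp only: td sl) (simp add: algebra_simps)
    also have "\<dots> = - \<i> * directional_deriv 1 \<theta> t * ?a t - \<theta> t * ?b t"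
      using i by (subst Bochner_Integration.integral_diff) auto
    finally show ?thesis using t by simp
  next
    case False
    then have "\<theta> t = 0" "directional_deriv 1 \<theta> t = 0" using d0 supp by auto
    then show ?thesis by (simp add: td sl)
  qed
  have R: "indicator {0<..<T} t *\<^sub>R (LINT x|lborel. complex_of_real \<kappa> * nls_nonlinearity p (u t x) * ?\<phi> (t, x))
    = of_real \<kappa> * (\<theta> t * ?n t)" for t
  proof (cases "t \<in> {l..h}")
    case True
    then have t: "t \<in> {0<..<T}" using lh by auto
    have "(LINT x|lborel. complex_of_real \<kappa> * nls_nonlinearity p (u t x) * ?\<phi> (t, x))
      = (LINT x|lborel. (of_real \<kappa> * \<theta> t) * (nls_nonlinearity p (u t x) * \<psi> x))"
      by (simp add: mult_ac)
    also have "\<dots> = of_real \<kappa> * (\<theta> t * ?n t)" by (simp add: mult.assoc)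
    finally show ?thesis using t by simp
  next
    case False
    then have "\<theta> t = 0" using supp by auto
    then show ?thesis by simp
  qed
  have "test_function_on ({0<..<T} \<times> UNIV) ?\<phi>"
    by (rule test_function_tensor[OF \<theta> lh _ \<psi>]) (use supp in auto)
  from eq[unfolded nls_distributional_def, rule_format, OF this]
  show "(LINT t|lborel. - \<i> * directional_deriv 1 \<theta> t * ?a t - \<theta> t * ?b t) = (LINT t|lborel. of_real \<kappa> * (\<theta> t * ?n t))"
    unfolding set_lebesgue_integral_def by (simp only: L R)
qed

section \<open>Test functions in time\<close>

lemma continuous_mult_integrable:
  fixes k a :: "real \<Rightarrow> complex"
  assumes "continuous_on {l..h} a" "continuous_on UNIV k" "\<And>t. t \<notin> {l..h} \<Longrightarrow> k t = 0"
  shows "integrable lborel (\<lambda>t. k t * a t)"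
proof -
  have "integrable lborel (\<lambda>t. indicator {l..h} t *\<^sub>R (k t * a t))"
    by (intro borel_integrable_compact compact_Icc continuous_on_mult assms continuous_on_subset[OF assms(2)]) auto
  also have "(\<lambda>t. indicator {l..h} t *\<^sub>R (k t * a t)) = (\<lambda>t. k t * a t)"
    using assms(3) by (auto simp: indicator_def)
  finally show ?thesis .
qed

definition smooth_step :: "(real \<Rightarrow> real) \<Rightarrow> (real \<Rightarrow> real) \<Rightarrow> bool" where
  "smooth_step H h \<longleftrightarrow> smooth_fun (\<lambda>x. complex_of_real (H x)) \<and> smooth_fun (\<lambda>x. complex_of_real (h x)) \<and>
     (\<forall>x. (H has_real_derivative h x) (at x)) \<and> (\<forall>x. 0 \<le> h x) \<and> (\<forall>x. x \<notin> {0<..<1} \<longrightarrow> h x = 0) \<and>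
     (\<forall>x\<le>0. H x = 0) \<and> (\<forall>x\<ge>1. H x = 1) \<and> (\<forall>x. 0 \<le> H x) \<and> (\<forall>x. H x \<le> 1)"

lemma smooth_stepD:
  assumes "smooth_step H h"
  shows "smooth_fun (\<lambda>x. complex_of_real (H x))" "smooth_fun (\<lambda>x. complex_of_real (h x))"
    "(H has_real_derivative h x) (at x)" "0 \<le> h x" "x \<notin> {0<..<1} \<Longrightarrow> h x = 0"
    "x \<le> 0 \<Longrightarrow> H x = 0" "1 \<le> x \<Longrightarrow> H x = 1" "0 \<le> H x" "H x \<le> 1"
  using assms unfolding smooth_step_def by blast+

lemma smooth_step_obtain: obtains H h where "smooth_step H h"
proof -
  obtain H h :: "real \<Rightarrow> real" where
    "smooth_fun (\<lambda>x. complex_of_real (H x))" "smooth_fun (\<lambda>x. complex_of_real (h x))"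
    "\<And>x. (H has_real_derivative h x) (at x)" "\<And>x. 0 \<le> h x" "\<And>x. x \<notin> {0<..<1} \<Longrightarrow> h x = 0"
    "\<And>x. x \<le> 0 \<Longrightarrow> H x = 0" "\<And>x. 1 \<le> x \<Longrightarrow> H x = 1" "\<And>x. 0 \<le> H x" "\<And>x. H x \<le> 1"
    by (rule smooth_step_exists) (rule that, assumption+)
  then have "smooth_step H h" unfolding smooth_step_def by blast
  then show thesis by (rule that)
qed

text \<open>The window h((t - c)/\<epsilon> - 1)/\<epsilon> lives on
  [c + \<epsilon>, c + 2\<epsilon>]. The shift by -1 keeps it at distance \<epsilon> to the right of
  c, so for c = 0 it has compact support in the open time interval and can still probe the initial
  value.\<close>

lemma smooth_window:
  fixes H h :: "real \<Rightarrow> real"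
  assumes step: "smooth_step H h" and e: "\<epsilon> > 0"
  shows "smooth_fun (\<lambda>t. complex_of_real (H ((t - c) / \<epsilon> - 1)))"
    and "smooth_fun (\<lambda>t. complex_of_real (h ((t - c) / \<epsilon> - 1)))"
    and "directional_deriv 1 (\<lambda>t. complex_of_real (H ((t - c) / \<epsilon> - 1))) = (\<lambda>t. complex_of_real (h ((t - c) / \<epsilon> - 1) / \<epsilon>))"
    and "integrable lborel (\<lambda>t. h ((t - c) / \<epsilon> - 1) / \<epsilon>)" and "(LINT t|lborel. h ((t - c) / \<epsilon> - 1) / \<epsilon>) = 1"
proof -
  note H = smooth_stepD[OF step]
  have arg: "(t - c) / \<epsilon> - 1 = (1 / \<epsilon>) *\<^sub>R t + (- c / \<epsilon> - 1)" for t by (simp add: diff_divide_distrib)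
  show "smooth_fun (\<lambda>t. complex_of_real (H ((t - c) / \<epsilon> - 1)))" "smooth_fun (\<lambda>t. complex_of_real (h ((t - c) / \<epsilon> - 1)))"
    unfolding arg by (intro smooth_fun_compose_linear[OF _ H(1)] smooth_fun_compose_linear[OF _ H(2)] bounded_linear_scaleR_right)+
  have "((\<lambda>t. H ((t - c) / \<epsilon> - 1)) has_real_derivative h ((t - c) / \<epsilon> - 1) * (1 / \<epsilon>)) (at t)" for t
    by (rule DERIV_chain2[OF H(3)]) (use e in \<open>auto intro!: derivative_eq_intros\<close>)
  then have d0: "((\<lambda>t. H ((t - c) / \<epsilon> - 1)) has_vector_derivative h ((t - c) / \<epsilon> - 1) / \<epsilon>) (at t)" for t
    by (simp add: has_real_derivative_iff_has_vector_derivative)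
  have d: "((\<lambda>t. complex_of_real (H ((t - c) / \<epsilon> - 1))) has_vector_derivative complex_of_real (h ((t - c) / \<epsilon> - 1) / \<epsilon>)) (at t)" for t
    by (rule bounded_linear.has_vector_derivative[OF bounded_linear_of_real d0])
  show "directional_deriv 1 (\<lambda>t. complex_of_real (H ((t - c) / \<epsilon> - 1))) = (\<lambda>t. complex_of_real (h ((t - c) / \<epsilon> - 1) / \<epsilon>))"
    by (rule directional_deriv_real[OF d])
  have hc: "continuous_on S h" for S
  proof -
    have "continuous_on S (\<lambda>x. Re (complex_of_real (h x)))"
      by (intro continuous_on_Re smooth_fun_continuous_on H)
    then show ?thesis by simp
  qed
  have hi: "integrable lborel h"
    by (rule continuous_compact_support_integrable[OF hc, where R=1]) (rule H(5), auto)
  have "(LINT x|lborel. indicator {0..1} x *\<^sub>R h x) = H 1 - H 0"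
    by (rule integral_FTC_atLeastAtMost)
       (use H(3) hc in \<open>auto simp: has_real_derivative_iff_has_vector_derivative intro: has_vector_derivative_at_within\<close>)
  also have "(\<lambda>x. indicator {0..1} x *\<^sub>R h x) = h"
  proof
    show "indicator {0..1} x *\<^sub>R h x = h x" for x
      using H(5)[of x] by (cases "x \<in> {0<..<1}") (auto simp: indicator_def)
  qed
  finally have h1: "(LINT x|lborel. h x) = 1" using H(6)[of 0] H(7)[of 1] by simp
  have arg': "(t - c) / \<epsilon> - 1 = (- c / \<epsilon> - 1) + (1 / \<epsilon>) * t" for t by (simp add: diff_divide_distrib)
  have "integrable lborel (\<lambda>t. h ((- c / \<epsilon> - 1) + (1 / \<epsilon>) * t))" using hi e by (intro lborel_integrable_real_affine) auto
  then show "integrable lborel (\<lambda>t. h ((t - c) / \<epsilon> - 1) / \<epsilon>)" unfolding arg' by simp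
  have "(LINT x|lborel. h x) = \<bar>1 / \<epsilon>\<bar> *\<^sub>R (LINT t|lborel. h ((- c / \<epsilon> - 1) + (1 / \<epsilon>) * t))"
    using e by (intro lborel_integral_real_affine) auto
  then show "(LINT t|lborel. h ((t - c) / \<epsilon> - 1) / \<epsilon>) = 1" unfolding arg' using h1 e by simp
qed

lemma averaged_value:
  fixes a :: "real \<Rightarrow> complex" and k :: "real \<Rightarrow> real"
  assumes k: "continuous_on UNIV (\<lambda>t. complex_of_real (k t))" "integrable lborel k" "(LINT t|lborel. k t) = 1" "\<And>t. 0 \<le> k t"
    "\<And>t. t \<notin> {l..h} \<Longrightarrow> k t = 0"
    and a: "continuous_on {l..h} a" "\<And>t. t \<in> {l..h} \<Longrightarrow> norm (a t - z) \<le> \<eta>"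
  shows "norm ((LINT t|lborel. complex_of_real (k t) * a t) - z) \<le> \<eta>"
proof -
  have i: "integrable lborel (\<lambda>t. complex_of_real (k t) * a t)"
    by (rule continuous_mult_integrable[OF a(1) k(1)]) (use k(5) in auto)
  have kc: "integrable lborel (\<lambda>t. complex_of_real (k t) * z)" using k(2) by simp
  have "(LINT t|lborel. complex_of_real (k t) * z) = z" using k(3) by simp
  then have "(LINT t|lborel. complex_of_real (k t) * a t) - z = (LINT t|lborel. complex_of_real (k t) * a t - complex_of_real (k t) * z)"
    using i kc by simp
  also have "norm \<dots> \<le> (LINT t|lborel. k t * \<eta>)"
  proof (rule Bochner_Integration.integral_norm_bound_integral)
    show "norm (complex_of_real (k t) * a t - complex_of_real (k t) * z) \<le> k t * \<eta>" for t
    proof (cases "t \<in> {l..h}")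
      case True
      have "norm (complex_of_real (k t) * a t - complex_of_real (k t) * z) = k t * norm (a t - z)"
        using k(4)[of t] by (simp add: right_diff_distrib[symmetric] norm_mult)
      then show ?thesis using a(2)[OF True] k(4)[of t] by (simp add: mult_left_mono)
    qed (use k(5) in simp)
  qed (use i kc k(2) in auto)
  also have "\<dots> = \<eta>" using k(3) by simp
  finally show ?thesis .
qed

text \<open>The test function is a smooth substitute for the indicator of (0, t), a difference of
  two steps; its derivative is the difference of two windows of mass one, right of 0 and right of t.
  Continuity of \<open>a\<close> up to the endpoint turns the window averages into a(0) and a(t),
  although the hypothesis sees only the open interval.\<close>

lemma weak_lipschitz:
  fixes a :: "real \<Rightarrow> complex"
  assumes a: "continuous_on {0..T} a" and B: "B \<ge> 0"
    and H: "\<And>\<theta> l h. test_fun \<theta> \<Longrightarrow> 0 < l \<Longrightarrow> h < T \<Longrightarrow> (\<And>t. t \<notin> {l..h} \<Longrightarrow> \<theta> t = 0) \<Longrightarrow>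
      norm (LINT t|lborel. directional_deriv 1 \<theta> t * a t) \<le> B * (LINT t|lborel. norm (\<theta> t))"
    and t: "0 < t" "t < T"
  shows "norm (a t - a 0) \<le> B * t"
proof (rule field_le_epsilon)
  fix \<eta> :: real assume \<eta>: "\<eta> > 0"
  obtain H h where step: "smooth_step H h" by (rule smooth_step_obtain)
  note Hh = smooth_stepD[OF step]
  have near: "\<exists>d>0. \<forall>\<tau>\<in>{0..T}. \<bar>\<tau> - c\<bar> < d \<longrightarrow> norm (a \<tau> - a c) \<le> \<eta> / 4" if cin: "c \<in> {0..T}" for c
  proof -
    have "\<eta> / 4 > 0" using \<eta> by simp
    then obtain d where "d > 0" "\<forall>\<tau>\<in>{0..T}. dist \<tau> c < d \<longrightarrow> dist (a \<tau>) (a c) < \<eta> / 4"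
      using a[unfolded continuous_on_iff, rule_format, OF cin] by metis
    then show ?thesis unfolding dist_norm real_norm_def using less_imp_le by metis
  qed
  obtain d0 where d0: "d0 > 0" "\<And>\<tau>. \<tau> \<in> {0..T} \<Longrightarrow> \<bar>\<tau> - 0\<bar> < d0 \<Longrightarrow> norm (a \<tau> - a 0) \<le> \<eta> / 4"
    using near[of 0] t by auto
  obtain d1 where d1: "d1 > 0" "\<And>\<tau>. \<tau> \<in> {0..T} \<Longrightarrow> \<bar>\<tau> - t\<bar> < d1 \<Longrightarrow> norm (a \<tau> - a t) \<le> \<eta> / 4"
    using near[of t] t by auto
  \<comment> \<open>The windows end at 2\<epsilon> beyond 0 and t. The first three bounds keep them
    inside (0, T) and where \<open>a\<close> is within \<eta>/4 of a(0) or a(t); the last makes the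
    excess 2 B \<epsilon> in the integral of |\<theta>| at most \<eta>/2. The errors add up to
    \<eta>.\<close>
  define \<epsilon> where "\<epsilon> = min (min (d0 / 3) (d1 / 3)) (min ((T - t) / 3) (\<eta> / (4 * (B + 1))))"
  have e: "\<epsilon> > 0" "3 * \<epsilon> \<le> d0" "3 * \<epsilon> \<le> d1" "3 * \<epsilon> \<le> T - t" "\<epsilon> \<le> \<eta> / (4 * (B + 1))"
  proof -
    have "0 < \<eta> / (4 * (B + 1))" using \<eta> B by simp
    then show "\<epsilon> > 0" using d0(1) d1(1) t by (simp add: \<epsilon>_def)
    have "\<epsilon> \<le> d0 / 3" "\<epsilon> \<le> d1 / 3" "\<epsilon> \<le> (T - t) / 3" unfolding \<epsilon>_def by linarith+
    then show "3 * \<epsilon> \<le> d0" "3 * \<epsilon> \<le> d1" "3 * \<epsilon> \<le> T - t" by (simp_all add: field_simps)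
    show "\<epsilon> \<le> \<eta> / (4 * (B + 1))" by (simp add: \<epsilon>_def min_le_iff_disj)
  qed
  have Be: "2 * B * \<epsilon> \<le> \<eta> / 2"
  proof -
    have "\<epsilon> * (4 * (B + 1)) \<le> \<eta>" using e(5) B by (simp add: pos_le_divide_eq)
    then show ?thesis using e(1) by (simp add: algebra_simps)
  qed
  note W = smooth_window[OF step e(1)]
  define k where "k c \<tau> = h ((\<tau> - c) / \<epsilon> - 1) / \<epsilon>" for c \<tau>
  have k0: "0 \<le> k c \<tau>" for c \<tau> using Hh(4) e(1) by (simp add: k_def)
  have ks: "k c \<tau> = 0" if "\<tau> \<notin> {c + \<epsilon>..c + 2 * \<epsilon>}" for c \<tau>
  proof -
    have "(\<tau> - c) / \<epsilon> - 1 \<notin> {0<..<1}" using that e(1) by (auto simp: field_simps)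
    then show ?thesis using Hh(5) by (simp add: k_def)
  qed
  have kc: "continuous_on UNIV (\<lambda>\<tau>. complex_of_real (k c \<tau>))" for c
  proof -
    have "continuous_on UNIV (\<lambda>\<tau>. complex_of_real (h ((\<tau> - c) / \<epsilon> - 1)) / complex_of_real \<epsilon>)"
      by (intro continuous_on_divide smooth_fun_continuous_on W continuous_on_const) (use e in auto)
    then show ?thesis by (simp add: k_def)
  qed
  have av0: "norm ((LINT \<tau>|lborel. complex_of_real (k 0 \<tau>) * a \<tau>) - a 0) \<le> \<eta> / 4"
  proof (rule averaged_value[OF kc _ _ k0 ks])
    show "integrable lborel (k 0)" "(LINT t|lborel. k 0 t) = 1" using W(4,5)[of 0] by (simp_all add: k_def[abs_def])
    show "continuous_on {0 + \<epsilon>..0 + 2 * \<epsilon>} a" by (rule continuous_on_subset[OF a]) (use e t in auto)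
    show "norm (a \<tau> - a 0) \<le> \<eta> / 4" if "\<tau> \<in> {0 + \<epsilon>..0 + 2 * \<epsilon>}" for \<tau>
      by (rule d0) (use that e t in auto)
  qed auto
  have av1: "norm ((LINT \<tau>|lborel. complex_of_real (k t \<tau>) * a \<tau>) - a t) \<le> \<eta> / 4"
  proof (rule averaged_value[OF kc _ _ k0 ks])
    show "integrable lborel (k t)" "(LINT \<tau>|lborel. k t \<tau>) = 1" using W(4,5)[of t] by (simp_all add: k_def[abs_def])
    show "continuous_on {t + \<epsilon>..t + 2 * \<epsilon>} a" by (rule continuous_on_subset[OF a]) (use e t in auto)
    show "norm (a \<tau> - a t) \<le> \<eta> / 4" if "\<tau> \<in> {t + \<epsilon>..t + 2 * \<epsilon>}" for \<tau>
      by (rule d1) (use that e t in auto)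
  qed auto
  define \<theta> where "\<theta> \<tau> = complex_of_real (H ((\<tau> - 0) / \<epsilon> - 1)) - complex_of_real (H ((\<tau> - t) / \<epsilon> - 1))" for \<tau>
  have \<theta>s: "\<theta> \<tau> = 0" if "\<tau> \<notin> {\<epsilon>..t + 2 * \<epsilon>}" for \<tau>
  proof (cases "\<tau> < \<epsilon>")
    case True
    then have "(\<tau> - 0) / \<epsilon> - 1 \<le> 0" "(\<tau> - t) / \<epsilon> - 1 \<le> 0" using e(1) t by (auto simp: field_simps)
    then show ?thesis using Hh(6) by (simp add: \<theta>_def)
  next
    case False
    then have "1 \<le> (\<tau> - 0) / \<epsilon> - 1" "1 \<le> (\<tau> - t) / \<epsilon> - 1" using e(1) t that by (auto simp: field_simps)
    then show ?thesis using Hh(7) by (simp add: \<theta>_def)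
  qed
  have \<theta>sm: "smooth_fun \<theta>" unfolding \<theta>_def[abs_def] by (intro smooth_fun_diff W)
  have \<theta>t: "test_fun \<theta>"
    by (rule test_funI[OF \<theta>sm, where R="t + 2 * \<epsilon>"]) (rule \<theta>s, use e t in auto)
  have \<theta>d: "directional_deriv 1 \<theta> = (\<lambda>\<tau>. complex_of_real (k 0 \<tau>) - complex_of_real (k t \<tau>))"
  proof
    show "directional_deriv 1 \<theta> \<tau> = complex_of_real (k 0 \<tau>) - complex_of_real (k t \<tau>)" for \<tau>
      unfolding \<theta>_def[abs_def]
      by (subst directional_deriv_diff[OF smooth_fun_differentiable[OF W(1)] smooth_fun_differentiable[OF W(1)]])
         (simp only: W(3) k_def)
  qed
  have \<theta>1: "norm (\<theta> \<tau>) \<le> 1" for \<tau>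
    using Hh(8,9)[of "(\<tau> - 0) / \<epsilon> - 1"] Hh(8,9)[of "(\<tau> - t) / \<epsilon> - 1"]
    unfolding \<theta>_def of_real_diff[symmetric] norm_of_real by (simp add: abs_le_iff)
  have "(LINT \<tau>|lborel. norm (\<theta> \<tau>)) \<le> (LINT \<tau>|lborel. indicator {\<epsilon>..t + 2 * \<epsilon>} \<tau>)"
  proof (rule integral_mono)
    show "integrable lborel (\<lambda>\<tau>. norm (\<theta> \<tau>))" using test_fun_integrable[OF \<theta>t] by simp
    show "integrable lborel (indicator {\<epsilon>..t + 2 * \<epsilon>} :: real \<Rightarrow> real)"
      by (rule indicator_bounded_integrable) auto
    show "norm (\<theta> \<tau>) \<le> indicator {\<epsilon>..t + 2 * \<epsilon>} \<tau>" for \<tau>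
      using \<theta>1[of \<tau>] \<theta>s[of \<tau>] by (cases "\<tau> \<in> {\<epsilon>..t + 2 * \<epsilon>}") simp_all
  qed
  also have "\<dots> \<le> t + 2 * \<epsilon>" using e t by simp
  finally have I\<theta>: "(LINT \<tau>|lborel. norm (\<theta> \<tau>)) \<le> t + 2 * \<epsilon>" .
  have i0: "integrable lborel (\<lambda>\<tau>. complex_of_real (k 0 \<tau>) * a \<tau>)"
    by (rule continuous_mult_integrable[OF _ kc, where l="0 + \<epsilon>" and h="0 + 2 * \<epsilon>"])
       (use ks[of _ 0] e t in \<open>auto intro: continuous_on_subset[OF a]\<close>)
  have i1: "integrable lborel (\<lambda>\<tau>. complex_of_real (k t \<tau>) * a \<tau>)"
    by (rule continuous_mult_integrable[OF _ kc, where l="t + \<epsilon>" and h="t + 2 * \<epsilon>"])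
       (use ks[of _ t] e t in \<open>auto intro: continuous_on_subset[OF a]\<close>)
  let ?A0 = "LINT \<tau>|lborel. complex_of_real (k 0 \<tau>) * a \<tau>" and ?A1 = "LINT \<tau>|lborel. complex_of_real (k t \<tau>) * a \<tau>"
  have "norm (LINT \<tau>|lborel. directional_deriv 1 \<theta> \<tau> * a \<tau>) \<le> B * (LINT \<tau>|lborel. norm (\<theta> \<tau>))"
    by (rule H[OF \<theta>t e(1), where h="t + 2 * \<epsilon>"]) (use e \<theta>s in auto)
  also have "\<dots> \<le> B * (t + 2 * \<epsilon>)" by (rule mult_left_mono[OF I\<theta> B])
  also have "(LINT \<tau>|lborel. directional_deriv 1 \<theta> \<tau> * a \<tau>) = ?A0 - ?A1"
    using i0 i1 by (simp add: \<theta>d left_diff_distrib)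
  finally have "norm (?A0 - ?A1) \<le> B * (t + 2 * \<epsilon>)" .
  moreover have split: "a t - a 0 = (?A0 - a 0) - (?A1 - a t) - (?A0 - ?A1)" by simp
  have "norm (a t - a 0) \<le> norm (?A0 - a 0) + norm (?A1 - a t) + norm (?A0 - ?A1)"
    unfolding split using norm_triangle_ineq4[of "?A0 - a 0" "?A1 - a t"] norm_triangle_ineq4[of "(?A0 - a 0) - (?A1 - a t)" "?A0 - ?A1"]
    by linarith
  ultimately show "norm (a t - a 0) \<le> B * t + \<eta>" using av0 av1 Be by (simp add: algebra_simps)
qed

text \<open>The scalar equation is tested with a bump of mass one on [\<rho>, 2\<rho>]. The
  derivative of the bump integrates to zero, so a(t) may be replaced by a(t) - a(0); it is
  O(\<rho>^(-2)) on a set of length \<rho>, whence M A1/\<rho>. The constant \<open>M\<close>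
  depends on the bump alone and is fixed ahead of \<rho> and of the functions, as the later choice
  of small parameters requires.\<close>

lemma window_estimate:
  obtains M :: real where "M > 0"
    "\<And>\<kappa> T a b n \<rho> A1 B1 N1. weak_ode \<kappa> T a b n \<Longrightarrow> \<bar>\<kappa>\<bar> = 1 \<Longrightarrow>
      continuous_on {0..T} a \<Longrightarrow> continuous_on {0..T} b \<Longrightarrow> continuous_on {0..T} n \<Longrightarrow>
      0 < \<rho> \<Longrightarrow> 2 * \<rho> < T \<Longrightarrow> (\<And>t. 0 \<le> t \<Longrightarrow> t \<le> 2 * \<rho> \<Longrightarrow> norm (a t - a 0) \<le> A1) \<Longrightarrow>
      (\<And>t. 0 \<le> t \<Longrightarrow> t \<le> 2 * \<rho> \<Longrightarrow> norm (b t) \<le> B1) \<Longrightarrow> (\<And>t. 0 \<le> t \<Longrightarrow> t \<le> 2 * \<rho> \<Longrightarrow> norm (n t - n 0) \<le> N1) \<Longrightarrow>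
      norm (n 0) \<le> N1 + M * A1 / \<rho> + B1"
proof -
  obtain H h where step: "smooth_step H h" by (rule smooth_step_obtain)
  note Hh = smooth_stepD[OF step]
  have ht: "test_fun (\<lambda>x. complex_of_real (h x))"
  proof (rule test_funI[OF Hh(2), where R=1])
    fix x :: real assume "1 < norm x"
    then have "x \<notin> {0<..<1}" by auto
    then have "h x = 0" by (rule Hh(5))
    then show "complex_of_real (h x) = 0" by simp
  qed
  obtain M where M: "M > 0" "\<And>x. norm (directional_deriv 1 (\<lambda>x. complex_of_real (h x)) x) \<le> M"
    using test_fun_bounded[OF test_fun_dd[OF ht]] by blast
  show thesis
  proof (rule that[OF M(1)])
    fix \<kappa> T :: real and a b n :: "real \<Rightarrow> complex" and \<rho> A1 B1 N1 :: real
    assume ode: "weak_ode \<kappa> T a b n" and \<kappa>: "\<bar>\<kappa>\<bar> = 1"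
      and c: "continuous_on {0..T} a" "continuous_on {0..T} b" "continuous_on {0..T} n"
      and \<rho>: "0 < \<rho>" "2 * \<rho> < T" and A: "\<And>t. 0 \<le> t \<Longrightarrow> t \<le> 2 * \<rho> \<Longrightarrow> norm (a t - a 0) \<le> A1"
      and B: "\<And>t. 0 \<le> t \<Longrightarrow> t \<le> 2 * \<rho> \<Longrightarrow> norm (b t) \<le> B1"
      and N: "\<And>t. 0 \<le> t \<Longrightarrow> t \<le> 2 * \<rho> \<Longrightarrow> norm (n t - n 0) \<le> N1"
    note W = smooth_window[OF step \<rho>(1), where c=0, simplified]
    define k where "k t = h (t / \<rho> - 1) / \<rho>" for t
    define \<theta> where "\<theta> t = complex_of_real (k t)" for t
    have ks: "k t = 0" if "t \<notin> {\<rho>..2 * \<rho>}" for t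
    proof -
      have "t / \<rho> - 1 \<notin> {0<..<1}" using that \<rho>(1) by (auto simp: field_simps)
      then show ?thesis using Hh(5) by (simp add: k_def)
    qed
    have k0: "0 \<le> k t" for t using Hh(4) \<rho> by (simp add: k_def)
    have ki: "integrable lborel k" "(LINT t|lborel. k t) = 1"
      using smooth_window(4,5)[OF step \<rho>(1), of 0] by (simp_all add: k_def[abs_def])
    have \<theta>eq: "\<theta> = (\<lambda>t. complex_of_real (1 / \<rho>) * complex_of_real (h (t / \<rho> - 1)))" by (simp add: \<theta>_def k_def fun_eq_iff)
    have \<theta>sm: "smooth_fun \<theta>" unfolding \<theta>eq by (intro smooth_fun_mult smooth_fun_const W)
    have \<theta>t: "test_fun \<theta>"
    proof (rule test_funI[OF \<theta>sm, where R="2 * \<rho>"])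
      fix t :: real assume "2 * \<rho> < norm t"
      then have "t \<notin> {\<rho>..2 * \<rho>}" using \<rho> by auto
      then have "k t = 0" by (rule ks)
      then show "\<theta> t = 0" by (simp add: \<theta>_def)
    qed
    have \<theta>d: "norm (directional_deriv 1 \<theta> t) \<le> M / \<rho>\<^sup>2" for t
    proof -
      have g: "directional_deriv 1 (\<lambda>t. complex_of_real (h (t / \<rho> - 1))) t = directional_deriv (1 / \<rho>) (\<lambda>x. complex_of_real (h x)) (t / \<rho> - 1)"
        using directional_deriv_compose_linear[OF bounded_linear_scaleR_right[of "1 / \<rho>"], where f="\<lambda>x. complex_of_real (h x)" and c="- 1" and v=1 and x=t]
          smooth_fun_differentiable[OF Hh(2)] by simp
      have g2: "directional_deriv (1 / \<rho>) (\<lambda>x. complex_of_real (h x)) y = complex_of_real (1 / \<rho>) * directional_deriv 1 (\<lambda>x. complex_of_real (h x)) y" for y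
        using linear_scale[OF has_derivative_linear[OF smooth_fun_has_derivative[OF Hh(2), of y]], of "1 / \<rho>" 1] by (simp add: scaleR_conv_of_real)
      have "directional_deriv 1 \<theta> t = complex_of_real (1 / \<rho>) * directional_deriv 1 (\<lambda>t. complex_of_real (h (t / \<rho> - 1))) t"
      proof -
        have "directional_deriv 1 \<theta> t = complex_of_real (1 / \<rho>) * directional_deriv 1 (\<lambda>t. complex_of_real (h (t / \<rho> - 1))) t
          + directional_deriv 1 (\<lambda>t. complex_of_real (1 / \<rho>)) t * complex_of_real (h (t / \<rho> - 1))"
          unfolding \<theta>eq by (intro directional_deriv_mult smooth_fun_differentiable smooth_fun_const W(2))
        then show ?thesis by simp
      qed
      then have "norm (directional_deriv 1 \<theta> t) = norm (directional_deriv 1 (\<lambda>x. complex_of_real (h x)) (t / \<rho> - 1)) / \<rho>\<^sup>2"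
        using \<rho> by (simp add: g g2 norm_mult norm_divide power2_eq_square)
      then show ?thesis using M(2) \<rho> by (simp add: divide_right_mono)
    qed
    have \<theta>d0: "directional_deriv 1 \<theta> t = 0" if "t \<notin> {\<rho>..2 * \<rho>}" for t
      by (rule directional_deriv_zero_outside[where S="{\<rho>..2 * \<rho>}"]) (use \<theta>sm ks that in \<open>auto simp: \<theta>_def\<close>)
    have sub: "{\<rho>..2 * \<rho>} \<subseteq> {0..T}" using \<rho> by auto
    have \<theta>c: "continuous_on UNIV \<theta>" "continuous_on UNIV (directional_deriv 1 \<theta>)"
      by (intro smooth_fun_continuous_on \<theta>sm smooth_fun_dd)+
    have ia: "integrable lborel (\<lambda>t. directional_deriv 1 \<theta> t * a t)"
      by (rule continuous_mult_integrable[OF continuous_on_subset[OF c(1) sub] \<theta>c(2) \<theta>d0])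
    have ib: "integrable lborel (\<lambda>t. \<theta> t * b t)"
      by (rule continuous_mult_integrable[OF continuous_on_subset[OF c(2) sub] \<theta>c(1)]) (use ks in \<open>auto simp: \<theta>_def\<close>)
    have i\<theta>: "integrable lborel (directional_deriv 1 \<theta>)" by (intro test_fun_integrable test_fun_dd \<theta>t)
    have na: "norm (LINT t|lborel. directional_deriv 1 \<theta> t * a t) \<le> M * A1 / \<rho>"
    proof -
      have "(LINT t|lborel. directional_deriv 1 \<theta> t * a t) = (LINT t|lborel. directional_deriv 1 \<theta> t * a t - directional_deriv 1 \<theta> t * a 0)"
        using ia i\<theta> integral_directional_deriv[OF \<theta>t, of 1] by simp
      also have "norm \<dots> \<le> (LINT t|lborel. indicator {\<rho>..2 * \<rho>} t * (M / \<rho>\<^sup>2 * A1))"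
      proof (rule Bochner_Integration.integral_norm_bound_integral)
        show "norm (directional_deriv 1 \<theta> t * a t - directional_deriv 1 \<theta> t * a 0) \<le> indicator {\<rho>..2 * \<rho>} t * (M / \<rho>\<^sup>2 * A1)" for t
        proof (cases "t \<in> {\<rho>..2 * \<rho>}")
          case True
          have "norm (directional_deriv 1 \<theta> t * a t - directional_deriv 1 \<theta> t * a 0) = norm (directional_deriv 1 \<theta> t) * norm (a t - a 0)"
            by (simp add: right_diff_distrib[symmetric] norm_mult)
          also have "\<dots> \<le> M / \<rho>\<^sup>2 * A1" using True \<rho> M by (intro mult_mono \<theta>d A) auto
          finally show ?thesis using True by simp
        qed (simp add: \<theta>d0)
        show "integrable lborel (\<lambda>t. indicator {\<rho>..2 * \<rho>} t * (M / \<rho>\<^sup>2 * A1))"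
          by (intro integrable_mult_left integrable_real_indicator) (use \<rho> in auto)
      qed (use ia i\<theta> in auto)
      also have "\<dots> = M * A1 / \<rho>" using \<rho> by (simp add: power2_eq_square)
      finally show ?thesis .
    qed
    have nb: "norm (LINT t|lborel. \<theta> t * b t) \<le> B1"
      using averaged_value[of k \<rho> "2 * \<rho>" b 0 B1] \<theta>c(1) ki k0 ks continuous_on_subset[OF c(2) sub] B \<rho>
      by (auto simp: \<theta>_def[abs_def])
    have nn: "norm ((LINT t|lborel. \<theta> t * n t) - n 0) \<le> N1"
      using averaged_value[of k \<rho> "2 * \<rho>" n "n 0" N1] \<theta>c(1) ki k0 ks continuous_on_subset[OF c(3) sub] N \<rho>
      by (auto simp: \<theta>_def[abs_def])
    have "(LINT t|lborel. - \<i> * directional_deriv 1 \<theta> t * a t - \<theta> t * b t) = (LINT t|lborel. of_real \<kappa> * (\<theta> t * n t))"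
    proof (rule ode[unfolded weak_ode_def, rule_format, OF \<theta>t \<rho>(1) \<rho>(2)])
      show "\<theta> t = 0" if "t \<notin> {\<rho>..2 * \<rho>}" for t using ks[OF that] by (simp add: \<theta>_def)
    qed
    moreover have "(LINT t|lborel. - \<i> * directional_deriv 1 \<theta> t * a t - \<theta> t * b t)
      = - \<i> * (LINT t|lborel. directional_deriv 1 \<theta> t * a t) - (LINT t|lborel. \<theta> t * b t)"
      using ia ib by (simp add: mult.assoc)
    ultimately have "of_real \<kappa> * (LINT t|lborel. \<theta> t * n t) = - \<i> * (LINT t|lborel. directional_deriv 1 \<theta> t * a t) - (LINT t|lborel. \<theta> t * b t)"
      by simp
    then have "norm (of_real \<kappa> * (LINT t|lborel. \<theta> t * n t)) \<le> M * A1 / \<rho> + B1"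
      using norm_triangle_ineq4[of "- \<i> * (LINT t|lborel. directional_deriv 1 \<theta> t * a t)" "LINT t|lborel. \<theta> t * b t"] na nb
      by (simp add: norm_mult)
    then have "norm (LINT t|lborel. \<theta> t * n t) \<le> M * A1 / \<rho> + B1" using \<kappa> by (simp add: norm_mult)
    moreover have "norm (n 0) \<le> norm (LINT t|lborel. \<theta> t * n t) + norm ((LINT t|lborel. \<theta> t * n t) - n 0)"
      using norm_triangle_ineq4[of "LINT t|lborel. \<theta> t * n t" "(LINT t|lborel. \<theta> t * n t) - n 0"] by simp
    ultimately show "norm (n 0) \<le> N1 + M * A1 / \<rho> + B1" using nn by linarith
  qed
qed

subsection \<open>Estimates for a hypothetical solution\<close>

text \<open>Below the threshold \<open>l\<close> the power is bounded trivially; above it the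
  missing exponent is bought at the rate l^(a-P). On sets of finite measure this takes the place of
  Hoelder's inequality and leaves the threshold free.\<close>

lemma powr_interpolation:
  fixes x :: real
  assumes "0 \<le> x" "0 < l" "0 < a" "a \<le> P"
  shows "x powr a \<le> l powr a + l powr (a - P) * x powr P"
proof (cases "x \<le> l")
  case True
  then have "x powr a \<le> l powr a" using assms by (intro powr_mono2) auto
  then show ?thesis by (rule order_trans) simp
next
  case False
  then have "x powr a = x powr (a - P) * x powr P" using assms by (simp add: powr_add[symmetric])
  also have "\<dots> \<le> l powr (a - P) * x powr P"
    using False assms by (intro mult_right_mono powr_mono2') auto
  finally show ?thesis by (rule order_trans) simp
qed

text \<open>A Young inequality with a free parameter, proved by comparing y with l x: if y > l x,
  the first factor is at most (y/l)^(p-1).\<close>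

lemma powr_product_split:
  fixes x y :: real
  assumes "0 \<le> x" "0 \<le> y" "0 < l" "1 < p"
  shows "x powr (p - 1) * y \<le> l * x powr p + l powr (1 - p) * y powr p"
proof (cases "y \<le> l * x")
  case True
  have "x powr (p - 1) * y \<le> x powr (p - 1) * (l * x)" using True by (intro mult_left_mono) auto
  also have "\<dots> = l * x powr p" using assms by (cases "x = 0") (auto simp: powr_mult_base mult_ac)
  finally show ?thesis by (rule order_trans) simp
next
  case False
  then have y: "y > 0" using assms by (smt (verit) mult_nonneg_nonneg)
  have "x \<le> y / l" using False assms by (simp add: pos_le_divide_eq mult.commute)
  then have "x powr (p - 1) * y \<le> (y / l) powr (p - 1) * y"
    using assms y by (intro mult_right_mono powr_mono2) auto
  also have "(y / l) powr (p - 1) = y powr (p - 1) * l powr (1 - p)"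
  proof -
    have "(y / l) powr (p - 1) = y powr (p - 1) / l powr (p - 1)" by (rule powr_divide)
    then show ?thesis using powr_minus_divide[of l "p - 1"] by (simp add: algebra_simps)
  qed
  also have "y powr (p - 1) * l powr (1 - p) * y = l powr (1 - p) * y powr p"
    using y powr_mult_base[of y "p - 1"] by (simp add: mult_ac)
  finally show ?thesis using assms by (smt (verit) mult_nonneg_nonneg powr_ge_zero)
qed

lemma young_powr:
  fixes x y :: real
  assumes "0 \<le> x" "0 \<le> y" "1 < P"
  shows "x * y \<le> x powr P + y powr (P / (P - 1))"
proof (cases "y \<le> x powr (P - 1)")
  case True
  then have "x * y \<le> x * x powr (P - 1)" using assms by (intro mult_left_mono) auto
  also have "\<dots> = x powr P" using assms by (cases "x = 0") (auto simp: powr_mult_base)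
  finally show ?thesis by (rule order_trans) simp
next
  case False
  then have y: "y > 0" by (smt (verit) powr_ge_zero)
  have "x = (x powr (P - 1)) powr (1 / (P - 1))" using assms by (simp add: powr_powr)
  also have "\<dots> \<le> y powr (1 / (P - 1))" using False assms by (intro powr_mono2) auto
  finally have "x * y \<le> y powr (1 / (P - 1)) * y" using assms by (intro mult_right_mono) auto
  also have "\<dots> = y powr (1 / (P - 1) + 1)" using y by (simp add: powr_add)
  also have "1 / (P - 1) + 1 = P / (P - 1)" using assms by (simp add: field_simps)
  finally show ?thesis by (rule order_trans) simp
qed

lemma local_power_bound:
  fixes w :: "'a::euclidean_space \<Rightarrow> complex"
  assumes [measurable]: "w \<in> borel_measurable borel" "K \<in> sets borel"
    and K: "emeasure lborel K \<le> ennreal m" "0 \<le> m" and Q: "(\<integral>\<^sup>+x. ennreal (norm (w x) powr P) \<partial>lborel) \<le> ennreal Q" "0 \<le> Q"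
    and a: "0 < a" "a \<le> P" and l: "0 < l"
  shows "(\<integral>\<^sup>+x. ennreal (indicator K x * norm (w x) powr a) \<partial>lborel) \<le> ennreal (l powr a * m + l powr (a - P) * Q)"
proof -
  have mK: "(\<lambda>x. ennreal (l powr a) * indicator K x) \<in> borel_measurable lborel"
    and mW: "(\<lambda>x. ennreal (norm (w x) powr P)) \<in> borel_measurable lborel" by measurable
  have "(\<integral>\<^sup>+x. ennreal (indicator K x * norm (w x) powr a) \<partial>lborel)
    \<le> (\<integral>\<^sup>+x. ennreal (l powr a) * indicator K x + ennreal (l powr (a - P)) * ennreal (norm (w x) powr P) \<partial>lborel)"
  proof (rule nn_integral_mono)
    fix x
    have "norm (w x) powr a \<le> l powr a + l powr (a - P) * norm (w x) powr P"
      using a l by (intro powr_interpolation) auto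
    then show "ennreal (indicator K x * norm (w x) powr a)
      \<le> ennreal (l powr a) * indicator K x + ennreal (l powr (a - P)) * ennreal (norm (w x) powr P)"
      by (cases "x \<in> K") (simp_all add: ennreal_mult[symmetric] ennreal_plus[symmetric] ennreal_leI del: ennreal_plus)
  qed
  also have "\<dots> = ennreal (l powr a) * emeasure lborel K + ennreal (l powr (a - P)) * (\<integral>\<^sup>+x. ennreal (norm (w x) powr P) \<partial>lborel)"
  proof -
    have "(\<integral>\<^sup>+x. ennreal (l powr a) * indicator K x \<partial>lborel) = ennreal (l powr a) * emeasure lborel K"
      by (rule nn_integral_cmult_indicator) simp
    then show ?thesis
      using nn_integral_add[OF mK borel_measurable_times_ennreal[OF borel_measurable_const mW]] nn_integral_cmult[OF mW] by simp
  qed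
  also have "\<dots> \<le> ennreal (l powr a) * ennreal m + ennreal (l powr (a - P)) * ennreal Q"
    by (intro add_mono mult_left_mono K Q) auto
  also have "\<dots> = ennreal (l powr a * m + l powr (a - P) * Q)"
    using K Q by (simp add: ennreal_mult ennreal_plus)
  finally show ?thesis .
qed

lemma nls_nonlinearity_measurable [measurable]: "nls_nonlinearity p \<in> borel_measurable borel"
  unfolding nls_nonlinearity_def[abs_def]
proof -
  have [measurable]: "complex_of_real \<in> borel_measurable borel"
    by (intro borel_measurable_continuous_onI linear_continuous_on bounded_linear_of_real)
  show "(\<lambda>z. complex_of_real (norm z powr (p - 1)) * z) \<in> borel_measurable borel" by measurable
qed

lemma nonlinear_integrable:
  fixes v :: "'a::euclidean_space \<Rightarrow> complex"
  assumes [measurable]: "v \<in> borel_measurable borel" "\<psi> \<in> borel_measurable borel" and p: "p > 1"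
    and fin: "(\<integral>\<^sup>+x. ennreal (indicator K x * norm (v x) powr p) \<partial>lborel) < \<infinity>"
    and \<psi>: "\<And>x. norm (\<psi> x) \<le> M" "\<And>x. x \<notin> K \<Longrightarrow> \<psi> x = 0" and [measurable]: "K \<in> sets borel"
  shows "integrable lborel (\<lambda>x. nls_nonlinearity p (v x) * \<psi> x)"
proof -
  have "integrable lborel (\<lambda>x. indicator K x * norm (v x) powr p)"
    using fin by (intro integrableI_bounded) auto
  then have "integrable lborel (\<lambda>x. (indicator K x * norm (v x) powr p) * M)" by simp
  then show ?thesis
  proof (rule Bochner_Integration.integrable_bound)
    show "AE x in lborel. norm (nls_nonlinearity p (v x) * \<psi> x) \<le> norm ((indicator K x * norm (v x) powr p) * M)"
    proof (rule AE_I2)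
      fix x
      show "norm (nls_nonlinearity p (v x) * \<psi> x) \<le> norm ((indicator K x * norm (v x) powr p) * M)"
      proof (cases "x \<in> K")
        case True
        have "norm (v x) powr p * norm (\<psi> x) \<le> norm (v x) powr p * \<bar>M\<bar>"
          using \<psi>(1)[of x] by (intro mult_left_mono) auto
        then show ?thesis using True by (simp add: norm_mult nls_nonlinearity_norm[OF p] abs_mult)
      qed (simp add: \<psi>)
    qed
  qed measurable
qed

lemma nonlinear_pairing_diff:
  fixes v w :: "'a::euclidean_space \<Rightarrow> complex"
  assumes [measurable]: "v \<in> borel_measurable borel" "w \<in> borel_measurable borel" "\<psi> \<in> borel_measurable borel"
    and [measurable]: "K \<in> sets borel" and p: "p > 1"
    and \<psi>: "\<And>x. norm (\<psi> x) \<le> M" "\<And>x. x \<notin> K \<Longrightarrow> \<psi> x = 0" "0 \<le> M"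
    and i: "integrable lborel (\<lambda>x. nls_nonlinearity p (v x) * \<psi> x)" "integrable lborel (\<lambda>x. nls_nonlinearity p (v x + w x) * \<psi> x)"
    and I1: "(\<integral>\<^sup>+x. ennreal (indicator K x * (norm (v x) powr (p - 1) * norm (w x))) \<partial>lborel) \<le> ennreal I1" "0 \<le> I1"
    and I2: "(\<integral>\<^sup>+x. ennreal (indicator K x * norm (w x) powr p) \<partial>lborel) \<le> ennreal I2" "0 \<le> I2"
  shows "norm ((LINT x|lborel. nls_nonlinearity p (v x + w x) * \<psi> x) - (LINT x|lborel. nls_nonlinearity p (v x) * \<psi> x))
    \<le> M * nl_const p * (I1 + I2)"
proof -
  have C: "0 \<le> nl_const p" using p by (simp add: nl_const_def)
  let ?f = "\<lambda>x. indicator K x * (norm (v x) powr (p - 1) * norm (w x))" and ?g = "\<lambda>x. indicator K x * norm (w x) powr p"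
  have "ennreal (norm ((LINT x|lborel. nls_nonlinearity p (v x + w x) * \<psi> x) - (LINT x|lborel. nls_nonlinearity p (v x) * \<psi> x)))
    = ennreal (norm (LINT x|lborel. nls_nonlinearity p (v x + w x) * \<psi> x - nls_nonlinearity p (v x) * \<psi> x))"
    using i by simp
  also have "\<dots> \<le> (\<integral>\<^sup>+x. ennreal (norm (nls_nonlinearity p (v x + w x) * \<psi> x - nls_nonlinearity p (v x) * \<psi> x)) \<partial>lborel)"
    by (rule ennreal_norm_integral_le)
  also have "\<dots> \<le> (\<integral>\<^sup>+x. ennreal (M * nl_const p) * (ennreal (?f x) + ennreal (?g x)) \<partial>lborel)"
  proof (rule nn_integral_mono)
    fix x
    show "ennreal (norm (nls_nonlinearity p (v x + w x) * \<psi> x - nls_nonlinearity p (v x) * \<psi> x)) \<le> ennreal (M * nl_const p) * (ennreal (?f x) + ennreal (?g x))"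
    proof (cases "x \<in> K")
      case True
      have "norm (nls_nonlinearity p (v x + w x) * \<psi> x - nls_nonlinearity p (v x) * \<psi> x)
        = norm (nls_nonlinearity p (v x + w x) - nls_nonlinearity p (v x)) * norm (\<psi> x)"
        by (simp add: left_diff_distrib[symmetric] norm_mult)
      also have "\<dots> \<le> (nl_const p * (norm (v x) powr (p - 1) * norm (w x) + norm (w x) powr p)) * M"
        using C by (intro mult_mono nls_nonlinearity_diff p \<psi>(1)) auto
      also have "\<dots> = (M * nl_const p) * (?f x + ?g x)" using True by simp
      finally show ?thesis using C \<psi>(3)
        by (simp add: ennreal_mult[symmetric] ennreal_plus[symmetric] ennreal_leI del: ennreal_plus)
    qed (simp add: \<psi>)
  qed
  also have "\<dots> = ennreal (M * nl_const p) * ((\<integral>\<^sup>+x. ennreal (?f x) \<partial>lborel) + (\<integral>\<^sup>+x. ennreal (?g x) \<partial>lborel))"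
    by (subst nn_integral_cmult, measurable) (subst nn_integral_add, measurable)
  also have "\<dots> \<le> ennreal (M * nl_const p) * (ennreal I1 + ennreal I2)"
    by (intro mult_left_mono add_mono I1 I2) auto
  also have "\<dots> = ennreal (M * nl_const p * (I1 + I2))"
    using I1(2) I2(2) C \<psi>(3) by (simp add: ennreal_mult ennreal_plus)
  finally show ?thesis using I1(2) I2(2) C \<psi>(3) by (subst (asm) ennreal_le_iff) auto
qed

lemma sobolev_norm_zero: "sobolev_norm s (\<lambda>x::'a::euclidean_space. 0) = 0"
  using sobolev_norm_cmult_test[OF test_fun_zero, of s 0] by simp

lemma powr_sum_le: "0 \<le> x \<Longrightarrow> 0 \<le> y \<Longrightarrow> 0 \<le> q \<Longrightarrow> (x + y) powr q \<le> 2 powr q * (x powr q + y powr q)" for x y q :: real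
proof -
  assume a: "0 \<le> x" "0 \<le> y" "0 \<le> q"
  have "(x + y) powr q \<le> (2 * max x y) powr q" using a by (intro powr_mono2) auto
  also have "\<dots> = 2 powr q * (max x y) powr q" by (rule powr_mult)
  also have "(max x y) powr q \<le> x powr q + y powr q" by (simp add: max_def)
  finally show ?thesis by (simp add: mult_left_mono)
qed

text \<open>A solution without prescribed datum: what is required of the initial value is stated
  where it is used, as the values of \<open>u 0\<close> on a box. Both signs of the nonlinearity are
  covered at once by |\<kappa>| = 1.\<close>

locale sobolev_nls_solution =
  fixes p \<kappa> s T :: real and u :: "real \<Rightarrow> 'a::euclidean_space \<Rightarrow> complex"
  assumes p: "p > 1" and \<kappa>: "\<bar>\<kappa>\<bar> = 1" and T: "T > 0"
    and s: "s \<ge> critical_exponent DIM('a) p" "s \<ge> p + 5 / 2"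
    and cont: "continuous_into_sobolev T s u" and eq: "nls_distributional p \<kappa> T u"
begin

text \<open>P \<ge> 2 serves the embeddings from the L^2-based scale, and P \<ge> p lets an L^P
  bound control p-th powers on sets of finite measure.\<close>

definition P :: real where "P = max p 2"

lemma P: "P \<ge> 2" "P \<ge> p" "P > 1" using p by (auto simp: P_def)

lemma exponents: "s - 2 > real DIM('a) * (1 / 2 - 1 / P)" "s > real DIM('a) * (1 / 2 - 1 / P)"
  "s > real DIM('a) * (1 / 2 - 1 / (p * P))"
  using exponent_conditions[OF p _ s] unfolding P_def by (simp_all add: Suc_leI)

lemma in_sobolev: "t \<in> {0..T} \<Longrightarrow> u t \<in> sobolev_space s"
  using cont by (simp add: continuous_into_sobolev_def)

lemma diff_in_sobolev: "t \<in> {0..T} \<Longrightarrow> r \<in> {0..T} \<Longrightarrow> (\<lambda>x. u r x - u t x) \<in> sobolev_space s"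
  by (intro sobolev_space_diff in_sobolev)

lemma diff_tendsto: "t \<in> {0..T} \<Longrightarrow> ((\<lambda>r. sobolev_norm s (\<lambda>x. u r x - u t x)) \<longlongrightarrow> 0) (at t within {0..T})"
  using cont by (simp add: continuous_into_sobolev_def)

lemma sq: "t \<in> {0..T} \<Longrightarrow> square_integrable (u t)"
  by (rule sobolev_space_square_integrable[OF in_sobolev])

lemma u_measurable: "t \<in> {0..T} \<Longrightarrow> u t \<in> borel_measurable borel"
  using sq by (simp add: square_integrable_def)

lemma pairing_diff:
  assumes "t \<in> {0..T}" "r \<in> {0..T}" "test_fun \<psi>"
  shows "(LINT x|lborel. u r x * \<psi> x) - (LINT x|lborel. u t x * \<psi> x) = (LINT x|lborel. (u r x - u t x) * \<psi> x)"
  using square_integrable_mult_test[OF sq[OF assms(1)] assms(3)] square_integrable_mult_test[OF sq[OF assms(2)] assms(3)]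
  by (simp add: left_diff_distrib)

lemma pairing_continuous:
  assumes \<psi>: "test_fun \<psi>" shows "continuous_on {0..T} (\<lambda>t. LINT x|lborel. u t x * \<psi> x)"
  unfolding continuous_on_def
proof
  fix t assume t: "t \<in> {0..T}"
  let ?b = "LINT x|lborel. (norm (\<psi> x))\<^sup>2"
  have b: "0 \<le> ?b" by (intro integral_nonneg_AE AE_I2) simp
  have s0: "s \<ge> 0" using s p by simp
  have "((\<lambda>r. (LINT x|lborel. u r x * \<psi> x) - (LINT x|lborel. u t x * \<psi> x)) \<longlongrightarrow> 0) (at t within {0..T})"
  proof (rule Lim_null_comparison)
    show "\<forall>\<^sub>F r in at t within {0..T}. norm ((LINT x|lborel. u r x * \<psi> x) - (LINT x|lborel. u t x * \<psi> x))
      \<le> sobolev_norm s (\<lambda>x. u r x - u t x) * sqrt ?b"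
      unfolding eventually_at_filter
    proof (intro always_eventually allI impI)
      fix r assume r: "r \<in> {0..T}"
      show "norm ((LINT x|lborel. u r x * \<psi> x) - (LINT x|lborel. u t x * \<psi> x)) \<le> sobolev_norm s (\<lambda>x. u r x - u t x) * sqrt ?b"
        unfolding pairing_diff[OF t r \<psi>]
        by (rule sobolev_pairing[OF diff_in_sobolev[OF t r] \<psi> test_fun_weight_finite[OF \<psi> s0] b])
    qed
    show "((\<lambda>r. sobolev_norm s (\<lambda>x. u r x - u t x) * sqrt ?b) \<longlongrightarrow> 0) (at t within {0..T})"
      using tendsto_mult_right[OF diff_tendsto[OF t], of "sqrt ?b"] by simp
  qed
  then show "((\<lambda>t. LINT x|lborel. u t x * \<psi> x) \<longlongrightarrow> (LINT x|lborel. u t x * \<psi> x)) (at t within {0..T})"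
    by (simp add: LIM_zero_iff)
qed

lemma local_p_finite:
  fixes v :: "'a \<Rightarrow> complex"
  assumes v: "v \<in> sobolev_space s" and K: "K \<in> sets borel" "emeasure lborel K \<le> ennreal m" "0 \<le> m"
  obtains V where "0 \<le> V" "(\<integral>\<^sup>+x. ennreal (indicator K x * norm (v x) powr p) \<partial>lborel) \<le> ennreal V"
proof -
  obtain C where C: "C \<ge> 0" "(\<integral>\<^sup>+x. ennreal (norm (v x) powr P) \<partial>lborel) \<le> ennreal ((C * sobolev_norm s v) powr P)"
    using sobolev_embedding[OF P(1) exponents(2)] v by metis
  have vm: "v \<in> borel_measurable borel" using sobolev_space_square_integrable[OF v] by (simp add: square_integrable_def)
  show thesis
  proof (rule that)
    show "(\<integral>\<^sup>+x. ennreal (indicator K x * norm (v x) powr p) \<partial>lborel) \<le> ennreal (1 powr p * m + 1 powr (p - P) * (C * sobolev_norm s v) powr P)"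
      by (rule local_power_bound[OF vm K C(2)]) (use p P in auto)
  qed (use K in simp)
qed

lemma nonlinear_pairing_integrable:
  fixes v :: "'a \<Rightarrow> complex"
  assumes v: "v \<in> sobolev_space s" and \<psi>: "test_fun \<psi>"
  shows "integrable lborel (\<lambda>x. nls_nonlinearity p (v x) * \<psi> x)"
proof -
  obtain R where R: "R > 0" "\<And>x. R < norm x \<Longrightarrow> \<psi> x = 0" using test_fun_support[OF \<psi>] by blast
  obtain M where M: "M > 0" "\<And>x. norm (\<psi> x) \<le> M" using test_fun_bounded[OF \<psi>] by blast
  have vm: "v \<in> borel_measurable borel" using sobolev_space_square_integrable[OF v] by (simp add: square_integrable_def)
  have mR: "emeasure lborel (cball (0::'a) R) \<le> ennreal ((2 * R) ^ DIM('a))" "0 \<le> (2 * R) ^ DIM('a)"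
    using emeasure_cball_le[of R] R by auto
  obtain V where V: "(\<integral>\<^sup>+x. ennreal (indicator (cball (0::'a) R) x * norm (v x) powr p) \<partial>lborel) \<le> ennreal V"
    using local_p_finite[OF v cball_borel mR] by blast
  show ?thesis
    by (rule nonlinear_integrable[OF vm test_fun_measurable[OF \<psi>] p _ M(2), where K="cball 0 R"])
       (use V R in \<open>auto simp: le_less_trans not_le intro: le_less_trans[OF _ ennreal_less_top]\<close>)
qed

text \<open>Continuity into H^s gives convergence in L^P and hence of p-th powers on the support of
  the test function. The mixed term |u(t)|^(p-1) |w|, with w the increment, is split with a
  parameter that tends to zero slowly.\<close>

lemma nonlinear_continuous:
  assumes \<psi>: "test_fun \<psi>" shows "continuous_on {0..T} (\<lambda>t. LINT x|lborel. nls_nonlinearity p (u t x) * \<psi> x)"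
  unfolding continuous_on_def
proof
  fix t assume t: "t \<in> {0..T}"
  obtain R where R: "R > 0" "\<And>x. R < norm x \<Longrightarrow> \<psi> x = 0" using test_fun_support[OF \<psi>] by blast
  obtain M where M: "M > 0" "\<And>x. norm (\<psi> x) \<le> M" using test_fun_bounded[OF \<psi>] by blast
  obtain C where C: "C \<ge> 0" "\<And>f :: 'a \<Rightarrow> complex. f \<in> sobolev_space s \<Longrightarrow>
      (\<integral>\<^sup>+x. ennreal (norm (f x) powr P) \<partial>lborel) \<le> ennreal ((C * sobolev_norm s f) powr P)"
    using sobolev_embedding[OF P(1) exponents(2)] by metis
  define m where "m = (2 * R) ^ DIM('a)"
  have K: "emeasure lborel (cball (0::'a) R) \<le> ennreal m" "0 \<le> m"
    using emeasure_cball_le[of R] R by (auto simp: m_def)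
  obtain V where V: "0 \<le> V" "(\<integral>\<^sup>+x. ennreal (indicator (cball (0::'a) R) x * norm (u t x) powr p) \<partial>lborel) \<le> ennreal V"
    using local_p_finite[OF in_sobolev[OF t] cball_borel K] by blast
  let ?N = "\<lambda>r. LINT x|lborel. nls_nonlinearity p (u r x) * \<psi> x"
  \<comment> \<open>The summand |r - t| makes \<open>\<delta> r\<close> positive for r \<noteq> t,
    so that it can serve as a threshold and be raised to negative powers.\<close>
  define \<delta> where "\<delta> r = C * sobolev_norm s (\<lambda>x. u r x - u t x) + \<bar>r - t\<bar>" for r
  define g where "g d = M * nl_const p * ((d powr (1/2) * V + d powr ((1 - p) / 2) * (d powr p * (m + 1))) + d powr p * (m + 1))" for d :: real
  have bound: "norm (?N r - ?N t) \<le> g (\<delta> r)" if r: "r \<in> {0..T}" "r \<noteq> t" for r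
  proof -
    let ?w = "\<lambda>x. u r x - u t x"
    have d0: "\<delta> r > 0" using r C(1) sobolev_norm_nonneg[of s ?w] by (simp add: \<delta>_def add_nonneg_pos)
    have [measurable]: "u t \<in> borel_measurable borel" "u r \<in> borel_measurable borel" "\<psi> \<in> borel_measurable borel"
      by (intro u_measurable t r test_fun_measurable[OF \<psi>])+
    have "(\<integral>\<^sup>+x. ennreal (norm (?w x) powr P) \<partial>lborel) \<le> ennreal ((C * sobolev_norm s ?w) powr P)"
      by (rule C(2)[OF diff_in_sobolev[OF t r(1)]])
    also have "\<dots> \<le> ennreal (\<delta> r powr P)"
      using C(1) sobolev_norm_nonneg[of s ?w] P by (intro ennreal_leI powr_mono2) (auto simp: \<delta>_def)
    finally have WP: "(\<integral>\<^sup>+x. ennreal (norm (?w x) powr P) \<partial>lborel) \<le> ennreal (\<delta> r powr P)" .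
    have I2: "(\<integral>\<^sup>+x. ennreal (indicator (cball 0 R) x * norm (?w x) powr p) \<partial>lborel) \<le> ennreal (\<delta> r powr p * (m + 1))"
    proof -
      have "(\<integral>\<^sup>+x. ennreal (indicator (cball 0 R) x * norm (?w x) powr p) \<partial>lborel) \<le> ennreal (\<delta> r powr p * m + \<delta> r powr (p - P) * \<delta> r powr P)"
        by (rule local_power_bound[OF _ _ K WP]) (use p P d0 in auto)
      also have "\<delta> r powr p * m + \<delta> r powr (p - P) * \<delta> r powr P = \<delta> r powr p * (m + 1)"
        by (simp add: powr_add[symmetric] distrib_left)
      finally show ?thesis .
    qed
    \<comment> \<open>With this splitting parameter the two parts of the mixed term have orders
      \<delta>^(1/2) and \<delta>^((1-p)/2 + p) = \<delta>^((p+1)/2), and both tend to zero.\<close>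
    let ?l = "\<delta> r powr (1/2)"
    have l0: "?l > 0" using d0 by simp
    have I1: "(\<integral>\<^sup>+x. ennreal (indicator (cball 0 R) x * (norm (u t x) powr (p - 1) * norm (?w x))) \<partial>lborel)
      \<le> ennreal (?l * V + \<delta> r powr ((1 - p) / 2) * (\<delta> r powr p * (m + 1)))"
    proof -
      have mm: "(\<lambda>x. ennreal (indicator (cball 0 R) x * norm (u t x) powr p)) \<in> borel_measurable lborel"
        "(\<lambda>x. ennreal (indicator (cball 0 R) x * norm (?w x) powr p)) \<in> borel_measurable lborel" by measurable
      have "(\<integral>\<^sup>+x. ennreal (indicator (cball 0 R) x * (norm (u t x) powr (p - 1) * norm (?w x))) \<partial>lborel)
        \<le> (\<integral>\<^sup>+x. ennreal ?l * ennreal (indicator (cball 0 R) x * norm (u t x) powr p)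
           + ennreal (\<delta> r powr ((1 - p) / 2)) * ennreal (indicator (cball 0 R) x * norm (?w x) powr p) \<partial>lborel)"
      proof (rule nn_integral_mono)
        fix x :: 'a
        have "norm (u t x) powr (p - 1) * norm (?w x) \<le> ?l * norm (u t x) powr p + ?l powr (1 - p) * norm (?w x) powr p"
          by (rule powr_product_split) (use l0 p in auto)
        also have "?l powr (1 - p) = \<delta> r powr ((1 - p) / 2)" by (simp add: powr_powr)
        finally show "ennreal (indicator (cball 0 R) x * (norm (u t x) powr (p - 1) * norm (?w x)))
          \<le> ennreal ?l * ennreal (indicator (cball 0 R) x * norm (u t x) powr p)
           + ennreal (\<delta> r powr ((1 - p) / 2)) * ennreal (indicator (cball 0 R) x * norm (?w x) powr p)"
          by (cases "x \<in> cball 0 R") (simp_all add: ennreal_mult[symmetric] ennreal_plus[symmetric] ennreal_leI del: ennreal_plus mem_cball_0)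
      qed
      also have "\<dots> = ennreal ?l * (\<integral>\<^sup>+x. ennreal (indicator (cball 0 R) x * norm (u t x) powr p) \<partial>lborel)
           + ennreal (\<delta> r powr ((1 - p) / 2)) * (\<integral>\<^sup>+x. ennreal (indicator (cball 0 R) x * norm (?w x) powr p) \<partial>lborel)"
        using nn_integral_add[OF borel_measurable_times_ennreal[OF borel_measurable_const mm(1)] borel_measurable_times_ennreal[OF borel_measurable_const mm(2)]]
          nn_integral_cmult[OF mm(1)] nn_integral_cmult[OF mm(2)] by simp
      also have "\<dots> \<le> ennreal ?l * ennreal V + ennreal (\<delta> r powr ((1 - p) / 2)) * ennreal (\<delta> r powr p * (m + 1))"
        by (intro add_mono mult_left_mono V I2) auto
      also have "\<dots> = ennreal (?l * V + \<delta> r powr ((1 - p) / 2) * (\<delta> r powr p * (m + 1)))"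
        using V(1) K(2) by (simp add: ennreal_mult ennreal_plus)
      finally show ?thesis .
    qed
    have "norm ((LINT x|lborel. nls_nonlinearity p (u t x + ?w x) * \<psi> x) - (LINT x|lborel. nls_nonlinearity p (u t x) * \<psi> x)) \<le> g (\<delta> r)"
      unfolding g_def
    proof (rule nonlinear_pairing_diff[OF _ _ _ _ p M(2) _ _ _ _ I1 _ I2])
      show "integrable lborel (\<lambda>x. nls_nonlinearity p (u t x) * \<psi> x)"
        by (rule nonlinear_pairing_integrable[OF in_sobolev[OF t] \<psi>])
      show "integrable lborel (\<lambda>x. nls_nonlinearity p (u t x + ?w x) * \<psi> x)"
        using nonlinear_pairing_integrable[OF in_sobolev[OF r(1)] \<psi>] by simp
      show "\<psi> x = 0" if "x \<notin> cball 0 R" for x using that R(2)[of x] by auto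
    qed (use M V K in auto)
    then show ?thesis by simp
  qed
  have "((\<lambda>r. ?N r - ?N t) \<longlongrightarrow> 0) (at t within {0..T})"
  proof (rule Lim_null_comparison)
    show "\<forall>\<^sub>F r in at t within {0..T}. norm (?N r - ?N t) \<le> g (\<delta> r)"
      unfolding eventually_at_filter using bound by (intro always_eventually allI impI) auto
    have \<delta>l: "(\<delta> \<longlongrightarrow> 0) (at t within {0..T})"
    proof -
      have "((\<lambda>r. C * sobolev_norm s (\<lambda>x. u r x - u t x) + \<bar>r - t\<bar>) \<longlongrightarrow> C * 0 + \<bar>t - t\<bar>) (at t within {0..T})"
        by (intro tendsto_add tendsto_mult_left diff_tendsto[OF t] tendsto_rabs tendsto_diff tendsto_ident_at tendsto_const)
      then show ?thesis by (simp add: \<delta>_def[abs_def])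
    qed
    have \<delta>0: "\<delta> r \<ge> 0" for r
      unfolding \<delta>_def by (intro add_nonneg_nonneg mult_nonneg_nonneg sobolev_norm_nonneg abs_ge_zero C(1))
    have pw: "((\<lambda>r. \<delta> r powr c) \<longlongrightarrow> 0) (at t within {0..T})" if "c > 0" for c
      using tendsto_powr'[OF \<delta>l tendsto_const[of c]] that \<delta>0 by simp
    have geq: "g (\<delta> r) = M * nl_const p * ((\<delta> r powr (1/2) * V + \<delta> r powr ((p + 1) / 2) * (m + 1)) + \<delta> r powr p * (m + 1))" for r
    proof -
      have "\<delta> r powr ((1 - p) / 2) * \<delta> r powr p = \<delta> r powr ((p + 1) / 2)"
        by (simp add: powr_add[symmetric] field_simps)
      then show ?thesis unfolding g_def by (simp add: mult.assoc[symmetric])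
    qed
    have "((\<lambda>r. M * nl_const p * ((\<delta> r powr (1/2) * V + \<delta> r powr ((p + 1) / 2) * (m + 1)) + \<delta> r powr p * (m + 1))) \<longlongrightarrow>
      M * nl_const p * ((0 * V + 0 * (m + 1)) + 0 * (m + 1))) (at t within {0..T})"
      by (intro tendsto_mult_left tendsto_add tendsto_mult_right pw) (use p in auto)
    then show "((\<lambda>r. g (\<delta> r)) \<longlongrightarrow> 0) (at t within {0..T})" by (simp add: geq)
  qed
  then show "((\<lambda>t. ?N t) \<longlongrightarrow> ?N t) (at t within {0..T})" by (simp add: LIM_zero_iff)
qed

lemma uniformly_near:
  assumes "\<eta> > 0"
  obtains T1 where "0 < T1" "T1 < T" "\<And>t. t \<in> {0..T1} \<Longrightarrow> sobolev_norm s (\<lambda>x. u t x - u 0 x) \<le> \<eta>"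
proof -
  have "\<forall>\<^sub>F r in at 0 within {0..T}. sobolev_norm s (\<lambda>x. u r x - u 0 x) < \<eta>"
    using diff_tendsto[of 0] T assms by (intro order_tendstoD(2)) auto
  then obtain d where d: "d > 0" "\<And>r. r \<in> {0..T} \<Longrightarrow> r \<noteq> 0 \<Longrightarrow> dist r 0 < d \<Longrightarrow> sobolev_norm s (\<lambda>x. u r x - u 0 x) < \<eta>"
    unfolding eventually_at by metis
  show thesis
  proof (rule that[of "min (d / 2) (T / 2)"])
    fix t assume t: "t \<in> {0..min (d / 2) (T / 2)}"
    show "sobolev_norm s (\<lambda>x. u t x - u 0 x) \<le> \<eta>"
    proof (cases "t = 0")
      case True then show ?thesis using assms by (simp add: sobolev_norm_zero)
    next
      case False
      then show ?thesis using d(2)[of t] d(1) t T by (auto simp: dist_norm)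
    qed
  qed (use d T in auto)
qed

text \<open>Both \<open>\<Delta>u\<close> and the nonlinearity are bounded in \<open>L\<^sup>P\<close>, which is seen by duality.\<close>

lemma lipschitz_in_time:
  obtains B T1 where "B \<ge> 0" "0 < T1" "T1 < T"
    "\<And>t. 0 < t \<Longrightarrow> t < T1 \<Longrightarrow> (\<integral>\<^sup>+x. ennreal (norm (u t x - u 0 x) powr P) \<partial>lborel) \<le> ennreal ((B * t) powr P)"
proof -
  obtain T1 where T1: "0 < T1" "T1 < T" "\<And>t. t \<in> {0..T1} \<Longrightarrow> sobolev_norm s (\<lambda>x. u t x - u 0 x) \<le> 1"
    using uniformly_near[of 1] by auto
  have sub: "{0..T1} \<subseteq> {0..T}" and z: "0 \<in> {0..T}" using T1 T by auto
  \<comment> \<open>Normalized test functions are bounded in order -(s-2) rather than -s; the two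
    spare orders are spent on the Laplacian that is moved onto \<psi>.\<close>
  obtain D where D: "D \<ge> 0" "\<And>\<psi> :: 'a \<Rightarrow> complex. test_fun \<psi> \<Longrightarrow> (LINT x|lborel. norm (\<psi> x) powr (P / (P - 1))) \<le> 1 \<Longrightarrow>
      (\<integral>\<^sup>+\<xi>. ennreal ((1 + (norm \<xi>)\<^sup>2) powr (- (s - 2)) * (norm (inv_fourier \<psi> \<xi>))\<^sup>2) \<partial>lborel) \<le> ennreal D"
    using dual_sobolev[OF P(1) exponents(1)] by blast
  let ?q = "p * P"
  have q: "?q \<ge> 2" using P p mult_mono[of 1 p 2 P] by simp
  obtain C where C: "C \<ge> 0" "\<And>f :: 'a \<Rightarrow> complex. f \<in> sobolev_space s \<Longrightarrow>
      (\<integral>\<^sup>+x. ennreal (norm (f x) powr ?q) \<partial>lborel) \<le> ennreal ((C * sobolev_norm s f) powr ?q)"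
    using sobolev_embedding[OF q exponents(3)] by metis
  define N0 where "N0 = sobolev_norm s (u 0)"
  have N0: "N0 \<ge> 0" by (simp add: N0_def sobolev_norm_nonneg)
  define Q where "Q = 2 powr ?q * (C powr ?q + (C * N0) powr ?q)"
  have Q0: "Q \<ge> 0" by (simp add: Q_def)
  have uq: "(\<integral>\<^sup>+x. ennreal (norm (u t x) powr ?q) \<partial>lborel) \<le> ennreal Q" if t: "t \<in> {0..T1}" for t
  proof -
    have tT: "t \<in> {0..T}" using t sub by auto
    let ?w = "\<lambda>x. u t x - u 0 x"
    have [measurable]: "u t \<in> borel_measurable borel" "u 0 \<in> borel_measurable borel" by (intro u_measurable tT z)+
    have m: "(\<lambda>x. ennreal (norm (?w x) powr ?q)) \<in> borel_measurable lborel" "(\<lambda>x. ennreal (norm (u 0 x) powr ?q)) \<in> borel_measurable lborel" by measurable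
    have "(\<integral>\<^sup>+x. ennreal (norm (u t x) powr ?q) \<partial>lborel)
      \<le> (\<integral>\<^sup>+x. ennreal (2 powr ?q) * (ennreal (norm (?w x) powr ?q) + ennreal (norm (u 0 x) powr ?q)) \<partial>lborel)"
    proof (rule nn_integral_mono)
      fix x
      have "norm (u t x) \<le> norm (?w x) + norm (u 0 x)" using norm_triangle_ineq[of "?w x" "u 0 x"] by simp
      then have "norm (u t x) powr ?q \<le> (norm (?w x) + norm (u 0 x)) powr ?q" using q by (intro powr_mono2) auto
      also have "\<dots> \<le> 2 powr ?q * (norm (?w x) powr ?q + norm (u 0 x) powr ?q)" using q by (intro powr_sum_le) auto
      finally show "ennreal (norm (u t x) powr ?q) \<le> ennreal (2 powr ?q) * (ennreal (norm (?w x) powr ?q) + ennreal (norm (u 0 x) powr ?q))"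
        by (simp add: ennreal_mult[symmetric] ennreal_plus[symmetric] ennreal_leI del: ennreal_plus)
    qed
    also have "\<dots> = ennreal (2 powr ?q) * ((\<integral>\<^sup>+x. ennreal (norm (?w x) powr ?q) \<partial>lborel) + (\<integral>\<^sup>+x. ennreal (norm (u 0 x) powr ?q) \<partial>lborel))"
      using m by (simp add: nn_integral_cmult nn_integral_add)
    also have "\<dots> \<le> ennreal (2 powr ?q) * (ennreal (C powr ?q) + ennreal ((C * N0) powr ?q))"
    proof (intro mult_left_mono add_mono)
      have "C * sobolev_norm s ?w \<le> C * 1" using T1(3)[OF t] C(1) by (intro mult_left_mono)
      then have "(C * sobolev_norm s ?w) powr ?q \<le> C powr ?q"
        using q C(1) sobolev_norm_nonneg[of s ?w] by (intro powr_mono2) auto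
      then show "(\<integral>\<^sup>+x. ennreal (norm (?w x) powr ?q) \<partial>lborel) \<le> ennreal (C powr ?q)"
        using C(2)[OF diff_in_sobolev[OF z tT]] by (meson ennreal_leI order_trans)
      show "(\<integral>\<^sup>+x. ennreal (norm (u 0 x) powr ?q) \<partial>lborel) \<le> ennreal ((C * N0) powr ?q)"
        unfolding N0_def by (rule C(2)[OF in_sobolev[OF z]])
    qed auto
    also have "\<dots> = ennreal Q" by (simp add: Q_def ennreal_mult ennreal_plus)
    finally show ?thesis .
  qed
  \<comment> \<open>A bound for the time derivative of the pairing, the same for every normalized
    \<psi>, as duality demands. The first summand bounds the pairing with the Laplacian, writing
    u(r) as u(0) plus an increment of H^s norm at most 1; Q + 1 bounds the nonlinear pairing by
    Young's inequality, with Q for the L^(pP) integral of u and 1 for that of \<psi>.\<close>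
  define B where "B = (1 + N0) * sqrt D + (Q + 1)"
  have B0: "B \<ge> 0" using N0 D(1) Q0 by (simp add: B_def)
  have main: "norm (LINT x|lborel. (u t x - u 0 x) * \<psi> x) \<le> B * t"
    if t: "0 < t" "t < T1" and \<psi>: "test_fun \<psi>" "(LINT x|lborel. norm (\<psi> x) powr (P / (P - 1))) \<le> 1" for t \<psi>
  proof -
    let ?a = "\<lambda>t. LINT x|lborel. u t x * \<psi> x" and ?b = "\<lambda>t. LINT x|lborel. u t x * lap \<psi> x"
      and ?n = "\<lambda>t. LINT x|lborel. nls_nonlinearity p (u t x) * \<psi> x"
    have ode: "weak_ode \<kappa> T ?a ?b ?n" by (rule nls_weak_ode[OF eq sq \<psi>(1)])
    have wD: "(\<integral>\<^sup>+\<xi>. ennreal ((1 + (norm \<xi>)\<^sup>2) powr (- s) * (norm (inv_fourier (lap \<psi>) \<xi>))\<^sup>2) \<partial>lborel) \<le> ennreal D"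
      by (rule order_trans[OF lap_weight_le[OF \<psi>(1) order_refl] D(2)[OF \<psi>]])
    have nb: "norm (?b r) \<le> (1 + N0) * sqrt D" if r: "r \<in> {0..T1}" for r
    proof -
      have rT: "r \<in> {0..T}" using r sub by auto
      have "?b r = (LINT x|lborel. (u r x - u 0 x) * lap \<psi> x) + ?b 0"
        using pairing_diff[OF z rT test_fun_lap[OF \<psi>(1)]] by (simp add: algebra_simps)
      also have "norm \<dots> \<le> 1 * sqrt D + N0 * sqrt D"
      proof (rule norm_triangle_le, rule add_mono)
        have "norm (LINT x|lborel. (u r x - u 0 x) * lap \<psi> x) \<le> sobolev_norm s (\<lambda>x. u r x - u 0 x) * sqrt D"
          by (rule sobolev_pairing[OF diff_in_sobolev[OF z rT] test_fun_lap[OF \<psi>(1)] wD D(1)])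
        also have "\<dots> \<le> 1 * sqrt D" using T1(3)[OF r] D(1) by (intro mult_right_mono) auto
        finally show "norm (LINT x|lborel. (u r x - u 0 x) * lap \<psi> x) \<le> 1 * sqrt D" .
        show "norm (?b 0) \<le> N0 * sqrt D"
          unfolding N0_def by (rule sobolev_pairing[OF in_sobolev[OF z] test_fun_lap[OF \<psi>(1)] wD D(1)])
      qed
      finally show ?thesis by (simp add: distrib_right)
    qed
    have nn: "norm (?n r) \<le> Q + 1" if r: "r \<in> {0..T1}" for r
    proof -
      have rT: "r \<in> {0..T}" using r sub by auto
      have [measurable]: "u r \<in> borel_measurable borel" "\<psi> \<in> borel_measurable borel"
        by (intro u_measurable rT test_fun_measurable[OF \<psi>(1)])+
      have m: "(\<lambda>x. ennreal (norm (u r x) powr ?q)) \<in> borel_measurable lborel"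
        "(\<lambda>x. ennreal (norm (\<psi> x) powr (P / (P - 1)))) \<in> borel_measurable lborel" by measurable
      have "ennreal (norm (?n r)) \<le> (\<integral>\<^sup>+x. ennreal (norm (nls_nonlinearity p (u r x) * \<psi> x)) \<partial>lborel)"
        by (rule ennreal_norm_integral_le)
      also have "\<dots> \<le> (\<integral>\<^sup>+x. ennreal (norm (u r x) powr ?q) + ennreal (norm (\<psi> x) powr (P / (P - 1))) \<partial>lborel)"
      proof (rule nn_integral_mono)
        fix x
        have "norm (u r x) powr p * norm (\<psi> x) \<le> (norm (u r x) powr p) powr P + norm (\<psi> x) powr (P / (P - 1))"
          using P by (intro young_powr) auto
        then show "ennreal (norm (nls_nonlinearity p (u r x) * \<psi> x)) \<le> ennreal (norm (u r x) powr ?q) + ennreal (norm (\<psi> x) powr (P / (P - 1)))"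
          by (simp add: norm_mult nls_nonlinearity_norm[OF p] powr_powr ennreal_plus[symmetric] ennreal_leI del: ennreal_plus)
      qed
      also have "\<dots> = (\<integral>\<^sup>+x. ennreal (norm (u r x) powr ?q) \<partial>lborel) + (\<integral>\<^sup>+x. ennreal (norm (\<psi> x) powr (P / (P - 1))) \<partial>lborel)"
        by (rule nn_integral_add[OF m])
      also have "(\<integral>\<^sup>+x. ennreal (norm (\<psi> x) powr (P / (P - 1))) \<partial>lborel) = ennreal (LINT x|lborel. norm (\<psi> x) powr (P / (P - 1)))"
        using P by (intro nn_integral_eq_integral test_fun_powr_integrable \<psi>) (auto simp: field_simps)
      also have "(\<integral>\<^sup>+x. ennreal (norm (u r x) powr ?q) \<partial>lborel) + \<dots> \<le> ennreal Q + ennreal 1"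
        by (intro add_mono uq r ennreal_leI \<psi>)
      also have "\<dots> = ennreal (Q + 1)" using Q0 by (simp add: ennreal_plus)
      finally show ?thesis using Q0 by (subst (asm) ennreal_le_iff) auto
    qed
    have cts: "continuous_on {0..T1} ?a" "continuous_on {0..T} ?b" "continuous_on {0..T} ?n"
      using pairing_continuous[OF \<psi>(1)] pairing_continuous[OF test_fun_lap[OF \<psi>(1)]] nonlinear_continuous[OF \<psi>(1)] sub
      by (auto intro: continuous_on_subset)
    have "norm (?a t - ?a 0) \<le> B * t"
    proof (rule weak_lipschitz[OF cts(1) B0 _ t])
      fix \<theta> :: "real \<Rightarrow> complex" and l h
      assume \<theta>: "test_fun \<theta>" and l: "0 < l" and h: "h < T1" and supp: "\<And>t. t \<notin> {l..h} \<Longrightarrow> \<theta> t = 0"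
      have lh: "{l..h} \<subseteq> {0..T}" "{l..h} \<subseteq> {0..T1}" using l h T1 by auto
      have \<theta>c: "continuous_on UNIV \<theta>" "continuous_on UNIV (directional_deriv 1 \<theta>)"
        by (intro smooth_fun_continuous_on smooth_fun_dd test_fun_smooth[OF \<theta>])+
      have d0: "directional_deriv 1 \<theta> t = 0" if "t \<notin> {l..h}" for t
        by (rule directional_deriv_zero_outside[where S="{l..h}"]) (use test_fun_smooth[OF \<theta>] supp that in auto)
      have ia: "integrable lborel (\<lambda>t. directional_deriv 1 \<theta> t * ?a t)"
        by (rule continuous_mult_integrable[OF continuous_on_subset[OF cts(1) lh(2)] \<theta>c(2) d0])
      have ib: "integrable lborel (\<lambda>t. \<theta> t * ?b t)"
        by (rule continuous_mult_integrable[OF continuous_on_subset[OF cts(2) lh(1)] \<theta>c(1) supp])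
      have inn: "integrable lborel (\<lambda>t. \<theta> t * ?n t)"
        by (rule continuous_mult_integrable[OF continuous_on_subset[OF cts(3) lh(1)] \<theta>c(1) supp])
      have i\<theta>: "integrable lborel \<theta>" by (rule test_fun_integrable[OF \<theta>])
      have "(LINT t|lborel. - \<i> * directional_deriv 1 \<theta> t * ?a t - \<theta> t * ?b t) = (LINT t|lborel. of_real \<kappa> * (\<theta> t * ?n t))"
        by (rule ode[unfolded weak_ode_def, rule_format, OF \<theta> l]) (use h T1 supp in auto)
      moreover have "(LINT t|lborel. - \<i> * directional_deriv 1 \<theta> t * ?a t - \<theta> t * ?b t)
        = - \<i> * (LINT t|lborel. directional_deriv 1 \<theta> t * ?a t) - (LINT t|lborel. \<theta> t * ?b t)"
        using ia ib by (simp add: mult.assoc)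
      ultimately have e: "- \<i> * (LINT t|lborel. directional_deriv 1 \<theta> t * ?a t) = of_real \<kappa> * (LINT t|lborel. \<theta> t * ?n t) + (LINT t|lborel. \<theta> t * ?b t)"
        by (simp add: algebra_simps)
      have k: "norm (LINT t|lborel. \<theta> t * f t) \<le> K * (LINT t|lborel. norm (\<theta> t))"
        if "integrable lborel (\<lambda>t. \<theta> t * f t)" "\<And>t. t \<in> {0..T1} \<Longrightarrow> norm (f t) \<le> K" for f :: "real \<Rightarrow> complex" and K
      proof -
        have "norm (LINT t|lborel. \<theta> t * f t) \<le> (LINT t|lborel. K * norm (\<theta> t))"
        proof (rule Bochner_Integration.integral_norm_bound_integral)
          show "norm (\<theta> t * f t) \<le> K * norm (\<theta> t)" for t
          proof (cases "t \<in> {l..h}")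
            case True
            then have "norm (f t) \<le> K" using that(2) lh by auto
            from mult_left_mono[OF this norm_ge_zero[of "\<theta> t"]] show ?thesis by (simp add: norm_mult mult.commute)
          qed (simp add: supp)
        qed (use that(1) i\<theta> in auto)
        then show ?thesis by simp
      qed
      have "norm (LINT t|lborel. directional_deriv 1 \<theta> t * ?a t) = norm (- \<i> * (LINT t|lborel. directional_deriv 1 \<theta> t * ?a t))"
        by (simp add: norm_mult)
      also have "\<dots> \<le> norm (LINT t|lborel. \<theta> t * ?n t) + norm (LINT t|lborel. \<theta> t * ?b t)"
        unfolding e by (rule norm_triangle_le) (simp add: norm_mult \<kappa>)
      also have "\<dots> \<le> (Q + 1) * (LINT t|lborel. norm (\<theta> t)) + ((1 + N0) * sqrt D) * (LINT t|lborel. norm (\<theta> t))"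
        by (intro add_mono k inn ib nn nb)
      also have "\<dots> = B * (LINT t|lborel. norm (\<theta> t))" by (simp add: B_def algebra_simps)
      finally show "norm (LINT t|lborel. directional_deriv 1 \<theta> t * ?a t) \<le> B * (LINT t|lborel. norm (\<theta> t))" .
    qed
    then show ?thesis using pairing_diff[OF z _ \<psi>(1), of t] t T1 by auto
  qed
  show thesis
  proof (rule that[OF B0 T1(1,2)])
    fix t assume t: "0 < t" "t < T1"
    have tT: "t \<in> {0..T}" using t T1 by auto
    note W = sobolev_space_square_integrable[OF diff_in_sobolev[OF z tT]]
    show "(\<integral>\<^sup>+x. ennreal (norm (u t x - u 0 x) powr P) \<partial>lborel) \<le> ennreal ((B * t) powr P)"
      by (rule converse_holder[OF _ square_integrable_local[OF W] P(3)])
         (use W t B0 main in \<open>auto simp: square_integrable_def\<close>)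
  qed
qed

end

subsection \<open>Wave packets with prescribed moment\<close>

text \<open>The pairing with the odd power |y|^(p-1) y, the profile of the nonlinearity of a linear
  function. That it does not vanish on all m-th derivatives of test functions says that the profile
  is not a polynomial of degree below m.\<close>

definition moment :: "real \<Rightarrow> (real \<Rightarrow> complex) \<Rightarrow> complex" where
  "moment p \<omega> = (LINT y|lborel. nls_nonlinearity p (complex_of_real y) * \<omega> y)"

lemma of_real_borel_measurable [measurable]: "complex_of_real \<in> borel_measurable borel"
  by (intro borel_measurable_continuous_onI linear_continuous_on bounded_linear_of_real)

lemma moment_integrable:
  assumes "p > 1" "test_fun \<omega>"
  shows "integrable lborel (\<lambda>y::real. nls_nonlinearity p (complex_of_real y) * \<omega> y)"
proof -
  obtain R where R: "R > 0" "\<And>x. R < norm x \<Longrightarrow> \<omega> x = 0" using test_fun_support[OF assms(2)] by blast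
  obtain M where M: "M > 0" "\<And>x. norm (\<omega> x) \<le> M" using test_fun_bounded[OF assms(2)] by blast
  have "integrable lborel (\<lambda>x::real. indicator (cball 0 R) x * R powr p)" by (rule cball_const_integrable)
  then have "integrable lborel (\<lambda>x::real. indicator (cball 0 R) x * norm (complex_of_real x) powr p)"
    by (rule Bochner_Integration.integrable_bound)
       (use assms R in \<open>auto simp: indicator_def intro!: powr_mono2 AE_I2\<close>)
  then have "(\<integral>\<^sup>+x. ennreal (indicator (cball 0 R) x * norm (complex_of_real x) powr p) \<partial>lborel) < \<infinity>"
    by (subst nn_integral_eq_integral) auto
  then show ?thesis
    by (rule nonlinear_integrable[OF of_real_borel_measurable test_fun_measurable[OF assms(2)] assms(1) _ M(2)])
       (use R in auto)
qed

lemma nls_nonlinearity_scale: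
  assumes "p > 1" "c \<noteq> 0"
  shows "nls_nonlinearity p (of_real c * z) = of_real (sgn c * \<bar>c\<bar> powr p) * nls_nonlinearity p z"
proof -
  have "\<bar>c\<bar> powr (p - 1) * c = sgn c * \<bar>c\<bar> powr p"
    using assms by (simp add: powr_diff sgn_if)
  then show ?thesis
    by (simp add: nls_nonlinearity_def norm_mult powr_mult mult_ac of_real_mult[symmetric] del: of_real_mult)
qed

text \<open>The power -p - 1 is the homogeneity of degree p together with the Jacobian; the sign of
  \<open>c\<close> appears because the profile is odd.\<close>

lemma moment_dilation:
  assumes p: "p > 1" and c: "c \<noteq> 0" and \<omega>: "\<omega> \<in> borel_measurable borel"
  shows "moment p (\<lambda>y. \<omega> (c * y)) = of_real (sgn c * \<bar>c\<bar> powr (- p - 1)) * moment p \<omega>"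
proof -
  have [measurable]: "\<omega> \<in> borel_measurable borel" by (rule \<omega>)
  have "moment p \<omega> = \<bar>c\<bar> *\<^sub>R (LINT y|lborel. nls_nonlinearity p (complex_of_real (0 + c * y)) * \<omega> (0 + c * y))"
    unfolding moment_def by (rule lborel_integral_real_affine[OF c])
  also have "\<dots> = \<bar>c\<bar> *\<^sub>R (of_real (sgn c * \<bar>c\<bar> powr p) * moment p (\<lambda>y. \<omega> (c * y)))"
    using c by (simp add: nls_nonlinearity_scale[OF p c] moment_def mult.assoc)
  finally have "moment p \<omega> = of_real (\<bar>c\<bar> * (sgn c * \<bar>c\<bar> powr p)) * moment p (\<lambda>y. \<omega> (c * y))"
    by (simp add: scaleR_conv_of_real mult.assoc)
  moreover have "(sgn c * \<bar>c\<bar> powr (- p - 1)) * (\<bar>c\<bar> * (sgn c * \<bar>c\<bar> powr p)) = 1"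
  proof -
    have "\<bar>c\<bar> powr (- p - 1) * (\<bar>c\<bar> * \<bar>c\<bar> powr p) = 1"
      using c by (simp add: powr_mult_base powr_add[symmetric])
    moreover have "sgn c * sgn c = 1" using c by (simp add: sgn_if)
    moreover have "(sgn c * \<bar>c\<bar> powr (- p - 1)) * (\<bar>c\<bar> * (sgn c * \<bar>c\<bar> powr p))
      = (sgn c * sgn c) * (\<bar>c\<bar> powr (- p - 1) * (\<bar>c\<bar> * \<bar>c\<bar> powr p))" by (simp only: mult_ac)
    ultimately show ?thesis by simp
  qed
  ultimately have "of_real (sgn c * \<bar>c\<bar> powr (- p - 1)) * moment p \<omega> = of_real 1 * moment p (\<lambda>y. \<omega> (c * y))"
    by (simp only: mult.assoc[symmetric] of_real_mult[symmetric])
  then show ?thesis by simp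
qed

lemma funpow_directional_deriv_dilation:
  fixes \<omega> :: "real \<Rightarrow> complex"
  assumes "smooth_fun \<omega>"
  shows "(directional_deriv 1 ^^ m) (\<lambda>y. \<omega> (c * y)) = (\<lambda>y. of_real (c ^ m) * (directional_deriv 1 ^^ m) \<omega> (c * y))"
proof (induction m)
  case (Suc m)
  let ?g = "(directional_deriv 1 ^^ m) \<omega>"
  have sm: "smooth_fun ?g" using assms by (induction m) (auto intro: smooth_fun_dd)
  have L: "bounded_linear (\<lambda>y. c * y)" by (rule bounded_linear_mult_right)
  have sm2: "smooth_fun (\<lambda>y. ?g (c * y))" by (rule smooth_fun_linear_arg[OF L sm])
  have "directional_deriv 1 (\<lambda>y. of_real (c ^ m) * ?g (c * y)) y = of_real (c ^ Suc m) * directional_deriv 1 ?g (c * y)" for y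
  proof -
    have "directional_deriv 1 (\<lambda>y. of_real (c ^ m) * ?g (c * y)) y = of_real (c ^ m) * directional_deriv 1 (\<lambda>y. ?g (c * y)) y"
      using directional_deriv_mult[OF smooth_fun_differentiable[OF smooth_fun_const] smooth_fun_differentiable[OF sm2]] by simp
    also have "directional_deriv 1 (\<lambda>y. ?g (c * y)) y = directional_deriv c ?g (c * y)"
      using directional_deriv_compose_linear[OF L, where c=0 and v=1] smooth_fun_differentiable[OF sm] by simp
    also have "directional_deriv c ?g (c * y) = of_real c * directional_deriv 1 ?g (c * y)"
      using linear_scale[OF has_derivative_linear[OF smooth_fun_has_derivative[OF sm, of "c * y"]], of c 1] by (simp add: scaleR_conv_of_real)
    finally show ?thesis by simp
  qed
  then show ?case unfolding funpow.simps o_apply Suc by (intro ext)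
qed simp

lemma smooth_fun_funpow: "smooth_fun f \<Longrightarrow> smooth_fun ((directional_deriv v ^^ m) f)"
  by (induction m) (auto intro: smooth_fun_dd)

lemma funpow_directional_deriv_diff:
  assumes "smooth_fun f" "smooth_fun g"
  shows "(directional_deriv v ^^ m) (\<lambda>x. f x - c * g x) = (\<lambda>x. (directional_deriv v ^^ m) f x - c * (directional_deriv v ^^ m) g x)"
proof (induction m)
  case (Suc m)
  let ?f = "(directional_deriv v ^^ m) f" and ?g = "(directional_deriv v ^^ m) g"
  have sm: "smooth_fun ?f" "smooth_fun ?g" by (intro smooth_fun_funpow assms)+
  have "directional_deriv v (\<lambda>x. ?f x - c * ?g x) x = directional_deriv v ?f x - c * directional_deriv v ?g x" for x
  proof -
    have "directional_deriv v (\<lambda>x. ?f x - c * ?g x) x = directional_deriv v ?f x - directional_deriv v (\<lambda>x. c * ?g x) x"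
      by (intro directional_deriv_diff smooth_fun_differentiable sm smooth_fun_mult smooth_fun_const)
    moreover have "directional_deriv v (\<lambda>x. c * ?g x) x = c * directional_deriv v ?g x"
      using directional_deriv_mult[OF smooth_fun_differentiable[OF smooth_fun_const] smooth_fun_differentiable[OF sm(2)]] by simp
    ultimately show ?thesis by simp
  qed
  then show ?case unfolding funpow.simps o_apply Suc by (intro ext)
qed simp

text \<open>This is the only place where \<open>p - 1 \<notin> 2\<nat>\<close> is used. A test function with non-vanishing
  moment against \<open>\<omega>\<^bsup>(m)\<^esup>\<close> is improved to one for \<open>m + 1\<close> by subtracting a dilation
  (a reflection, if \<open>m = p\<close>) so that the mean vanishes, and integrating.\<close>

lemma moment_nonvanishing:
  assumes p: "p > 1" and np: "\<not> (\<exists>k::nat. k \<ge> 1 \<and> p - 1 = 2 * real k)"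
  shows "\<exists>\<omega>. test_fun \<omega> \<and> moment p ((directional_deriv 1 ^^ m) \<omega>) \<noteq> 0"
proof (induction m)
  case 0
  obtain g :: "real \<Rightarrow> real" where g: "smooth_fun (\<lambda>x. complex_of_real (g x))"
    "\<And>x. 0 \<le> g x" "\<And>x. 0 < x \<Longrightarrow> x < 1 \<Longrightarrow> 0 < g x" "\<And>x. x \<notin> {0<..<1} \<Longrightarrow> g x = 0"
    by (rule bump_exists) (rule that, assumption+)
  have t: "test_fun (\<lambda>x. complex_of_real (g x))"
  proof (rule test_funI[OF g(1), where R=1])
    fix x :: real assume "1 < norm x"
    then have "x \<notin> {0<..<1}" by auto
    then have "g x = 0" by (rule g(4))
    then show "complex_of_real (g x) = 0" by simp
  qed
  let ?f = "\<lambda>y. \<bar>y\<bar> powr (p - 1) * y * g y"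
  have f0: "0 \<le> ?f y" for y
  proof (cases "y \<in> {0<..<1}")
    case False
    then have "g y = 0" by (rule g(4))
    then show ?thesis by simp
  qed (use g(2) in auto)
  have eq: "nls_nonlinearity p (complex_of_real y) * complex_of_real (g y) = complex_of_real (?f y)" for y
    by (simp add: nls_nonlinearity_def)
  have int: "integrable lborel ?f"
    using moment_integrable[OF p t] unfolding eq by (simp only: complex_of_real_integrable_eq)
  have "(LINT y|lborel. ?f y) \<noteq> 0"
  proof
    assume "(LINT y|lborel. ?f y) = 0"
    then have "AE y in lborel. ?f y = 0" using integral_nonneg_eq_0_iff_AE[OF int] f0 by simp
    then have "AE y::real in lborel. y \<notin> {0<..<1}"
    proof eventually_elim
      case (elim y)
      then show ?case using g(3)[of y] by auto
    qed
    then have "{0<..<1::real} \<in> null_sets lborel" by (subst AE_iff_null_sets) auto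
    then show False by (auto dest: null_setsD1)
  qed
  moreover have "moment p (\<lambda>x. complex_of_real (g x)) = complex_of_real (LINT y|lborel. ?f y)"
    unfolding moment_def eq by (rule Bochner_Integration.integral_complex_of_real)
  ultimately have "moment p (\<lambda>x. complex_of_real (g x)) \<noteq> 0" by (simp only: of_real_eq_0_iff not_False_eq_True)
  with t show ?case by auto
next
  case (Suc m)
  then obtain \<omega> where \<omega>: "test_fun \<omega>" "moment p ((directional_deriv 1 ^^ m) \<omega>) \<noteq> 0" by blast
  have sm: "smooth_fun \<omega>" by (rule test_fun_smooth[OF \<omega>(1)])
  \<comment> \<open>The new moment will be the old one times 1 - c^m sgn(c) |c|^(-p), so
    \<open>c\<close> has to avoid the zero of this factor. c = 2 works unless p = m. In that case
    \<open>m\<close> is even, since m = 2k + 1 would give p - 1 = 2k, and the reflection c = -1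
    yields the factor 2.\<close>
  obtain c :: real where c: "c \<noteq> 0" "c ^ m * (sgn c * \<bar>c\<bar> powr (- p)) \<noteq> 1"
  proof (cases "p = real m")
    case False
    have "(2::real) ^ m * 2 powr (- p) = 2 powr (real m - p)"
      by (simp add: powr_realpow[symmetric] powr_add[symmetric])
    moreover have "2 powr (real m - p) \<noteq> (1::real)" using False by (simp add: powr_eq_one_iff_gen)
    ultimately show thesis by (intro that[of 2]) auto
  next
    case True
    have "even m"
    proof (rule ccontr)
      assume "odd m"
      then obtain k where k: "m = 2 * k + 1" by (rule oddE)
      then have "k \<ge> 1" "p - 1 = 2 * real k" using True p by auto
      then show False using np by blast
    qed
    then show thesis by (intro that[of "-1"]) auto
  qed
  \<comment> \<open>The coefficient |c| is the Jacobian of the dilation. It makes the mean vanish,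
    so that \<open>\<omega>1\<close> has a primitive among the test functions.\<close>
  define \<omega>1 where "\<omega>1 y = \<omega> y - of_real \<bar>c\<bar> * \<omega> (c * y)" for y
  have tc: "test_fun (\<lambda>y. \<omega> (c * y))" using test_fun_affine[OF \<omega>(1) c(1), of 0] by simp
  have t1: "test_fun \<omega>1" unfolding \<omega>1_def by (intro test_fun_diff test_fun_cmult tc \<omega>(1))
  have "(LINT y|lborel. \<omega>1 y) = (LINT y|lborel. \<omega> y) - of_real \<bar>c\<bar> * (LINT y|lborel. \<omega> (c * y))"
    unfolding \<omega>1_def using test_fun_integrable[OF \<omega>(1)] test_fun_integrable[OF tc] by simp
  also have "(LINT y|lborel. \<omega> y) = of_real \<bar>c\<bar> * (LINT y|lborel. \<omega> (c * y))"
    using lborel_integral_real_affine[OF c(1), of \<omega> 0] by (simp add: scaleR_conv_of_real)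
  finally have z: "(LINT y|lborel. \<omega>1 y) = 0" by simp
  obtain F where F: "test_fun F" "directional_deriv 1 F = \<omega>1" by (rule test_antiderivative[OF t1 z])
  let ?D = "(directional_deriv 1 ^^ m) \<omega>"
  have tD1: "test_fun ?D" by (rule test_fun_funpow[OF \<omega>(1)])
  then have tD: "test_fun ?D" "test_fun (\<lambda>y. ?D (c * y))"
    using test_fun_affine[OF tD1 c(1), of 0] by simp_all
  have "(directional_deriv 1 ^^ Suc m) F = (directional_deriv 1 ^^ m) \<omega>1"
    by (simp add: funpow_swap1 F(2))
  also have "\<dots> = (\<lambda>y. ?D y - of_real \<bar>c\<bar> * (of_real (c ^ m) * ?D (c * y)))"
    unfolding \<omega>1_def[abs_def] funpow_directional_deriv_diff[OF sm test_fun_smooth[OF tc]]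
      funpow_directional_deriv_dilation[OF sm] ..
  finally have DF: "(directional_deriv 1 ^^ Suc m) F = (\<lambda>y. ?D y - of_real \<bar>c\<bar> * (of_real (c ^ m) * ?D (c * y)))" .
  have "moment p ((directional_deriv 1 ^^ Suc m) F) = moment p ?D - of_real \<bar>c\<bar> * (of_real (c ^ m) * moment p (\<lambda>y. ?D (c * y)))"
  proof -
    let ?N = "\<lambda>y. nls_nonlinearity p (complex_of_real y)"
    have "?N y * (?D y - of_real \<bar>c\<bar> * (of_real (c ^ m) * ?D (c * y)))
      = ?N y * ?D y - (of_real \<bar>c\<bar> * of_real (c ^ m)) * (?N y * ?D (c * y))" for y
      by (simp only: right_diff_distrib mult_ac)
    then show ?thesis
      unfolding DF moment_def using moment_integrable[OF p tD(1)] moment_integrable[OF p tD(2)]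
      by (simp add: mult.assoc)
  qed
  also have "moment p (\<lambda>y. ?D (c * y)) = of_real (sgn c * \<bar>c\<bar> powr (- p - 1)) * moment p ?D"
    by (rule moment_dilation[OF p c(1) test_fun_measurable[OF tD(1)]])
  also have "moment p ?D - of_real \<bar>c\<bar> * (of_real (c ^ m) * (of_real (sgn c * \<bar>c\<bar> powr (- p - 1)) * moment p ?D))
    = of_real (1 - \<bar>c\<bar> * (c ^ m * (sgn c * \<bar>c\<bar> powr (- p - 1)))) * moment p ?D"
    by (simp add: algebra_simps)
  also have "\<bar>c\<bar> * (c ^ m * (sgn c * \<bar>c\<bar> powr (- p - 1))) = c ^ m * (sgn c * \<bar>c\<bar> powr (- p))"
    using c(1) powr_mult_base[of "\<bar>c\<bar>" "- p - 1"] by (simp add: mult.left_commute)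
  finally have "moment p ((directional_deriv 1 ^^ Suc m) F) \<noteq> 0" using c(2) \<omega>(2) by (simp only: mult_eq_0_iff of_real_eq_0_iff) simp
  with F(1) show ?case by blast
qed

lemma funpow_directional_deriv_zero_outside:
  assumes "smooth_fun f" "closed S" "\<And>x. x \<notin> S \<Longrightarrow> f x = 0" "x \<notin> S"
  shows "(directional_deriv v ^^ m) f x = 0"
  using assms(4)
proof (induction m arbitrary: x)
  case (Suc m)
  show ?case using directional_deriv_zero_outside[OF smooth_fun_funpow[OF assms(1)] assms(2) Suc.IH Suc.prems] by simp
qed (simp add: assms(3))

text \<open>Everything the contradiction uses about the packets. In 2\<sigma> + 1 the power
  2\<sigma> comes from the derivatives of the profile and the extra 1 from the volume O(r) of the
  slab \<open>K r\<close>. The power r^(p+1) is the homogeneity r^p of the profile times the width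
  r, and the last identity is harmonicity of x \<bullet> b. The constants are independent of r and
  of any solution; \<open>L\<close> is the size of the box on which the datum has to be
  linear.\<close>

lemma packets_exist:
  fixes b :: "'a::euclidean_space"
  assumes p: "p > 1" and np: "\<not> (\<exists>k::nat. k \<ge> 1 \<and> p - 1 = 2 * real k)" and b: "b \<in> Basis"
  obtains L C M :: real and z :: complex and \<psi> :: "real \<Rightarrow> 'a \<Rightarrow> complex" and K :: "real \<Rightarrow> 'a set" where
    "L > 0" "C > 0" "M > 0" "z \<noteq> 0"
    "\<And>r. 0 < r \<Longrightarrow> test_fun (\<psi> r)" "\<And>r x. norm (\<psi> r x) \<le> M" "\<And>r x. 0 < r \<Longrightarrow> x \<notin> K r \<Longrightarrow> \<psi> r x = 0"
    "\<And>r. closed (K r)" "\<And>r. 0 < r \<Longrightarrow> emeasure lborel (K r) \<le> ennreal (C * r)"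
    "\<And>r x. x \<in> K r \<Longrightarrow> \<bar>x \<bullet> b\<bar> \<le> L * r" "\<And>r x i. 0 < r \<Longrightarrow> r \<le> 1 \<Longrightarrow> x \<in> K r \<Longrightarrow> i \<in> Basis \<Longrightarrow> \<bar>x \<bullet> i\<bar> \<le> L"
    "\<And>r \<sigma>. 0 < r \<Longrightarrow> 0 \<le> \<sigma> \<Longrightarrow> \<sigma> \<le> p + 5 / 2 \<Longrightarrow>
      (\<integral>\<^sup>+\<xi>. ennreal ((1 + (norm \<xi>)\<^sup>2) powr (- \<sigma>) * (norm (inv_fourier (\<psi> r) \<xi>))\<^sup>2) \<partial>lborel) \<le> ennreal (C * r powr (2 * \<sigma> + 1))"
    "\<And>r. 0 < r \<Longrightarrow> (LINT x|lborel. nls_nonlinearity p (of_real (x \<bullet> b)) * \<psi> r x) = of_real (r powr (p + 1)) * z"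
    "\<And>r. 0 < r \<Longrightarrow> (LINT x|lborel. of_real (x \<bullet> b) * lap (\<psi> r) x) = 0"
proof -
  \<comment> \<open>The negative Sobolev bound holds for 0 \<le> \<sigma> \<le> m and will be
    applied up to \<sigma> = p + 5/2.\<close>
  obtain m :: nat where m: "p + 5 / 2 \<le> real m" using real_arch_simple by blast
  obtain \<omega> where \<omega>: "test_fun \<omega>" "moment p ((directional_deriv 1 ^^ m) \<omega>) \<noteq> 0"
    using moment_nonvanishing[OF p np] by blast
  have \<omega>s: "smooth_fun \<omega>" by (rule test_fun_smooth[OF \<omega>(1)])
  let ?D = "(directional_deriv 1 ^^ m) \<omega>"
  have Dt: "test_fun ?D" by (rule test_fun_funpow[OF \<omega>(1)])
  obtain R where R: "R > 0" "\<And>y. R < norm y \<Longrightarrow> \<omega> y = 0" using test_fun_support[OF \<omega>(1)] by blast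
  have D0: "?D y = 0" if "R < \<bar>y\<bar>" for y
    by (rule funpow_directional_deriv_zero_outside[OF \<omega>s, where S="cball 0 R"]) (use R that in auto)
  obtain M1 where M1: "M1 > 0" "\<And>y. norm (\<omega> y) \<le> M1" using test_fun_bounded[OF \<omega>(1)] by blast
  obtain M2 where M2: "M2 > 0" "\<And>y. norm (?D y) \<le> M2" using test_fun_bounded[OF Dt] by blast
  obtain H h where step: "smooth_step H h" by (rule smooth_step_obtain)
  note Hh = smooth_stepD[OF step]
  define \<beta> where "\<beta> y = complex_of_real (h y)" for y
  have \<beta>s: "smooth_fun \<beta>" unfolding \<beta>_def[abs_def] by (rule Hh(2))
  have \<beta>0: "\<beta> y = 0" if "1 < \<bar>y\<bar>" for y
  proof -
    have "y \<notin> {0<..<1}" using that by auto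
    then show ?thesis using Hh(5) by (simp add: \<beta>_def)
  qed
  have \<beta>t: "test_fun \<beta>" by (rule test_funI[OF \<beta>s, where R=1]) (simp add: \<beta>0)
  have \<beta>int: "(LINT y|lborel. \<beta> y) = 1"
  proof -
    \<comment> \<open>With c = -1 and \<epsilon> = 1 the window is \<open>h\<close> itself, which
      gives its total mass.\<close>
    have "(LINT t|lborel. h ((t - (- 1)) / 1 - 1) / 1) = 1" by (rule smooth_window(5)[OF step]) simp
    then have "complex_of_real (LINT t|lborel. h t) = 1" by simp
    then show ?thesis unfolding \<beta>_def[abs_def] by (simp only: Bochner_Integration.integral_complex_of_real)
  qed
  obtain M3 where M3: "M3 > 0" "\<And>y. norm (\<beta> y) \<le> M3" using test_fun_bounded[OF \<beta>t] by blast
  let ?d = "DIM('a)"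
  define \<eta> where "\<eta> x = (\<Prod>i\<in>Basis - {b}. \<beta> (x \<bullet> i))" for x :: 'a
  have \<eta>s: "smooth_fun \<eta>"
    unfolding \<eta>_def[abs_def] by (intro smooth_fun_prod smooth_fun_compose[OF \<beta>s] smooth_fun_inner)
  define M where "M = max M1 M2 * (max 1 M3) ^ ?d"
  have M: "M > 0" using M1 by (simp add: M_def)
  have \<eta>M: "norm (\<eta> x) \<le> (max 1 M3) ^ ?d" for x
  proof -
    have "norm (\<eta> x) \<le> (\<Prod>i\<in>Basis - {b}. max 1 M3)"
      unfolding \<eta>_def prod_norm[symmetric] by (intro prod_mono) (use M3(2) in \<open>auto simp: le_max_iff_disj\<close>)
    also have "\<dots> = (max 1 M3) ^ card (Basis - {b})" by simp
    also have "\<dots> \<le> (max 1 M3) ^ ?d" by (intro power_increasing card_mono) auto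
    finally show ?thesis .
  qed
  \<comment> \<open>\<open>X\<close> carries the undifferentiated profile. As \<open>\<eta>\<close>
    does not depend on x \<bullet> b, the m-th derivative of \<open>X r\<close> along
    \<open>b\<close> is r^(-m) times the packet, the relation asked for by
    \<open>packet_negative_sobolev\<close>.\<close>
  define X where "X r x = \<omega> (x \<bullet> b / r) * \<eta> x" for r and x :: 'a
  define \<psi> where "\<psi> r x = ?D (x \<bullet> b / r) * \<eta> x" for r and x :: 'a
  define K where "K r = {x::'a. \<bar>x \<bullet> b\<bar> \<le> R * r \<and> (\<forall>i\<in>Basis - {b}. \<bar>x \<bullet> i\<bar> \<le> 1)}" for r
  have Kcbox: "K r = cbox (\<Sum>i\<in>Basis. (if i = b then - R * r else - 1) *\<^sub>R i) (\<Sum>i\<in>Basis. (if i = b then R * r else 1) *\<^sub>R i)" for r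
  proof (rule set_eqI)
    fix x :: 'a
    have "(x \<in> cbox (\<Sum>i\<in>Basis. (if i = b then - R * r else - 1) *\<^sub>R i) (\<Sum>i\<in>Basis. (if i = b then R * r else 1) *\<^sub>R i))
      \<longleftrightarrow> (\<forall>i\<in>Basis. (if i = b then - R * r else - 1) \<le> x \<bullet> i \<and> x \<bullet> i \<le> (if i = b then R * r else 1))"
      unfolding mem_box by (intro ball_cong refl) (simp add: inner_sum_left_Basis del: if_split)
    then show "x \<in> K r \<longleftrightarrow> x \<in> cbox (\<Sum>i\<in>Basis. (if i = b then - R * r else - 1) *\<^sub>R i) (\<Sum>i\<in>Basis. (if i = b then R * r else 1) *\<^sub>R i)"
      using b by (auto simp: K_def abs_le_iff)
  qed
  have Kclosed: "closed (K r)" for r unfolding Kcbox by (rule closed_cbox)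
  define CK where "CK = 2 * R * 2 ^ ?d"
  have CK: "CK > 0" using R by (simp add: CK_def)
  have Kmeas: "emeasure lborel (K r) \<le> ennreal (CK * r)" if r: "r > 0" for r
  proof -
    let ?l = "\<Sum>i\<in>Basis. (if i = b then - R * r else - 1) *\<^sub>R i :: 'a" and ?u = "\<Sum>i\<in>Basis. (if i = b then R * r else 1) *\<^sub>R i :: 'a"
    have le: "?l \<bullet> i \<le> ?u \<bullet> i" if "i \<in> Basis" for i using that R r by (simp add: inner_sum_left_Basis)
    have "(\<Prod>i\<in>Basis. (?u - ?l) \<bullet> i) = (\<Prod>i\<in>Basis. if i = b then 2 * R * r else 2)"
      by (rule prod.cong) (auto simp: inner_diff_left inner_sum_left_Basis)
    also have "\<dots> = (2 * R * r) * (\<Prod>i\<in>Basis - {b}. 2)"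
      using b by (subst prod.remove[OF finite_Basis b]) (auto intro!: prod.cong)
    also have "\<dots> = (2 * R * r) * 2 ^ card (Basis - {b})" by simp
    also have "\<dots> \<le> (2 * R * r) * 2 ^ ?d" using R r by (intro mult_left_mono power_increasing card_mono) auto
    also have "\<dots> = CK * r" by (simp add: CK_def)
    finally show ?thesis unfolding Kcbox using le by (subst emeasure_lborel_cbox) (auto intro: ennreal_leI)
  qed
  have off: "x \<bullet> b / r \<notin> cball 0 R \<or> \<eta> x = 0" if r0: "r > 0" and xK: "x \<notin> K r" for r x
  proof (cases "\<bar>x \<bullet> b\<bar> \<le> R * r")
    case True
    then obtain i where i: "i \<in> Basis - {b}" "1 < \<bar>x \<bullet> i\<bar>" using xK by (auto simp: K_def not_le)
    then have "\<eta> x = 0" unfolding \<eta>_def using \<beta>0[OF i(2)] by (intro prod_zero) auto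
    then show ?thesis ..
  next
    case False
    then show ?thesis using r0 by (simp add: abs_divide pos_divide_le_eq)
  qed
  have X0: "X r x = 0" if "r > 0" "x \<notin> K r" for r x
    using off[OF that] R(2)[of "x \<bullet> b / r"] by (auto simp: X_def)
  have \<psi>0: "\<psi> r x = 0" if "r > 0" "x \<notin> K r" for r x
    using off[OF that] D0[of "x \<bullet> b / r"] by (auto simp: \<psi>_def)
  have sarg: "smooth_fun (\<lambda>x::'a. complex_of_real (x \<bullet> b / r))" for r
    using smooth_fun_mult[OF smooth_fun_inner[of b] smooth_fun_const[of "complex_of_real (1 / r)"]] by simp
  have Xs: "smooth_fun (X r)" for r
    unfolding X_def[abs_def] by (intro smooth_fun_mult smooth_fun_compose[OF \<omega>s sarg] \<eta>s)
  have Kb: "norm x \<le> R * r + real ?d" if "x \<in> K r" "r > 0" for r x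
  proof -
    have "norm x \<le> (\<Sum>i\<in>Basis. \<bar>x \<bullet> i\<bar>)" by (rule norm_le_l1)
    also have "\<dots> = \<bar>x \<bullet> b\<bar> + (\<Sum>i\<in>Basis - {b}. \<bar>x \<bullet> i\<bar>)" by (rule sum.remove[OF finite_Basis b])
    also have "\<dots> \<le> R * r + (\<Sum>i\<in>(Basis::'a set) - {b}. 1)" using that by (intro add_mono sum_mono) (auto simp: K_def)
    also have "\<dots> \<le> R * r + real ?d" by (simp add: card_mono Diff_subset del: One_nat_def card_Diff_singleton)
    finally show ?thesis .
  qed
  have Xt: "test_fun (X r)" if "r > 0" for r
  proof (rule test_funI[OF Xs, where R="R * r + real ?d"])
    fix x :: 'a assume "R * r + real ?d < norm x"
    then have "x \<notin> K r" using Kb[OF _ that] by force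
    then show "X r x = 0" by (rule X0[OF that])
  qed
  have XM: "norm (X r x) \<le> M" and \<psi>M: "norm (\<psi> r x) \<le> M" for r x
  proof -
    have "norm (X r x) \<le> max M1 M2 * (max 1 M3) ^ ?d"
      unfolding X_def norm_mult using M1 by (intro mult_mono \<eta>M) (auto simp: le_max_iff_disj)
    then show "norm (X r x) \<le> M" by (simp add: M_def)
    have "norm (\<psi> r x) \<le> max M1 M2 * (max 1 M3) ^ ?d"
      unfolding \<psi>_def norm_mult using M1 M2 by (intro mult_mono \<eta>M) (auto simp: le_max_iff_disj)
    then show "norm (\<psi> r x) \<le> M" by (simp add: M_def)
  qed
  have d\<eta>: "directional_deriv b \<eta> x = 0" for x
  proof -
    have "((\<lambda>t. \<eta> (x + t *\<^sub>R b)) has_vector_derivative directional_deriv b \<eta> (x + 0 *\<^sub>R b)) (at 0)"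
      by (rule smooth_fun_vector_derivative_line[OF \<eta>s])
    moreover have "(\<lambda>t. \<eta> (x + t *\<^sub>R b)) = (\<lambda>t. \<eta> x)"
      unfolding \<eta>_def using b by (intro ext prod.cong) (auto simp: inner_add_left inner_not_same_Basis)
    ultimately have "((\<lambda>t::real. \<eta> x) has_vector_derivative directional_deriv b \<eta> x) (at 0)" by simp
    then show ?thesis using vector_derivative_unique_at[OF _ has_vector_derivative_const] by blast
  qed
  have XD: "(directional_deriv b ^^ k) (X r) = (\<lambda>x. of_real ((1 / r) ^ k) * ((directional_deriv 1 ^^ k) \<omega> (x \<bullet> b / r) * \<eta> x))" for k r
  proof (induction k)
    case 0
    then show ?case by (simp add: X_def[abs_def])
  next
    case (Suc k)
    let ?g = "(directional_deriv 1 ^^ k) \<omega>"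
    have gs: "smooth_fun ?g" by (rule smooth_fun_funpow[OF \<omega>s])
    have gs': "smooth_fun (\<lambda>x::'a. ?g (x \<bullet> b / r))" by (rule smooth_fun_compose[OF gs sarg])
    have L: "bounded_linear (\<lambda>x::'a. x \<bullet> b / r)"
      by (intro bounded_linear_compose[OF bounded_linear_divide bounded_linear_inner_left])
    have g1: "directional_deriv b (\<lambda>x::'a. ?g (x \<bullet> b / r)) x = of_real (1 / r) * directional_deriv 1 ?g (x \<bullet> b / r)" for x
    proof -
      have "directional_deriv b (\<lambda>x::'a. ?g (x \<bullet> b / r)) x = directional_deriv (b \<bullet> b / r) ?g (x \<bullet> b / r)"
        using directional_deriv_compose_linear[OF L, where c=0 and v=b and f="?g" and x=x] smooth_fun_differentiable[OF gs] by simp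
      also have "\<dots> = of_real (1 / r) * directional_deriv 1 ?g (x \<bullet> b / r)"
        using linear_scale[OF has_derivative_linear[OF smooth_fun_has_derivative[OF gs, of "x \<bullet> b / r"]], of "1 / r" 1] b
        by (simp add: scaleR_conv_of_real)
      finally show ?thesis .
    qed
    have "directional_deriv b (\<lambda>x. of_real ((1 / r) ^ k) * (?g (x \<bullet> b / r) * \<eta> x)) x
      = of_real ((1 / r) ^ Suc k) * (directional_deriv 1 ?g (x \<bullet> b / r) * \<eta> x)" for x
    proof -
      have "directional_deriv b (\<lambda>x. of_real ((1 / r) ^ k) * (?g (x \<bullet> b / r) * \<eta> x)) x
        = of_real ((1 / r) ^ k) * directional_deriv b (\<lambda>x. ?g (x \<bullet> b / r) * \<eta> x) x"
        using directional_deriv_mult[OF smooth_fun_differentiable[OF smooth_fun_const] smooth_fun_differentiable[OF smooth_fun_mult[OF gs' \<eta>s]]] by simp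
      also have "directional_deriv b (\<lambda>x. ?g (x \<bullet> b / r) * \<eta> x) x = directional_deriv b (\<lambda>x. ?g (x \<bullet> b / r)) x * \<eta> x"
        using directional_deriv_mult[OF smooth_fun_differentiable[OF gs'] smooth_fun_differentiable[OF \<eta>s], of b x] by (simp add: d\<eta>)
      finally show ?thesis by (simp add: g1)
    qed
    then show ?case unfolding funpow.simps o_apply Suc by (intro ext)
  qed
  have \<psi>X: "\<psi> r = (\<lambda>x. of_real (r ^ m) * (directional_deriv b ^^ m) (X r) x)" if "r > 0" for r
  proof
    fix x
    have "complex_of_real (r ^ m) * of_real ((1 / r) ^ m) = 1"
      unfolding of_real_mult[symmetric] power_mult_distrib[symmetric] using that by simp
    then show "\<psi> r x = of_real (r ^ m) * (directional_deriv b ^^ m) (X r) x"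
      unfolding XD mult.assoc[symmetric] by (simp add: \<psi>_def)
  qed
  have \<psi>t: "test_fun (\<psi> r)" if "r > 0" for r
    unfolding \<psi>X[OF that] by (intro test_fun_cmult test_fun_funpow Xt that)
  \<comment> \<open>\<open>X r\<close> and \<open>\<psi> r\<close> are bounded by \<open>M\<close>
    and live on a slab of volume O(r), which is the source of the additional power of r.\<close>
  have L2: "(LINT x|lborel. (norm (f x))\<^sup>2) \<le> M\<^sup>2 * (CK * r)"
    if "r > 0" "test_fun f" "\<And>x. norm (f x) \<le> M" "\<And>x. x \<notin> K r \<Longrightarrow> f x = 0" for f :: "'a \<Rightarrow> complex" and r
  proof -
    have Ki: "integrable lborel (indicator (K r) :: 'a \<Rightarrow> real)"
      by (rule indicator_bounded_integrable) (auto simp: Kcbox)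
    have "(LINT x|lborel. (norm (f x))\<^sup>2) \<le> (LINT x|lborel. M\<^sup>2 * indicator (K r) x)"
    proof (rule integral_mono)
      show "integrable lborel (\<lambda>x. (norm (f x))\<^sup>2)" by (rule test_fun_square_integrable[OF that(2)])
      show "(norm (f x))\<^sup>2 \<le> M\<^sup>2 * indicator (K r) x" for x
        using power_mono[OF that(3)[of x], of 2] that(4)[of x] by (cases "x \<in> K r") auto
    qed (use Ki in simp)
    also have "\<dots> = M\<^sup>2 * measure lborel (K r)" by simp
    also have "measure lborel (K r) \<le> CK * r"
      using Kmeas[OF that(1)] CK that(1) unfolding measure_def by (intro enn2real_leI) auto
    finally show ?thesis by (simp add: mult_left_mono)
  qed
  define C where "C = max CK (2 * M\<^sup>2 * CK)"
  have C: "C > 0" "CK \<le> C" "2 * M\<^sup>2 * CK \<le> C" using CK by (auto simp: C_def)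
  show thesis
  proof (rule that[of "max R 1" C M "moment p ?D" \<psi> K])
    show "max R 1 > 0" "C > 0" "M > 0" "moment p ?D \<noteq> 0" using R C M \<omega> by auto
    show "test_fun (\<psi> r)" if "0 < r" for r by (rule \<psi>t[OF that])
    show "norm (\<psi> r x) \<le> M" for r x by (rule \<psi>M)
    show "\<psi> r x = 0" if "0 < r" "x \<notin> K r" for r x by (rule \<psi>0[OF that])
    show "closed (K r)" for r by (rule Kclosed)
    show "emeasure lborel (K r) \<le> ennreal (C * r)" if "0 < r" for r
      by (rule order_trans[OF Kmeas[OF that]]) (use C that in \<open>auto intro!: ennreal_leI mult_right_mono\<close>)
    show "\<bar>x \<bullet> b\<bar> \<le> max R 1 * r" if "x \<in> K r" for r x
    proof -
      have xr: "\<bar>x \<bullet> b\<bar> \<le> R * r" using that by (simp add: K_def)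
      then have "0 \<le> R * r" by (rule order_trans[OF abs_ge_zero])
      then have "0 \<le> r" using R(1) by (simp add: zero_le_mult_iff)
      then have "R * r \<le> max R 1 * r" by (intro mult_right_mono) auto
      then show ?thesis using xr by simp
    qed
    show "\<bar>x \<bullet> i\<bar> \<le> max R 1" if "0 < r" "r \<le> 1" "x \<in> K r" "i \<in> Basis" for r x i
    proof (cases "i = b")
      case True
      have "R * r \<le> R * 1" using that R by (intro mult_left_mono) auto
      then show ?thesis using that True by (auto simp: K_def)
    next
      case False
      then have "\<bar>x \<bullet> i\<bar> \<le> 1" using that by (auto simp: K_def)
      then show ?thesis by simp
    qed
    show "(\<integral>\<^sup>+\<xi>. ennreal ((1 + (norm \<xi>)\<^sup>2) powr (- \<sigma>) * (norm (inv_fourier (\<psi> r) \<xi>))\<^sup>2) \<partial>lborel) \<le> ennreal (C * r powr (2 * \<sigma> + 1))"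
      if r: "0 < r" and \<sigma>: "0 \<le> \<sigma>" "\<sigma> \<le> p + 5 / 2" for r \<sigma>
    proof -
      have "(\<integral>\<^sup>+\<xi>. ennreal ((1 + (norm \<xi>)\<^sup>2) powr (- \<sigma>) * (norm (inv_fourier (\<psi> r) \<xi>))\<^sup>2) \<partial>lborel)
        \<le> ennreal (r powr (2 * \<sigma>) * ((LINT x|lborel. (norm (X r x))\<^sup>2) + (LINT x|lborel. (norm (\<psi> r x))\<^sup>2)))"
        by (rule packet_negative_sobolev[OF Xt[OF r] b r \<sigma>(1) _ \<psi>X[OF r]]) (use \<sigma> m in simp)
      also have "\<dots> \<le> ennreal (r powr (2 * \<sigma>) * (M\<^sup>2 * (CK * r) + M\<^sup>2 * (CK * r)))"
        by (intro ennreal_leI mult_left_mono add_mono L2 r Xt \<psi>t XM \<psi>M X0 \<psi>0) auto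
      also have "\<dots> \<le> ennreal (C * r powr (2 * \<sigma> + 1))"
      proof (rule ennreal_leI)
        have "r powr (2 * \<sigma>) * (M\<^sup>2 * (CK * r) + M\<^sup>2 * (CK * r)) = (2 * M\<^sup>2 * CK) * (r powr (2 * \<sigma>) * r)" by simp
        also have "r powr (2 * \<sigma>) * r = r powr (2 * \<sigma> + 1)" using r by (simp add: powr_add)
        also have "(2 * M\<^sup>2 * CK) * r powr (2 * \<sigma> + 1) \<le> C * r powr (2 * \<sigma> + 1)" using C by (intro mult_right_mono) auto
        finally show "r powr (2 * \<sigma>) * (M\<^sup>2 * (CK * r) + M\<^sup>2 * (CK * r)) \<le> C * r powr (2 * \<sigma> + 1)" .
      qed
      finally show ?thesis .
    qed
    show "(LINT x|lborel. nls_nonlinearity p (of_real (x \<bullet> b)) * \<psi> r x) = of_real (r powr (p + 1)) * moment p ?D" if r: "0 < r" for r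
    proof -
      \<comment> \<open>The integrand is a tensor product: a dilated moment integral in the
        direction \<open>b\<close> and factors of mass one in all others.\<close>
      let ?f = "\<lambda>i y. if i = b then nls_nonlinearity p (complex_of_real y) * ?D ((1 / r) * y) else \<beta> y"
      have tr: "test_fun (\<lambda>y. ?D ((1 / r) * y))" using test_fun_affine[OF Dt, of "1 / r" 0] r by simp
      have "nls_nonlinearity p (of_real (x \<bullet> b)) * \<psi> r x = (\<Prod>i\<in>Basis. ?f i (x \<bullet> i))" for x :: 'a
        by (subst prod.remove[OF finite_Basis b]) (auto simp: \<psi>_def \<eta>_def mult.assoc intro!: prod.cong)
      then have "(LINT x|lborel. nls_nonlinearity p (of_real (x \<bullet> b)) * \<psi> r x) = (LINT x|lborel. (\<Prod>i\<in>Basis. ?f i ((x::'a) \<bullet> i)))" by simp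
      also have "\<dots> = (\<Prod>i\<in>(Basis::'a set). (LINT y|lborel. ?f i y))"
      proof (rule lborel_product_integral(2))
        show "integrable lborel (?f i)" for i
          by (cases "i = b") (use moment_integrable[OF p tr] test_fun_integrable[OF \<beta>t] in auto)
      qed
      also have "\<dots> = moment p (\<lambda>y. ?D ((1 / r) * y)) * (\<Prod>i\<in>(Basis::'a set) - {b}. (LINT y|lborel. \<beta> y))"
        by (subst prod.remove[OF finite_Basis b]) (auto simp: moment_def intro!: prod.cong)
      also have "\<dots> = of_real (sgn (1 / r) * \<bar>1 / r\<bar> powr (- p - 1)) * moment p ?D"
        using r by (subst moment_dilation[OF p _ test_fun_measurable[OF Dt]]) (auto simp: \<beta>int)
      also have "sgn (1 / r) * \<bar>1 / r\<bar> powr (- p - 1) = r powr (p + 1)"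
      proof -
        have e: "1 / r = r powr (- 1)" using r powr_minus_divide[of r 1] by simp
        have "(1 / r) powr (- p - 1) = r powr (p + 1)" unfolding e powr_powr by (simp add: algebra_simps)
        moreover have "sgn (1 / r) = 1" "\<bar>1 / r\<bar> = 1 / r" using r by simp_all
        ultimately show ?thesis by (simp only: mult_1)
      qed
      finally show ?thesis .
    qed
    \<comment> \<open>One integration by parts replaces the linear function by a constant; what
      remains is the integral of a derivative of a test function.\<close>
    show "(LINT x|lborel. of_real (x \<bullet> b) * lap (\<psi> r) x) = 0" if r: "0 < r" for r
    proof -
      have dg: "directional_deriv v (\<lambda>x::'a. complex_of_real (x \<bullet> b)) = (\<lambda>x. of_real (v \<bullet> b))" for v
        by (rule directional_derivI)
           (intro bounded_linear_imp_has_derivative bounded_linear_compose[OF bounded_linear_of_real] bounded_linear_inner_left)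
      have ti: "test_fun (directional_deriv i (\<psi> r))" "test_fun (directional_deriv i (directional_deriv i (\<psi> r)))" for i
        by (intro test_fun_dd \<psi>t r)+
      have "(LINT x|lborel. of_real (x \<bullet> b) * directional_deriv i (directional_deriv i (\<psi> r)) x) = 0" for i
        unfolding integration_by_parts_test[OF ti(1) smooth_fun_inner] dg
        by (simp add: integral_directional_deriv[OF \<psi>t[OF r]])
      moreover have "integrable lborel (\<lambda>x. of_real (x \<bullet> b) * directional_deriv i (directional_deriv i (\<psi> r)) x)" for i
        by (intro test_fun_integrable test_fun_mult_left ti smooth_fun_inner)
      ultimately show ?thesis by (simp add: lap_def sum_distrib_left)
    qed
  qed
qed

subsection \<open>The contradiction\<close>

context sobolev_nls_solution
begin

text \<open>\<open>window_estimate\<close> with \<rho> = r^2 bounds c0 r^(p+1), the size of the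
  nonlinear pairing at time 0, by three errors. The two linear ones carry a factor \<eta> from
  continuity in H^s, the nonlinear one a factor r^(1/2). First \<eta> is fixed, then one
  sufficiently small r.\<close>

lemma packet_contradiction:
  fixes b :: 'a and L C M c :: real and z :: complex and \<psi> :: "real \<Rightarrow> 'a \<Rightarrow> complex" and K :: "real \<Rightarrow> 'a set"
  assumes L: "L > 0" and C: "C > 0" and M: "M > 0" and z: "z \<noteq> 0"
    and \<psi>t: "\<And>r. 0 < r \<Longrightarrow> test_fun (\<psi> r)" and \<psi>M: "\<And>r x. norm (\<psi> r x) \<le> M"
    and \<psi>0: "\<And>r x. 0 < r \<Longrightarrow> x \<notin> K r \<Longrightarrow> \<psi> r x = 0"
    and Kc: "\<And>r. closed (K r)" and Km: "\<And>r. 0 < r \<Longrightarrow> emeasure lborel (K r) \<le> ennreal (C * r)"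
    and Kb: "\<And>r x. x \<in> K r \<Longrightarrow> \<bar>x \<bullet> b\<bar> \<le> L * r"
    and KL: "\<And>r x i. 0 < r \<Longrightarrow> r \<le> 1 \<Longrightarrow> x \<in> K r \<Longrightarrow> i \<in> Basis \<Longrightarrow> \<bar>x \<bullet> i\<bar> \<le> L"
    and weight: "\<And>r \<sigma>. 0 < r \<Longrightarrow> 0 \<le> \<sigma> \<Longrightarrow> \<sigma> \<le> p + 5 / 2 \<Longrightarrow>
      (\<integral>\<^sup>+\<xi>. ennreal ((1 + (norm \<xi>)\<^sup>2) powr (- \<sigma>) * (norm (inv_fourier (\<psi> r) \<xi>))\<^sup>2) \<partial>lborel) \<le> ennreal (C * r powr (2 * \<sigma> + 1))"
    and mom: "\<And>r. 0 < r \<Longrightarrow> (LINT x|lborel. nls_nonlinearity p (of_real (x \<bullet> b)) * \<psi> r x) = of_real (r powr (p + 1)) * z"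
    and harm: "\<And>r. 0 < r \<Longrightarrow> (LINT x|lborel. of_real (x \<bullet> b) * lap (\<psi> r) x) = 0"
    and c: "c > 0" and lin: "AE x in lborel. (\<forall>i\<in>Basis. \<bar>x \<bullet> i\<bar> \<le> L) \<longrightarrow> u 0 x = of_real c * of_real (x \<bullet> b)"
  shows False
proof -
  obtain B T1 where B: "B \<ge> 0" and T1: "0 < T1" "T1 < T"
    and lip: "\<And>t. 0 < t \<Longrightarrow> t < T1 \<Longrightarrow> (\<integral>\<^sup>+x. ennreal (norm (u t x - u 0 x) powr P) \<partial>lborel) \<le> ennreal ((B * t) powr P)"
    by (rule lipschitz_in_time) (rule that, assumption+)
  obtain W :: real where W: "W > 0" and window: "\<And>\<kappa> T a b n \<rho> A1 B1 N1. weak_ode \<kappa> T a b n \<Longrightarrow> \<bar>\<kappa>\<bar> = 1 \<Longrightarrow>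
      continuous_on {0..T} a \<Longrightarrow> continuous_on {0..T} b \<Longrightarrow> continuous_on {0..T} n \<Longrightarrow>
      0 < \<rho> \<Longrightarrow> 2 * \<rho> < T \<Longrightarrow> (\<And>t. 0 \<le> t \<Longrightarrow> t \<le> 2 * \<rho> \<Longrightarrow> norm (a t - a 0) \<le> A1) \<Longrightarrow>
      (\<And>t. 0 \<le> t \<Longrightarrow> t \<le> 2 * \<rho> \<Longrightarrow> norm (b t) \<le> B1) \<Longrightarrow> (\<And>t. 0 \<le> t \<Longrightarrow> t \<le> 2 * \<rho> \<Longrightarrow> norm (n t - n 0) \<le> N1) \<Longrightarrow>
      norm (n 0) \<le> N1 + W * A1 / \<rho> + B1"
    by (fact window_estimate)
  define c0 where "c0 = c powr p * norm z"
  have c0: "c0 > 0" using c z by (simp add: c0_def)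
  define S where "S = sqrt C"
  have S: "S > 0" using C by (simp add: S_def)
  \<comment> \<open>The linear errors will be W \<eta> S r^(p+1) and \<eta> S r^(p+1); this value
    makes their sum (c0/4) r^(p+1).\<close>
  define \<eta> where "\<eta> = c0 / (4 * ((W + 1) * S))"
  have \<eta>: "\<eta> > 0" "\<eta> * S * (W + 1) = c0 / 4" 
  proof -
    have "(W + 1) * S > 0" using W S by simp
    then show "\<eta> > 0" using c0 by (simp add: \<eta>_def)
    have "\<eta> * ((W + 1) * S) = c0 / 4" using W S by (simp add: \<eta>_def)
    then show "\<eta> * S * (W + 1) = c0 / 4" by (simp add: mult.commute mult.left_commute mult.assoc)
  qed
  obtain T2 where T2: "0 < T2" "T2 < T" "\<And>t. t \<in> {0..T2} \<Longrightarrow> sobolev_norm s (\<lambda>x. u t x - u 0 x) \<le> \<eta>"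
    by (rule uniformly_near[OF \<eta>(1)]) (rule that, assumption+)
  \<comment> \<open>Collects both parts of the threshold splitting of the displacement: the slab
    volume C r below the threshold and the L^P bound (2 B r^2)^P above it.\<close>
  define G where "G = C + (2 * B) powr P"
  have G: "G > 0" using C by (simp add: G_def add_pos_nonneg)
  define C6 where "C6 = M * nl_const p * (((c * L) powr (p - 1) + 1) * G)"
  have nlc: "0 \<le> nl_const p" using p by (simp add: nl_const_def)
  have C6: "C6 \<ge> 0" using M nlc G by (simp add: C6_def add_nonneg_nonneg)
  \<comment> \<open>r \<le> 1 puts the slab into the box where the datum is linear. The window ends
    at 2 r^2 \<le> 2 r, hence the quarters of T1 and T2. The last bound gives C6 r^(1/2) \<le>
    c0/4.\<close>
  define r where "r = min (min 1 (T1 / 4)) (min (T2 / 4) ((c0 / (4 * (C6 + 1)))\<^sup>2))"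
  have r: "r > 0" "r \<le> 1" "r \<le> T1 / 4" "r \<le> T2 / 4" "r \<le> (c0 / (4 * (C6 + 1)))\<^sup>2"
  proof -
    have "0 < (c0 / (4 * (C6 + 1)))\<^sup>2" using c0 C6 by simp
    then show "r > 0" using T1(1) T2(1) by (simp add: r_def)
    show "r \<le> 1" "r \<le> T1 / 4" "r \<le> T2 / 4" "r \<le> (c0 / (4 * (C6 + 1)))\<^sup>2" unfolding r_def by linarith+
  qed
  have rr: "r\<^sup>2 \<le> r" using r by (simp add: power2_eq_square mult_left_le)
  have C6r: "C6 * r powr (1 / 2) \<le> c0 / 4"
  proof -
    have "r powr (1 / 2) \<le> c0 / (4 * (C6 + 1))"
      using r(1,5) c0 C6 by (simp add: powr_half_sqrt real_le_lsqrt)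
    then have "C6 * r powr (1 / 2) \<le> C6 * (c0 / (4 * (C6 + 1)))" using C6 by (rule mult_left_mono)
    also have "\<dots> \<le> c0 / 4" using C6 c0 by (simp add: field_simps)
    finally show ?thesis .
  qed
  let ?\<psi> = "\<psi> r"
  let ?a = "\<lambda>t. LINT x|lborel. u t x * ?\<psi> x" and ?b = "\<lambda>t. LINT x|lborel. u t x * lap ?\<psi> x"
    and ?n = "\<lambda>t. LINT x|lborel. nls_nonlinearity p (u t x) * ?\<psi> x"
  note \<psi> = \<psi>t[OF r(1)]
  have zT: "0 \<in> {0..T}" using T by simp
  have tT: "t \<in> {0..T}" "t \<in> {0..T2}" "t < T1" if "0 \<le> t" "t \<le> 2 * r\<^sup>2" for t
    using that rr r T1 T2 by auto
  have [measurable]: "?\<psi> \<in> borel_measurable borel" "u 0 \<in> borel_measurable borel" "K r \<in> sets borel"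
    by (intro test_fun_measurable \<psi> u_measurable zT borel_closed Kc)+
  have ode: "weak_ode \<kappa> T ?a ?b ?n" by (rule nls_weak_ode[OF eq sq \<psi>])
  have linK: "AE x in lborel. x \<in> K r \<longrightarrow> u 0 x = of_real c * of_real (x \<bullet> b)"
    using lin by eventually_elim (use KL[OF r(1,2)] in blast)
  \<comment> \<open>The packet is estimated at order p + 5/2 even for larger \<open>s\<close>: r^(2
    (p + 5/2) + 1) is the square of r^(p+3), and the later division by \<rho> = r^2 leaves
    r^(p+1).\<close>
  have A: "norm (?a t - ?a 0) \<le> \<eta> * (S * r powr (p + 3))" if "0 \<le> t" "t \<le> 2 * r\<^sup>2" for t
  proof -
    have w: "(\<integral>\<^sup>+\<xi>. ennreal ((1 + (norm \<xi>)\<^sup>2) powr (- s) * (norm (inv_fourier ?\<psi> \<xi>))\<^sup>2) \<partial>lborel) \<le> ennreal (C * r powr (2 * (p + 5 / 2) + 1))"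
      by (rule order_trans[OF weight_mono[OF s(2)] weight[OF r(1)]]) (use p in auto)
    have "norm (?a t - ?a 0) \<le> sobolev_norm s (\<lambda>x. u t x - u 0 x) * sqrt (C * r powr (2 * (p + 5 / 2) + 1))"
      unfolding pairing_diff[OF zT tT(1)[OF that] \<psi>]
      by (rule sobolev_pairing[OF diff_in_sobolev[OF zT tT(1)[OF that]] \<psi> w]) (use C in simp)
    also have "\<dots> \<le> \<eta> * sqrt (C * r powr (2 * (p + 5 / 2) + 1))"
      by (rule mult_right_mono[OF T2(3)[OF tT(2)[OF that]]]) (use C in simp)
    also have "sqrt (C * r powr (2 * (p + 5 / 2) + 1)) = S * r powr (p + 3)"
    proof -
      have q: "2 * (p + 5 / 2) + 1 = (p + 3) + (p + 3)" by simp
      have "r powr (2 * (p + 5 / 2) + 1) = (r powr (p + 3))\<^sup>2" by (simp only: q powr_add power2_eq_square)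
      then show ?thesis by (simp add: S_def real_sqrt_mult)
    qed
    finally show ?thesis .
  qed
  \<comment> \<open>The Laplacian of the packet is still supported in \<open>K r\<close>, where u(0)
    is a multiple of x \<bullet> b, so the pairing is exactly zero and not merely small.\<close>
  have b0: "?b 0 = 0"
  proof -
    have lap0: "lap ?\<psi> x = 0" if "x \<notin> K r" for x
    proof -
      have "directional_deriv i ?\<psi> y = 0" if "y \<notin> K r" for i y
        by (rule directional_deriv_zero_outside[OF test_fun_smooth[OF \<psi>] Kc \<psi>0[OF r(1)] that])
      then have "directional_deriv i (directional_deriv i ?\<psi>) x = 0" for i
        by (intro directional_deriv_zero_outside[OF test_fun_smooth[OF test_fun_dd[OF \<psi>]] Kc _ \<open>x \<notin> K r\<close>])
      then show ?thesis by (simp add: lap_def)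
    qed
    have [measurable]: "lap ?\<psi> \<in> borel_measurable borel" by (intro test_fun_measurable test_fun_lap \<psi>)
    have "?b 0 = (LINT x|lborel. of_real c * (of_real (x \<bullet> b) * lap ?\<psi> x))"
    proof (rule integral_cong_AE)
      show "AE x in lborel. u 0 x * lap ?\<psi> x = of_real c * (of_real (x \<bullet> b) * lap ?\<psi> x)"
        using linK by eventually_elim (use lap0 in fastforce)
    qed measurable
    then show ?thesis using harm[OF r(1)] by simp
  qed
  \<comment> \<open>Since \<open>?b 0 = 0\<close>, only u(t) - u(0) is paired. The Laplacian lowers
    the order to p + 1/2, and r^(2 (p + 1/2) + 1) is the square of r^(p+1).\<close>
  have Bb: "norm (?b t) \<le> \<eta> * (S * r powr (p + 1))" if "0 \<le> t" "t \<le> 2 * r\<^sup>2" for t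
  proof -
    have w: "(\<integral>\<^sup>+\<xi>. ennreal ((1 + (norm \<xi>)\<^sup>2) powr (- s) * (norm (inv_fourier (lap ?\<psi>) \<xi>))\<^sup>2) \<partial>lborel) \<le> ennreal (C * r powr (2 * (p + 5 / 2 - 2) + 1))"
      by (rule order_trans[OF lap_weight_le[OF \<psi> s(2)] weight[OF r(1)]]) (use p in auto)
    have "norm (?b t) = norm (?b t - ?b 0)" by (simp add: b0)
    also have "\<dots> \<le> sobolev_norm s (\<lambda>x. u t x - u 0 x) * sqrt (C * r powr (2 * (p + 5 / 2 - 2) + 1))"
      unfolding pairing_diff[OF zT tT(1)[OF that] test_fun_lap[OF \<psi>]]
      by (rule sobolev_pairing[OF diff_in_sobolev[OF zT tT(1)[OF that]] test_fun_lap[OF \<psi>] w]) (use C in simp)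
    also have "\<dots> \<le> \<eta> * sqrt (C * r powr (2 * (p + 5 / 2 - 2) + 1))"
      by (rule mult_right_mono[OF T2(3)[OF tT(2)[OF that]]]) (use C in simp)
    also have "sqrt (C * r powr (2 * (p + 5 / 2 - 2) + 1)) = S * r powr (p + 1)"
    proof -
      have q: "2 * (p + 5 / 2 - 2) + 1 = (p + 1) + (p + 1)" by simp
      have "r powr (2 * (p + 5 / 2 - 2) + 1) = (r powr (p + 1))\<^sup>2" by (simp only: q powr_add power2_eq_square)
      then show ?thesis by (simp add: S_def real_sqrt_mult)
    qed
    finally show ?thesis .
  qed
  have n0: "norm (?n 0) = c0 * r powr (p + 1)"
  proof -
    have "?n 0 = (LINT x|lborel. of_real (c powr p) * (nls_nonlinearity p (of_real (x \<bullet> b)) * ?\<psi> x))"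
    proof (rule integral_cong_AE)
      show "AE x in lborel. nls_nonlinearity p (u 0 x) * ?\<psi> x = of_real (c powr p) * (nls_nonlinearity p (of_real (x \<bullet> b)) * ?\<psi> x)"
        using linK
      proof eventually_elim
        case (elim x)
        show ?case
        proof (cases "x \<in> K r")
          case True
          then show ?thesis using elim c nls_nonlinearity_scale[OF p, of c "of_real (x \<bullet> b)"] by simp
        qed (simp add: \<psi>0[OF r(1)])
      qed
    qed measurable
    then show ?thesis using c r(1) by (simp add: mom norm_mult c0_def)
  qed
  have rpow: "r powr e \<le> r powr e'" if "e' \<le> e" for e e' using that r by (simp add: powr_mono')
  have N: "norm (?n t - ?n 0) \<le> C6 * r powr (p + 3 / 2)" if t: "0 \<le> t" "t \<le> 2 * r\<^sup>2" for t
  proof (cases "t = 0")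
    case True
    then show ?thesis using C6 by simp
  next
    case False
    note t' = tT[OF t]
    let ?w = "\<lambda>x. u t x - u 0 x"
    have [measurable]: "u t \<in> borel_measurable borel" by (rule u_measurable[OF t'(1)])
    define Q where "Q = (2 * B * r\<^sup>2) powr P"
    have Q0: "Q \<ge> 0" by (simp add: Q_def)
    have "(\<integral>\<^sup>+x. ennreal (norm (?w x) powr P) \<partial>lborel) \<le> ennreal ((B * t) powr P)"
      by (rule lip) (use False t t' in auto)
    also have "\<dots> \<le> ennreal Q"
      unfolding Q_def using t B P mult_left_mono[OF t(2) B] by (intro ennreal_leI powr_mono2) (auto simp: mult_ac)
    finally have WQ: "(\<integral>\<^sup>+x. ennreal (norm (?w x) powr P) \<partial>lborel) \<le> ennreal Q" .
    \<comment> \<open>The threshold r^(3/2) lies strictly between the size r of the datum on the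
      slab and the scale r^2 of the displacement. Values below it contribute l^e times the volume r.
      The part above it gives no worse power exactly when 3/2 \<le> 2 - 1/P, that is, when P \<ge>
      2.\<close>
    define l where "l = r powr (3 / 2)"
    have l: "l > 0" using r by (simp add: l_def)
    have Cr: "0 \<le> C * r" using C r by simp
    have bnd: "l powr e * (C * r) + l powr (e - P) * Q \<le> G * r powr (3 / 2 * e + 1)" if e: "e > 0" for e
    proof -
      have Qe: "Q = (2 * B) powr P * r powr (2 * P)"
      proof -
        have r2: "r\<^sup>2 = r powr 2" using r by simp
        have "0 \<le> 2 * B" "0 \<le> r powr 2" using B by auto
        then show ?thesis unfolding Q_def r2 by (simp only: powr_mult powr_powr)
      qed
      have "l powr e * (C * r) = C * r powr (3 / 2 * e + 1)"
        using r by (simp add: l_def powr_powr powr_add)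
      moreover have "l powr (e - P) * Q = (2 * B) powr P * r powr (3 / 2 * (e - P) + 2 * P)"
        unfolding Qe l_def by (simp add: powr_powr powr_add)
      moreover have "r powr (3 / 2 * (e - P) + 2 * P) \<le> r powr (3 / 2 * e + 1)"
        using P by (intro rpow) (simp add: field_simps)
      then have "(2 * B) powr P * r powr (3 / 2 * (e - P) + 2 * P) \<le> (2 * B) powr P * r powr (3 / 2 * e + 1)"
        by (rule mult_left_mono) simp
      ultimately show ?thesis unfolding G_def distrib_right by linarith
    qed
    have I2: "(\<integral>\<^sup>+x. ennreal (indicator (K r) x * norm (?w x) powr p) \<partial>lborel) \<le> ennreal (G * r powr (p + 3 / 2))"
    proof -
      have "(\<integral>\<^sup>+x. ennreal (indicator (K r) x * norm (?w x) powr p) \<partial>lborel) \<le> ennreal (l powr p * (C * r) + l powr (p - P) * Q)"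
        by (rule local_power_bound[OF _ _ Km[OF r(1)] Cr WQ Q0]) (use p P l in auto)
      also have "\<dots> \<le> ennreal (G * r powr (p + 3 / 2))"
      proof (rule ennreal_leI)
        have "G * r powr (3 / 2 * p + 1) \<le> G * r powr (p + 3 / 2)"
          using G p by (intro mult_left_mono rpow) auto
        then show "l powr p * (C * r) + l powr (p - P) * Q \<le> G * r powr (p + 3 / 2)" using bnd[of p] p by simp
      qed
      finally show ?thesis .
    qed
    \<comment> \<open>On the slab the datum is at most c L r; together with the bound r^(5/2) for
      the first power of the displacement this gives r^(p-1) r^(5/2) = r^(p + 3/2), half a power
      better than r^(p+1).\<close>
    have I1: "(\<integral>\<^sup>+x. ennreal (indicator (K r) x * (norm (u 0 x) powr (p - 1) * norm (?w x))) \<partial>lborel)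
      \<le> ennreal ((c * L) powr (p - 1) * (G * r powr (p + 3 / 2)))"
    proof -
      have m: "(\<lambda>x. ennreal (indicator (K r) x * norm (?w x) powr 1)) \<in> borel_measurable lborel" by measurable
      have "(\<integral>\<^sup>+x. ennreal (indicator (K r) x * (norm (u 0 x) powr (p - 1) * norm (?w x))) \<partial>lborel)
        \<le> (\<integral>\<^sup>+x. ennreal ((c * L * r) powr (p - 1)) * ennreal (indicator (K r) x * norm (?w x) powr 1) \<partial>lborel)"
      proof (rule nn_integral_mono_AE)
        show "AE x in lborel. ennreal (indicator (K r) x * (norm (u 0 x) powr (p - 1) * norm (?w x)))
          \<le> ennreal ((c * L * r) powr (p - 1)) * ennreal (indicator (K r) x * norm (?w x) powr 1)"
          using linK
        proof eventually_elim
          case (elim x)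
          show ?case
          proof (cases "x \<in> K r")
            case True
            then have "norm (u 0 x) = c * \<bar>x \<bullet> b\<bar>" using elim c by (simp add: norm_mult)
            also have "\<dots> \<le> c * L * r" using mult_left_mono[OF Kb[OF True], of c] c by (simp add: mult.assoc)
            finally have "norm (u 0 x) powr (p - 1) \<le> (c * L * r) powr (p - 1)" using p by (intro powr_mono2) auto
            then show ?thesis using True
              by (simp add: ennreal_mult[symmetric] ennreal_leI mult_right_mono)
          qed simp
        qed
      qed
      also have "\<dots> = ennreal ((c * L * r) powr (p - 1)) * (\<integral>\<^sup>+x. ennreal (indicator (K r) x * norm (?w x) powr 1) \<partial>lborel)"
        by (rule nn_integral_cmult[OF m])
      also have "\<dots> \<le> ennreal ((c * L * r) powr (p - 1)) * ennreal (l powr 1 * (C * r) + l powr (1 - P) * Q)"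
        by (intro mult_left_mono local_power_bound[OF _ _ Km[OF r(1)] Cr WQ Q0]) (use P l in auto)
      also have "\<dots> \<le> ennreal ((c * L * r) powr (p - 1)) * ennreal (G * r powr (3 / 2 * 1 + 1))"
        by (intro mult_left_mono ennreal_leI bnd) auto
      also have "\<dots> = ennreal ((c * L * r) powr (p - 1) * (G * r powr (5 / 2)))"
        using G by (simp add: ennreal_mult)
      also have "(c * L * r) powr (p - 1) * (G * r powr (5 / 2)) = (c * L) powr (p - 1) * (G * (r powr (p - 1) * r powr (5 / 2)))"
        by (simp add: powr_mult mult_ac)
      also have "r powr (p - 1) * r powr (5 / 2) = r powr (p + 3 / 2)"
        by (simp add: powr_add[symmetric] add.commute)
      finally show ?thesis .
    qed
    have "norm ((LINT x|lborel. nls_nonlinearity p (u 0 x + ?w x) * ?\<psi> x) - ?n 0)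
      \<le> M * nl_const p * ((c * L) powr (p - 1) * (G * r powr (p + 3 / 2)) + G * r powr (p + 3 / 2))"
    proof (rule nonlinear_pairing_diff[OF _ _ _ _ p \<psi>M \<psi>0[OF r(1)] _ _ _ I1 _ I2])
      show "integrable lborel (\<lambda>x. nls_nonlinearity p (u 0 x) * ?\<psi> x)"
        by (rule nonlinear_pairing_integrable[OF in_sobolev[OF zT] \<psi>])
      show "integrable lborel (\<lambda>x. nls_nonlinearity p (u 0 x + ?w x) * ?\<psi> x)"
        using nonlinear_pairing_integrable[OF in_sobolev[OF t'(1)] \<psi>] by simp
    qed (use M G in auto)
    then show ?thesis by (simp add: C6_def algebra_simps)
  qed
  have "norm (?n 0) \<le> C6 * r powr (p + 3 / 2) + W * (\<eta> * (S * r powr (p + 3))) / r\<^sup>2 + \<eta> * (S * r powr (p + 1))"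
    by (rule window[OF ode \<kappa> pairing_continuous[OF \<psi>] pairing_continuous[OF test_fun_lap[OF \<psi>]] nonlinear_continuous[OF \<psi>] _ _ A Bb N])
       (use r rr T1 in auto)
  also have "W * (\<eta> * (S * r powr (p + 3))) / r\<^sup>2 = W * \<eta> * S * r powr (p + 1)"
  proof -
    have "r powr (p + 3) = r powr (p + 1) * r\<^sup>2"
      using r powr_add[of r "p + 1" 2] by (simp add: add.commute)
    then show ?thesis using r by simp
  qed
  also have "C6 * r powr (p + 3 / 2) = (C6 * r powr (1 / 2)) * r powr (p + 1)"
    by (simp add: powr_add[symmetric] mult.assoc add.commute add.left_commute)
  finally have "c0 * r powr (p + 1) \<le> (C6 * r powr (1 / 2) + \<eta> * S * (W + 1)) * r powr (p + 1)"
    unfolding n0 by (simp add: algebra_simps)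
  then have "c0 \<le> C6 * r powr (1 / 2) + \<eta> * S * (W + 1)" using r by simp
  then show False using C6r \<eta>(2) c0 by linarith
qed

end

text \<open>The datum is c (x \<bullet> b) times a cutoff. \<epsilon> and \<sigma> enter only
  through the factor c, and neither T nor s enters at all, so one datum excludes every solution
  class at once.\<close>

theorem theorem1p5:
  fixes p \<kappa> :: real
  assumes "p > 1"
    and "\<not> (\<exists>k::nat. k \<ge> 1 \<and> p - 1 = 2 * real k)"
    and "\<kappa> \<in> {1, -1}"
  shows "\<forall>\<epsilon>>0. \<forall>\<sigma>\<ge>0. \<exists>u\<^sub>0 :: real ^ 'n \<Rightarrow> complex.
           test_function_on UNIV u\<^sub>0 \<and>
           u\<^sub>0 \<in> sobolev_space \<sigma> \<and> sobolev_norm \<sigma> u\<^sub>0 < \<epsilon> \<and>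
           (\<forall>T>0. \<forall>s \<ge> max (critical_exponent CARD('n) p) (p + 5 / 2).
              \<not> (\<exists>u. nls_solution p \<kappa> s T u\<^sub>0 u))"
proof (intro allI impI)
  fix \<epsilon> \<sigma> :: real assume \<epsilon>: "\<epsilon> > 0"
  obtain b :: "real ^ 'n" where b: "b \<in> Basis" using nonempty_Basis by blast
  \<comment> \<open>The packets are fixed before the datum, because \<open>L\<close> determines the
    box on which the cutoff has to be 1.\<close>
  obtain L C M :: real and z :: complex and \<psi> :: "real \<Rightarrow> real ^ 'n \<Rightarrow> complex" and K :: "real \<Rightarrow> (real ^ 'n) set" where
    packet: "L > 0" "C > 0" "M > 0" "z \<noteq> 0"
    "\<And>r. 0 < r \<Longrightarrow> test_fun (\<psi> r)" "\<And>r x. norm (\<psi> r x) \<le> M" "\<And>r x. 0 < r \<Longrightarrow> x \<notin> K r \<Longrightarrow> \<psi> r x = 0"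
    "\<And>r. closed (K r)" "\<And>r. 0 < r \<Longrightarrow> emeasure lborel (K r) \<le> ennreal (C * r)"
    "\<And>r x. x \<in> K r \<Longrightarrow> \<bar>x \<bullet> b\<bar> \<le> L * r" "\<And>r x i. 0 < r \<Longrightarrow> r \<le> 1 \<Longrightarrow> x \<in> K r \<Longrightarrow> i \<in> Basis \<Longrightarrow> \<bar>x \<bullet> i\<bar> \<le> L"
    "\<And>r \<sigma>. 0 < r \<Longrightarrow> 0 \<le> \<sigma> \<Longrightarrow> \<sigma> \<le> p + 5 / 2 \<Longrightarrow>
      (\<integral>\<^sup>+\<xi>. ennreal ((1 + (norm \<xi>)\<^sup>2) powr (- \<sigma>) * (norm (inv_fourier (\<psi> r) \<xi>))\<^sup>2) \<partial>lborel) \<le> ennreal (C * r powr (2 * \<sigma> + 1))"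
    "\<And>r. 0 < r \<Longrightarrow> (LINT x|lborel. nls_nonlinearity p (of_real (x \<bullet> b)) * \<psi> r x) = of_real (r powr (p + 1)) * z"
    "\<And>r. 0 < r \<Longrightarrow> (LINT x|lborel. of_real (x \<bullet> b) * lap (\<psi> r) x) = 0"
    by (rule packets_exist[OF assms(1,2) b]) (rule that, assumption+)
  obtain \<Theta> :: "real ^ 'n \<Rightarrow> real" where \<Theta>: "test_fun (\<lambda>x. complex_of_real (\<Theta> x))"
    "\<And>x. (\<forall>b\<in>Basis. \<bar>x \<bullet> b\<bar> \<le> L) \<Longrightarrow> \<Theta> x = 1" "\<And>x. 0 \<le> \<Theta> x" "\<And>x. \<Theta> x \<le> 1"
    by (rule cutoff_exists[OF packet(1)]) (rule that, assumption+)
  define w where "w x = complex_of_real (x \<bullet> b) * complex_of_real (\<Theta> x)" for x :: "real ^ 'n"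
  have w: "test_fun w" unfolding w_def[abs_def] by (intro test_fun_mult_left \<Theta>(1) smooth_fun_inner)
  \<comment> \<open>The summand 1 avoids a division by zero, and the factor 2 makes the norm bound
    strict.\<close>
  define c where "c = \<epsilon> / (2 * (sobolev_norm \<sigma> w + 1))"
  have N0: "0 \<le> sobolev_norm \<sigma> w" by (rule sobolev_norm_nonneg)
  have c: "c > 0" using \<epsilon> N0 by (simp add: c_def)
  define u0 where "u0 x = complex_of_real c * w x" for x
  have u0: "test_fun u0" unfolding u0_def[abs_def] by (rule test_fun_cmult[OF w])
  have "sobolev_norm \<sigma> u0 = c * sobolev_norm \<sigma> w"
    unfolding u0_def[abs_def] sobolev_norm_cmult_test[OF w] using c by simp
  also have "\<dots> < c * (2 * (sobolev_norm \<sigma> w + 1))" using c N0 by (intro mult_strict_left_mono) auto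
  also have "\<dots> = \<epsilon>" using N0 by (simp add: c_def)
  finally have small: "sobolev_norm \<sigma> u0 < \<epsilon>" .
  have "\<not> (\<exists>u. nls_solution p \<kappa> s T u0 u)" if T: "T > 0" and s: "s \<ge> max (critical_exponent CARD('n) p) (p + 5 / 2)" for T s
  proof
    assume "\<exists>u. nls_solution p \<kappa> s T u0 u"
    then obtain u where u: "continuous_into_sobolev T s u" "AE x in lborel. u 0 x = u0 x" "nls_distributional p \<kappa> T u"
      unfolding nls_solution_def by blast
    interpret sobolev_nls_solution p \<kappa> s T u
      by standard (use assms T s u in auto)
    have "AE x in lborel. (\<forall>i\<in>Basis. \<bar>x \<bullet> i\<bar> \<le> L) \<longrightarrow> u 0 x = of_real c * of_real (x \<bullet> b)"
      using u(2) by eventually_elim (use \<Theta>(2) in \<open>simp add: u0_def w_def\<close>)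
    from packet_contradiction[OF packet c this] show False .
  qed
  then show "\<exists>u\<^sub>0 :: real ^ 'n \<Rightarrow> complex. test_function_on UNIV u\<^sub>0 \<and>
           u\<^sub>0 \<in> sobolev_space \<sigma> \<and> sobolev_norm \<sigma> u\<^sub>0 < \<epsilon> \<and>
           (\<forall>T>0. \<forall>s \<ge> max (critical_exponent CARD('n) p) (p + 5 / 2).
              \<not> (\<exists>u. nls_solution p \<kappa> s T u\<^sub>0 u))"
    using u0 test_fun_sobolev[OF u0] small by blast
qed

end
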